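(* Let $n\ge 2$ and let $\mathcal{E}$ be a 1-type uniform Steiner vector bundle on $\mathbb{P}^n$ with $c_1(\mathcal{E}) = -c$ and rank $r\geq c +2(n-1)$. Then there exist an integer $\alpha\ge 0$ and a 1-type uniform Steiner vector bundle $\mathcal{F}$ on $\mathbb{P}^n$ with $\operatorname{rk}(\mathcal{F}) = c+2(n-1)$ such that $\mathcal{E}$ fits into a short exact sequence $$0 \longrightarrow \mathcal{F} \longrightarrow \mathcal{E} \longrightarrow \mathcal{O}_{\mathbb{P}^n}^\alpha \longrightarrow 0.$$
   Context: The base field $\mathbb{K}$ is algebraically closed of characteristic $0$. A vector bundle $\mathcal{E}$ on $\mathbb{P}^n$ is a Steiner bundle if it is the kernel in a short exact sequence $0\to\mathcal{E}\to\mathcal{O}_{\mathbb{P}^n}^{x}\to\mathcal{O}_{\mathbb{P}^n}(1)^{c}\to 0$; then $c_1(\mathcal{E})=-c$ and $\operatorname{rk}\mathcal{E}=x-c$. A rank $r$ vector bundle $\mathcal{E}$ on $\mathbb{P}^n$ is uniform if its splitting type (the integers $a_1\le\dots\le a_r$ with $\mathcal{E}|_L\cong\bigoplus_{i=1}^r\mathcal{O}_L(a_i)$) is the same for every line $L\subset\mathbb{P}^n$. For an integer $k\ge1$, a uniform Steiner bundle is called $k$-type uniform if for every line $L$ one has $\mathcal{E}|_L\cong\bigoplus_{i=0}^{k}\mathcal{O}_L(-i)^{a_i}$ with $a_i\ge 0$ independent of $L$ and $a_k>0$. *)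

theory Defs
  imports "HOL-Analysis.Analysis" "HOL-Library.Function_Algebras"
begin

text \<open>A point of the projective space of \<open>'k^'n\<close>, which has dimension \<open>CARD('n) - 1\<close>, is a
  one-dimensional subspace.  The field is algebraically closed where this is used below, so varieties
  are treated through their closed points.\<close>

definition proj_space :: "('k::field ^ 'n::finite) set set" where
  "proj_space = {x. vec.subspace x \<and> vec.dim x = 1}"

definition proj_lines :: "('k::field ^ 'n::finite) set set set" where
  "proj_lines = {{x \<in> proj_space. x \<subseteq> S} | S. vec.subspace S \<and> vec.dim S = 2}"

text \<open>Homogeneous polynomials of degree \<open>d\<close>, as functions (the fields of interest are infinite).\<close>

definition forms :: "nat \<Rightarrow> ('k::field ^ 'n::finite \<Rightarrow> 'k) set" where
  "forms d = {(\<lambda>v. \<Sum>m\<in>{m. sum m UNIV = d}. c m * (\<Prod>i\<in>UNIV. (v $ i) ^ m i)) | c :: ('n \<Rightarrow> nat) \<Rightarrow> 'k. True}"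

definition zariski :: "('k::field ^ 'n::finite) set topology" where
  "zariski = topology_generated_by
     {{x \<in> proj_space. \<exists>v\<in>x - {0}. p v \<noteq> 0} | p. \<exists>d. p \<in> forms d}"

abbreviation zopen :: "('k::field ^ 'n::finite) set set \<Rightarrow> ('k ^ 'n) set set \<Rightarrow> bool" where
  "zopen X \<equiv> openin (subtopology zariski X)"

definition regular_functions ::
  "('k::field ^ 'n::finite) set set \<Rightarrow> ('k ^ 'n) set set \<Rightarrow> (('k ^ 'n) set \<Rightarrow> 'k) set" where
  "regular_functions X U = {f. \<forall>x\<in>U. \<exists>W d. \<exists>p\<in>forms d. \<exists>q\<in>forms d.
     zopen X W \<and> x \<in> W \<and> W \<subseteq> U \<and> (\<forall>y\<in>W. \<forall>v\<in>y - {0}. q v \<noteq> 0 \<and> f y = p v / q v)}"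

text \<open>A bundle consists of a base, a family of fibres, which are subspaces of an ambient vector space
  with scalar multiplication \<open>smult\<close>, and for every open set the set of regular sections over it.
  The ambient space only serves as a carrier; it may have infinite dimension.  Only the values
  on \<open>U\<close> of an element of \<open>sects E U\<close> matter.\<close>

record ('p, 'k, 'v) vbundle =
  base :: "'p set"
  fibre :: "'p \<Rightarrow> 'v set"
  smult :: "'k \<Rightarrow> 'v \<Rightarrow> 'v"
  sects :: "'p set \<Rightarrow> ('p \<Rightarrow> 'v) set"

locale vector_bundle = vector_space "smult E"
  for E :: "(('k::field ^ 'n::finite) set, 'k, 'v::ab_group_add) vbundle" +
  fixes r :: nat
  assumes base_subset: "base E \<subseteq> proj_space"
    and fibre_subspace: "x \<in> base E \<Longrightarrow> subspace (fibre E x)"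
    and sects_restrict: "s \<in> sects E U \<Longrightarrow> zopen (base E) U \<Longrightarrow> zopen (base E) V \<Longrightarrow> V \<subseteq> U \<Longrightarrow> s \<in> sects E V"
    and sects_glue: "zopen (base E) U \<Longrightarrow>
      (\<And>x. x \<in> U \<Longrightarrow> \<exists>V. zopen (base E) V \<and> x \<in> V \<and> V \<subseteq> U \<and> s \<in> sects E V) \<Longrightarrow> s \<in> sects E U"
    and locally_trivial: "x \<in> base E \<Longrightarrow>
      \<exists>U e. zopen (base E) U \<and> x \<in> U \<and>
        (\<forall>y\<in>U. inj_on (\<lambda>i. e i y) {..<r} \<and> independent ((\<lambda>i. e i y) ` {..<r}) \<and>
          span ((\<lambda>i. e i y) ` {..<r}) = fibre E y) \<and>
        (\<forall>V. zopen (base E) V \<longrightarrow> V \<subseteq> U \<longrightarrow>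
          sects E V = {s. \<exists>f. (\<forall>i<r. f i \<in> regular_functions (base E) V) \<and>
            (\<forall>y\<in>V. s y = (\<Sum>i<r. smult E (f i y) (e i y)))})"

definition bundle_hom ::
  "(('k::field ^ 'n::finite) set, 'k, 'v::ab_group_add) vbundle \<Rightarrow>
   (('k ^ 'n) set, 'k, 'w::ab_group_add) vbundle \<Rightarrow> (('k ^ 'n) set \<Rightarrow> 'v \<Rightarrow> 'w) \<Rightarrow> bool" where
  "bundle_hom E F \<phi> \<longleftrightarrow> base E = base F \<and>
     (\<forall>x\<in>base E. \<phi> x ` fibre E x \<subseteq> fibre F x \<and>
       (\<forall>u\<in>fibre E x. \<forall>v\<in>fibre E x. \<phi> x (u + v) = \<phi> x u + \<phi> x v) \<and>
       (\<forall>a. \<forall>u\<in>fibre E x. \<phi> x (smult E a u) = smult F a (\<phi> x u))) \<and>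
     (\<forall>U. zopen (base E) U \<longrightarrow> (\<forall>s\<in>sects E U. (\<lambda>x. \<phi> x (s x)) \<in> sects F U))"

definition bundle_iso ::
  "(('k::field ^ 'n::finite) set, 'k, 'v::ab_group_add) vbundle \<Rightarrow>
   (('k ^ 'n) set, 'k, 'w::ab_group_add) vbundle \<Rightarrow> bool" where
  "bundle_iso E F \<longleftrightarrow> (\<exists>\<phi> \<psi>. bundle_hom E F \<phi> \<and> bundle_hom F E \<psi> \<and>
     (\<forall>x\<in>base E. (\<forall>u\<in>fibre E x. \<psi> x (\<phi> x u) = u) \<and> (\<forall>w\<in>fibre F x. \<phi> x (\<psi> x w) = w)))"

text \<open>For vector bundles, exactness of a short sequence of sheaves of sections is exactness of the
  sequences of fibres.\<close>

definition short_exact ::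
  "(('k::field ^ 'n::finite) set, 'k, 'u::ab_group_add) vbundle \<Rightarrow>
   (('k ^ 'n) set, 'k, 'v::ab_group_add) vbundle \<Rightarrow> (('k ^ 'n) set, 'k, 'w::ab_group_add) vbundle \<Rightarrow>
   (('k ^ 'n) set \<Rightarrow> 'u \<Rightarrow> 'v) \<Rightarrow> (('k ^ 'n) set \<Rightarrow> 'v \<Rightarrow> 'w) \<Rightarrow> bool" where
  "short_exact F E G \<phi> \<psi> \<longleftrightarrow> bundle_hom F E \<phi> \<and> bundle_hom E G \<psi> \<and>
     (\<forall>x\<in>base E. inj_on (\<phi> x) (fibre F x) \<and>
       \<phi> x ` fibre F x = {u \<in> fibre E x. \<psi> x u = 0} \<and>
       \<psi> x ` fibre E x = fibre G x)"

text \<open>For \<open>L\<close> closed in the base, the regular sections over an open subset of \<open>L\<close> are those that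
  locally extend to regular sections of \<open>E\<close>.\<close>

definition restrict_bundle ::
  "('k::field ^ 'n::finite) set set \<Rightarrow> (('k ^ 'n) set, 'k, 'v) vbundle \<Rightarrow> (('k ^ 'n) set, 'k, 'v) vbundle" where
  "restrict_bundle L E = \<lparr>base = L, fibre = fibre E, smult = smult E,
     sects = (\<lambda>U. {s. \<forall>x\<in>U. \<exists>W. \<exists>t\<in>sects E W. zopen (base E) W \<and> x \<in> W \<and> (\<forall>y\<in>W \<inter> U. s y = t y)})\<rparr>"

definition bundle_sum ::
  "'p set \<Rightarrow> 'i set \<Rightarrow> ('i \<Rightarrow> ('p, 'k, 'v::zero) vbundle) \<Rightarrow> ('p, 'k, 'i \<Rightarrow> 'v) vbundle" where
  "bundle_sum X I B = \<lparr>base = X,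
     fibre = (\<lambda>x. {u. (\<forall>i\<in>I. u i \<in> fibre (B i) x) \<and> (\<forall>i. i \<notin> I \<longrightarrow> u i = 0)}),
     smult = (\<lambda>a u i. smult (B i) a (u i)),
     sects = (\<lambda>U. {s. (\<forall>i\<in>I. (\<lambda>x. s x i) \<in> sects (B i) U) \<and> (\<forall>i. i \<notin> I \<longrightarrow> (\<forall>x\<in>U. s x i = 0))})\<rparr>"

text \<open>The line bundle \<open>O(d)\<close> on \<open>X\<close>: its fibre at \<open>x\<close> consists of the functions on \<open>x - {0}\<close> that are
  homogeneous of degree \<open>d\<close>, extended by zero.  Thus \<open>O(1)\<close> has fibre the dual of \<open>x\<close>, and
  sections of \<open>O(d)\<close> are homogeneous functions of degree \<open>d\<close> on the cone.  On a line, it is the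
  line bundle of degree \<open>d\<close>.\<close>

definition twist ::
  "('k::field ^ 'n::finite) set set \<Rightarrow> int \<Rightarrow> (('k ^ 'n) set, 'k, 'k ^ 'n \<Rightarrow> 'k) vbundle" where
  "twist X d = \<lparr>base = X,
     fibre = (\<lambda>x. {h. (\<forall>v. v \<notin> x - {0} \<longrightarrow> h v = 0) \<and>
                     (\<forall>v\<in>x - {0}. \<forall>a. a \<noteq> 0 \<longrightarrow> h (a *s v) = a powi d * h v)}),
     smult = (\<lambda>a h v. a * h v),
     sects = (\<lambda>U. {s. \<forall>x\<in>U. \<exists>W k l. \<exists>p\<in>forms k. \<exists>q\<in>forms l.
        zopen X W \<and> x \<in> W \<and> W \<subseteq> U \<and> int k - int l = d \<and>
        (\<forall>y\<in>W. (\<forall>v. v \<notin> y - {0} \<longrightarrow> s y v = 0) \<and> (\<forall>v\<in>y - {0}. q v \<noteq> 0 \<and> s y v = p v / q v))})\<rparr>"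

definition twist_power ::
  "('k::field ^ 'n::finite) set set \<Rightarrow> int \<Rightarrow> nat \<Rightarrow> (('k ^ 'n) set, 'k, nat \<Rightarrow> 'k ^ 'n \<Rightarrow> 'k) vbundle" where
  "twist_power X d m = bundle_sum X {..<m} (\<lambda>_. twist X d)"

text \<open>\<open>c\<^sub>1(E) = d\<close>, that is, \<open>det E\<close> is isomorphic to \<open>O(d)\<close>.  By the universal property of
  the exterior power, an isomorphism \<open>\<Lambda>\<^sup>r E \<longrightarrow> O(d)\<close> is a regular alternating \<open>r\<close>-linear map
  from \<open>E\<close> to \<open>O(d)\<close> that is nonzero on each fibre.\<close>

definition first_chern ::
  "(('k::field ^ 'n::finite) set, 'k, 'v::ab_group_add) vbundle \<Rightarrow> nat \<Rightarrow> int \<Rightarrow> bool" where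
  "first_chern E r d \<longleftrightarrow> (\<exists>\<delta> :: ('k ^ 'n) set \<Rightarrow> (nat \<Rightarrow> 'v) \<Rightarrow> 'k ^ 'n \<Rightarrow> 'k.
     (\<forall>x\<in>base E.
       (\<forall>u\<in>{..<r} \<rightarrow>\<^sub>E fibre E x.
         \<delta> x u \<in> fibre (twist (base E) d) x \<and>
         (\<forall>i<r. \<forall>v\<in>fibre E x. \<forall>w\<in>fibre E x. \<delta> x (u(i := v + w)) = \<delta> x (u(i := v)) + \<delta> x (u(i := w))) \<and>
         (\<forall>i<r. \<forall>a. \<forall>v\<in>fibre E x.
            \<delta> x (u(i := smult E a v)) = smult (twist (base E) d) a (\<delta> x (u(i := v)))) \<and>
         (\<forall>i<r. \<forall>j<r. i \<noteq> j \<longrightarrow> u i = u j \<longrightarrow> \<delta> x u = 0)) \<and>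
       (\<exists>u\<in>{..<r} \<rightarrow>\<^sub>E fibre E x. \<delta> x u \<noteq> 0)) \<and>
     (\<forall>U s. zopen (base E) U \<longrightarrow> (\<forall>i<r. s i \<in> sects E U) \<longrightarrow>
       (\<lambda>x. \<delta> x (\<lambda>i\<in>{..<r}. s i x)) \<in> sects (twist (base E) d) U))"

definition steiner ::
  "(('k::field ^ 'n::finite) set, 'k, 'v::ab_group_add) vbundle \<Rightarrow> nat \<Rightarrow> bool" where
  "steiner E r \<longleftrightarrow> vector_bundle E r \<and> base E = proj_space \<and>
     (\<exists>x c \<phi> \<psi>. short_exact E (twist_power proj_space 0 x) (twist_power proj_space 1 c) \<phi> \<psi>)"

definition uniform ::
  "(('k::field ^ 'n::finite) set, 'k, 'v::ab_group_add) vbundle \<Rightarrow> nat \<Rightarrow> bool" where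
  "uniform E r \<longleftrightarrow> vector_bundle E r \<and> base E = proj_space \<and>
     (\<exists>a :: nat \<Rightarrow> int. mono_on {..<r} a \<and>
       (\<forall>L\<in>proj_lines. bundle_iso (restrict_bundle L E) (bundle_sum L {..<r} (\<lambda>i. twist L (a i)))))"

definition type_uniform_steiner ::
  "nat \<Rightarrow> (('k::field ^ 'n::finite) set, 'k, 'v::ab_group_add) vbundle \<Rightarrow> nat \<Rightarrow> bool" where
  "type_uniform_steiner k E r \<longleftrightarrow> steiner E r \<and> uniform E r \<and>
     (\<exists>a :: nat \<Rightarrow> nat. a k > 0 \<and>
       (\<forall>L\<in>proj_lines. bundle_iso (restrict_bundle L E)
          (bundle_sum L {..k} (\<lambda>i. twist_power L (- int i) (a i)))))"

end

theory Submission
  imports Defs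
begin

text \<open>
  A Steiner bundle is the kernel of a matrix \<open>a v\<close> with \<open>c\<close> rows and linear entries that is surjective
  for every \<open>v\<close>.  A constant vector has no coefficients in \<open>O(-1)\<close> on a line; applied to the rows of
  \<open>a\<close> and to a frame of the restriction of \<open>E\<close> to the line through \<open>v\<close> and \<open>w\<close>, this shows that
  the splitting into copies of \<open>O\<close> and \<open>O(-1)\<close> forces the \<open>2c\<close> rows of \<open>a v\<close> and \<open>a w\<close> to be
  independent, and conversely this independence gives an explicit splitting.  The spans of these rows,
  over all lines, are parametrised by \<open>2c + 2(n - 1)\<close> scalars.  If the number \<open>r + c\<close> of columns is
  larger, then some functional \<open>l\<close> lies in none of the spans, and the subbundle of \<open>E\<close> on which \<open>l\<close>
  vanishes is again of the same kind, with rank \<open>r - 1\<close> and with quotient \<open>O\<close>.  Iterating gives \<open>F\<close>.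
  That \<open>c\<close> is the number of rows follows by evaluating the determinant form of \<open>E\<close> on a
  homogeneous frame over one line: it is a nowhere vanishing homogeneous function, so its degree is zero.
\<close>

section \<open>Linear systems over a field\<close>

text \<open>Cohomology on a line is replaced by polynomials in one variable: a section of
  \<open>O(d)\<close> is a homogeneous function on the cone, the two affine charts of the line turn
  it into two polynomials, and comparing degrees gives the sections of \<open>O(-1)\<close>,
  \<open>O\<close> and \<open>O(1)\<close>. For this reason bundles are handled through frame
  vectors over the cone, homogeneous of prescribed degrees, rather than through isomorphisms with
  sums of line bundles. A functional \<open>l\<close> has to do two things. Avoiding the row space
  of \<open>a v\<close> makes it nonzero on the fibre over \<open>v\<close>, so that its kernel is a
  bundle with quotient \<open>O\<close>. Avoiding the span of the rows of \<open>a v\<close> and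
  \<open>a w\<close> keeps these rows independent modulo \<open>l\<close>, so that the kernel still
  splits into copies of \<open>O\<close> and \<open>O(-1)\<close> on the line. Both demands are met
  by avoiding all the spans. The technical obstacle is that sections over a line are by definition
  local restrictions of sections over the whole space, while frames are given fibre by fibre. Each
  passage between them solves a linear system with fractions as coefficients and checks that the
  solution is again a fraction of the right degree.\<close>

lemma eliminate:
  fixes M :: "'j \<Rightarrow> 'i \<Rightarrow> 'k::field"
  assumes "finite I" "i0 \<in> I" "M j0 i0 \<noteq> 0" "(\<Sum>i\<in>I. M j0 i * y i) = d"
  shows "(\<Sum>i\<in>I. M j i * y i) = (\<Sum>i\<in>I-{i0}. (M j i - M j i0 * M j0 i / M j0 i0) * y i) + M j i0 * d / M j0 i0"
proof -
  let ?S = "\<Sum>i\<in>I-{i0}. M j0 i * y i"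
  have "M j0 i0 * y i0 + ?S = d"
    using assms by (simp add: sum.remove)
  then have y: "y i0 = (d - ?S) / M j0 i0"
    using assms(3) by (simp add: field_simps)
  have "(\<Sum>i\<in>I-{i0}. (M j i - M j i0 * M j0 i / M j0 i0) * y i)
      = (\<Sum>i\<in>I-{i0}. M j i * y i) - (M j i0 / M j0 i0) * ?S"
    unfolding sum_distrib_left sum_subtractf[symmetric]
    using assms(3) by (intro sum.cong) (auto simp: field_simps)
  then show ?thesis
    using assms by (simp add: sum.remove[of I i0] y diff_divide_distrib algebra_simps)
qed

lemma pivot_value:
  fixes M :: "'j \<Rightarrow> 'i \<Rightarrow> 'k::field" and y :: "'i \<Rightarrow> 'k" and d :: 'k
  assumes "finite I" "i0 \<in> I" "M j0 i0 \<noteq> 0"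
  defines "y' \<equiv> y(i0 := (d - (\<Sum>i\<in>I-{i0}. M j0 i * y i)) / M j0 i0)"
  shows "(\<Sum>i\<in>I. M j0 i * y' i) = d"
proof -
  have "(\<Sum>i\<in>I-{i0}. M j0 i * y' i) = (\<Sum>i\<in>I-{i0}. M j0 i * y i)"
    by (rule sum.cong) (auto simp: y'_def)
  then show ?thesis
    using assms by (simp add: sum.remove[of I i0])
qed

text \<open>Induction on the equations: a pivot removes one equation and one unknown, so the strict
  inequality persists. It supplies the nonzero solutions behind the later dimension counts.\<close>

lemma underdetermined:
  fixes M :: "'j \<Rightarrow> 'i \<Rightarrow> 'k::field"
  assumes "finite J" "finite I" "card J < card I"
  shows "\<exists>y. (\<exists>i\<in>I. y i \<noteq> 0) \<and> (\<forall>j\<in>J. (\<Sum>i\<in>I. M j i * y i) = 0)"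
  using assms
proof (induction J arbitrary: I M rule: finite_induct)
  case empty
  then have "I \<noteq> {}" by auto
  then show ?case by (intro exI[of _ "\<lambda>_. 1"]) auto
next
  case (insert j0 J)
  show ?case
  proof (cases "\<exists>i0\<in>I. M j0 i0 \<noteq> 0")
    case False
    have "card J < card I" using insert by simp
    from insert.IH[OF insert.prems(1) this, of M] False show ?thesis by fastforce
  next
    case True
    then obtain i0 where i0: "i0 \<in> I" "M j0 i0 \<noteq> 0" by blast
    have "card J < card (I - {i0})" using insert i0 by simp
    from insert.IH[OF _ this, of "\<lambda>j i. M j i - M j i0 * M j0 i / M j0 i0"] insert.prems(1)
    obtain y where y: "\<exists>i\<in>I-{i0}. y i \<noteq> 0"
      "\<forall>j\<in>J. (\<Sum>i\<in>I-{i0}. (M j i - M j i0 * M j0 i / M j0 i0) * y i) = 0" by auto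
    define y' where "y' = y(i0 := (0 - (\<Sum>i\<in>I-{i0}. M j0 i * y i)) / M j0 i0)"
    have 0: "(\<Sum>i\<in>I. M j0 i * y' i) = 0"
      unfolding y'_def by (rule pivot_value[of I i0 M j0]) (use insert.prems i0 in auto)
    have "(\<Sum>i\<in>I. M j i * y' i) = 0" if "j \<in> J" for j
    proof -
      have "(\<Sum>i\<in>I-{i0}. (M j i - M j i0 * M j0 i / M j0 i0) * y' i)
         = (\<Sum>i\<in>I-{i0}. (M j i - M j i0 * M j0 i / M j0 i0) * y i)"
        by (rule sum.cong) (auto simp: y'_def)
      then show ?thesis
        using eliminate[of I i0 M j0, OF insert.prems(1) i0 0, of j] y(2) that by simp
    qed
    moreover have "\<exists>i\<in>I. y' i \<noteq> 0" using y(1) by (auto simp: y'_def)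
    ultimately show ?thesis using 0 by (intro exI[of _ y']) auto
  qed
qed

text \<open>Dual to \<open>eliminate\<close>: a relation among the reduced rows lifts to the
  original rows together with the pivot row, whose coefficient is forced by column
  \<open>i0\<close>. Inductions on the rows use it to pass their hypotheses to the smaller
  system.\<close>

lemma rows_eliminate:
  fixes M :: "'j \<Rightarrow> 'i \<Rightarrow> 'k::field" and z :: "'j \<Rightarrow> 'k"
  assumes "finite J" "j0 \<notin> J" "M j0 i0 \<noteq> 0"
    and z: "\<forall>i\<in>I-{i0}. (\<Sum>j\<in>J. z j * (M j i - M j i0 * M j0 i / M j0 i0)) = 0"
  defines "z' \<equiv> z(j0 := - (\<Sum>j\<in>J. z j * M j i0) / M j0 i0)"
  shows "\<forall>i\<in>I. (\<Sum>j\<in>insert j0 J. z' j * M j i) = 0"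
proof
  fix i assume i: "i \<in> I"
  have "(\<Sum>j\<in>J. z' j * M j i) = (\<Sum>j\<in>J. z j * M j i)"
    using assms(2) by (intro sum.cong) (auto simp: z'_def)
  then have eq: "(\<Sum>j\<in>insert j0 J. z' j * M j i)
      = (\<Sum>j\<in>J. z j * M j i) - (\<Sum>j\<in>J. z j * M j i0) / M j0 i0 * M j0 i"
    using assms(1,2) by (simp add: z'_def)
  show "(\<Sum>j\<in>insert j0 J. z' j * M j i) = 0"
  proof (cases "i = i0")
    case True then show ?thesis using eq assms(3) by simp
  next
    case False
    then have "(\<Sum>j\<in>J. z j * (M j i - M j i0 * M j0 i / M j0 i0)) = 0" using z i by simp
    also have "(\<Sum>j\<in>J. z j * (M j i - M j i0 * M j0 i / M j0 i0))
        = (\<Sum>j\<in>J. z j * M j i) - (\<Sum>j\<in>J. z j * M j i0) / M j0 i0 * M j0 i"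
      unfolding sum_divide_distrib sum_distrib_right sum_subtractf[symmetric]
      using assms(3) by (intro sum.cong) (auto simp: field_simps)
    finally show ?thesis using eq by simp
  qed
qed

text \<open>Elimination preserves the hypothesis, because every relation among the reduced rows
  comes from one among all rows. Applied to a transposed matrix, the lemma says that a functional
  vanishing on a kernel is a combination of the rows; this is how duality enters below.\<close>

lemma fredholm_alternative:
  fixes M :: "'j \<Rightarrow> 'i \<Rightarrow> 'k::field"
  assumes "finite J" "finite I"
    and "\<And>z. (\<forall>i\<in>I. (\<Sum>j\<in>J. z j * M j i) = 0) \<Longrightarrow> (\<Sum>j\<in>J. z j * b j) = 0"
  shows "\<exists>y. \<forall>j\<in>J. (\<Sum>i\<in>I. M j i * y i) = b j"
  using assms
proof (induction J arbitrary: I M b rule: finite_induct)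
  case empty
  then show ?case by auto
next
  case (insert j0 J)
  show ?case
  proof (cases "\<exists>i0\<in>I. M j0 i0 \<noteq> 0")
    case False
    have "(\<Sum>j\<in>J. z j * b j) = 0" if "\<forall>i\<in>I. (\<Sum>j\<in>J. z j * M j i) = 0" for z
    proof -
      have *: "(\<Sum>j\<in>J. (z(j0 := 0)) j * c j) = (\<Sum>j\<in>J. z j * c j)" for c
        using insert.hyps by (intro sum.cong) auto
      show ?thesis
        using insert.prems(2)[of "z(j0 := 0)"] insert.hyps that * by (simp add: False)
    qed
    from insert.IH[of I M b, OF insert.prems(1) this] obtain y
      where y: "\<forall>j\<in>J. (\<Sum>i\<in>I. M j i * y i) = b j" by blast
    have "(\<Sum>j\<in>J. (if j = j0 then 1 else 0) * c j) = 0" for c :: "'j \<Rightarrow> 'k"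
      using insert.hyps by (intro sum.neutral) auto
    \<comment> \<open>Row \<open>j0\<close> is zero, so the relation supported on \<open>j0\<close>
      alone tests its right-hand side.\<close>
    then have "b j0 = 0"
      using insert.prems(2)[of "\<lambda>j. if j = j0 then 1 else 0"] insert.hyps False by simp
    then show ?thesis using y False by (intro exI[of _ y]) auto
  next
    case True
    then obtain i0 where i0: "i0 \<in> I" "M j0 i0 \<noteq> 0" by blast
    define b' where "b' j = b j - M j i0 * b j0 / M j0 i0" for j
    have "(\<Sum>j\<in>J. z j * b' j) = 0"
      if z: "\<forall>i\<in>I-{i0}. (\<Sum>j\<in>J. z j * (M j i - M j i0 * M j0 i / M j0 i0)) = 0" for z
    proof -
      define z' where "z' = z(j0 := - (\<Sum>j\<in>J. z j * M j i0) / M j0 i0)"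
      have "\<forall>i\<in>I. (\<Sum>j\<in>insert j0 J. z' j * M j i) = 0"
        unfolding z'_def by (rule rows_eliminate[of J j0 M i0]) (use insert.hyps i0 z in auto)
      from insert.prems(2)[OF this] have "z' j0 * b j0 + (\<Sum>j\<in>J. z' j * b j) = 0"
        using insert.hyps by simp
      moreover have "(\<Sum>j\<in>J. z' j * b j) = (\<Sum>j\<in>J. z j * b j)"
        using insert.hyps by (intro sum.cong) (auto simp: z'_def)
      moreover have "(\<Sum>j\<in>J. z j * b' j) = (\<Sum>j\<in>J. z j * b j) - (\<Sum>j\<in>J. z j * M j i0) * (b j0 / M j0 i0)"
        unfolding sum_distrib_right sum_subtractf[symmetric] b'_def
        using i0 by (intro sum.cong) (auto simp: field_simps)
      ultimately show ?thesis
        by (simp add: z'_def)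
    qed
    from insert.IH[of "I - {i0}" "\<lambda>j i. M j i - M j i0 * M j0 i / M j0 i0", OF _ this] insert.prems(1) obtain y
      where y: "\<forall>j\<in>J. (\<Sum>i\<in>I-{i0}. (M j i - M j i0 * M j0 i / M j0 i0) * y i) = b' j" by auto
    define y' where "y' = y(i0 := (b j0 - (\<Sum>i\<in>I-{i0}. M j0 i * y i)) / M j0 i0)"
    have 0: "(\<Sum>i\<in>I. M j0 i * y' i) = b j0"
      unfolding y'_def by (rule pivot_value[of I i0 M j0]) (use insert.prems i0 in auto)
    have "(\<Sum>i\<in>I. M j i * y' i) = b j" if "j \<in> J" for j
    proof -
      have "(\<Sum>i\<in>I-{i0}. (M j i - M j i0 * M j0 i / M j0 i0) * y' i)
         = (\<Sum>i\<in>I-{i0}. (M j i - M j i0 * M j0 i / M j0 i0) * y i)"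
        by (rule sum.cong) (auto simp: y'_def)
      then show ?thesis
        using eliminate[of I i0 M j0, OF insert.prems(1) i0 0, of j] y that by (simp add: b'_def)
    qed
    then show ?thesis using 0 by (intro exI[of _ y']) auto
  qed
qed

text \<open>\<open>K\<close> consists of the columns never chosen as pivots. A solution is
  determined by arbitrary values on \<open>K\<close>, so the solutions with unit vectors on
  \<open>K\<close> form a basis of the kernel: rank-nullity with an explicit basis.\<close>

lemma free_variables:
  fixes M :: "'j \<Rightarrow> 'i \<Rightarrow> 'k::field"
  assumes "finite J" "finite I"
    and "\<And>z. (\<forall>i\<in>I. (\<Sum>j\<in>J. z j * M j i) = 0) \<Longrightarrow> (\<forall>j\<in>J. z j = 0)"
  shows "\<exists>K\<subseteq>I. card I = card K + card J \<and>
    (\<forall>b. \<exists>y. (\<forall>i\<in>K. y i = b i) \<and> (\<forall>j\<in>J. (\<Sum>i\<in>I. M j i * y i) = 0)) \<and>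
    (\<forall>y. (\<forall>i\<in>K. y i = 0) \<longrightarrow> (\<forall>j\<in>J. (\<Sum>i\<in>I. M j i * y i) = 0) \<longrightarrow> (\<forall>i\<in>I. y i = 0))"
  using assms
proof (induction J arbitrary: I M rule: finite_induct)
  case empty
  then show ?case by (intro exI[of _ I]) auto
next
  case (insert j0 J)
  have "\<exists>i0\<in>I. M j0 i0 \<noteq> 0"
  proof (rule ccontr)
    assume "\<not> ?thesis"
    moreover have "(\<Sum>j\<in>J. (if j = j0 then 1 else 0) * c j) = 0" for c :: "'j \<Rightarrow> 'k"
      using insert.hyps by (intro sum.neutral) auto
    ultimately have "(if j0 = j0 then 1 else 0 :: 'k) = 0"
      using insert.prems(2)[of "\<lambda>j. if j = j0 then 1 else 0"] insert.hyps by auto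
    then show False by simp
  qed
  then obtain i0 where i0: "i0 \<in> I" "M j0 i0 \<noteq> 0" by blast
  have indep: "\<forall>j\<in>J. z j = 0"
    if z: "\<forall>i\<in>I-{i0}. (\<Sum>j\<in>J. z j * (M j i - M j i0 * M j0 i / M j0 i0)) = 0" for z
  proof -
    define z' where "z' = z(j0 := - (\<Sum>j\<in>J. z j * M j i0) / M j0 i0)"
    have "\<forall>i\<in>I. (\<Sum>j\<in>insert j0 J. z' j * M j i) = 0"
      unfolding z'_def by (rule rows_eliminate[of J j0 M i0]) (use insert.hyps i0 z in auto)
    from insert.prems(2)[OF this] show ?thesis
      using insert.hyps by (auto simp: z'_def split: if_splits)
  qed
  have "finite (I - {i0})" using insert.prems(1) by simp
  note IH = insert.IH[of "I - {i0}" "\<lambda>j i. M j i - M j i0 * M j0 i / M j0 i0", OF this]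
  have "\<exists>K. K \<subseteq> I - {i0} \<and> card (I - {i0}) = card K + card J \<and>
    (\<forall>b. \<exists>y. (\<forall>i\<in>K. y i = b i) \<and> (\<forall>j\<in>J. (\<Sum>i\<in>I-{i0}. (M j i - M j i0 * M j0 i / M j0 i0) * y i) = 0)) \<and>
    (\<forall>y. (\<forall>i\<in>K. y i = 0) \<longrightarrow> (\<forall>j\<in>J. (\<Sum>i\<in>I-{i0}. (M j i - M j i0 * M j0 i / M j0 i0) * y i) = 0) \<longrightarrow>
      (\<forall>i\<in>I-{i0}. y i = 0))"
    by (rule IH) (erule indep)
  then obtain K where K': "K \<subseteq> I - {i0} \<and> card (I - {i0}) = card K + card J \<and>
    (\<forall>b. \<exists>y. (\<forall>i\<in>K. y i = b i) \<and> (\<forall>j\<in>J. (\<Sum>i\<in>I-{i0}. (M j i - M j i0 * M j0 i / M j0 i0) * y i) = 0)) \<and>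
    (\<forall>y. (\<forall>i\<in>K. y i = 0) \<longrightarrow> (\<forall>j\<in>J. (\<Sum>i\<in>I-{i0}. (M j i - M j i0 * M j0 i / M j0 i0) * y i) = 0) \<longrightarrow>
      (\<forall>i\<in>I-{i0}. y i = 0))"
    by (elim exE) (rule that)
  note K = K'[THEN conjunct1] K'[THEN conjunct2, THEN conjunct1]
    K'[THEN conjunct2, THEN conjunct2, THEN conjunct1, rule_format]
    K'[THEN conjunct2, THEN conjunct2, THEN conjunct2, THEN spec, THEN mp, THEN mp]
  have ex: "\<exists>y. (\<forall>i\<in>K. y i = b i) \<and> (\<forall>j\<in>insert j0 J. (\<Sum>i\<in>I. M j i * y i) = 0)" for b
  proof -
    obtain y where y: "\<forall>i\<in>K. y i = b i"
      "\<forall>j\<in>J. (\<Sum>i\<in>I-{i0}. (M j i - M j i0 * M j0 i / M j0 i0) * y i) = 0"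
      using K(3)[of b] by (elim exE conjE) (rule that, auto)
    define y' where "y' = y(i0 := (0 - (\<Sum>i\<in>I-{i0}. M j0 i * y i)) / M j0 i0)"
    have 0: "(\<Sum>i\<in>I. M j0 i * y' i) = 0"
      unfolding y'_def by (rule pivot_value[of I i0 M j0]) (use insert.prems i0 in auto)
    have "(\<Sum>i\<in>I. M j i * y' i) = 0" if "j \<in> J" for j
    proof -
      have "(\<Sum>i\<in>I-{i0}. (M j i - M j i0 * M j0 i / M j0 i0) * y' i)
         = (\<Sum>i\<in>I-{i0}. (M j i - M j i0 * M j0 i / M j0 i0) * y i)"
        by (rule sum.cong) (auto simp: y'_def)
      then show ?thesis
        using eliminate[of I i0 M j0, OF insert.prems(1) i0 0, of j] y(2) that by simp
    qed
    moreover have "\<forall>i\<in>K. y' i = b i" using K(1) y(1) by (auto simp: y'_def)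
    ultimately show ?thesis using 0 by (intro exI[of _ y']) auto
  qed
  have uni: "\<forall>i\<in>I. y i = 0"
    if y: "\<forall>i\<in>K. y i = 0" "\<forall>j\<in>insert j0 J. (\<Sum>i\<in>I. M j i * y i) = 0" for y
  proof -
    have 0: "(\<Sum>i\<in>I. M j0 i * y i) = 0" using y(2) by simp
    have "\<forall>j\<in>J. (\<Sum>i\<in>I-{i0}. (M j i - M j i0 * M j0 i / M j0 i0) * y i) = 0"
      using eliminate[of I i0 M j0, OF insert.prems(1) i0 0] y(2) by simp
    then have *: "\<forall>i\<in>I-{i0}. y i = 0" by (rule K(4)[OF y(1)])
    then have "M j0 i0 * y i0 = 0" using 0 insert.prems(1) i0(1) by (simp add: sum.remove[of I i0])
    then show ?thesis using * i0 by auto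
  qed
  have "card I = card K + card (insert j0 J)"
    using K(2) insert.prems(1) insert.hyps i0(1)
    by (metis add_Suc_right card.remove card_insert_disjoint)
  moreover have "K \<subseteq> I" using K(1) by auto
  moreover have "\<forall>y. (\<forall>i\<in>K. y i = 0) \<longrightarrow> (\<forall>j\<in>insert j0 J. (\<Sum>i\<in>I. M j i * y i) = 0) \<longrightarrow> (\<forall>i\<in>I. y i = 0)"
    by (rule allI, rule impI, rule impI, rule uni)
  ultimately show ?case
    using ex by (intro exI[of _ K]) simp
qed

section \<open>Forms and fractions near a point\<close>

lemma finite_multi_indices: "finite {m :: 'n::finite \<Rightarrow> nat. sum m UNIV = d}"
proof (rule finite_subset)
  show "{m :: 'n \<Rightarrow> nat. sum m UNIV = d} \<subseteq> PiE UNIV (\<lambda>_. {..d})"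
    by (auto simp: PiE_def extensional_def intro: member_le_sum)
qed (simp add: finite_PiE)

definition monomial :: "('n::finite \<Rightarrow> nat) \<Rightarrow> 'k::field ^ 'n \<Rightarrow> 'k" where
  "monomial m v = (\<Prod>i\<in>UNIV. (v $ i) ^ m i)"

lemma monomial_mult: "monomial m v * monomial m' v = monomial (\<lambda>i. m i + m' i) v"
  unfolding monomial_def power_add prod.distrib by (rule refl)

lemma formsI:
  assumes "\<And>v. p v = (\<Sum>m\<in>{m. sum m UNIV = d}. c m * monomial m v)" shows "p \<in> forms d"
proof -
  have "p = (\<lambda>v. \<Sum>m\<in>{m. sum m UNIV = d}. c m * (\<Prod>i\<in>UNIV. (v $ i) ^ m i))"
    using assms by (simp add: fun_eq_iff monomial_def)
  then show ?thesis unfolding forms_def by blast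
qed

lemma formsE:
  assumes "p \<in> forms d"
  shows "\<exists>c. \<forall>v. p v = (\<Sum>m\<in>{m. sum m UNIV = d}. c m * monomial m v)"
proof -
  from assms obtain c where "p = (\<lambda>v. \<Sum>m\<in>{m. sum m UNIV = d}. c m * monomial m v)"
    unfolding forms_def monomial_def by blast
  then show ?thesis by (intro exI[of _ c]) simp
qed

lemma forms_add:
  assumes "p \<in> forms d" "q \<in> forms d" shows "(\<lambda>v. p v + q v) \<in> forms d"
proof -
  obtain b where "\<And>v. p v = (\<Sum>m\<in>{m. sum m UNIV = d}. b m * monomial m v)" using formsE[OF assms(1)] by blast
  moreover obtain c where "\<And>v. q v = (\<Sum>m\<in>{m. sum m UNIV = d}. c m * monomial m v)" using formsE[OF assms(2)] by blast
  ultimately show ?thesis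
    by (intro formsI[where d = d and c = "\<lambda>m. b m + c m"]) (simp add: sum.distrib distrib_right)
qed

lemma forms_scale:
  assumes "p \<in> forms d" shows "(\<lambda>v. a * p v) \<in> forms d"
proof -
  obtain b where "\<And>v. p v = (\<Sum>m\<in>{m. sum m UNIV = d}. b m * monomial m v)" using formsE[OF assms] by blast
  then show ?thesis
    by (intro formsI[where d = d and c = "\<lambda>m. a * b m"]) (simp add: sum_distrib_left mult.assoc)
qed

lemma forms_zero: "(\<lambda>v. 0) \<in> forms d"
  by (rule formsI[where d = d and c = "\<lambda>_. 0"]) simp

lemma forms_sum: "(\<And>a. a \<in> A \<Longrightarrow> p a \<in> forms d) \<Longrightarrow> (\<lambda>v. \<Sum>a\<in>A. p a v) \<in> forms d"
  by (induction A rule: infinite_finite_induct) (auto simp: forms_zero intro: forms_add)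

lemma forms_monomial:
  assumes "sum m UNIV = d" shows "monomial m \<in> forms d"
proof (rule formsI)
  fix v :: "'b ^ 'a"
  have "(\<Sum>m'\<in>{m'. sum m' UNIV = d}. (if m' = m then 1 else 0) * monomial m' v)
      = (\<Sum>m'\<in>{m'. sum m' UNIV = d}. if m' = m then monomial m v else 0)"
    by (intro sum.cong) auto
  then show "monomial m v = (\<Sum>m'\<in>{m'. sum m' UNIV = d}. (if m' = m then 1 else 0) * monomial m' v)"
    using assms by (simp add: sum.delta finite_multi_indices)
qed

lemma forms_mult:
  assumes "p \<in> forms d" "q \<in> forms e" shows "(\<lambda>v. p v * q v) \<in> forms (d + e)"
proof -
  obtain b where p: "\<And>v. p v = (\<Sum>m\<in>{m. sum m UNIV = d}. b m * monomial m v)" using formsE[OF assms(1)] by blast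
  obtain c where q: "\<And>v. q v = (\<Sum>m\<in>{m. sum m UNIV = e}. c m * monomial m v)" using formsE[OF assms(2)] by blast
  note * = p q
  have "(\<lambda>v. p v * q v) = (\<lambda>v. \<Sum>m\<in>{m. sum m UNIV = d}. \<Sum>m'\<in>{m. sum m UNIV = e}.
     (b m * c m') * monomial (\<lambda>i. m i + m' i) v)"
    unfolding * by (simp add: sum_product fun_eq_iff monomial_mult[symmetric] ac_simps)
  also have "\<dots> \<in> forms (d + e)"
    by (intro forms_sum forms_scale forms_monomial) (auto simp: sum.distrib)
  finally show ?thesis .
qed

lemma forms_const: "(\<lambda>v. a) \<in> forms 0"
proof -
  have "(\<lambda>v. a * monomial (\<lambda>_. 0) v) \<in> forms 0"
    by (intro forms_scale forms_monomial) auto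
  then show ?thesis by (simp add: monomial_def)
qed

lemma forms_coord: "(\<lambda>v :: 'b::field ^ 'a::finite. v $ i) \<in> forms 1"
proof -
  have "monomial (\<lambda>j. if j = i then 1 else 0) \<in> (forms 1 :: ('b ^ 'a \<Rightarrow> 'b) set)"
    by (intro forms_monomial) auto
  moreover have "monomial (\<lambda>j. if j = i then 1 else 0) = (\<lambda>v :: 'b ^ 'a. v $ i)"
    by (simp add: monomial_def if_distrib[of "\<lambda>x. _ ^ x"] prod.delta fun_eq_iff cong: if_cong)
  ultimately show ?thesis by simp
qed

lemma forms_linear: "(\<lambda>v. \<Sum>i\<in>UNIV. c i * v $ i) \<in> forms 1"
  using forms_coord by (intro forms_sum forms_scale) auto

lemma forms_power: "p \<in> forms d \<Longrightarrow> (\<lambda>v. p v ^ n) \<in> forms (d * n)"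
  by (induction n) (auto simp: forms_const intro: forms_mult)

lemma forms_homogeneous: "p \<in> forms d \<Longrightarrow> p (a *s v) = a ^ d * p v"
proof -
  assume "p \<in> forms d"
  from formsE[OF this] obtain c where p: "\<And>v. p v = (\<Sum>m\<in>{m. sum m UNIV = d}. c m * monomial m v)"
    by blast
  have "monomial m (a *s v) = a ^ d * monomial m v" if "sum m UNIV = d" for m
    using that by (simp add: monomial_def power_mult_distrib prod.distrib power_sum[symmetric])
  then show ?thesis unfolding p sum_distrib_left
    by (intro sum.cong) auto
qed

text \<open>The passage from several variables to one; the arguments with roots and degrees on a
  line are carried out with such polynomials in \<open>t\<close>.\<close>

lemma forms_on_line: "p \<in> forms d \<Longrightarrow> \<exists>P. \<forall>t. p (v + t *s w) = poly P t"
proof -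
  assume "p \<in> forms d"
  from formsE[OF this] obtain c where p: "\<And>v. p v = (\<Sum>m\<in>{m. sum m UNIV = d}. c m * monomial m v)"
    by blast
  have "p (v + t *s w) = poly (\<Sum>m\<in>{m. sum m UNIV = d}. Polynomial.smult (c m) (\<Prod>i\<in>UNIV. [:v $ i, w $ i:] ^ m i)) t" for t
    unfolding p by (simp add: poly_sum poly_prod monomial_def)
  then show ?thesis by blast
qed

section \<open>Points, the Zariski topology and germs of homogeneous fractions\<close>

definition pt :: "'k::field ^ 'n::finite \<Rightarrow> ('k ^ 'n) set" where
  "pt v = vec.span {v}"

lemma mem_pt: "w \<in> pt v \<longleftrightarrow> (\<exists>a. w = a *s v)"
  by (auto simp: pt_def vec.span_singleton)

lemma self_in_pt [simp]: "v \<in> pt v"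
  by (simp add: pt_def vec.span_base)

lemma pt_in_proj_space [simp]: "v \<noteq> 0 \<Longrightarrow> pt v \<in> proj_space"
  by (simp add: pt_def proj_space_def vec.dim_eq_card_independent[of "{v}"] vec.dim_span vec.dim_singleton)

lemma proj_space_eq_pt: "y \<in> proj_space \<Longrightarrow> v \<in> y \<Longrightarrow> v \<noteq> 0 \<Longrightarrow> y = pt v"
  unfolding proj_space_def pt_def
  by (rule sym, rule vec.subspace_dim_equal)
     (auto simp: vec.dim_eq_card_independent[of "{v}"] vec.dim_span vec.dim_singleton vec.span_minimal)

lemma proj_space_nonzero: "y \<in> proj_space \<Longrightarrow> \<exists>v\<in>y. v \<noteq> 0"
proof (rule ccontr)
  assume "y \<in> proj_space" "\<not> ?thesis"
  then have "y \<subseteq> {0}" "vec.dim y = 1" by (auto simp: proj_space_def)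
  then show False using vec.dim_subset[of y "{0}"] by simp
qed

lemma proj_spaceE:
  assumes "y \<in> proj_space" obtains v where "v \<noteq> 0" "y = pt v"
  using assms proj_space_eq_pt proj_space_nonzero by metis

lemma pt_scale: "a \<noteq> 0 \<Longrightarrow> pt (a *s v) = pt v"
  unfolding pt_def by (rule vec.span_image_scale[of "{v}" "\<lambda>_. a", simplified])

lemma mem_pt_minus_zero:
  assumes "v \<noteq> 0" shows "w \<in> pt v - {0} \<longleftrightarrow> (\<exists>a. a \<noteq> 0 \<and> w = a *s v)"
proof
  assume w: "w \<in> pt v - {0}"
  then obtain a where "w = a *s v" by (auto simp: mem_pt)
  with w show "\<exists>a. a \<noteq> 0 \<and> w = a *s v" by (intro exI[of _ a]) auto
next
  assume "\<exists>a. a \<noteq> 0 \<and> w = a *s v"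
  with assms show "w \<in> pt v - {0}" by (auto simp: mem_pt)
qed

lemma zariski_basis: "p \<in> forms d \<Longrightarrow> openin zariski {x \<in> proj_space. \<exists>v\<in>x - {0}. p v \<noteq> 0}"
  unfolding zariski_def by (rule topology_generated_by_Basis) blast

lemma topspace_zariski: "topspace zariski = proj_space"
proof
  show "topspace zariski \<subseteq> proj_space" unfolding zariski_def by auto
  have "openin zariski {x \<in> proj_space :: ('a^'b) set set. \<exists>v\<in>x - {0}. (1::'a) \<noteq> 0}"
    by (rule zariski_basis[OF forms_const])
  moreover have "{x \<in> proj_space. \<exists>v\<in>x - {0}. (1::'a) \<noteq> 0} = (proj_space :: ('a^'b) set set)"
    using proj_space_nonzero by auto
  ultimately show "proj_space \<subseteq> topspace (zariski :: ('a^'b) set topology)"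
    using openin_subset by metis
qed

lemma zopen_self: "X \<subseteq> proj_space \<Longrightarrow> zopen X X"
  by (metis openin_topspace topspace_subtopology_subset topspace_zariski)

lemma zopen_subset: "zopen X W \<Longrightarrow> W \<subseteq> X"
  using openin_subset by fastforce

lemma zopen_mono: "L \<subseteq> X \<Longrightarrow> zopen X W \<Longrightarrow> zopen L (W \<inter> L)"
  by (auto simp: openin_subtopology)

lemma zopen_extend:
  assumes "L \<subseteq> X" "zopen L W" shows "\<exists>W'. zopen X W' \<and> W = W' \<inter> L"
proof -
  from assms obtain T where "openin zariski T" "W = T \<inter> L" by (auto simp: openin_subtopology)
  then have "zopen X (T \<inter> X)" "W = (T \<inter> X) \<inter> L" using assms(1) by (auto simp: openin_subtopology)
  then show ?thesis by blast
qed

lemma zopen_Int: "zopen X U \<Longrightarrow> zopen X V \<Longrightarrow> zopen X (U \<inter> V)"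
  by (rule openin_Int)

lemma zopen_basis:
  assumes "p \<in> forms d" "X \<subseteq> proj_space"
  shows "zopen X {x\<in>X. \<exists>v\<in>x - {0}. p v \<noteq> 0}"
  unfolding openin_subtopology using zariski_basis[OF assms(1)] assms(2)
  by (intro exI[of _ "{x \<in> proj_space. \<exists>v\<in>x - {0}. p v \<noteq> 0}"]) auto

text \<open>Functions on the cone over \<open>X\<close> are studied near a point \<open>x\<close> by means of the filter of the
  cones over its Zariski neighbourhoods.\<close>

definition zn :: "('k::field ^ 'n::finite) set set \<Rightarrow> ('k ^ 'n) set \<Rightarrow> ('k ^ 'n) filter" where
  "zn X x = Abs_filter (\<lambda>P. x \<in> X \<longrightarrow> (\<exists>W. zopen X W \<and> x \<in> W \<and> (\<forall>y\<in>W. \<forall>v\<in>y - {0}. P v)))"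

lemma eventually_zn:
  assumes "X \<subseteq> proj_space" "x \<in> X"
  shows "eventually P (zn X x) \<longleftrightarrow> (\<exists>W. zopen X W \<and> x \<in> W \<and> (\<forall>y\<in>W. \<forall>v\<in>y - {0}. P v))"
proof -
  have "is_filter (\<lambda>P. x \<in> X \<longrightarrow> (\<exists>W. zopen X W \<and> x \<in> W \<and> (\<forall>y\<in>W. \<forall>v\<in>y - {0}. P v)))"
  proof (rule is_filter.intro, goal_cases)
    case 1 then show ?case using zopen_self[OF assms(1)] by auto
  next
    case (2 P Q)
    show ?case
    proof
      assume x: "x \<in> X"
      from 2(1)[rule_format, OF x] obtain V where V: "zopen X V" "x \<in> V" "\<forall>y\<in>V. \<forall>v\<in>y - {0}. P v"
        by (elim exE conjE) (rule that)
      from 2(2)[rule_format, OF x] obtain W where W: "zopen X W" "x \<in> W" "\<forall>y\<in>W. \<forall>v\<in>y - {0}. Q v"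
        by (elim exE conjE) (rule that)
      from V W show "\<exists>W. zopen X W \<and> x \<in> W \<and> (\<forall>y\<in>W. \<forall>v\<in>y - {0}. P v \<and> Q v)"
        by (intro exI[of _ "V \<inter> W"]) (auto simp: zopen_Int)
    qed
  next
    case (3 P Q)
    show ?case
    proof
      assume x: "x \<in> X"
      from 3(2)[rule_format, OF x] obtain W where W: "zopen X W" "x \<in> W" "\<forall>y\<in>W. \<forall>v\<in>y - {0}. P v"
        by (elim exE conjE) (rule that)
      then show "\<exists>W. zopen X W \<and> x \<in> W \<and> (\<forall>y\<in>W. \<forall>v\<in>y - {0}. Q v)"
        using 3(1) by (intro exI[of _ W]) simp
    qed
  qed
  from eventually_Abs_filter[OF this] show ?thesis using assms(2) by (simp add: zn_def)
qed

lemma eventually_zn_at: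
  assumes "eventually P (zn X (pt v))" "X \<subseteq> proj_space" "pt v \<in> X" "v \<noteq> 0"
  shows "P v"
  using assms by (auto simp: eventually_zn)

text \<open>By homogeneity the vanishing of a form at a point does not depend on the representative,
  so the basic open set of \<open>p\<close> is a suitable neighbourhood.\<close>

lemma eventually_zn_nonzero:
  assumes "p \<in> forms d" "p v \<noteq> 0" "X \<subseteq> proj_space" "pt v \<in> X" "v \<noteq> 0"
  shows "eventually (\<lambda>u. p u \<noteq> 0) (zn X (pt v))"
proof -
  let ?W = "{x\<in>X. \<exists>v\<in>x - {0}. p v \<noteq> 0}"
  have "p u \<noteq> 0" if "y \<in> ?W" "u \<in> y - {0}" for y u
  proof -
    from that obtain u' where u': "u' \<in> y" "u' \<noteq> 0" "p u' \<noteq> 0" by auto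
    have "u \<in> pt u'" using that u' assms(3) proj_space_eq_pt by blast
    then obtain a where "u = a *s u'" by (auto simp: mem_pt)
    moreover from this have "a \<noteq> 0" using that by auto
    ultimately show ?thesis using u' forms_homogeneous[OF assms(1)] by simp
  qed
  moreover have "pt v \<in> ?W" using assms by auto
  ultimately show ?thesis
    using zopen_basis[OF assms(1,3)] assms(3,4)
    by (subst eventually_zn) (auto intro!: exI[of _ ?W])
qed

lemma eventually_zn_mono:
  assumes "eventually P (zn X x)" "L \<subseteq> X" "X \<subseteq> proj_space" "x \<in> L"
  shows "eventually P (zn L x)"
proof -
  from assms have "x \<in> X" by auto
  with assms(1) eventually_zn[OF assms(3), of x P]
  obtain W where W: "zopen X W" "x \<in> W" "\<forall>y\<in>W. \<forall>v\<in>y - {0}. P v" by auto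
  then have "zopen L (W \<inter> L) \<and> x \<in> W \<inter> L \<and> (\<forall>y\<in>W \<inter> L. \<forall>v\<in>y - {0}. P v)"
    using zopen_mono[OF assms(2)] assms(4) by auto
  then have "\<exists>W. zopen L W \<and> x \<in> W \<and> (\<forall>y\<in>W. \<forall>v\<in>y - {0}. P v)" by (rule exI)
  moreover have "L \<subseteq> proj_space" using assms by auto
  ultimately show ?thesis using eventually_zn[of L x P] assms(4) by simp
qed

lemma eventually_zn_open:
  assumes "zopen X U" "x \<in> U" "X \<subseteq> proj_space"
  shows "eventually (\<lambda>v. v \<noteq> 0 \<and> pt v \<in> U) (zn X x)"
proof -
  have "pt v \<in> U" if "y \<in> U" "v \<in> y - {0}" for y v
    using that assms zopen_subset[OF assms(1)] proj_space_eq_pt[of y v] by auto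
  then show ?thesis using assms zopen_subset[OF assms(1)] by (subst eventually_zn) auto
qed

text \<open>Germs of sections of \<open>O(d)\<close>, viewed as functions on the cone. Regular
  functions, sections of twists, frame coefficients and matrix entries thereby share one calculus in
  which only the degree is tracked.\<close>

definition rat :: "('k::field ^ 'n::finite) set set \<Rightarrow> int \<Rightarrow> ('k ^ 'n \<Rightarrow> 'k) \<Rightarrow> ('k ^ 'n) set \<Rightarrow> bool" where
  "rat X d g x \<longleftrightarrow> (\<exists>k l. \<exists>p\<in>forms k. \<exists>q\<in>forms l. int k - int l = d \<and>
     eventually (\<lambda>v. q v \<noteq> 0 \<and> g v = p v / q v) (zn X x))"

lemma ratI:
  "p \<in> forms k \<Longrightarrow> q \<in> forms l \<Longrightarrow> int k - int l = d \<Longrightarrow>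
    eventually (\<lambda>v. q v \<noteq> 0 \<and> g v = p v / q v) (zn X x) \<Longrightarrow> rat X d g x"
  unfolding rat_def by blast

lemma ratE:
  assumes "rat X d g x"
  obtains k l p q where "p \<in> forms k" "q \<in> forms l" "int k - int l = d"
    "eventually (\<lambda>v. q v \<noteq> 0 \<and> g v = p v / q v) (zn X x)"
  using assms unfolding rat_def by (elim exE bexE conjE) (rule that)

lemma rat_cong:
  assumes "rat X d g x" "eventually (\<lambda>v. g v = h v) (zn X x)" shows "rat X d h x"
proof -
  from assms(1) obtain k l p q where *: "p \<in> forms k" "q \<in> forms l" "int k - int l = d"
    and ev: "eventually (\<lambda>v. q v \<noteq> 0 \<and> g v = p v / q v) (zn X x)"
    by (rule ratE)
  from ev assms(2) have "eventually (\<lambda>v. q v \<noteq> 0 \<and> h v = p v / q v) (zn X x)"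
    by eventually_elim simp
  with * show ?thesis by (rule ratI)
qed

lemma rat_mono:
  assumes "rat X d g x" "L \<subseteq> X" "X \<subseteq> proj_space" "x \<in> L" shows "rat L d g x"
proof -
  from assms(1) obtain k l p q where *: "p \<in> forms k" "q \<in> forms l" "int k - int l = d"
    and ev: "eventually (\<lambda>v. q v \<noteq> 0 \<and> g v = p v / q v) (zn X x)"
    by (rule ratE)
  from * eventually_zn_mono[OF ev assms(2-4)] show ?thesis by (rule ratI)
qed

lemma rat_form: "p \<in> forms d \<Longrightarrow> rat X (int d) p x"
  by (rule ratI[OF _ forms_const[of 1]]) auto

lemma rat_const: "rat X 0 (\<lambda>_. a) x"
  using rat_form[OF forms_const] by simp

lemma rat_mult:
  assumes "rat X d g x" "rat X e h x" shows "rat X (d + e) (\<lambda>v. g v * h v) x"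
proof -
  from assms(1) obtain k l p q where *: "p \<in> forms k" "q \<in> forms l" "int k - int l = d"
    and ev: "eventually (\<lambda>v. q v \<noteq> 0 \<and> g v = p v / q v) (zn X x)"
    by (rule ratE)
  from assms(2) obtain k' l' p' q' where **: "p' \<in> forms k'" "q' \<in> forms l'" "int k' - int l' = e"
    and ev': "eventually (\<lambda>v. q' v \<noteq> 0 \<and> h v = p' v / q' v) (zn X x)"
    by (rule ratE)
  from ev ev' have "eventually (\<lambda>v. q v * q' v \<noteq> 0 \<and> g v * h v = (p v * p' v) / (q v * q' v)) (zn X x)"
    by eventually_elim simp
  moreover have "int (k + k') - int (l + l') = d + e" using * ** by simp
  ultimately show ?thesis
    by (intro ratI[OF forms_mult[OF *(1) **(1)] forms_mult[OF *(2) **(2)]])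
qed

lemma rat_add:
  assumes "rat X d g x" "rat X d h x" shows "rat X d (\<lambda>v. g v + h v) x"
proof -
  from assms(1) obtain k l p q where *: "p \<in> forms k" "q \<in> forms l" "int k - int l = d"
    and ev: "eventually (\<lambda>v. q v \<noteq> 0 \<and> g v = p v / q v) (zn X x)"
    by (rule ratE)
  from assms(2) obtain k' l' p' q' where **: "p' \<in> forms k'" "q' \<in> forms l'" "int k' - int l' = d"
    and ev': "eventually (\<lambda>v. q' v \<noteq> 0 \<and> h v = p' v / q' v) (zn X x)"
    by (rule ratE)
  from ev ev' have "eventually (\<lambda>v. q v * q' v \<noteq> 0 \<and> g v + h v = (p v * q' v + p' v * q v) / (q v * q' v)) (zn X x)"
    by eventually_elim (simp add: add_frac_eq)
  moreover have "int (k + l') - int (l + l') = d" "k' + l = k + l'" using * ** by simp_all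
  moreover have "(\<lambda>v. p v * q' v + p' v * q v) \<in> forms (k + l')"
    using * ** forms_mult[of p' k' q l] \<open>k' + l = k + l'\<close> by (intro forms_add) (auto intro: forms_mult)
  ultimately show ?thesis by (intro ratI[OF _ forms_mult[OF *(2) **(2)]])
qed

lemma rat_scale: "rat X d g x \<Longrightarrow> rat X d (\<lambda>v. a * g v) x"
  using rat_mult[OF rat_const, of X d g x a] by simp

lemma rat_diff:
  assumes "rat X d g x" "rat X d h x" shows "rat X d (\<lambda>v. g v - h v) x"
  using rat_add[OF assms(1) rat_scale[OF assms(2), of "-1"]] by simp

lemma rat_inverse:
  assumes "rat X d g (pt v)" "g v \<noteq> 0" "X \<subseteq> proj_space" "pt v \<in> X" "v \<noteq> 0"
  shows "rat X (-d) (\<lambda>v. 1 / g v) (pt v)"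
proof -
  from assms(1) obtain k l p q where *: "p \<in> forms k" "q \<in> forms l" "int k - int l = d"
    and ev: "eventually (\<lambda>v. q v \<noteq> 0 \<and> g v = p v / q v) (zn X (pt v))"
    by (rule ratE)
  have "p v \<noteq> 0" using eventually_zn_at[OF ev assms(3-5)] assms(2) by auto
  from eventually_zn_nonzero[OF *(1) this assms(3-5)] ev
  have "eventually (\<lambda>v. p v \<noteq> 0 \<and> 1 / g v = q v / p v) (zn X (pt v))"
    by eventually_elim simp
  moreover have "int l - int k = -d" using * by simp
  ultimately show ?thesis by (intro ratI[OF *(2,1)])
qed

lemma rat_divide:
  assumes "rat X d g (pt v)" "rat X e h (pt v)" "h v \<noteq> 0" "X \<subseteq> proj_space" "pt v \<in> X" "v \<noteq> 0"
  shows "rat X (d - e) (\<lambda>v. g v / h v) (pt v)"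
  using rat_mult[OF assms(1) rat_inverse[OF assms(2-6)]] by simp

lemma rat_eventually_nonzero:
  assumes "rat X d g (pt v)" "g v \<noteq> 0" "X \<subseteq> proj_space" "pt v \<in> X" "v \<noteq> 0"
  shows "eventually (\<lambda>v. g v \<noteq> 0) (zn X (pt v))"
proof -
  from assms(1) obtain k l p q where *: "p \<in> forms k" "q \<in> forms l" "int k - int l = d"
    and ev: "eventually (\<lambda>v. q v \<noteq> 0 \<and> g v = p v / q v) (zn X (pt v))"
    by (rule ratE)
  have "p v \<noteq> 0" using eventually_zn_at[OF ev assms(3-5)] assms(2) by auto
  from eventually_zn_nonzero[OF *(1) this assms(3-5)] ev show ?thesis
    by eventually_elim simp
qed

lemma nonzero_coord: "v \<noteq> 0 \<Longrightarrow> \<exists>i. v $ i \<noteq> 0"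
  by (simp add: vec_eq_iff)

lemma rat_zero: assumes "X \<subseteq> proj_space" "x \<in> X" shows "rat X d (\<lambda>_. 0) x"
proof -
  obtain v where v: "v \<noteq> 0" "x = pt v" using assms proj_spaceE by blast
  obtain i where i: "v $ i \<noteq> 0" using nonzero_coord[OF v(1)] by blast
  \<comment> \<open>The zero form has every degree, but a negative \<open>d\<close> requires a
    denominator of degree \<open>-d\<close> that does not vanish at \<open>x\<close>.\<close>
  let ?q = "\<lambda>v. (v $ i) ^ nat (-d)"
  have q: "?q \<in> forms (1 * nat (-d))" by (intro forms_power forms_coord)
  have "eventually (\<lambda>v. ?q v \<noteq> 0) (zn X x)"
    unfolding v(2) by (rule eventually_zn_nonzero[OF q]) (use assms v i in auto)
  then have "eventually (\<lambda>v. ?q v \<noteq> 0 \<and> 0 = 0 / ?q v) (zn X x)"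
    by eventually_elim simp
  moreover have "int (nat d) - int (1 * nat (-d)) = d" by simp
  ultimately show ?thesis by (intro ratI[OF forms_zero q])
qed

lemma rat_sum:
  assumes "\<And>a. a \<in> A \<Longrightarrow> rat X d (g a) x" "X \<subseteq> proj_space" "x \<in> X"
  shows "rat X d (\<lambda>v. \<Sum>a\<in>A. g a v) x"
  using assms(1)
  by (induction A rule: infinite_finite_induct) (auto simp: rat_zero[OF assms(2,3)] intro: rat_add)

lemma rat_linear: "rat X 1 (\<lambda>v. \<Sum>i\<in>UNIV. c i * v $ i) x"
  using rat_form[OF forms_linear] by simp

section \<open>Fractions on a line\<close>

definition indep2 :: "'k::field ^ 'n::finite \<Rightarrow> 'k ^ 'n \<Rightarrow> bool" where
  "indep2 v w \<longleftrightarrow> (\<forall>s t. s *s v + t *s w = 0 \<longrightarrow> s = 0 \<and> t = 0)"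

lemma indep2D: "indep2 v w \<Longrightarrow> s *s v + t *s w = 0 \<Longrightarrow> s = 0 \<and> t = 0"
  by (auto simp: indep2_def)

lemma indep2_nonzero:
  assumes "indep2 v w" shows "v \<noteq> 0" "w \<noteq> 0" "v + t *s w \<noteq> 0"
proof -
  show "v \<noteq> 0" using indep2D[OF assms, of 1 0] by auto
  show "w \<noteq> 0" using indep2D[OF assms, of 0 1] by auto
  show "v + t *s w \<noteq> 0" using indep2D[OF assms, of 1 t] by auto
qed

lemma indep2_sym: "indep2 v w \<Longrightarrow> indep2 w v"
  unfolding indep2_def by (metis add.commute)

text \<open>Induction over the generation of the topology. Only basic sets need an argument: a form
  restricts to a polynomial in \<open>t\<close>, which is zero or has finitely many roots. This is
  the irreducibility of the line, and it lets an identity near one point hold for all but finitely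
  many parameters.\<close>

lemma line_meets_generated_open:
  fixes v w :: "'k::field ^ 'n::finite"
  assumes "generate_topology_on {{x \<in> proj_space. \<exists>v\<in>x - {0}. p v \<noteq> 0} | p. \<exists>d. p \<in> forms d} W"
    and "indep2 v w"
  shows "pt (v + t0 *s w) \<in> W \<longrightarrow> finite {t. pt (v + t *s w) \<notin> W}"
  using assms(1)
proof induction
  case Empty then show ?case by simp
next
  case (Int A B)
  have "{t. pt (v + t *s w) \<notin> A \<inter> B} = {t. pt (v + t *s w) \<notin> A} \<union> {t. pt (v + t *s w) \<notin> B}" by auto
  then show ?case using Int by auto
next
  case (UN K)
  show ?case
  proof
    assume "pt (v + t0 *s w) \<in> \<Union> K"
    then obtain A where A: "A \<in> K" "pt (v + t0 *s w) \<in> A" by blast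
    then have "finite {t. pt (v + t *s w) \<notin> A}" using UN by blast
    then show "finite {t. pt (v + t *s w) \<notin> \<Union> K}"
      by (rule rev_finite_subset) (use A in auto)
  qed
next
  case (Basis A)
  then obtain p d where p: "p \<in> forms d" and A: "A = {x \<in> proj_space. \<exists>v\<in>x - {0}. p v \<noteq> 0}" by blast
  have in_A: "pt (v + t *s w) \<in> A \<longleftrightarrow> p (v + t *s w) \<noteq> 0" for t
  proof
    assume "pt (v + t *s w) \<in> A"
    then obtain u where "u \<in> pt (v + t *s w)" "p u \<noteq> 0" unfolding A by auto
    moreover from this obtain a where "u = a *s (v + t *s w)" unfolding mem_pt by blast
    ultimately show "p (v + t *s w) \<noteq> 0" using forms_homogeneous[OF p, of a "v + t *s w"] by auto
  next
    assume "p (v + t *s w) \<noteq> 0"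
    then show "pt (v + t *s w) \<in> A"
      unfolding A using indep2_nonzero(3)[OF assms(2), of t] self_in_pt[of "v + t *s w"] by auto
  qed
  obtain P where P: "\<And>t. p (v + t *s w) = poly P t" using forms_on_line[OF p] by blast
  show ?case using poly_roots_finite[of P] by (cases "P = 0") (simp_all add: in_A P)
qed

lemma line_meets_open:
  assumes "zopen X W" "indep2 v w" "\<And>t. pt (v + t *s w) \<in> X" "pt (v + t0 *s w) \<in> W"
  shows "finite {t. pt (v + t *s w) \<notin> W}"
proof -
  from assms(1) obtain T where T: "openin zariski T" "W = T \<inter> X" by (auto simp: openin_subtopology)
  from T(1) have "generate_topology_on {{x \<in> proj_space. \<exists>v\<in>x - {0}. p v \<noteq> 0} | p. \<exists>d. p \<in> forms d} T"
    unfolding zariski_def by (rule openin_topology_generated_by)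
  from line_meets_generated_open[OF this assms(2), of t0] T assms(3,4) show ?thesis by auto
qed

lemma eventually_zn_line:
  assumes ev: "eventually P (zn X (pt (v + t0 *s w)))" and "indep2 v w"
    and "X \<subseteq> proj_space" "\<And>t. pt (v + t *s w) \<in> X"
  shows "finite {t. \<not> P (v + t *s w)}"
proof -
  from ev obtain W where W: "zopen X W" "pt (v + t0 *s w) \<in> W" "\<forall>y\<in>W. \<forall>v\<in>y - {0}. P v"
    unfolding eventually_zn[OF assms(3,4)] by auto
  have "{t. \<not> P (v + t *s w)} \<subseteq> {t. pt (v + t *s w) \<notin> W}"
    using W(3) indep2_nonzero(3)[OF assms(2)] self_in_pt by blast
  then show ?thesis using line_meets_open[OF W(1) assms(2,4) W(2)] finite_subset by blast
qed

lemma poly_eq_cofinitely: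
  fixes P Q :: "'k::{field_char_0} poly"
  assumes "finite {t. poly P t \<noteq> poly Q t}" shows "P = Q"
proof (rule ccontr)
  assume "P \<noteq> Q"
  then have "finite {t. poly (P - Q) t = 0}" by (intro poly_roots_finite) simp
  with assms have "finite ({t. poly P t \<noteq> poly Q t} \<union> {t. poly (P - Q) t = 0})" by (rule finite_UnI)
  moreover have "{t. poly P t \<noteq> poly Q t} \<union> {t. poly (P - Q) t = 0} = UNIV" by auto
  ultimately show False using infinite_UNIV_char_0 by metis
qed

lemma no_roots_imp_const:
  fixes P :: "'k::alg_closed_field poly"
  assumes "\<And>t. poly P t \<noteq> 0" shows "\<exists>c. P = [:c:]"
proof -
  have "degree P = 0"
    using assms alg_closed_imp_poly_has_root[of P] by auto
  then show ?thesis by (metis degree_eq_zeroE)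
qed

text \<open>Any two local fractions agree cofinitely, hence have equal cross products as
  polynomials. A fraction whose denominator has least degree cannot have a root in the denominator,
  so the denominator is constant because the field is algebraically closed.\<close>

lemma regular_on_line_is_poly:
  fixes v w :: "'k::{alg_closed_field, field_char_0} ^ 'n::finite"
  assumes vw: "indep2 v w" and X: "X \<subseteq> proj_space" "\<And>t. pt (v + t *s w) \<in> X"
    and g: "\<And>t. rat X d g (pt (v + t *s w))"
  shows "\<exists>P. \<forall>t. g (v + t *s w) = poly P t"
proof -
  define frac where "frac P Q \<longleftrightarrow> finite {t. \<not> (poly Q t \<noteq> 0 \<and> g (v + t *s w) = poly P t / poly Q t)}" for P Q
  have loc: "\<exists>P Q. frac P Q \<and> poly Q t \<noteq> 0 \<and> g (v + t *s w) = poly P t / poly Q t" for t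
  proof -
    from g[of t] obtain k l p q where *: "p \<in> forms k" "q \<in> forms l"
      and ev: "eventually (\<lambda>v. q v \<noteq> 0 \<and> g v = p v / q v) (zn X (pt (v + t *s w)))"
      by (rule ratE)
    obtain P where P: "\<And>t. p (v + t *s w) = poly P t" using forms_on_line[OF *(1)] by blast
    obtain Q where Q: "\<And>t. q (v + t *s w) = poly Q t" using forms_on_line[OF *(2)] by blast
    have "frac P Q" unfolding frac_def using eventually_zn_line[OF ev vw X] by (simp add: P Q)
    moreover have "poly Q t \<noteq> 0 \<and> g (v + t *s w) = poly P t / poly Q t"
      using eventually_zn_at[OF ev X(1) X(2) indep2_nonzero(3)[OF vw]] by (simp add: P Q)
    ultimately show ?thesis by blast
  qed
  have nz: "Q \<noteq> 0" if "frac P Q" for P Q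
    using that unfolding frac_def by (auto simp: infinite_UNIV_char_0)
  \<comment> \<open>Degrees of denominators of fractions that represent \<open>g\<close> at all but
    finitely many parameters; a fraction attaining the least degree takes the place of a reduced
    one.\<close>
  define D where "D n \<longleftrightarrow> (\<exists>P Q. frac P Q \<and> degree Q = n)" for n
  have "\<exists>n. D n" using loc[of 0] unfolding D_def by blast
  then have "D (LEAST n. D n)" by (rule LeastI_ex)
  then obtain P Q where PQ: "frac P Q" and deg: "degree Q = (LEAST n. D n)" unfolding D_def by blast
  have cross: "P * Q' = P' * Q" if "frac P' Q'" for P' Q'
  proof (rule poly_eq_cofinitely)
    have "{t. poly (P * Q') t \<noteq> poly (P' * Q) t} \<subseteq>
      {t. \<not> (poly Q t \<noteq> 0 \<and> g (v + t *s w) = poly P t / poly Q t)} \<union>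
      {t. \<not> (poly Q' t \<noteq> 0 \<and> g (v + t *s w) = poly P' t / poly Q' t)}"
      by (auto simp: field_simps)
    then show "finite {t. poly (P * Q') t \<noteq> poly (P' * Q) t}"
      using PQ that unfolding frac_def by (meson finite_UnI finite_subset)
  qed
  have no_root: "poly Q t \<noteq> 0" for t
  proof
    assume Qt: "poly Q t = 0"
    \<comment> \<open>A fraction valid at the root \<open>t\<close> forces \<open>P\<close> to
      vanish there as well; cancelling the common factor contradicts minimality.\<close>
    obtain P' Q' where *: "frac P' Q'" "poly Q' t \<noteq> 0" using loc[of t] by blast
    have "poly P t * poly Q' t = poly P' t * poly Q t" using cross[OF *(1)] by (metis poly_mult)
    then have "poly P t = 0" using Qt *(2) by simp
    then obtain P1 where P1: "P = [:-t, 1:] * P1" unfolding poly_eq_0_iff_dvd by blast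
    from Qt obtain Q1 where Q1: "Q = [:-t, 1:] * Q1" unfolding poly_eq_0_iff_dvd by blast
    have "{s. \<not> (poly Q1 s \<noteq> 0 \<and> g (v + s *s w) = poly P1 s / poly Q1 s)} \<subseteq>
      {s. \<not> (poly Q s \<noteq> 0 \<and> g (v + s *s w) = poly P s / poly Q s)} \<union> {t}"
      by (auto simp: P1 Q1 simp del: mult_pCons_left)
    then have "frac P1 Q1" using PQ unfolding frac_def by (meson finite_UnI finite_subset finite.intros)
    then have "D (degree Q1)" unfolding D_def by blast
    then have "degree Q \<le> degree Q1" unfolding deg by (rule Least_le)
    moreover have "degree Q = Suc (degree Q1)"
    proof -
      have "Q1 \<noteq> 0" using nz[OF PQ] Q1 by auto
      then show ?thesis unfolding Q1 by (subst degree_mult_eq) auto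
    qed
    ultimately show False by simp
  qed
  from no_roots_imp_const[OF no_root] obtain c where c: "Q = [:c:]" by blast
  have "c \<noteq> 0" using no_root[of 0] c by simp
  have "g (v + t *s w) = poly (Polynomial.smult (1 / c) P) t" for t
  proof -
    \<comment> \<open>So far the fraction represents \<open>g\<close> only cofinitely; comparison
      with one that is valid at \<open>t\<close> gives equality at every parameter.\<close>
    obtain P' Q' where *: "frac P' Q'" "poly Q' t \<noteq> 0" "g (v + t *s w) = poly P' t / poly Q' t"
      using loc[of t] by blast
    have "poly P t * poly Q' t = poly P' t * poly Q t" using cross[OF *(1)] by (metis poly_mult)
    also have "poly P' t = g (v + t *s w) * poly Q' t" using * by simp
    finally have "poly P t = g (v + t *s w) * c" using *(2) by (simp add: c)
    then show ?thesis using \<open>c \<noteq> 0\<close> by simp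
  qed
  then show ?thesis by blast
qed

text \<open>\<open>P\<close> and \<open>Q\<close> are the expressions of one section in the two
  standard charts of the projective line, and homogeneity of degree \<open>d\<close> produces the
  transition factor of \<open>O(d)\<close>.\<close>

lemma regular_on_line_degrees:
  fixes v w :: "'k::{alg_closed_field, field_char_0} ^ 'n::finite"
  assumes vw: "indep2 v w" and X: "X \<subseteq> proj_space" "\<And>s t. s \<noteq> 0 \<or> t \<noteq> 0 \<Longrightarrow> pt (s *s v + t *s w) \<in> X"
    and g: "\<And>s t. s \<noteq> 0 \<or> t \<noteq> 0 \<Longrightarrow> rat X d g (pt (s *s v + t *s w))"
    and hom: "\<And>a s t. a \<noteq> 0 \<Longrightarrow> s \<noteq> 0 \<or> t \<noteq> 0 \<Longrightarrow> g (a *s (s *s v + t *s w)) = a powi d * g (s *s v + t *s w)"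
  shows "\<exists>P Q. (\<forall>t. g (v + t *s w) = poly P t) \<and> (\<forall>t. g (w + t *s v) = poly Q t) \<and>
    (\<forall>t. t \<noteq> 0 \<longrightarrow> poly P t = t powi d * poly Q (1 / t))"
proof -
  have 1: "pt (v + t *s w) \<in> X" "rat X d g (pt (v + t *s w))" for t
    using X(2)[of 1 t] g[of 1 t] by simp_all
  have 2: "pt (w + t *s v) \<in> X" "rat X d g (pt (w + t *s v))" for t
    using X(2)[of t 1] g[of t 1] by (simp_all add: add.commute)
  obtain P where P: "\<And>t. g (v + t *s w) = poly P t"
    using regular_on_line_is_poly[OF vw X(1) 1] by blast
  obtain Q where Q: "\<And>t. g (w + t *s v) = poly Q t"
    using regular_on_line_is_poly[OF indep2_sym[OF vw] X(1) 2] by blast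
  have "poly P t = t powi d * poly Q (1 / t)" if "t \<noteq> 0" for t
  proof -
    have "v + t *s w = t *s ((1 / t) *s v + 1 *s w)"
      using that by (simp add: vector_add_ldistrib)
    then show ?thesis using hom[of t "1 / t" 1] that P[of t] Q[of "1 / t"] by (simp add: add.commute)
  qed
  with P Q show ?thesis by blast
qed

lemma powi_two_eq_one:
  assumes "2 powi d = (1 :: 'k::field_char_0)" shows "d = 0"
proof -
  have *: "n = 0" if "(2 :: 'k) ^ n = 1" for n
  proof -
    have "of_nat (2 ^ n) = (of_nat 1 :: 'k)" using that by simp
    then show ?thesis unfolding of_nat_eq_iff by simp
  qed
  show ?thesis
  proof (cases "d \<ge> 0")
    case True
    then have "(2 :: 'k) ^ nat d = 1" using assms by (simp add: power_int_def)
    then show ?thesis using *[of "nat d"] True by simp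
  next
    case False
    then have "(2 :: 'k) ^ nat (- d) = 1" using assms by (simp add: power_int_def power_inverse field_simps)
    then show ?thesis using *[of "nat (- d)"] False by simp
  qed
qed

lemma poly_reverse:
  fixes Q :: "'k::field poly" assumes "t \<noteq> 0"
  shows "poly (reflect_poly Q) t = t ^ degree Q * poly Q (1 / t)"
  using poly_reflect_poly_nz[of t Q] assms by (simp add: divide_inverse)

text \<open>Clearing denominators in the transition rule gives \<open>t ^ (degree Q + 1)\<close>
  times \<open>P\<close> on one side and the reversed polynomial of \<open>Q\<close>, of degree at
  most \<open>degree Q\<close>, on the other. So \<open>P\<close> is zero: \<open>O(-1)\<close> has
  no global sections.\<close>

lemma global_form_negative:
  fixes v w :: "'k::{alg_closed_field, field_char_0} ^ 'n::finite"
  assumes "indep2 v w" and "X \<subseteq> proj_space" "\<And>s t. s \<noteq> 0 \<or> t \<noteq> 0 \<Longrightarrow> pt (s *s v + t *s w) \<in> X"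
    and "\<And>s t. s \<noteq> 0 \<or> t \<noteq> 0 \<Longrightarrow> rat X (-1) g (pt (s *s v + t *s w))"
    and "\<And>a s t. a \<noteq> 0 \<Longrightarrow> s \<noteq> 0 \<or> t \<noteq> 0 \<Longrightarrow> g (a *s (s *s v + t *s w)) = a powi (-1) * g (s *s v + t *s w)"
  shows "g v = 0"
proof -
  obtain P Q where P: "\<And>t. g (v + t *s w) = poly P t" and Q: "\<And>t. g (w + t *s v) = poly Q t"
    and PQ: "\<And>t. t \<noteq> 0 \<Longrightarrow> poly P t = t powi (-1) * poly Q (1 / t)"
    using regular_on_line_degrees[OF assms] by blast
  have "monom 1 (Suc (degree Q)) * P = reflect_poly Q"
  proof (rule poly_eq_cofinitely, rule finite_subset)
    have "poly (monom 1 (Suc (degree Q)) * P) t = poly (reflect_poly Q) t" if "t \<noteq> 0" for t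
      by (simp add: poly_monom PQ[OF that] poly_reverse[OF that] that power_int_minus)
    then show "{t. poly (monom 1 (Suc (degree Q)) * P) t \<noteq> poly (reflect_poly Q) t} \<subseteq> {0}" by blast
  qed simp
  then have "P = 0"
    using degree_reflect_poly_le[of Q] degree_mult_eq[of "monom 1 (Suc (degree Q))" P]
    by (cases "P = 0") (auto simp: degree_monom_eq)
  then show ?thesis using P[of 0] by simp
qed

text \<open>The same comparison of degrees with one factor \<open>t\<close> fewer: \<open>P\<close>
  is constant, and the transition rule then makes \<open>Q\<close> the same constant.\<close>

lemma global_form_degree_0:
  fixes v w :: "'k::{alg_closed_field, field_char_0} ^ 'n::finite"
  assumes "indep2 v w" and "X \<subseteq> proj_space" "\<And>s t. s \<noteq> 0 \<or> t \<noteq> 0 \<Longrightarrow> pt (s *s v + t *s w) \<in> X"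
    and "\<And>s t. s \<noteq> 0 \<or> t \<noteq> 0 \<Longrightarrow> rat X 0 g (pt (s *s v + t *s w))"
    and "\<And>a s t. a \<noteq> 0 \<Longrightarrow> s \<noteq> 0 \<or> t \<noteq> 0 \<Longrightarrow> g (a *s (s *s v + t *s w)) = g (s *s v + t *s w)"
  shows "g (v + t *s w) = g v" "g w = g v"
proof -
  obtain P Q where P: "\<And>t. g (v + t *s w) = poly P t" and Q: "\<And>t. g (w + t *s v) = poly Q t"
    and PQ: "\<And>t. t \<noteq> 0 \<Longrightarrow> poly P t = t powi 0 * poly Q (1 / t)"
    using regular_on_line_degrees[OF assms(1-4)] assms(5) by (auto 4 4)
  have eq: "monom 1 (degree Q) * P = reflect_poly Q"
  proof (rule poly_eq_cofinitely, rule finite_subset)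
    have "poly (monom 1 (degree Q) * P) t = poly (reflect_poly Q) t" if "t \<noteq> 0" for t
      by (simp add: poly_monom PQ[OF that] poly_reverse[OF that] that power_int_minus)
    then show "{t. poly (monom 1 (degree Q) * P) t \<noteq> poly (reflect_poly Q) t} \<subseteq> {0}" by blast
  qed simp
  have "degree P = 0"
    using eq degree_reflect_poly_le[of Q] degree_mult_eq[of "monom 1 (degree Q)" P]
    by (cases "P = 0") (auto simp: degree_monom_eq)
  then obtain c where c: "P = [:c:]" by (metis degree_eq_zeroE)
  have "Q = [:c:]"
  proof (rule poly_eq_cofinitely, rule finite_subset)
    show "{t. poly Q t \<noteq> poly [:c:] t} \<subseteq> {0}" using PQ[of "1 / t" for t] by (auto simp: c)
  qed simp
  then show "g (v + t *s w) = g v" "g w = g v" using P[of t] P[of 0] Q[of 0] by (simp_all add: c)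
qed

text \<open>Here the comparison of degrees allows \<open>degree P = 1\<close>; the transition rule
  reverses the two coefficients, so the slope of \<open>P\<close> is the value of \<open>Q\<close>
  at \<open>0\<close>, which is \<open>g w\<close>.\<close>

lemma global_form_degree_1:
  fixes v w :: "'k::{alg_closed_field, field_char_0} ^ 'n::finite"
  assumes "indep2 v w" and "X \<subseteq> proj_space" "\<And>s t. s \<noteq> 0 \<or> t \<noteq> 0 \<Longrightarrow> pt (s *s v + t *s w) \<in> X"
    and "\<And>s t. s \<noteq> 0 \<or> t \<noteq> 0 \<Longrightarrow> rat X 1 g (pt (s *s v + t *s w))"
    and "\<And>a s t. a \<noteq> 0 \<Longrightarrow> s \<noteq> 0 \<or> t \<noteq> 0 \<Longrightarrow> g (a *s (s *s v + t *s w)) = a * g (s *s v + t *s w)"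
  shows "g (v + t *s w) = g v + t * g w"
proof -
  obtain P Q where P: "\<And>t. g (v + t *s w) = poly P t" and Q: "\<And>t. g (w + t *s v) = poly Q t"
    and PQ: "\<And>t. t \<noteq> 0 \<Longrightarrow> poly P t = t powi 1 * poly Q (1 / t)"
    using regular_on_line_degrees[OF assms(1-4)] assms(5) by (auto 4 4)
  have eq: "monom 1 (degree Q) * P = monom 1 1 * reflect_poly Q"
  proof (rule poly_eq_cofinitely, rule finite_subset)
    have "poly (monom 1 (degree Q) * P) t = poly (monom 1 1 * reflect_poly Q) t" if "t \<noteq> 0" for t
      by (simp add: poly_monom PQ[OF that] poly_reverse[OF that] that power_int_minus)
    then show "{t. poly (monom 1 (degree Q) * P) t \<noteq> poly (monom 1 1 * reflect_poly Q) t} \<subseteq> {0}" by blast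
  qed simp
  have "degree P \<le> 1"
  proof (cases "P = 0")
    case False
    have "degree (monom 1 1 * reflect_poly Q) \<le> 1 + degree Q"
      using degree_reflect_poly_le[of Q] degree_mult_le[of "monom 1 1" "reflect_poly Q"]
      by (simp add: degree_monom_eq)
    moreover have "degree (monom (1::'k) (degree Q) * P) = degree Q + degree P"
      using False by (subst degree_mult_eq) (auto simp: degree_monom_eq)
    ultimately show ?thesis using eq by simp
  qed simp
  obtain a b where ab: "P = [:a, b:]"
  proof
    show "P = [:coeff P 0, coeff P 1:]"
    proof (rule poly_eqI)
      fix n
      have "coeff P n = 0" if "n > 1" using that \<open>degree P \<le> 1\<close> by (intro coeff_eq_0) simp
      then show "coeff P n = coeff [:coeff P 0, coeff P 1:] n"
        by (cases n; cases "n - 1") auto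
    qed
  qed
  have "Q = [:b, a:]"
  proof (rule poly_eq_cofinitely, rule finite_subset)
    have "poly Q t = poly [:b, a:] t" if "t \<noteq> 0" for t
      using PQ[of "1 / t"] that by (simp add: ab field_simps)
    then show "{t. poly Q t \<noteq> poly [:b, a:] t} \<subseteq> {0}" by blast
  qed simp
  then show ?thesis using P[of t] P[of 0] Q[of 0] by (simp add: ab)
qed

text \<open>Without zeros, both chart polynomials are constant, so the transition factor takes the
  value \<open>1\<close> at every nonzero parameter. In other words, \<open>O(d)\<close> on a line
  is trivial only for \<open>d = 0\<close>; this identifies the first Chern class later.\<close>

lemma global_unit_degree_0:
  fixes v w :: "'k::{alg_closed_field, field_char_0} ^ 'n::finite"
  assumes "indep2 v w" and "X \<subseteq> proj_space" "\<And>s t. s \<noteq> 0 \<or> t \<noteq> 0 \<Longrightarrow> pt (s *s v + t *s w) \<in> X"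
    and "\<And>s t. s \<noteq> 0 \<or> t \<noteq> 0 \<Longrightarrow> rat X d g (pt (s *s v + t *s w))"
    and "\<And>a s t. a \<noteq> 0 \<Longrightarrow> s \<noteq> 0 \<or> t \<noteq> 0 \<Longrightarrow> g (a *s (s *s v + t *s w)) = a powi d * g (s *s v + t *s w)"
    and nz: "\<And>s t. s \<noteq> 0 \<or> t \<noteq> 0 \<Longrightarrow> g (s *s v + t *s w) \<noteq> 0"
  shows "d = 0"
proof -
  obtain P Q where P: "\<And>t. g (v + t *s w) = poly P t" and Q: "\<And>t. g (w + t *s v) = poly Q t"
    and PQ: "\<And>t. t \<noteq> 0 \<Longrightarrow> poly P t = t powi d * poly Q (1 / t)"
    using regular_on_line_degrees[OF assms(1-5)] by blast
  have "poly P t \<noteq> 0" for t using nz[of 1 t] P[of t] by simp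
  from no_roots_imp_const[OF this] obtain a where a: "P = [:a:]" by blast
  have nQ: "poly Q t \<noteq> 0" for t using nz[of t 1] Q[of t] by (simp add: add.commute)
  from no_roots_imp_const[OF this] obtain b where b: "Q = [:b:]" by blast
  have "b \<noteq> 0" using nQ[of 0] b by simp
  have *: "a = t powi d * b" if "t \<noteq> 0" for t using PQ[OF that] by (simp add: a b)
  have "a = b" using *[of 1] by simp
  \<comment> \<open>The parameter \<open>2\<close> suffices, since in characteristic zero its powers
    with different exponents differ.\<close>
  then have "2 powi d = (1 :: 'k)" using *[of 2] \<open>b \<noteq> 0\<close> by simp
  then show ?thesis by (rule powi_two_eq_one)
qed

section \<open>Coefficients and generic points\<close>

text \<open>Cramer's rule by elimination. Independence of the rows at \<open>v0\<close> gives a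
  pivot that is nonzero at \<open>v0\<close> and hence nearby; equation \<open>i0\<close> removes
  the unknown \<open>f r\<close>, and independence at \<open>v0\<close> passes to the reduced rows.
  This is the tool that turns coefficients chosen pointwise into regular ones, with degrees read off
  from the system.\<close>

lemma coefficients_rat:
  fixes m :: "'j \<Rightarrow> 'i \<Rightarrow> ('k::field ^ 'n::finite) \<Rightarrow> 'k"
  assumes "finite J" and X: "X \<subseteq> proj_space" "pt v0 \<in> X" "v0 \<noteq> 0"
    and "\<And>j i. j \<in> J \<Longrightarrow> i \<in> I \<Longrightarrow> rat X (d j) (m j i) (pt v0)"
    and "\<And>i. i \<in> I \<Longrightarrow> rat X e (g i) (pt v0)"
    and "eventually (\<lambda>v. \<forall>i\<in>I. (\<Sum>j\<in>J. f j v * m j i v) = g i v) (zn X (pt v0))"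
    and "\<And>z. (\<forall>i\<in>I. (\<Sum>j\<in>J. z j * m j i v0) = 0) \<Longrightarrow> (\<forall>j\<in>J. z j = 0)"
  shows "\<forall>j\<in>J. rat X (e - d j) (f j) (pt v0)"
  using assms(1,5-)
proof (induction J arbitrary: m g rule: finite_induct)
  case empty then show ?case by simp
next
  case (insert r J)
  have "\<exists>i0\<in>I. m r i0 v0 \<noteq> 0"
  proof (rule ccontr)
    assume "\<not> ?thesis"
    moreover have "(\<Sum>j\<in>J. (if j = r then 1 else 0) * c j) = 0" for c :: "'j \<Rightarrow> 'k"
      using insert.hyps by (intro sum.neutral) auto
    ultimately have "(if r = r then 1 else 0 :: 'k) = 0"
      using insert.prems(4)[of "\<lambda>j. if j = r then 1 else 0"] insert.hyps by auto
    then show False by simp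
  qed
  then obtain i0 where i0: "i0 \<in> I" "m r i0 v0 \<noteq> 0" by blast
  define m' where "m' j i v = m j i v - m j i0 v * m r i v / m r i0 v" for j i v
  define g' where "g' i v = g i v - g i0 v * m r i v / m r i0 v" for i v
  have rat_r: "rat X (d r) (m r i) (pt v0)" if "i \<in> I" for i
    using insert.prems(1)[of r i] that by simp
  have ev_nz: "eventually (\<lambda>v. m r i0 v \<noteq> 0) (zn X (pt v0))"
    by (rule rat_eventually_nonzero[OF rat_r]) (use i0 X in auto)
  have elim: "rat X k (\<lambda>v. a v - b v * m r i v / m r i0 v) (pt v0)"
    if "rat X k a (pt v0)" "rat X k b (pt v0)" "i \<in> I" for a b i k
    using rat_diff[OF that(1)] rat_divide[OF rat_mult[OF that(2) rat_r[OF that(3)]] rat_r[OF i0(1)] i0(2) X]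
    by simp
  have IH: "\<forall>j\<in>J. rat X (e - d j) (f j) (pt v0)"
  proof (rule insert.IH[where m = m' and g = g'])
    show "rat X (d j) (m' j i) (pt v0)" if "j \<in> J" "i \<in> I" for j i
      unfolding m'_def using that i0 insert.prems(1) by (intro elim) auto
    show "rat X e (g' i) (pt v0)" if "i \<in> I" for i
      unfolding g'_def using that i0 insert.prems(2) by (intro elim) auto
    show "eventually (\<lambda>v. \<forall>i\<in>I. (\<Sum>j\<in>J. f j v * m' j i v) = g' i v) (zn X (pt v0))"
      using insert.prems(3) ev_nz
    proof eventually_elim
      case (elim v)
      show ?case
      proof
        fix i assume i: "i \<in> I"
        have eq: "(\<Sum>j\<in>J. f j v * m j i v) = g i v - f r v * m r i v" if "i \<in> I" for i
          using elim(1) that insert.hyps by (simp add: algebra_simps)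
        have "(\<Sum>j\<in>J. f j v * m' j i v)
          = (\<Sum>j\<in>J. f j v * m j i v) - (\<Sum>j\<in>J. f j v * m j i0 v) * (m r i v / m r i0 v)"
          unfolding sum_distrib_right sum_subtractf[symmetric] m'_def
          by (intro sum.cong) (auto simp: algebra_simps)
        also have "\<dots> = g' i v"
          using elim(2) by (simp add: eq[OF i] eq[OF i0(1)] g'_def field_simps)
        finally show "(\<Sum>j\<in>J. f j v * m' j i v) = g' i v" .
      qed
    qed
    show "\<forall>j\<in>J. z j = 0" if z: "\<forall>i\<in>I. (\<Sum>j\<in>J. z j * m' j i v0) = 0" for z
    proof -
      define z' where "z' = z(r := - (\<Sum>j\<in>J. z j * m j i0 v0) / m r i0 v0)"
      have "\<forall>i\<in>I. (\<Sum>j\<in>insert r J. z' j * m j i v0) = 0"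
        unfolding z'_def
        by (rule rows_eliminate[of J r "\<lambda>j i. m j i v0" i0])
           (use insert.hyps i0 z in \<open>auto simp: m'_def\<close>)
      from insert.prems(4)[OF this] show ?thesis
        using insert.hyps by (auto simp: z'_def split: if_splits)
    qed
  qed
  have "rat X (e - d r) (f r) (pt v0)"
  proof (rule rat_cong)
    have "rat X ((e - d j) + d j) (\<lambda>v. f j v * m j i0 v) (pt v0)" if "j \<in> J" for j
      using IH that insert.prems(1)[of j i0] i0 by (intro rat_mult) auto
    then have "rat X e (\<lambda>v. \<Sum>j\<in>J. f j v * m j i0 v) (pt v0)"
      by (intro rat_sum X) simp
    then show "rat X (e - d r) (\<lambda>v. (g i0 v - (\<Sum>j\<in>J. f j v * m j i0 v)) / m r i0 v) (pt v0)"
      using i0 insert.prems(2) by (intro rat_divide rat_diff rat_r X) auto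
    show "eventually (\<lambda>v. (g i0 v - (\<Sum>j\<in>J. f j v * m j i0 v)) / m r i0 v = f r v) (zn X (pt v0))"
      using insert.prems(3) ev_nz
    proof eventually_elim
      case (elim v)
      then have "f r v * m r i0 v + (\<Sum>j\<in>J. f j v * m j i0 v) = g i0 v"
        using i0(1) insert.hyps by simp
      then show ?case using elim(2) by (simp add: field_simps)
    qed
  qed
  with IH show ?case by simp
qed

text \<open>Coordinates are released from the grid one at a time: with the others fixed,
  \<open>G\<close> is a polynomial with more zeros in \<open>T\<close> than its degree
  allows.\<close>

lemma vanishing_on_grid:
  fixes G :: "('p \<Rightarrow> 'k::field) \<Rightarrow> 'k"
  assumes "finite P" "finite T"
    and G: "\<And>\<theta> p. p \<in> P \<Longrightarrow> \<theta> \<in> extensional P \<Longrightarrow> \<exists>R. degree R < card T \<and> (\<forall>t. G (\<theta>(p := t)) = poly R t)"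
    and 0: "\<And>\<theta>. \<theta> \<in> PiE P (\<lambda>_. T) \<Longrightarrow> G \<theta> = 0"
    and "\<theta> \<in> extensional P"
  shows "G \<theta> = 0"
proof -
  \<comment> \<open>\<open>Q\<close> collects the coordinates that are already free; the remaining
    ones still lie in \<open>T\<close>.\<close>
  have "\<forall>\<theta>\<in>extensional P. (\<forall>p\<in>P-Q. \<theta> p \<in> T) \<longrightarrow> G \<theta> = 0" if "finite Q" "Q \<subseteq> P" for Q
    using that
  proof (induction Q rule: finite_induct)
    case empty then show ?case using 0 by (auto simp: PiE_def Pi_def)
  next
    case (insert p Q)
    show ?case
    proof (intro ballI impI)
      fix \<theta> assume \<theta>: "\<theta> \<in> extensional P" "\<forall>q\<in>P - insert p Q. \<theta> q \<in> T"
      obtain R where R: "degree R < card T" "\<And>t. G (\<theta>(p := t)) = poly R t"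
        using G[of p \<theta>] \<theta> insert.prems by auto
      have "poly R t = 0" if "t \<in> T" for t
      proof -
        have "\<theta>(p := t) \<in> extensional P" using \<theta> insert.prems by (auto simp: extensional_def)
        moreover have "\<forall>q\<in>P - Q. (\<theta>(p := t)) q \<in> T" using \<theta> that by auto
        ultimately show ?thesis using insert.IH insert.prems R(2)[of t] by simp
      qed
      then have "R = 0" using R(1) by (intro poly_eqI_degree[of T]) auto
      then show "G \<theta> = 0" using R(2)[of "\<theta> p"] by simp
    qed
  qed
  from this[OF assms(1) subset_refl] assms(5) show ?thesis by simp
qed

text \<open>The Lagrange interpolation polynomial for the node \<open>a\<close> among the nodes
  \<open>T\<close>, without its normalising factor.\<close>

definition nodal_poly :: "'k::field set \<Rightarrow> 'k \<Rightarrow> 'k poly" where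
  "nodal_poly T a = (\<Prod>s\<in>T-{a}. [:-s, 1:])"

lemma nodal_poly_nonzero: "finite T \<Longrightarrow> poly (nodal_poly T a) a \<noteq> 0"
  by (auto simp: nodal_poly_def poly_prod prod_zero_iff)

lemma nodal_poly_zero: "finite T \<Longrightarrow> b \<in> T \<Longrightarrow> b \<noteq> a \<Longrightarrow> poly (nodal_poly T a) b = 0"
  by (auto simp: nodal_poly_def poly_prod prod_zero_iff)

lemma degree_nodal_poly: "finite T \<Longrightarrow> a \<in> T \<Longrightarrow> degree (nodal_poly T a) < card T"
proof -
  assume *: "finite T" "a \<in> T"
  have "degree (nodal_poly T a) \<le> (\<Sum>s\<in>T-{a}. degree [:-s, 1:])"
    unfolding nodal_poly_def using degree_prod_sum_le[of "T - {a}" "\<lambda>s. [:-s, 1:]"] * by (simp add: o_def)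
  also have "\<dots> = card T - 1" using * by simp
  also have "\<dots> < card T" using * card_gt_0_iff[of T] by auto
  finally show ?thesis .
qed

text \<open>A dimension count without dimension theory: some nonzero polynomial with exponents below \<open>N\<close>
  vanishes on all images, because for large \<open>N\<close> there are more coefficients than conditions.\<close>

lemma images_miss_point:
  fixes f :: "'s \<Rightarrow> ('p \<Rightarrow> 'k::field_char_0) \<Rightarrow> 'i \<Rightarrow> 'k"
  assumes fin: "finite S" "finite P" "finite I" and card: "card P < card I"
    and aff: "\<And>s \<theta> p i. s \<in> S \<Longrightarrow> p \<in> P \<Longrightarrow> i \<in> I \<Longrightarrow> \<theta> \<in> extensional P \<Longrightarrow>
      \<exists>R. degree R \<le> 1 \<and> (\<forall>t. f s (\<theta>(p := t)) i = poly R t)"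
  shows "\<exists>l. \<forall>s\<in>S. \<forall>\<theta>\<in>extensional P. \<exists>i\<in>I. f s \<theta> i \<noteq> l i"
proof -
  \<comment> \<open>\<open>N\<close> is chosen so that
    \<open>card S * (N * card I) ^ card P < N ^ card I\<close>, which is possible because
    \<open>card P < card I\<close>. The left side counts grid conditions on the parameters, the
    right side counts interpolation nodes in the target space.\<close>
  define N where "N = card S * card I ^ card P + 1"
  define T' where "T' = (of_nat ` {..<N :: nat} :: 'k set)"
  define T where "T = (of_nat ` {..<N * card I :: nat} :: 'k set)"
  have T': "finite T'" "card T' = N" and T: "finite T" "card T = N * card I"
    unfolding T'_def T_def by (auto simp: card_image inj_on_def)
  define A where "A = PiE I (\<lambda>_. T')"
  define B where "B = S \<times> PiE P (\<lambda>_. T)"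
  have A: "finite A" "card A = N ^ card I"
    unfolding A_def using fin T' by (auto simp: finite_PiE card_PiE)
  have B: "finite B" "card B = card S * (N * card I) ^ card P"
    unfolding B_def using fin T by (auto simp: finite_PiE card_PiE card_cartesian_product)
  have "card S * (N * card I) ^ card P = (card S * card I ^ card P) * N ^ card P"
    by (simp add: power_mult_distrib)
  also have "\<dots> < N * N ^ card P"
    by (rule mult_strict_right_mono) (auto simp: N_def)
  also have "\<dots> = N ^ Suc (card P)" by simp
  also have "\<dots> \<le> N ^ card I" using card by (intro power_increasing) (auto simp: N_def)
  finally have "card B < card A" using A B by simp
  \<comment> \<open>The value at the image of the grid point \<open>b\<close> of the product of
    interpolation polynomials belonging to the node \<open>\<tau>\<close>. A vector \<open>g\<close>
    of coefficients thus describes a polynomial on the target space in the Lagrange basis.\<close>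
  define M where "M b \<tau> = (\<Prod>i\<in>I. poly (nodal_poly T' (\<tau> i)) (f (fst b) (snd b) i))" for b \<tau>
  obtain g where g: "\<exists>\<tau>\<in>A. g \<tau> \<noteq> 0" "\<forall>b\<in>B. (\<Sum>\<tau>\<in>A. M b \<tau> * g \<tau>) = 0"
    using underdetermined[OF B(1) A(1) \<open>card B < card A\<close>, of M] by blast
  \<comment> \<open>Each image coordinate is affine in each single parameter, so the pulled-back
    polynomial has degree at most \<open>card I * (N - 1)\<close> in it, below the number
    \<open>N * card I\<close> of grid values.\<close>
  have vanish: "(\<Sum>\<tau>\<in>A. M (s, \<theta>) \<tau> * g \<tau>) = 0" if "s \<in> S" "\<theta> \<in> extensional P" for s \<theta>
  proof (rule vanishing_on_grid[OF fin(2) T(1) _ _ that(2), where G = "\<lambda>\<theta>. \<Sum>\<tau>\<in>A. M (s, \<theta>) \<tau> * g \<tau>"])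
    show "(\<Sum>\<tau>\<in>A. M (s, \<theta>) \<tau> * g \<tau>) = 0" if "\<theta> \<in> PiE P (\<lambda>_. T)" for \<theta>
      using g(2) that \<open>s \<in> S\<close> by (auto simp: B_def)
    fix \<theta> :: "'p \<Rightarrow> 'k" and p assume \<theta>: "p \<in> P" "\<theta> \<in> extensional P"
    have "\<forall>i\<in>I. \<exists>R. degree R \<le> 1 \<and> (\<forall>t. f s (\<theta>(p := t)) i = poly R t)" using aff \<open>s \<in> S\<close> \<theta> by blast
    then obtain R where R: "\<And>i. i \<in> I \<Longrightarrow> degree (R i) \<le> 1"
      "\<And>i t. i \<in> I \<Longrightarrow> f s (\<theta>(p := t)) i = poly (R i) t"
      by (auto simp: bchoice_iff)
    define Q where "Q = (\<Sum>\<tau>\<in>A. Polynomial.smult (g \<tau>) (\<Prod>i\<in>I. pcompose (nodal_poly T' (\<tau> i)) (R i)))"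
    have "(\<Sum>\<tau>\<in>A. M (s, \<theta>(p := t)) \<tau> * g \<tau>) = poly Q t" for t
      unfolding Q_def M_def
      by (simp add: poly_sum poly_prod poly_pcompose R(2) mult.commute)
    moreover have "degree Q \<le> card I * (N - 1)"
      unfolding Q_def
    proof (rule degree_sum_le[OF A(1)])
      fix \<tau> assume \<tau>: "\<tau> \<in> A"
      have "degree (pcompose (nodal_poly T' (\<tau> i)) (R i)) \<le> N - 1" if "i \<in> I" for i
      proof -
        have "degree (nodal_poly T' (\<tau> i)) \<le> N - 1"
          using degree_nodal_poly[OF T'(1), of "\<tau> i"] \<tau> that T'(2) by (auto simp: A_def PiE_def Pi_def)
        then have "degree (nodal_poly T' (\<tau> i)) * degree (R i) \<le> (N - 1) * 1"
          using R(1)[OF that] by (rule mult_le_mono)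
        then show ?thesis using degree_pcompose_le[of "nodal_poly T' (\<tau> i)" "R i"] by simp
      qed
      then have "(\<Sum>i\<in>I. degree (pcompose (nodal_poly T' (\<tau> i)) (R i))) \<le> card I * (N - 1)"
        using sum_bounded_above[of I "\<lambda>i. degree (pcompose (nodal_poly T' (\<tau> i)) (R i))" "N - 1"] by simp
      moreover have "degree (\<Prod>i\<in>I. pcompose (nodal_poly T' (\<tau> i)) (R i))
          \<le> (\<Sum>i\<in>I. degree (pcompose (nodal_poly T' (\<tau> i)) (R i)))"
        using degree_prod_sum_le[OF fin(3), of "\<lambda>i. pcompose (nodal_poly T' (\<tau> i)) (R i)"] by simp
      ultimately show "degree (Polynomial.smult (g \<tau>) (\<Prod>i\<in>I. pcompose (nodal_poly T' (\<tau> i)) (R i))) \<le> card I * (N - 1)"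
        using degree_smult_le le_trans by blast
    qed
    moreover have "card I * (N - 1) < card T"
      using card T(2) by (simp add: N_def)
    ultimately show "\<exists>R. degree R < card T \<and> (\<forall>t. (\<Sum>\<tau>\<in>A. M (s, \<theta>(p := t)) \<tau> * g \<tau>) = poly R t)"
      by (intro exI[of _ Q]) auto
  qed
  \<comment> \<open>In the Lagrange basis a node with nonzero coefficient is a point where the
    polynomial does not vanish, so this node itself is the missed point.\<close>
  from g(1) obtain \<tau>0 where \<tau>0: "\<tau>0 \<in> A" "g \<tau>0 \<noteq> 0" by blast
  have "\<exists>i\<in>I. f s \<theta> i \<noteq> \<tau>0 i" if "s \<in> S" "\<theta> \<in> extensional P" for s \<theta>
  proof (rule ccontr)
    assume "\<not> ?thesis"
    then have M: "M (s, \<theta>) \<tau> = (\<Prod>i\<in>I. poly (nodal_poly T' (\<tau> i)) (\<tau>0 i))" for \<tau>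
      unfolding M_def by (intro prod.cong) auto
    have "M (s, \<theta>) \<tau> = 0" if "\<tau> \<in> A - {\<tau>0}" for \<tau>
    proof -
      have "\<tau> = \<tau>0" if "\<forall>i\<in>I. \<tau> i = \<tau>0 i"
        using PiE_ext[of \<tau> I "\<lambda>_. T'" \<tau>0] \<open>\<tau> \<in> A - {\<tau>0}\<close> \<tau>0(1) that by (simp add: A_def)
      then obtain i where i: "i \<in> I" "\<tau> i \<noteq> \<tau>0 i" using \<open>\<tau> \<in> A - {\<tau>0}\<close> by blast
      then have "\<tau>0 i \<in> T'" using \<tau>0(1) unfolding A_def by auto
      then have "poly (nodal_poly T' (\<tau> i)) (\<tau>0 i) = 0"
        using i(2) by (intro nodal_poly_zero T'(1)) auto
      then show ?thesis unfolding M using i(1) fin(3) by (intro prod_zero) auto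
    qed
    then have "(\<Sum>\<tau>\<in>A. M (s, \<theta>) \<tau> * g \<tau>) = M (s, \<theta>) \<tau>0 * g \<tau>0"
      using A(1) \<tau>0 by (simp add: sum.remove[of A \<tau>0])
    moreover have "M (s, \<theta>) \<tau>0 \<noteq> 0" unfolding M using fin T'(1) by (simp add: prod_zero_iff nodal_poly_nonzero)
    ultimately show False using vanish[OF that] \<tau>0 by simp
  qed
  then show ?thesis by blast
qed

section \<open>Homogeneous frames of bundles\<close>

lemma regular_functions_iff:
  assumes X: "X \<subseteq> proj_space" and U: "zopen X U"
  shows "f \<in> regular_functions X U \<longleftrightarrow> (\<forall>x\<in>U. rat X 0 (\<lambda>v. f (pt v)) x)"
proof
  assume f: "f \<in> regular_functions X U"
  show "\<forall>x\<in>U. rat X 0 (\<lambda>v. f (pt v)) x"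
  proof
    fix x assume x: "x \<in> U"
    from f[unfolded regular_functions_def mem_Collect_eq, THEN bspec, OF x]
    obtain W d p q where *: "p \<in> forms d" "q \<in> forms d" "zopen X W" "x \<in> W" "W \<subseteq> U"
      "\<forall>y\<in>W. \<forall>v\<in>y - {0}. q v \<noteq> 0 \<and> f y = p v / q v"
      by (elim exE bexE conjE) (rule that)
    have xX: "x \<in> X" using zopen_subset[OF U] x by auto
    have "q v \<noteq> 0 \<and> f (pt v) = p v / q v" if "y \<in> W" "v \<in> y - {0}" for y v
      using * that zopen_subset[OF *(3)] X proj_space_eq_pt[of y v] by auto
    then have "eventually (\<lambda>v. q v \<noteq> 0 \<and> f (pt v) = p v / q v) (zn X x)"
      unfolding eventually_zn[OF X xX] using *(3,4) by (intro exI[of _ W]) auto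
    then show "rat X 0 (\<lambda>v. f (pt v)) x" by (intro ratI[OF *(1,2)]) auto
  qed
next
  assume r: "\<forall>x\<in>U. rat X 0 (\<lambda>v. f (pt v)) x"
  have "\<exists>W d. \<exists>p\<in>forms d. \<exists>q\<in>forms d. zopen X W \<and> x \<in> W \<and> W \<subseteq> U \<and>
      (\<forall>y\<in>W. \<forall>v\<in>y - {0}. q v \<noteq> 0 \<and> f y = p v / q v)" if x: "x \<in> U" for x
  proof -
    have xX: "x \<in> X" using zopen_subset[OF U] x by auto
    from r x have "rat X 0 (\<lambda>v. f (pt v)) x" by blast
    then obtain k l p q where *: "p \<in> forms k" "q \<in> forms l" "int k - int l = 0"
      "eventually (\<lambda>v. q v \<noteq> 0 \<and> f (pt v) = p v / q v) (zn X x)" by (rule ratE)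
    from *(4)[unfolded eventually_zn[OF X xX]]
    obtain W where W: "zopen X W" "x \<in> W" "\<forall>y\<in>W. \<forall>v\<in>y - {0}. q v \<noteq> 0 \<and> f (pt v) = p v / q v"
      by (elim exE conjE) (rule that)
    have "q v \<noteq> 0 \<and> f y = p v / q v" if "y \<in> W \<inter> U" "v \<in> y - {0}" for y v
      using W(3) that zopen_subset[OF W(1)] X proj_space_eq_pt[of y v] by auto
    moreover have "zopen X (W \<inter> U)" "x \<in> W \<inter> U" "k = l" using W U x * by (auto intro: zopen_Int)
    ultimately show ?thesis using *(1,2)
      by (intro exI[of _ "W \<inter> U"] exI[of _ k] bexI[of _ p] bexI[of _ q]) auto
  qed
  then show "f \<in> regular_functions X U" by (simp add: regular_functions_def)
qed

lemma rat_homogeneous: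
  assumes "rat X d g (pt v)" "X \<subseteq> proj_space" "pt v \<in> X" "v \<noteq> 0" "a \<noteq> 0"
  shows "g (a *s v) = a powi d * g v"
proof -
  from assms(1) obtain k l p q where *: "p \<in> forms k" "q \<in> forms l" "int k - int l = d"
    and ev: "eventually (\<lambda>v. q v \<noteq> 0 \<and> g v = p v / q v) (zn X (pt v))" by (rule ratE)
  have 1: "q v \<noteq> 0 \<and> g v = p v / q v" by (rule eventually_zn_at[OF ev assms(2-4)])
  have "q (a *s v) \<noteq> 0 \<and> g (a *s v) = p (a *s v) / q (a *s v)"
    by (rule eventually_zn_at) (use ev assms in \<open>auto simp: pt_scale\<close>)
  then have "g (a *s v) = (a ^ k * p v) / (a ^ l * q v)"
    using forms_homogeneous[OF *(1)] forms_homogeneous[OF *(2)] by simp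
  also have "\<dots> = a powi d * g v"
    using 1 assms(5) by (simp add: *(3)[symmetric] power_int_diff)
  finally show ?thesis .
qed

lemma twist_sects_iff:
  assumes X: "X \<subseteq> proj_space" and U: "zopen X U"
  shows "s \<in> sects (twist X d) U \<longleftrightarrow>
    (\<forall>x\<in>U. (\<forall>v. v \<notin> x - {0} \<longrightarrow> s x v = 0) \<and> rat X d (\<lambda>v. s (pt v) v) x)"
proof
  assume f: "s \<in> sects (twist X d) U"
  show "\<forall>x\<in>U. (\<forall>v. v \<notin> x - {0} \<longrightarrow> s x v = 0) \<and> rat X d (\<lambda>v. s (pt v) v) x"
  proof
    fix x assume x: "x \<in> U"
    from f have "\<forall>x\<in>U. \<exists>W k l. \<exists>p\<in>forms k. \<exists>q\<in>forms l. zopen X W \<and> x \<in> W \<and> W \<subseteq> U \<and> int k - int l = d \<and>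
      (\<forall>y\<in>W. (\<forall>v. v \<notin> y - {0} \<longrightarrow> s y v = 0) \<and> (\<forall>v\<in>y - {0}. q v \<noteq> 0 \<and> s y v = p v / q v))"
      unfolding twist_def by simp
    from this[THEN bspec, OF x] obtain W k l p q where *: "p \<in> forms k" "q \<in> forms l" "zopen X W" "x \<in> W" "W \<subseteq> U"
      "int k - int l = d"
      "\<forall>y\<in>W. (\<forall>v. v \<notin> y - {0} \<longrightarrow> s y v = 0) \<and> (\<forall>v\<in>y - {0}. q v \<noteq> 0 \<and> s y v = p v / q v)"
      by (elim exE bexE conjE) (rule that)
    have xX: "x \<in> X" using zopen_subset[OF U] x by auto
    have "q v \<noteq> 0 \<and> s (pt v) v = p v / q v" if "y \<in> W" "v \<in> y - {0}" for y v
      using * that zopen_subset[OF *(3)] X proj_space_eq_pt[of y v] by auto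
    then have "eventually (\<lambda>v. q v \<noteq> 0 \<and> s (pt v) v = p v / q v) (zn X x)"
      unfolding eventually_zn[OF X xX] using *(3,4) by (intro exI[of _ W]) auto
    then have "rat X d (\<lambda>v. s (pt v) v) x" by (intro ratI[OF *(1,2,6)])
    then show "(\<forall>v. v \<notin> x - {0} \<longrightarrow> s x v = 0) \<and> rat X d (\<lambda>v. s (pt v) v) x" using *(4,7) by blast
  qed
next
  assume r: "\<forall>x\<in>U. (\<forall>v. v \<notin> x - {0} \<longrightarrow> s x v = 0) \<and> rat X d (\<lambda>v. s (pt v) v) x"
  have "\<exists>W k l. \<exists>p\<in>forms k. \<exists>q\<in>forms l. zopen X W \<and> x \<in> W \<and> W \<subseteq> U \<and> int k - int l = d \<and>
      (\<forall>y\<in>W. (\<forall>v. v \<notin> y - {0} \<longrightarrow> s y v = 0) \<and> (\<forall>v\<in>y - {0}. q v \<noteq> 0 \<and> s y v = p v / q v))"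
    if x: "x \<in> U" for x
  proof -
    have xX: "x \<in> X" using zopen_subset[OF U] x by auto
    from r x have "rat X d (\<lambda>v. s (pt v) v) x" by blast
    then obtain k l p q where *: "p \<in> forms k" "q \<in> forms l" "int k - int l = d"
      "eventually (\<lambda>v. q v \<noteq> 0 \<and> s (pt v) v = p v / q v) (zn X x)" by (rule ratE)
    from *(4)[unfolded eventually_zn[OF X xX]]
    obtain W where W: "zopen X W" "x \<in> W" "\<forall>y\<in>W. \<forall>v\<in>y - {0}. q v \<noteq> 0 \<and> s (pt v) v = p v / q v"
      by (elim exE conjE) (rule that)
    have "q v \<noteq> 0 \<and> s y v = p v / q v" if "y \<in> W \<inter> U" "v \<in> y - {0}" for y v
      using W(3) that zopen_subset[OF W(1)] X proj_space_eq_pt[of y v] by auto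
    moreover have "\<forall>v. v \<notin> y - {0} \<longrightarrow> s y v = 0" if "y \<in> W \<inter> U" for y using r that by blast
    moreover have "zopen X (W \<inter> U)" "x \<in> W \<inter> U" using W U x by (auto intro: zopen_Int)
    ultimately show ?thesis using *(1-3)
      by (intro exI[of _ "W \<inter> U"] exI[of _ k] exI[of _ l] bexI[of _ p] bexI[of _ q]) auto
  qed
  then show "s \<in> sects (twist X d) U" unfolding twist_def by simp
qed

text \<open>The element of the fibre of \<open>O(d)\<close> at \<open>pt v\<close> with value \<open>c\<close> at \<open>v\<close>.\<close>

definition gen :: "int \<Rightarrow> 'k::field ^ 'n::finite \<Rightarrow> 'k \<Rightarrow> 'k ^ 'n \<Rightarrow> 'k" where
  "gen d v c u = (if u \<in> pt v - {0} then (THE a. u = a *s v) powi d * c else 0)"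

lemma scale_cancel: "v \<noteq> 0 \<Longrightarrow> (THE a'. a *s v = a' *s v) = (a :: 'k::field)"
  by (rule the_equality) auto

lemma gen_scale: "v \<noteq> 0 \<Longrightarrow> a \<noteq> 0 \<Longrightarrow> gen d v c (a *s v) = a powi d * c"
  by (auto simp: gen_def mem_pt scale_cancel)

lemma gen_self [simp]: "v \<noteq> 0 \<Longrightarrow> gen d v c v = c"
  using gen_scale[of v 1] by simp

lemma gen_outside: "u \<notin> pt v - {0} \<Longrightarrow> gen d v c u = 0"
  by (simp add: gen_def del: Diff_iff)

lemma gen_mult: "gen d v (a * c) u = a * gen d v c u"
  by (simp add: gen_def)

lemma gen_rescale:
  assumes "v \<noteq> 0" "a \<noteq> 0" shows "gen d (a *s v) c u = a powi (- d) * gen d v c u"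
proof (cases "u \<in> pt v - {0}")
  case True
  then obtain b where b: "b \<noteq> 0" "u = b *s v" unfolding mem_pt_minus_zero[OF assms(1)] by blast
  then have u: "u = (b / a) *s (a *s v)" using assms by simp
  have "gen d (a *s v) c u = (b / a) powi d * c"
    unfolding u by (rule gen_scale) (use assms b in auto)
  then show ?thesis using gen_scale[OF assms(1) b(1), of d c] b assms
    by (simp add: power_int_divide_distrib power_int_minus field_simps)
next
  case False
  then show ?thesis using assms by (simp add: gen_outside pt_scale del: Diff_iff)
qed

lemma twist_fibre_iff:
  assumes "v \<noteq> 0" shows "h \<in> fibre (twist X d) (pt v) \<longleftrightarrow> h = gen d v (h v)"
proof
  assume h: "h \<in> fibre (twist X d) (pt v)"
  show "h = gen d v (h v)"
  proof
    fix u show "h u = gen d v (h v) u"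
    proof (cases "u \<in> pt v - {0}")
      case True
      then obtain a where "a \<noteq> 0" "u = a *s v" unfolding mem_pt_minus_zero[OF assms] by blast
      then show ?thesis using h assms by (simp add: twist_def gen_scale)
    next
      case False
      then show ?thesis using h by (simp add: twist_def gen_outside del: Diff_iff)
    qed
  qed
next
  assume h: "h = gen d v (h v)"
  have "gen d v c (a *s u) = a powi d * gen d v c u" if u: "u \<in> pt v - {0}" and a: "a \<noteq> 0" for a u c
  proof -
    from u obtain e where e: "e \<noteq> 0" "u = e *s v" unfolding mem_pt_minus_zero[OF assms] by blast
    have "gen d v c ((a * e) *s v) = (a * e) powi d * c" "gen d v c (e *s v) = e powi d * c"
      using a e(1) by (simp_all add: gen_scale[OF assms] del: vector_smult_assoc)
    then show ?thesis by (simp add: e(2) power_int_mult_distrib)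
  qed
  moreover have "gen d v c u = 0" if "u \<notin> pt v - {0}" for u c using that by (rule gen_outside)
  ultimately have "gen d v c \<in> fibre (twist X d) (pt v)" for c
    unfolding twist_def by simp
  from this[of "h v"] show "h \<in> fibre (twist X d) (pt v)" by (subst h)
qed

lemma rat_coord_powi:
  assumes "X \<subseteq> proj_space" "pt v \<in> X" "v \<noteq> 0" "v $ i \<noteq> 0"
  shows "rat X e (\<lambda>v. (v $ i) powi e) (pt v)"
proof (cases "e \<ge> 0")
  case True
  then have "rat X (int (1 * nat e)) (\<lambda>v. (v $ i) ^ nat e) (pt v)"
    by (intro rat_form forms_power forms_coord)
  then show ?thesis using True by (simp add: power_int_def)
next
  case False
  have "rat X (int (1 * nat (-e))) (\<lambda>v. (v $ i) ^ nat (-e)) (pt v)"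
    by (intro rat_form forms_power forms_coord)
  then have "rat X (- int (1 * nat (-e))) (\<lambda>v. 1 / (v $ i) ^ nat (-e)) (pt v)"
    by (rule rat_inverse) (use assms in auto)
  then show ?thesis using False by (simp add: power_int_def power_inverse inverse_eq_divide power_one_over)
qed

text \<open>A splitting of \<open>F\<close> over \<open>L\<close> into line bundles
  \<open>O(d j)\<close>, recorded by frame vectors on the cone. The vectors scale with degree
  \<open>- d j\<close> and the coefficients of a section with degree \<open>d j\<close>, so their
  combinations depend only on the point. Unlike an isomorphism with a direct sum, such a frame can
  be inserted directly into linear systems.\<close>

locale framed = vector_space "smult F"
  for F :: "(('k::field ^ 'n::finite) set, 'k, 'v::ab_group_add) vbundle" +
  fixes L :: "('k ^ 'n) set set" and J :: "'j set" and d :: "'j \<Rightarrow> int" and b :: "'j \<Rightarrow> 'k ^ 'n \<Rightarrow> 'v"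
  assumes base: "base F = L" and L: "L \<subseteq> proj_space" and fin: "finite J"
    and fibre: "v \<noteq> 0 \<Longrightarrow> pt v \<in> L \<Longrightarrow> fibre F (pt v) = {\<Sum>j\<in>J. smult F (z j) (b j v) | z. True}"
    and indep: "v \<noteq> 0 \<Longrightarrow> pt v \<in> L \<Longrightarrow> (\<Sum>j\<in>J. smult F (z j) (b j v)) = 0 \<Longrightarrow> j \<in> J \<Longrightarrow> z j = 0"
    and homogeneous: "v \<noteq> 0 \<Longrightarrow> pt v \<in> L \<Longrightarrow> a \<noteq> 0 \<Longrightarrow> j \<in> J \<Longrightarrow> b j (a *s v) = smult F (a powi (- d j)) (b j v)"
    and sects: "zopen L U \<Longrightarrow> s \<in> sects F U \<longleftrightarrow>
      (\<forall>x\<in>U. \<exists>f. (\<forall>j\<in>J. rat L (d j) (f j) x) \<and>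
        eventually (\<lambda>v. s (pt v) = (\<Sum>j\<in>J. smult F (f j v) (b j v))) (zn L x))"
begin

lemma coeff_unique:
  assumes "v \<noteq> 0" "pt v \<in> L" "(\<Sum>j\<in>J. smult F (y j) (b j v)) = (\<Sum>j\<in>J. smult F (z j) (b j v))" "j \<in> J"
  shows "y j = z j"
proof -
  have "(\<Sum>j\<in>J. smult F (y j - z j) (b j v)) = 0"
    using assms(3) by (simp add: scale_left_diff_distrib sum_subtractf)
  from indep[OF assms(1,2) this assms(4)] show ?thesis by simp
qed

definition coeff :: "'k ^ 'n \<Rightarrow> 'v \<Rightarrow> 'j \<Rightarrow> 'k" where
  "coeff v u = (SOME z. u = (\<Sum>j\<in>J. smult F (z j) (b j v)))"

lemma coeff_sum:
  assumes "v \<noteq> 0" "pt v \<in> L" "u \<in> fibre F (pt v)"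
  shows "(\<Sum>j\<in>J. smult F (coeff v u j) (b j v)) = u"
proof -
  have "\<exists>z. u = (\<Sum>j\<in>J. smult F (z j) (b j v))" using assms(3) unfolding fibre[OF assms(1,2)] by blast
  then have "u = (\<Sum>j\<in>J. smult F (coeff v u j) (b j v))" unfolding coeff_def by (rule someI_ex)
  then show ?thesis by simp
qed

lemma sum_in_fibre: "v \<noteq> 0 \<Longrightarrow> pt v \<in> L \<Longrightarrow> (\<Sum>j\<in>J. smult F (z j) (b j v)) \<in> fibre F (pt v)"
  using fibre by blast

lemma b_as_sum: "j \<in> J \<Longrightarrow> b j v = (\<Sum>i\<in>J. smult F (if i = j then 1 else 0) (b i v))"
  using fin by (simp add: if_distrib[of "\<lambda>x. smult F x _"] cong: if_cong)

lemma b_in_fibre: "v \<noteq> 0 \<Longrightarrow> pt v \<in> L \<Longrightarrow> j \<in> J \<Longrightarrow> b j v \<in> fibre F (pt v)"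
  using sum_in_fibre[of v "\<lambda>i. if i = j then 1 else 0"] b_as_sum[of j v] by simp

lemma coeff_eq:
  assumes "v \<noteq> 0" "pt v \<in> L" "u = (\<Sum>j\<in>J. smult F (z j) (b j v))" "j \<in> J"
  shows "coeff v u j = z j"
proof (rule coeff_unique[OF assms(1,2) _ assms(4)])
  show "(\<Sum>j\<in>J. smult F (coeff v u j) (b j v)) = (\<Sum>j\<in>J. smult F (z j) (b j v))"
    using coeff_sum[OF assms(1,2), of u] sum_in_fibre[OF assms(1,2), of z] assms(3) by simp
qed

lemma sects_in_fibre:
  assumes "zopen L U" "s \<in> sects F U" "x \<in> U" shows "s x \<in> fibre F x"
proof -
  have x: "x \<in> L" using zopen_subset[OF assms(1)] assms(3) by auto
  then obtain v where v: "v \<noteq> 0" "x = pt v" using L proj_spaceE by blast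
  from assms sects[OF assms(1)] obtain f where
    "eventually (\<lambda>v. s (pt v) = (\<Sum>j\<in>J. smult F (f j v) (b j v))) (zn L x)" by blast
  then have "s (pt v) = (\<Sum>j\<in>J. smult F (f j v) (b j v))"
    unfolding v(2) by (rule eventually_zn_at) (use L x v in auto)
  then show ?thesis using sum_in_fibre[of v] x v by simp
qed

lemma coeff_scale:
  assumes v: "v \<noteq> 0" "pt v \<in> L" "a \<noteq> 0" and u: "u \<in> fibre F (pt v)" and j: "j \<in> J"
  shows "coeff (a *s v) u j = a powi (d j) * coeff v u j"
proof (rule coeff_eq[OF _ _ _ j])
  show "a *s v \<noteq> 0" "pt (a *s v) \<in> L" using v by (auto simp: pt_scale)
  have "smult F (a powi (d j) * coeff v u j) (b j (a *s v)) = smult F (coeff v u j) (b j v)" if "j \<in> J" for j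
    using homogeneous[OF v that] v(3) by (simp add: power_int_minus)
  then show "u = (\<Sum>j\<in>J. smult F (a powi (d j) * coeff v u j) (b j (a *s v)))"
    using coeff_sum[OF v(1,2) u] by simp
qed

text \<open>Division by a power of a linear form makes a homogeneous frame vector a local section.\<close>

lemma local_section:
  assumes "x \<in> L" "j \<in> J"
  obtains U s i where "zopen L U" "x \<in> U" "s \<in> sects F U"
    "\<And>v. v \<noteq> 0 \<Longrightarrow> pt v \<in> U \<Longrightarrow> v $ i \<noteq> 0 \<and> s (pt v) = smult F ((v $ i) powi (d j)) (b j v)"
proof -
  obtain v0 where v0: "v0 \<noteq> 0" "x = pt v0" using assms L proj_spaceE by blast
  obtain i where i: "v0 $ i \<noteq> 0" using nonzero_coord[OF v0(1)] by blast
  have "eventually (\<lambda>v. v $ i \<noteq> 0) (zn L x)"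
    unfolding v0(2) by (rule eventually_zn_nonzero[OF forms_coord i L]) (use assms v0 in auto)
  then obtain U where U: "zopen L U" "x \<in> U" "\<forall>y\<in>U. \<forall>v\<in>y - {0}. v $ i \<noteq> 0"
    unfolding eventually_zn[OF L assms(1)] by blast
  define rep where "rep y = (SOME v. v \<in> y - {0})" for y :: "('k ^ 'n) set"
  \<comment> \<open>The choice of representative is harmless: the coordinate power has degree
    \<open>d j\<close> and the frame vector degree \<open>- d j\<close>.\<close>
  define s where "s y = smult F ((rep y $ i) powi (d j)) (b j (rep y))" for y
  have s: "v $ i \<noteq> 0 \<and> s (pt v) = smult F ((v $ i) powi (d j)) (b j v)" if v: "v \<noteq> 0" "pt v \<in> U" for v
  proof -
    have "v \<in> pt v - {0}" using v by simp
    then have "rep (pt v) \<in> pt v - {0}" unfolding rep_def by (rule someI)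
    then obtain a where a: "a \<noteq> 0" "rep (pt v) = a *s v" unfolding mem_pt_minus_zero[OF v(1)] by blast
    have vi: "v $ i \<noteq> 0" using U(3) v \<open>v \<in> pt v - {0}\<close> by blast
    have "pt v \<in> L" using v zopen_subset[OF U(1)] by auto
    then show ?thesis
      using vi a by (simp add: s_def homogeneous[OF v(1) _ a(1) assms(2)] power_int_mult_distrib power_int_minus)
  qed
  have "s \<in> sects F U"
    unfolding sects[OF U(1)]
  proof
    fix y assume y: "y \<in> U"
    then have yL: "y \<in> L" using zopen_subset[OF U(1)] by auto
    then obtain v where v: "v \<noteq> 0" "y = pt v" using L proj_spaceE by blast
    define f where "f k v = (if k = j then (v $ i) powi (d j) else 0)" for k and v :: "'k ^ 'n"
    have "v $ i \<noteq> 0" using s[OF v(1)] y v(2) by simp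
    then have powi: "rat L e (\<lambda>v. (v $ i) powi e) y" for e
      unfolding v(2) by (intro rat_coord_powi L) (use v yL in auto)
    have "rat L (d k) (f k) y" for k
      by (cases "k = j") (simp_all add: f_def[abs_def] powi rat_zero[OF L yL])
    moreover have "eventually (\<lambda>v. s (pt v) = (\<Sum>k\<in>J. smult F (f k v) (b k v))) (zn L y)"
      using eventually_zn_open[OF U(1) y L]
    proof eventually_elim
      case (elim v)
      have "(\<Sum>k\<in>J. smult F (f k v) (b k v)) = smult F ((v $ i) powi (d j)) (b j v)"
        unfolding f_def using fin assms(2)
        by (simp add: if_distrib[of "\<lambda>x. smult F x _"] cong: if_cong)
      then show ?case using s elim by simp
    qed
    ultimately show "\<exists>f. (\<forall>k\<in>J. rat L (d k) (f k) y) \<and>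
        eventually (\<lambda>v. s (pt v) = (\<Sum>j\<in>J. smult F (f j v) (b j v))) (zn L y)" by blast
  qed
  with U s show thesis by (intro that) auto
qed

end

section \<open>Frames of twists and of direct sums\<close>

lemma vector_space_fun:
  "(\<And>i. vector_space (sc i)) \<Longrightarrow> vector_space (\<lambda>a u i. sc i a (u i))"
  unfolding vector_space_def by (simp add: fun_eq_iff)

lemma vector_space_scale_zero:
  assumes "vector_space sc" shows "sc a 0 = 0"
proof -
  interpret vector_space sc by (rule assms)
  show ?thesis by (rule scale_zero_right)
qed

lemma twist_smult_vector_space: "vector_space (smult (twist X d))"
  unfolding vector_space_def twist_def by (simp add: fun_eq_iff algebra_simps)

text \<open>The frame vector at \<open>v\<close> is the homogeneous function with value
  \<open>1\<close> at \<open>v\<close>, so the coefficient of a section \<open>s\<close> is the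
  function \<open>s (pt v) v\<close> on the cone.\<close>

lemma framed_twist:
  assumes "X \<subseteq> proj_space"
  shows "framed (twist X d) X {()} (\<lambda>_. d) (\<lambda>_ v. gen d v 1)"
proof -
  interpret vector_space "smult (twist X d)" by (rule twist_smult_vector_space)
  have sm: "smult (twist X d) a h = (\<lambda>v. a * h v)" for a h by (simp add: twist_def)
  show ?thesis
  proof (unfold_locales, goal_cases)
    case 1 then show ?case by (simp add: twist_def)
  next
    case 2 then show ?case by fact
  next
    case 3 then show ?case by simp
  next
    case (4 v)
    have "h = gen d v (h v) \<longleftrightarrow> (\<exists>z. h = (\<lambda>u. z * gen d v 1 u))" for h
    proof
      assume "h = gen d v (h v)"
      then have "h u = h v * gen d v 1 u" for u using gen_mult[of d v "h v" 1 u] by (metis mult.right_neutral)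
      then show "\<exists>z. h = (\<lambda>u. z * gen d v 1 u)" by blast
    next
      assume "\<exists>z. h = (\<lambda>u. z * gen d v 1 u)"
      then obtain z where "h = (\<lambda>u. z * gen d v 1 u)" by blast
      then show "h = gen d v (h v)" using 4 by (simp add: gen_mult[symmetric] fun_eq_iff)
    qed
    then show ?case using twist_fibre_iff[OF 4(1), of _ X d] by (auto simp: sm)
  next
    case (5 v z j)
    have "(\<Sum>j\<in>{()}. smult (twist X d) (z j) (gen d v 1)) v = 0" unfolding 5(3) by simp
    then show ?case using 5(1) by (simp add: sm)
  next
    case (6 v a j)
    then show ?case by (simp add: sm fun_eq_iff gen_rescale)
  next
    case (7 U s)
    have "s \<in> sects (twist X d) U \<longleftrightarrow>
      (\<forall>x\<in>U. \<exists>f. rat X d f x \<and> eventually (\<lambda>v. s (pt v) = (\<lambda>u. f v * gen d v 1 u)) (zn X x))"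
      unfolding twist_sects_iff[OF assms 7]
    proof
      assume s: "\<forall>x\<in>U. (\<forall>v. v \<notin> x - {0} \<longrightarrow> s x v = 0) \<and> rat X d (\<lambda>v. s (pt v) v) x"
      have eq: "s (pt v) = (\<lambda>u. s (pt v) v * gen d v 1 u)" if v: "v \<noteq> 0" "pt v \<in> U" for v
      proof
        fix u show "s (pt v) u = s (pt v) v * gen d v 1 u"
        proof (cases "u \<in> pt v - {0}")
          case True
          then obtain a where a: "a \<noteq> 0" "u = a *s v" unfolding mem_pt_minus_zero[OF v(1)] by blast
          have "s (pt (a *s v)) (a *s v) = a powi d * s (pt v) v"
            by (rule rat_homogeneous[where g = "\<lambda>v. s (pt v) v" and X = X]) (use s v a assms zopen_subset[OF 7] in auto)
          then show ?thesis using a v by (simp add: pt_scale gen_scale)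
        next
          case False
          then have "s (pt v) u = 0" using s v(2) by blast
          then show ?thesis using False by (simp add: gen_outside del: Diff_iff)
        qed
      qed
      show "\<forall>x\<in>U. \<exists>f. rat X d f x \<and> eventually (\<lambda>v. s (pt v) = (\<lambda>u. f v * gen d v 1 u)) (zn X x)"
      proof
        fix x assume x: "x \<in> U"
        have "eventually (\<lambda>v. s (pt v) = (\<lambda>u. s (pt v) v * gen d v 1 u)) (zn X x)"
          using eventually_zn_open[OF 7 x assms] by eventually_elim (use eq in blast)
        then show "\<exists>f. rat X d f x \<and> eventually (\<lambda>v. s (pt v) = (\<lambda>u. f v * gen d v 1 u)) (zn X x)"
          using s x by (intro exI[of _ "\<lambda>v. s (pt v) v"]) simp
      qed
    next
      assume r: "\<forall>x\<in>U. \<exists>f. rat X d f x \<and> eventually (\<lambda>v. s (pt v) = (\<lambda>u. f v * gen d v 1 u)) (zn X x)"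
      show "\<forall>x\<in>U. (\<forall>v. v \<notin> x - {0} \<longrightarrow> s x v = 0) \<and> rat X d (\<lambda>v. s (pt v) v) x"
      proof
        fix x assume x: "x \<in> U"
        then have xX: "x \<in> X" using zopen_subset[OF 7] by auto
        obtain v where v: "v \<noteq> 0" "x = pt v" using xX assms proj_spaceE by blast
        from r x obtain f where f: "rat X d f x"
          and ev: "eventually (\<lambda>v. s (pt v) = (\<lambda>u. f v * gen d v 1 u)) (zn X x)" by blast
        have "s (pt v) = (\<lambda>u. f v * gen d v 1 u)"
          using ev unfolding v(2) by (rule eventually_zn_at) (use assms v xX in auto)
        then have "\<forall>u. u \<notin> x - {0} \<longrightarrow> s x u = 0" by (simp add: v(2) gen_outside del: Diff_iff)
        moreover have "eventually (\<lambda>v. f v = s (pt v) v) (zn X x)"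
          using ev eventually_zn_open[OF zopen_self[OF assms] xX assms] by eventually_elim simp
        ultimately show "(\<forall>v. v \<notin> x - {0} \<longrightarrow> s x v = 0) \<and> rat X d (\<lambda>v. s (pt v) v) x"
          using rat_cong[OF f] by simp
      qed
    qed
    also have "\<dots> \<longleftrightarrow> (\<forall>x\<in>U. \<exists>f. (\<forall>j\<in>{()}. rat X d (f j) x) \<and>
        eventually (\<lambda>v. s (pt v) = (\<Sum>j\<in>{()}. smult (twist X d) (f j v) (gen d v 1))) (zn X x))"
    proof (intro ball_cong refl iffI)
      fix x assume "\<exists>f. rat X d f x \<and> eventually (\<lambda>v. s (pt v) = (\<lambda>u. f v * gen d v 1 u)) (zn X x)"
      then obtain f where "rat X d f x" "eventually (\<lambda>v. s (pt v) = (\<lambda>u. f v * gen d v 1 u)) (zn X x)" by blast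
      then show "\<exists>f. (\<forall>j\<in>{()}. rat X d (f j) x) \<and>
        eventually (\<lambda>v. s (pt v) = (\<Sum>j\<in>{()}. smult (twist X d) (f j v) (gen d v 1))) (zn X x)"
        by (intro exI[of _ "\<lambda>_. f"]) (simp add: sm)
    next
      fix x assume "\<exists>f. (\<forall>j\<in>{()}. rat X d (f j) x) \<and>
        eventually (\<lambda>v. s (pt v) = (\<Sum>j\<in>{()}. smult (twist X d) (f j v) (gen d v 1))) (zn X x)"
      then obtain f where "rat X d (f ()) x" "eventually (\<lambda>v. s (pt v) = (\<lambda>u. f () v * gen d v 1 u)) (zn X x)"
        by (auto simp: sm)
      then show "\<exists>f. rat X d f x \<and> eventually (\<lambda>v. s (pt v) = (\<lambda>u. f v * gen d v 1 u)) (zn X x)" by blast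
    qed
    finally show ?case .
  qed
qed

text \<open>The frame vector with index \<open>(i, j)\<close> lives in component \<open>i\<close>
  and is zero in the others, so everything reduces to the componentwise formula
  \<open>comp\<close>.\<close>

lemma framed_sum:
  fixes B :: "'i \<Rightarrow> (('k::field ^ 'n::finite) set, 'k, 'v::ab_group_add) vbundle"
  assumes I: "finite I" and X: "X \<subseteq> proj_space"
    and B: "\<And>i. i \<in> I \<Longrightarrow> framed (B i) X (J i) (d i) (b i)"
    and vs: "\<And>i. vector_space (smult (B i))"
  shows "framed (bundle_sum X I B) X (Sigma I J) (\<lambda>(i, j). d i j)
    (\<lambda>(i, j) v i'. if i' = i then b i j v else 0)"
proof -
  let ?S = "bundle_sum X I B"
  let ?b = "\<lambda>p v i'. if i' = fst p then b (fst p) (snd p) v else 0"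
  have sm: "smult ?S a u = (\<lambda>i. smult (B i) a (u i))" for a u by (simp add: bundle_sum_def)
  have fib: "fibre ?S x = {u. (\<forall>i\<in>I. u i \<in> fibre (B i) x) \<and> (\<forall>i. i \<notin> I \<longrightarrow> u i = 0)}" for x
    by (simp add: bundle_sum_def)
  interpret vector_space "smult ?S"
    unfolding bundle_sum_def using vector_space_fun[of "\<lambda>i. smult (B i)"] vs by simp
  have finJ: "finite (J i)" if "i \<in> I" for i using B[OF that] by (rule framed.fin)
  have comp: "(\<Sum>p\<in>Sigma I J. smult ?S (z p) (?b p v)) i =
      (if i \<in> I then \<Sum>j\<in>J i. smult (B i) (z (i, j)) (b i j v) else 0)" for z v i
  proof -
    have zero: "smult (B i) a 0 = 0" for a by (rule vector_space_scale_zero) (rule vs)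
    have split_sum: "(\<Sum>p\<in>Sigma I J. G p) = (\<Sum>i'\<in>I. \<Sum>j\<in>J i'. G (i', j))" for G :: "_ \<Rightarrow> 'v"
      using I finJ by (simp add: sum.Sigma)
    have sf: "(\<Sum>p\<in>A. h p) i = (\<Sum>p\<in>A. h p i)" for A and h :: "_ \<Rightarrow> 'i \<Rightarrow> 'v"
      by (induction A rule: infinite_finite_induct) auto
    have "(\<Sum>p\<in>Sigma I J. smult ?S (z p) (?b p v)) i = (\<Sum>p\<in>Sigma I J. smult (B i) (z p) (?b p v i))"
      unfolding sf sm by simp
    also have "\<dots> = (\<Sum>i'\<in>I. \<Sum>j\<in>J i'. smult (B i) (z (i', j)) (?b (i', j) v i))"
      by (rule split_sum)
    also have "\<dots> = (\<Sum>i'\<in>I. if i' = i then \<Sum>j\<in>J i'. smult (B i) (z (i', j)) (b i' j v) else 0)"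
      by (intro sum.cong) (auto simp: zero)
    also have "\<dots> = (if i \<in> I then \<Sum>j\<in>J i. smult (B i) (z (i, j)) (b i j v) else 0)"
      using I by simp
    finally show ?thesis .
  qed
  have frame: "framed ?S X (Sigma I J) (\<lambda>p. d (fst p) (snd p)) ?b"
  proof (unfold_locales, goal_cases)
    case 1 then show ?case by (simp add: bundle_sum_def)
  next
    case 2 then show ?case by (rule X)
  next
    case 3 then show ?case using I finJ by auto
  next
    case (4 v)
    have "u \<in> fibre ?S (pt v) \<longleftrightarrow> (\<exists>z. u = (\<Sum>p\<in>Sigma I J. smult ?S (z p) (?b p v)))" for u
    proof
      assume u: "u \<in> fibre ?S (pt v)"
      have "\<exists>z. u i = (\<Sum>j\<in>J i. smult (B i) (z j) (b i j v))" if "i \<in> I" for i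
        using u that framed.fibre[OF B[OF that] 4] by (auto simp: bundle_sum_def)
      then obtain z where z: "\<And>i. i \<in> I \<Longrightarrow> u i = (\<Sum>j\<in>J i. smult (B i) (z i j) (b i j v))" by metis
      have "u = (\<Sum>p\<in>Sigma I J. smult ?S ((\<lambda>(i, j). z i j) p) (?b p v))"
      proof
        fix i show "u i = (\<Sum>p\<in>Sigma I J. smult ?S ((\<lambda>(i, j). z i j) p) (?b p v)) i"
          unfolding comp using u z by (auto simp: bundle_sum_def)
      qed
      then show "\<exists>z. u = (\<Sum>p\<in>Sigma I J. smult ?S (z p) (?b p v))" by (intro exI[of _ "\<lambda>(i, j). z i j"])
    next
      assume "\<exists>z. u = (\<Sum>p\<in>Sigma I J. smult ?S (z p) (?b p v))"
      then obtain z where u: "u = (\<Sum>p\<in>Sigma I J. smult ?S (z p) (?b p v))" by blast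
      show "u \<in> fibre ?S (pt v)"
        unfolding u fib using framed.sum_in_fibre[OF B 4] by (simp add: comp)
    qed
    then show ?case by blast
  next
    case (5 v z p)
    obtain i j where p: "p = (i, j)" "i \<in> I" "j \<in> J i" using 5(4) by auto
    have "(\<Sum>j\<in>J i. smult (B i) (z (i, j)) (b i j v)) = 0"
      using comp[of z v i] p by (simp add: 5(3))
    from framed.indep[OF B[OF p(2)] 5(1,2) this p(3)] show ?case using p by simp
  next
    case (6 v a p)
    obtain i j where p: "p = (i, j)" "i \<in> I" "j \<in> J i" using 6(4) by auto
    have zero: "smult (B i) a 0 = 0" for a i by (rule vector_space_scale_zero) (rule vs)
    show ?case using framed.homogeneous[OF B[OF p(2)] 6(1-3) p(3)] by (auto simp: p sm zero)
  next
    case (7 U s)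
    have "s \<in> sects ?S U \<longleftrightarrow> (\<forall>i\<in>I. (\<lambda>x. s x i) \<in> sects (B i) U) \<and> (\<forall>x\<in>U. \<forall>i. i \<notin> I \<longrightarrow> s x i = 0)"
      by (auto simp: bundle_sum_def)
    also have "\<dots> \<longleftrightarrow> (\<forall>x\<in>U. \<exists>f. (\<forall>p\<in>Sigma I J. rat X (d (fst p) (snd p)) (f p) x) \<and>
        eventually (\<lambda>v. s (pt v) = (\<Sum>p\<in>Sigma I J. smult ?S (f p v) (?b p v))) (zn X x))"
    proof
      assume s: "(\<forall>i\<in>I. (\<lambda>x. s x i) \<in> sects (B i) U) \<and> (\<forall>x\<in>U. \<forall>i. i \<notin> I \<longrightarrow> s x i = 0)"
      show "\<forall>x\<in>U. \<exists>f. (\<forall>p\<in>Sigma I J. rat X (d (fst p) (snd p)) (f p) x) \<and>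
        eventually (\<lambda>v. s (pt v) = (\<Sum>p\<in>Sigma I J. smult ?S (f p v) (?b p v))) (zn X x)"
      proof
        fix x assume x: "x \<in> U"
        have "\<forall>i\<in>I. \<exists>f. (\<forall>j\<in>J i. rat X (d i j) (f j) x) \<and>
          eventually (\<lambda>v. s (pt v) i = (\<Sum>j\<in>J i. smult (B i) (f j v) (b i j v))) (zn X x)"
        proof
          fix i assume i: "i \<in> I"
          with s have "(\<lambda>x. s x i) \<in> sects (B i) U" by blast
          from this[unfolded framed.sects[OF B[OF i] 7], THEN bspec, OF x]
          show "\<exists>f. (\<forall>j\<in>J i. rat X (d i j) (f j) x) \<and>
            eventually (\<lambda>v. s (pt v) i = (\<Sum>j\<in>J i. smult (B i) (f j v) (b i j v))) (zn X x)" .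
        qed
        from bchoice[OF this] obtain f where f': "\<forall>i\<in>I. (\<forall>j\<in>J i. rat X (d i j) (f i j) x) \<and>
          eventually (\<lambda>v. s (pt v) i = (\<Sum>j\<in>J i. smult (B i) (f i j v) (b i j v))) (zn X x)"
          by (elim exE) (rule that)
        then have f: "\<And>i j. i \<in> I \<Longrightarrow> j \<in> J i \<Longrightarrow> rat X (d i j) (f i j) x"
          "\<And>i. i \<in> I \<Longrightarrow> eventually (\<lambda>v. s (pt v) i = (\<Sum>j\<in>J i. smult (B i) (f i j v) (b i j v))) (zn X x)"
          by auto
        have "eventually (\<lambda>v. \<forall>i\<in>I. s (pt v) i = (\<Sum>j\<in>J i. smult (B i) (f i j v) (b i j v))) (zn X x)"
          using f(2) by (intro eventually_ball_finite I) auto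
        then have "eventually (\<lambda>v. s (pt v) = (\<Sum>p\<in>Sigma I J. smult ?S (f (fst p) (snd p) v) (?b p v))) (zn X x)"
          using eventually_zn_open[OF 7 x X]
        proof eventually_elim
          case (elim v)
          show ?case
          proof
            fix i show "s (pt v) i = (\<Sum>p\<in>Sigma I J. smult ?S (f (fst p) (snd p) v) (?b p v)) i"
              unfolding comp using elim s by auto
          qed
        qed
        then show "\<exists>f. (\<forall>p\<in>Sigma I J. rat X (d (fst p) (snd p)) (f p) x) \<and>
            eventually (\<lambda>v. s (pt v) = (\<Sum>p\<in>Sigma I J. smult ?S (f p v) (?b p v))) (zn X x)"
          using f(1) by (intro exI[of _ "\<lambda>p. f (fst p) (snd p)"]) auto
      qed
    next
      assume r: "\<forall>x\<in>U. \<exists>f. (\<forall>p\<in>Sigma I J. rat X (d (fst p) (snd p)) (f p) x) \<and>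
        eventually (\<lambda>v. s (pt v) = (\<Sum>p\<in>Sigma I J. smult ?S (f p v) (?b p v))) (zn X x)"
      have "(\<lambda>x. s x i) \<in> sects (B i) U" if i: "i \<in> I" for i
        unfolding framed.sects[OF B[OF i] 7]
      proof
        fix x assume "x \<in> U"
        with r obtain f where f: "\<forall>p\<in>Sigma I J. rat X (d (fst p) (snd p)) (f p) x"
          "eventually (\<lambda>v. s (pt v) = (\<Sum>p\<in>Sigma I J. smult ?S (f p v) (?b p v))) (zn X x)" by blast
        from f(2) have "eventually (\<lambda>v. s (pt v) i = (\<Sum>j\<in>J i. smult (B i) (f (i, j) v) (b i j v))) (zn X x)"
          by eventually_elim (simp only: comp i if_True)
        then show "\<exists>f. (\<forall>j\<in>J i. rat X (d i j) (f j) x) \<and>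
            eventually (\<lambda>v. s (pt v) i = (\<Sum>j\<in>J i. smult (B i) (f j v) (b i j v))) (zn X x)"
          using f(1) i by (intro exI[of _ "\<lambda>j. f (i, j)"]) auto
      qed
      moreover have "s x i = 0" if x: "x \<in> U" and i: "i \<notin> I" for x i
      proof -
        have xX: "x \<in> X" using x zopen_subset[OF 7] by auto
        then obtain v where v: "v \<noteq> 0" "x = pt v" using X proj_spaceE by blast
        from r x obtain f where
          "eventually (\<lambda>v. s (pt v) = (\<Sum>p\<in>Sigma I J. smult ?S (f p v) (?b p v))) (zn X x)" by blast
        then have "s (pt v) = (\<Sum>p\<in>Sigma I J. smult ?S (f p v) (?b p v))"
          unfolding v(2) by (rule eventually_zn_at) (use X xX v in auto)
        then show ?thesis using comp[of "\<lambda>p. f p v" v i] i v by simp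
      qed
      ultimately show "(\<forall>i\<in>I. (\<lambda>x. s x i) \<in> sects (B i) U) \<and> (\<forall>x\<in>U. \<forall>i. i \<notin> I \<longrightarrow> s x i = 0)" by blast
    qed
    finally show ?case .
  qed
  then show ?thesis by (simp add: case_prod_beta')
qed

section \<open>Homomorphisms of framed bundles and restriction to subvarieties\<close>

lemma bundle_hom_sum:
  assumes h: "bundle_hom E F \<phi>" and x: "x \<in> base E"
    and E: "vector_space (smult E)" and F: "vector_space (smult F)"
    and sub: "module.subspace (smult E) (fibre E x)"
    and u: "\<And>j. j \<in> A \<Longrightarrow> u j \<in> fibre E x"
  shows "\<phi> x (\<Sum>j\<in>A. smult E (z j) (u j)) = (\<Sum>j\<in>A. smult F (z j) (\<phi> x (u j)))"
proof -
  interpret E: vector_space "smult E" by (rule E)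
  interpret F: vector_space "smult F" by (rule F)
  have add: "\<phi> x (p + q) = \<phi> x p + \<phi> x q" if "p \<in> fibre E x" "q \<in> fibre E x" for p q
    using h x that unfolding bundle_hom_def by blast
  have scale: "\<phi> x (smult E a p) = smult F a (\<phi> x p)" if "p \<in> fibre E x" for a p
    using h x that unfolding bundle_hom_def by blast
  have zero: "\<phi> x 0 = 0" using add[of 0 0] E.subspace_0[OF sub] by simp
  show ?thesis using u
  proof (induction A rule: infinite_finite_induct)
    case (insert j A)
    have "(\<Sum>j\<in>A. smult E (z j) (u j)) \<in> fibre E x"
      using insert.prems by (intro E.subspace_sum[OF sub] E.subspace_scale[OF sub]) auto
    then show ?case using insert by (simp add: add scale E.subspace_scale[OF sub])
  qed (auto simp: zero)
qed

lemma bundle_homD: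
  assumes "bundle_hom E F \<phi>"
  shows "base E = base F" "x \<in> base E \<Longrightarrow> u \<in> fibre E x \<Longrightarrow> \<phi> x u \<in> fibre F x"
    "zopen (base E) U \<Longrightarrow> s \<in> sects E U \<Longrightarrow> (\<lambda>x. \<phi> x (s x)) \<in> sects F U"
proof -
  show "base E = base F" using assms unfolding bundle_hom_def by blast
  show "\<phi> x u \<in> fibre F x" if "x \<in> base E" "u \<in> fibre E x"
    using assms that unfolding bundle_hom_def by blast
  show "(\<lambda>x. \<phi> x (s x)) \<in> sects F U" if "zopen (base E) U" "s \<in> sects E U"
    using assms that unfolding bundle_hom_def by blast
qed

context framed begin

lemma fibre_subspace: assumes "x \<in> L" shows "subspace (fibre F x)"
proof -
  obtain v where v: "v \<noteq> 0" "x = pt v" using assms L proj_spaceE by blast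
  have f: "fibre F x = {\<Sum>j\<in>J. smult F (z j) (b j v) | z. True}" using fibre assms v by simp
  show ?thesis
    unfolding f
  proof (rule subspaceI, goal_cases)
    case 1 then show ?case by (auto intro!: exI[of _ "\<lambda>_. 0"])
  next
    case (2 p q)
    then obtain y z where "p = (\<Sum>j\<in>J. smult F (y j) (b j v))" "q = (\<Sum>j\<in>J. smult F (z j) (b j v))" by blast
    then have "p + q = (\<Sum>j\<in>J. smult F (y j + z j) (b j v))" by (simp add: scale_left_distrib sum.distrib)
    then show ?case by (intro CollectI exI[of _ "\<lambda>j. y j + z j"]) simp
  next
    case (3 a p)
    then obtain y where "p = (\<Sum>j\<in>J. smult F (y j) (b j v))" by blast
    then have "smult F a p = (\<Sum>j\<in>J. smult F (a * y j) (b j v))" by (simp add: scale_sum_right)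
    then show ?case by (intro CollectI exI[of _ "\<lambda>j. a * y j"]) simp
  qed
qed

lemma coeff_add:
  assumes "v \<noteq> 0" "pt v \<in> L" "p \<in> fibre F (pt v)" "q \<in> fibre F (pt v)" "j \<in> J"
  shows "coeff v (p + q) j = coeff v p j + coeff v q j"
  by (rule coeff_eq[OF assms(1,2) _ assms(5)])
     (simp add: scale_left_distrib sum.distrib coeff_sum[OF assms(1,2)] assms)

lemma coeff_smult:
  assumes "v \<noteq> 0" "pt v \<in> L" "p \<in> fibre F (pt v)" "j \<in> J"
  shows "coeff v (smult F a p) j = a * coeff v p j"
  by (rule coeff_eq[OF assms(1,2) _ assms(4)])
     (simp add: scale_scale[symmetric] scale_sum_right[symmetric] coeff_sum[OF assms(1,2)] assms del: scale_scale)

end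

text \<open>Matching frame vectors have equal degrees, so sending one to the other, with
  coefficients unchanged, does not depend on the representative of the point and preserves regular
  coefficients.\<close>

lemma framed_hom:
  assumes F: "framed F L J d b" and B: "framed B L J' d' b'"
    and \<pi>: "bij_betw \<pi> J J'" and d: "\<And>j. j \<in> J \<Longrightarrow> d' (\<pi> j) = d j"
  shows "\<exists>\<phi>. bundle_hom F B \<phi> \<and> (\<forall>v z. v \<noteq> 0 \<longrightarrow> pt v \<in> L \<longrightarrow>
    \<phi> (pt v) (\<Sum>j\<in>J. smult F (z j) (b j v)) = (\<Sum>j\<in>J. smult B (z j) (b' (\<pi> j) v)))"
proof -
  interpret F: framed F L J d b by (rule F)
  interpret B: framed B L J' d' b' by (rule B)
  have \<pi>J: "\<pi> j \<in> J'" if "j \<in> J" for j using \<pi> that by (auto simp: bij_betw_def)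
  define rep where "rep y = (SOME v. v \<in> y - {0})" for y :: "('a ^ 'b) set"
  define \<phi> where "\<phi> y u = (\<Sum>j\<in>J. smult B (F.coeff (rep y) u j) (b' (\<pi> j) (rep y)))" for y u
  have \<phi>: "\<phi> (pt v) u = (\<Sum>j\<in>J. smult B (F.coeff v u j) (b' (\<pi> j) v))"
    if v: "v \<noteq> 0" "pt v \<in> L" and u: "u \<in> fibre F (pt v)" for v u
  proof -
    have "v \<in> pt v - {0}" using v by simp
    then have "rep (pt v) \<in> pt v - {0}" unfolding rep_def by (rule someI)
    then obtain a where a: "a \<noteq> 0" "rep (pt v) = a *s v" unfolding mem_pt_minus_zero[OF v(1)] by blast
    show ?thesis
      unfolding \<phi>_def a(2)
      using F.coeff_scale[OF v a(1) u] B.homogeneous[OF v a(1) \<pi>J] a(1)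
      by (intro sum.cong) (auto simp: d power_int_minus)
  qed
  have \<phi>_sum: "\<phi> (pt v) (\<Sum>j\<in>J. smult F (z j) (b j v)) = (\<Sum>j\<in>J. smult B (z j) (b' (\<pi> j) v))"
    if v: "v \<noteq> 0" "pt v \<in> L" for v z
    unfolding \<phi>[OF v F.sum_in_fibre[OF v]]
    using F.coeff_eq[OF v refl] by (intro sum.cong) auto
  have reindex: "(\<Sum>j\<in>J. smult B (z j) (b' (\<pi> j) v)) = (\<Sum>j\<in>J'. smult B (z (inv_into J \<pi> j)) (b' j v))" for z v
    using \<pi> by (intro sum.reindex_bij_witness[of _ "inv_into J \<pi>" \<pi>])
      (auto simp: bij_betw_def inv_into_into inv_into_f_f f_inv_into_f)
  have "bundle_hom F B \<phi>"
    unfolding bundle_hom_def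
  proof (intro conjI ballI allI impI)
    show "base F = base B" by (simp add: F.base B.base)
  next
    fix x assume "x \<in> base F"
    then have x: "x \<in> L" by (simp add: F.base)
    obtain v where v: "v \<noteq> 0" "x = pt v" using x F.L proj_spaceE by blast
    show "\<phi> x ` fibre F x \<subseteq> fibre B x"
      using \<phi>[OF v(1)] x B.sum_in_fibre[OF v(1)] by (auto simp: v(2) reindex)
    fix u assume u: "u \<in> fibre F x"
    have sub: "F.subspace (fibre F x)" by (rule F.fibre_subspace[OF x])
    show "\<phi> x (smult F a u) = smult B a (\<phi> x u)" for a
      using \<phi>[OF v(1)] x u F.subspace_scale[OF sub u] F.coeff_smult[OF v(1)]
      by (simp add: v(2) B.scale_sum_right)
    fix w assume w: "w \<in> fibre F x"
    show "\<phi> x (u + w) = \<phi> x u + \<phi> x w"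
      using \<phi>[OF v(1)] x u w F.subspace_add[OF sub u w] F.coeff_add[OF v(1)]
      by (simp add: v(2) B.scale_left_distrib sum.distrib)
  next
    fix U s assume U: "zopen (base F) U" and s: "s \<in> sects F U"
    have U': "zopen L U" using U by (simp add: F.base)
    show "(\<lambda>x. \<phi> x (s x)) \<in> sects B U"
      unfolding B.sects[OF U']
    proof
      fix x assume x: "x \<in> U"
      have xL: "x \<in> L" using x zopen_subset[OF U'] by auto
      from s[unfolded F.sects[OF U'], THEN bspec, OF x] obtain f where f: "\<forall>j\<in>J. rat L (d j) (f j) x"
        "eventually (\<lambda>v. s (pt v) = (\<Sum>j\<in>J. smult F (f j v) (b j v))) (zn L x)" by (elim exE conjE) (rule that)
      have "eventually (\<lambda>v. \<phi> (pt v) (s (pt v)) = (\<Sum>j\<in>J'. smult B (f (inv_into J \<pi> j) v) (b' j v))) (zn L x)"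
        using f(2) eventually_zn_open[OF zopen_self[OF F.L] xL F.L]
        by eventually_elim (simp add: \<phi>_sum reindex)
      moreover have "\<forall>j\<in>J'. rat L (d' j) (f (inv_into J \<pi> j)) x"
      proof
        fix j assume "j \<in> J'"
        then have "inv_into J \<pi> j \<in> J" "\<pi> (inv_into J \<pi> j) = j"
          using \<pi> by (auto simp: bij_betw_def inv_into_into f_inv_into_f)
        then show "rat L (d' j) (f (inv_into J \<pi> j)) x" using f(1) d by metis
      qed
      ultimately show "\<exists>f. (\<forall>j\<in>J'. rat L (d' j) (f j) x) \<and>
        eventually (\<lambda>v. \<phi> (pt v) (s (pt v)) = (\<Sum>j\<in>J'. smult B (f j v) (b' j v))) (zn L x)"
        by (intro exI[of _ "\<lambda>j. f (inv_into J \<pi> j)"]) auto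
    qed
  qed
  then show ?thesis using \<phi>_sum by blast
qed

text \<open>Frames with the same degrees, up to a bijection of the indices, suffice for an
  isomorphism. All isomorphisms demanded of the constructed bundle come from here.\<close>

lemma framed_iso:
  assumes F: "framed F L J d b" and B: "framed B L J' d' b'"
    and \<pi>: "bij_betw \<pi> J J'" and d: "\<And>j. j \<in> J \<Longrightarrow> d' (\<pi> j) = d j"
  shows "bundle_iso F B"
proof -
  interpret F: framed F L J d b by (rule F)
  interpret B: framed B L J' d' b' by (rule B)
  obtain \<phi> where \<phi>: "bundle_hom F B \<phi>" "\<And>v z. v \<noteq> 0 \<Longrightarrow> pt v \<in> L \<Longrightarrow>
    \<phi> (pt v) (\<Sum>j\<in>J. smult F (z j) (b j v)) = (\<Sum>j\<in>J. smult B (z j) (b' (\<pi> j) v))"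
    using framed_hom[OF assms] by blast
  let ?\<rho> = "inv_into J \<pi>"
  have \<rho>: "bij_betw ?\<rho> J' J" by (rule bij_betw_inv_into[OF \<pi>])
  have \<pi>\<rho>: "\<pi> (?\<rho> j) = j" "?\<rho> j \<in> J" if "j \<in> J'" for j
    using \<pi> that by (auto simp: bij_betw_def inv_into_into f_inv_into_f)
  have \<rho>\<pi>: "?\<rho> (\<pi> j) = j" if "j \<in> J" for j
    using \<pi> that by (auto simp: bij_betw_def)
  have d': "d (?\<rho> j) = d' j" if "j \<in> J'" for j using d[OF \<pi>\<rho>(2)[OF that]] \<pi>\<rho>(1)[OF that] by simp
  obtain \<psi> where \<psi>: "bundle_hom B F \<psi>" "\<And>v z. v \<noteq> 0 \<Longrightarrow> pt v \<in> L \<Longrightarrow>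
    \<psi> (pt v) (\<Sum>j\<in>J'. smult B (z j) (b' j v)) = (\<Sum>j\<in>J'. smult F (z j) (b (?\<rho> j) v))"
    using framed_hom[OF B F \<rho> d'] by blast
  have re1: "(\<Sum>j\<in>J. smult B (z j) (b' (\<pi> j) v)) = (\<Sum>j\<in>J'. smult B (z (?\<rho> j)) (b' j v))" for z v
    using \<pi> \<pi>\<rho> \<rho>\<pi> by (intro sum.reindex_bij_witness[of _ ?\<rho> \<pi>]) (auto simp: bij_betw_def)
  have re2: "(\<Sum>j\<in>J'. smult F (z j) (b (?\<rho> j) v)) = (\<Sum>j\<in>J. smult F (z (\<pi> j)) (b j v))" for z v
    using \<pi> \<pi>\<rho> \<rho>\<pi> by (intro sum.reindex_bij_witness[of _ \<pi> ?\<rho>]) (auto simp: bij_betw_def)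
  have "\<psi> x (\<phi> x u) = u" if x: "x \<in> L" and u: "u \<in> fibre F x" for x u
  proof -
    obtain v where v: "v \<noteq> 0" "x = pt v" using x F.L proj_spaceE by blast
    obtain z where z: "u = (\<Sum>j\<in>J. smult F (z j) (b j v))" using F.fibre[OF v(1)] x u v(2) by auto
    show ?thesis unfolding z v(2)
      using \<phi>(2)[OF v(1)] \<psi>(2)[OF v(1)] x by (simp add: v(2) re1 re2 \<rho>\<pi>)
  qed
  moreover have "\<phi> x (\<psi> x w) = w" if x: "x \<in> L" and w: "w \<in> fibre B x" for x w
  proof -
    obtain v where v: "v \<noteq> 0" "x = pt v" using x F.L proj_spaceE by blast
    obtain z where z: "w = (\<Sum>j\<in>J'. smult B (z j) (b' j v))" using B.fibre[OF v(1)] x w v(2) by auto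
    show ?thesis unfolding z v(2)
      using \<phi>(2)[OF v(1)] \<psi>(2)[OF v(1)] x by (simp add: v(2) re1 re2 \<pi>\<rho>)
  qed
  ultimately show ?thesis
    unfolding bundle_iso_def using \<phi>(1) \<psi>(1) F.base by metis
qed

text \<open>The frame is carried over by the isomorphism. The hypotheses \<open>in_fibre\<close> and
  \<open>cong\<close> are there because the two homomorphisms are inverse to each other only on
  fibres: a section and its image under the round trip agree only over the open set
  \<open>U\<close>.\<close>

lemma framed_transport:
  assumes iso: "bundle_iso F B" and B: "framed B L J d b" and F: "vector_space (smult F)"
    and sub: "\<And>x. x \<in> L \<Longrightarrow> module.subspace (smult F) (fibre F x)"
    and in_fibre: "\<And>U s x. zopen L U \<Longrightarrow> s \<in> sects F U \<Longrightarrow> x \<in> U \<Longrightarrow> s x \<in> fibre F x"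
    and cong: "\<And>U s s'. zopen L U \<Longrightarrow> s \<in> sects F U \<Longrightarrow> (\<And>x. x \<in> U \<Longrightarrow> s' x = s x) \<Longrightarrow> s' \<in> sects F U"
  shows "\<exists>b'. framed F L J d b'"
proof -
  interpret F: vector_space "smult F" by (rule F)
  interpret B: framed B L J d b by (rule B)
  from iso obtain \<phi> \<psi> where \<phi>: "bundle_hom F B \<phi>" and \<psi>: "bundle_hom B F \<psi>"
    and inv': "\<forall>x\<in>base F. (\<forall>u\<in>fibre F x. \<psi> x (\<phi> x u) = u) \<and> (\<forall>w\<in>fibre B x. \<phi> x (\<psi> x w) = w)"
    unfolding bundle_iso_def by blast
  have base: "base F = L" using bundle_homD(1)[OF \<phi>] B.base by simp
  have inv: "\<And>x u. x \<in> L \<Longrightarrow> u \<in> fibre F x \<Longrightarrow> \<psi> x (\<phi> x u) = u"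
    "\<And>x w. x \<in> L \<Longrightarrow> w \<in> fibre B x \<Longrightarrow> \<phi> x (\<psi> x w) = w" using inv' base by auto
  define b' where "b' j v = \<psi> (pt v) (b j v)" for j v
  have lin: "\<psi> (pt v) (\<Sum>j\<in>J. smult B (z j) (b j v)) = (\<Sum>j\<in>J. smult F (z j) (b' j v))"
    if v: "v \<noteq> 0" "pt v \<in> L" for v z
    unfolding b'_def
    by (rule bundle_hom_sum[OF \<psi> _ B.vector_space_axioms F B.fibre_subspace[OF v(2)] B.b_in_fibre[OF v]])
       (simp add: B.base v)
  have lin': "\<phi> (pt v) (\<Sum>j\<in>J. smult F (z j) (b' j v)) = (\<Sum>j\<in>J. smult B (z j) (b j v))"
    if v: "v \<noteq> 0" "pt v \<in> L" for v z
    unfolding lin[OF v, symmetric] by (rule inv(2)[OF v(2) B.sum_in_fibre[OF v]])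
  have "framed F L J d b'"
  proof (unfold_locales, goal_cases)
    case 1 show ?case by (rule base)
  next
    case 2 show ?case by (rule B.L)
  next
    case 3 show ?case by (rule B.fin)
  next
    case (4 v)
    show ?case
    proof (intro set_eqI iffI)
      fix u assume u: "u \<in> fibre F (pt v)"
      then have "\<phi> (pt v) u \<in> fibre B (pt v)" using bundle_homD(2)[OF \<phi>] 4 base by simp
      then obtain z where "\<phi> (pt v) u = (\<Sum>j\<in>J. smult B (z j) (b j v))" using B.fibre[OF 4] by auto
      then have "u = (\<Sum>j\<in>J. smult F (z j) (b' j v))" using inv(1)[OF 4(2) u] lin[OF 4] by simp
      then show "u \<in> {\<Sum>j\<in>J. smult F (z j) (b' j v) | z. True}" by blast
    next
      fix u assume "u \<in> {\<Sum>j\<in>J. smult F (z j) (b' j v) | z. True}"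
      then obtain z where u: "u = (\<Sum>j\<in>J. smult F (z j) (b' j v))" by blast
      show "u \<in> fibre F (pt v)"
        unfolding u lin[OF 4, symmetric]
        using bundle_homD(2)[OF \<psi>] B.sum_in_fibre[OF 4] 4 B.base by simp
    qed
  next
    case (5 v z j)
    have "\<phi> (pt v) 0 = \<phi> (pt v) (\<Sum>j\<in>J. smult F 0 (b' j v))" by simp
    also have "\<dots> = (\<Sum>j\<in>J. smult B 0 (b j v))" by (rule lin'[OF 5(1,2)])
    finally have "\<phi> (pt v) 0 = 0" by simp
    then have "(\<Sum>j\<in>J. smult B (z j) (b j v)) = 0" using lin'[OF 5(1,2), of z] 5(3) by simp
    then show ?case using B.indep[OF 5(1,2)] 5(4) by blast
  next
    case (6 v a j)
    have "\<psi> (pt v) (smult B (a powi (- d j)) (b j v)) = smult F (a powi (- d j)) (\<psi> (pt v) (b j v))"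
      using \<psi> 6(2) B.b_in_fibre[OF 6(1,2,4)] B.base unfolding bundle_hom_def by blast
    then show ?case unfolding b'_def using B.homogeneous[OF 6] 6(3) by (simp add: pt_scale)
  next
    case (7 U s)
    have UB: "zopen (base B) U" and UF: "zopen (base F) U" using 7 by (simp_all add: B.base base)
    show ?case
    proof
      assume s: "s \<in> sects F U"
      have "(\<lambda>x. \<phi> x (s x)) \<in> sects B U" by (rule bundle_homD(3)[OF \<phi> UF s])
      note * = this[unfolded B.sects[OF 7]]
      show "\<forall>x\<in>U. \<exists>f. (\<forall>j\<in>J. rat L (d j) (f j) x) \<and>
        eventually (\<lambda>v. s (pt v) = (\<Sum>j\<in>J. smult F (f j v) (b' j v))) (zn L x)"
      proof
        fix x assume x: "x \<in> U"
        from *[THEN bspec, OF x] obtain f where f: "\<forall>j\<in>J. rat L (d j) (f j) x"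
          "eventually (\<lambda>v. \<phi> (pt v) (s (pt v)) = (\<Sum>j\<in>J. smult B (f j v) (b j v))) (zn L x)"
          by (elim exE conjE) (rule that)
        have "eventually (\<lambda>v. s (pt v) = (\<Sum>j\<in>J. smult F (f j v) (b' j v))) (zn L x)"
          using f(2) eventually_zn_open[OF 7 x B.L]
        proof eventually_elim
          case (elim v)
          then have "pt v \<in> L" using zopen_subset[OF 7] by auto
          then show ?case using elim lin inv(1)[OF _ in_fibre[OF 7 s]] by metis
        qed
        with f(1) show "\<exists>f. (\<forall>j\<in>J. rat L (d j) (f j) x) \<and>
          eventually (\<lambda>v. s (pt v) = (\<Sum>j\<in>J. smult F (f j v) (b' j v))) (zn L x)" by blast
      qed
    next
      assume r: "\<forall>x\<in>U. \<exists>f. (\<forall>j\<in>J. rat L (d j) (f j) x) \<and>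
        eventually (\<lambda>v. s (pt v) = (\<Sum>j\<in>J. smult F (f j v) (b' j v))) (zn L x)"
      have loc: "\<exists>f. (\<forall>j\<in>J. rat L (d j) (f j) x) \<and>
          eventually (\<lambda>v. \<phi> (pt v) (s (pt v)) = (\<Sum>j\<in>J. smult B (f j v) (b j v))) (zn L x) \<and> s x \<in> fibre F x"
        if x: "x \<in> U" for x
      proof -
        have xL: "x \<in> L" using x zopen_subset[OF 7] by auto
        obtain v where v: "v \<noteq> 0" "x = pt v" using xL B.L proj_spaceE by blast
        from r[THEN bspec, OF x] obtain f where f: "\<forall>j\<in>J. rat L (d j) (f j) x"
          "eventually (\<lambda>v. s (pt v) = (\<Sum>j\<in>J. smult F (f j v) (b' j v))) (zn L x)"
          by (elim exE conjE) (rule that)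
        have "eventually (\<lambda>v. \<phi> (pt v) (s (pt v)) = (\<Sum>j\<in>J. smult B (f j v) (b j v))) (zn L x)"
          using f(2) eventually_zn_open[OF zopen_self[OF B.L] xL B.L] by eventually_elim (simp add: lin')
        moreover have "s (pt v) = (\<Sum>j\<in>J. smult F (f j v) (b' j v))"
          using f(2) unfolding v(2) by (rule eventually_zn_at) (use B.L xL v in auto)
        then have "s x = \<psi> (pt v) (\<Sum>j\<in>J. smult B (f j v) (b j v))" using lin v xL by simp
        then have "s x \<in> fibre F x" using bundle_homD(2)[OF \<psi>] B.sum_in_fibre[OF v(1)] v xL B.base by simp
        ultimately show ?thesis using f(1) by blast
      qed
      have "(\<lambda>x. \<phi> x (s x)) \<in> sects B U" unfolding B.sects[OF 7] using loc by blast
      from bundle_homD(3)[OF \<psi> UB this] show "s \<in> sects F U"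
      proof (rule cong[OF 7])
        fix x assume x: "x \<in> U"
        then show "s x = \<psi> x (\<phi> x (s x))" using inv(1)[of x "s x"] loc[OF x] zopen_subset[OF 7] by auto
      qed
    qed
  qed
  then show ?thesis by blast
qed

text \<open>The fraction \<open>p / q\<close> is its own extension, to the open set where
  \<open>q\<close> has no zero; since \<open>p\<close> and \<open>q\<close> have equal degrees, it
  is a function of the point. It provides the extensions off \<open>L\<close> that the definition of
  a restricted bundle asks for.\<close>

lemma rat_degree_0_extends:
  assumes "rat L 0 h x" "L \<subseteq> X" "X \<subseteq> proj_space" "x \<in> L"
  shows "\<exists>W f. zopen X W \<and> x \<in> W \<and> (\<forall>y\<in>W. rat X 0 (\<lambda>v. f (pt v)) y) \<and>
    (\<forall>v. v \<noteq> 0 \<longrightarrow> pt v \<in> W \<inter> L \<longrightarrow> f (pt v) = h v)"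
proof -
  have L: "L \<subseteq> proj_space" using assms by auto
  from assms(1) obtain k l p q where *: "p \<in> forms k" "q \<in> forms l" "int k - int l = 0"
    "eventually (\<lambda>v. q v \<noteq> 0 \<and> h v = p v / q v) (zn L x)" by (rule ratE)
  have kl: "k = l" using *(3) by simp
  from *(4)[unfolded eventually_zn[OF L assms(4)]]
  obtain W where W: "zopen L W" "x \<in> W" "\<forall>y\<in>W. \<forall>v\<in>y - {0}. q v \<noteq> 0 \<and> h v = p v / q v"
    by (elim exE conjE) (rule that)
  obtain W1 where W1: "zopen X W1" "W = W1 \<inter> L" using zopen_extend[OF assms(2) W(1)] by blast
  let ?Q = "{x\<in>X. \<exists>v\<in>x - {0}. q v \<noteq> 0}"
  have Q: "zopen X ?Q" by (rule zopen_basis[OF *(2) assms(3)])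
  define rep where "rep y = (SOME v. v \<in> y - {0})" for y :: "('a ^ 'b) set"
  define f where "f y = p (rep y) / q (rep y)" for y
  have f: "f (pt v) = p v / q v" if v: "v \<noteq> 0" for v
  proof -
    have "v \<in> pt v - {0}" using v by simp
    then have "rep (pt v) \<in> pt v - {0}" unfolding rep_def by (rule someI)
    then obtain a where a: "a \<noteq> 0" "rep (pt v) = a *s v" unfolding mem_pt_minus_zero[OF v] by blast
    then show ?thesis by (simp add: f_def kl forms_homogeneous[OF *(1)] forms_homogeneous[OF *(2)])
  qed
  have "rat X 0 (\<lambda>v. f (pt v)) y" if y: "y \<in> W1 \<inter> ?Q" for y
  proof (rule ratI[OF *(1-3)])
    obtain v where v: "v \<in> y - {0}" "q v \<noteq> 0" "y \<in> X" using y by blast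
    have "v \<noteq> 0" "y = pt v" using v assms(3) proj_space_eq_pt by auto
    then have "eventually (\<lambda>v. q v \<noteq> 0) (zn X y)"
      using eventually_zn_nonzero[OF *(2) v(2) assms(3)] v(3) by simp
    then show "eventually (\<lambda>v. q v \<noteq> 0 \<and> f (pt v) = p v / q v) (zn X y)"
      using eventually_zn_open[OF zopen_self[OF assms(3)] v(3) assms(3)]
      by eventually_elim (simp add: f)
  qed
  moreover have "x \<in> W1 \<inter> ?Q"
  proof -
    obtain v where v: "v \<noteq> 0" "x = pt v" using assms(4) L proj_spaceE by blast
    then show ?thesis using W(2,3) W1(2) assms(2,4) by auto
  qed
  moreover have "f (pt v) = h v" if "v \<noteq> 0" "pt v \<in> (W1 \<inter> ?Q) \<inter> L" for v
    using that W(3) W1(2) by (auto simp: f)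
  ultimately show ?thesis using zopen_Int[OF W1(1) Q] by blast
qed

context vector_bundle begin

text \<open>Local triviality in the shape needed for elimination: families of coefficients in place
  of sets of basis vectors, and \<open>rat\<close> in place of
  \<open>regular_functions\<close>.\<close>

lemma local_frame:
  assumes "x \<in> base E"
  obtains U e where "zopen (base E) U" "x \<in> U"
    "\<And>y. y \<in> U \<Longrightarrow> fibre E y = {\<Sum>i<r. smult E (z i) (e i y) | z. True}"
    "\<And>y z i. y \<in> U \<Longrightarrow> (\<Sum>i<r. smult E (z i) (e i y)) = 0 \<Longrightarrow> i < r \<Longrightarrow> z i = 0"
    "\<And>V s. zopen (base E) V \<Longrightarrow> V \<subseteq> U \<Longrightarrow> s \<in> sects E V \<longleftrightarrow>
      (\<exists>f. (\<forall>i<r. \<forall>y\<in>V. rat (base E) 0 (\<lambda>v. f i (pt v)) y) \<and> (\<forall>y\<in>V. s y = (\<Sum>i<r. smult E (f i y) (e i y))))"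
proof -
  from locally_trivial[OF assms] obtain U e where U: "zopen (base E) U" "x \<in> U"
    and fr: "\<forall>y\<in>U. inj_on (\<lambda>i. e i y) {..<r} \<and> independent ((\<lambda>i. e i y) ` {..<r}) \<and>
          span ((\<lambda>i. e i y) ` {..<r}) = fibre E y"
    and se: "\<forall>V. zopen (base E) V \<longrightarrow> V \<subseteq> U \<longrightarrow>
          sects E V = {s. \<exists>f. (\<forall>i<r. f i \<in> regular_functions (base E) V) \<and>
            (\<forall>y\<in>V. s y = (\<Sum>i<r. smult E (f i y) (e i y)))}"
    by (elim exE conjE) (rule that)
  have 1: "fibre E y = {\<Sum>i<r. smult E (z i) (e i y) | z. True}" if y: "y \<in> U" for y
  proof -
    have inj: "inj_on (\<lambda>i. e i y) {..<r}" and sp: "fibre E y = span ((\<lambda>i. e i y) ` {..<r})" using fr y by auto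
    have "(\<Sum>w\<in>(\<lambda>i. e i y) ` {..<r}. smult E (g w) w) = (\<Sum>i<r. smult E (g (e i y)) (e i y))" for g
      using sum.reindex[OF inj] by (simp add: o_def)
    moreover have "\<exists>g. \<forall>i<r. g (e i y) = z i" for z :: "nat \<Rightarrow> 'k"
      by (rule exI[of _ "\<lambda>w. z (inv_into {..<r} (\<lambda>i. e i y) w)"]) (use inv_into_f_f[OF inj] in auto)
    then have "\<exists>g. (\<Sum>i<r. smult E (z i) (e i y)) = (\<Sum>i<r. smult E (g (e i y)) (e i y))" for z :: "nat \<Rightarrow> 'k"
      by (metis (no_types, lifting) lessThan_iff sum.cong)
    ultimately have "range (\<lambda>g. \<Sum>w\<in>(\<lambda>i. e i y) ` {..<r}. smult E (g w) w) = {\<Sum>i<r. smult E (z i) (e i y) | z. True}"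
      by (auto simp: image_def)
    then show ?thesis unfolding sp by (simp add: span_finite)
  qed
  have 2: "z i = 0" if y: "y \<in> U" and s: "(\<Sum>i<r. smult E (z i) (e i y)) = 0" and i: "i < r" for y z i
  proof -
    have inj: "inj_on (\<lambda>i. e i y) {..<r}" and ind: "independent ((\<lambda>i. e i y) ` {..<r})" using fr y by auto
    let ?g = "\<lambda>w. z (inv_into {..<r} (\<lambda>i. e i y) w)"
    have "(\<Sum>w\<in>(\<lambda>i. e i y) ` {..<r}. smult E (?g w) w) = (\<Sum>i<r. smult E (z i) (e i y))"
      using sum.reindex[OF inj, of "\<lambda>w. smult E (?g w) w"] inv_into_f_f[OF inj] by (simp add: o_def)
    then have "(\<Sum>w\<in>(\<lambda>i. e i y) ` {..<r}. smult E (?g w) w) = 0" using s by simp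
    from independentD[OF ind _ subset_refl this, of "e i y"] i inv_into_f_f[OF inj] show ?thesis by auto
  qed
  have 3: "s \<in> sects E V \<longleftrightarrow> (\<exists>f. (\<forall>i<r. \<forall>y\<in>V. rat (base E) 0 (\<lambda>v. f i (pt v)) y) \<and>
      (\<forall>y\<in>V. s y = (\<Sum>i<r. smult E (f i y) (e i y))))" if V: "zopen (base E) V" "V \<subseteq> U" for V s
    using se V regular_functions_iff[OF base_subset V(1)] by auto
  show thesis
    by (rule that[of U e, OF U]) (erule 1, erule (2) 2, erule (1) 3)
qed

lemma sects_in_fibre:
  assumes U: "zopen (base E) U" and s: "s \<in> sects E U" and x: "x \<in> U"
  shows "s x \<in> fibre E x"
proof -
  have "x \<in> base E" using zopen_subset[OF U] x by auto
  then obtain V e where V: "zopen (base E) V" "x \<in> V"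
    and f: "\<And>y. y \<in> V \<Longrightarrow> fibre E y = {\<Sum>i<r. smult E (z i) (e i y) | z. True}"
    and se: "\<And>W s. zopen (base E) W \<Longrightarrow> W \<subseteq> V \<Longrightarrow> s \<in> sects E W \<longleftrightarrow>
      (\<exists>f. (\<forall>i<r. \<forall>y\<in>W. rat (base E) 0 (\<lambda>v. f i (pt v)) y) \<and> (\<forall>y\<in>W. s y = (\<Sum>i<r. smult E (f i y) (e i y))))"
    by (rule local_frame) blast
  have W: "zopen (base E) (U \<inter> V)" using U V by (intro zopen_Int)
  have "s \<in> sects E (U \<inter> V)" by (rule sects_restrict[OF s U W]) auto
  then show ?thesis using se[OF W] f[OF V(2)] x V by auto
qed

lemma restrict_vector_space: "vector_space (smult (restrict_bundle L E))"
  by (simp add: restrict_bundle_def vector_space_axioms)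

lemma framed_restrict:
  assumes L: "L \<subseteq> base E" and iso: "bundle_iso (restrict_bundle L E) B" and B: "framed B L J d b"
  shows "\<exists>b'. framed (restrict_bundle L E) L J d b'"
proof (rule framed_transport[OF iso B restrict_vector_space])
  show "module.subspace (smult (restrict_bundle L E)) (fibre (restrict_bundle L E) x)" if "x \<in> L" for x
    using that L fibre_subspace by (auto simp: restrict_bundle_def)
  fix U s assume U: "zopen L U" and s: "s \<in> sects (restrict_bundle L E) U"
  then have s': "\<forall>x\<in>U. \<exists>W. \<exists>t\<in>sects E W. zopen (base E) W \<and> x \<in> W \<and> (\<forall>y\<in>W \<inter> U. s y = t y)"
    by (simp add: restrict_bundle_def)
  show "s x \<in> fibre (restrict_bundle L E) x" if x: "x \<in> U" for x
  proof -
    from s'[THEN bspec, OF x] obtain W t where "t \<in> sects E W" "zopen (base E) W" "x \<in> W" "\<forall>y\<in>W \<inter> U. s y = t y"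
      by (elim exE bexE conjE) (rule that)
    then show ?thesis using sects_in_fibre[of W t x] x by (simp add: restrict_bundle_def)
  qed
  fix s' assume "\<And>x. x \<in> U \<Longrightarrow> s' x = s x"
  then show "s' \<in> sects (restrict_bundle L E) U" using s' by (simp add: restrict_bundle_def)
qed

end

section \<open>Steiner bundles in coordinates\<close>

lemma framed_reindex:
  assumes F: "framed F L J d b" and \<pi>: "bij_betw \<pi> K J"
  shows "framed F L K (\<lambda>k. d (\<pi> k)) (\<lambda>k. b (\<pi> k))"
proof -
  interpret framed F L J d b by (rule F)
  have re: "(\<Sum>k\<in>K. g (\<pi> k)) = (\<Sum>j\<in>J. g j)" for g :: "_ \<Rightarrow> 'c" by (rule sum.reindex_bij_betw[OF \<pi>])
  let ?\<rho> = "inv_into K \<pi>"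
  have \<pi>\<rho>: "\<pi> (?\<rho> j) = j" "?\<rho> j \<in> K" if "j \<in> J" for j
    using \<pi> that by (auto simp: bij_betw_def inv_into_into f_inv_into_f)
  have \<rho>\<pi>: "?\<rho> (\<pi> k) = k" "\<pi> k \<in> J" if "k \<in> K" for k
    using \<pi> that by (auto simp: bij_betw_def)
  have re': "(\<Sum>k\<in>K. smult F (z k) (b (\<pi> k) v)) = (\<Sum>j\<in>J. smult F (z (?\<rho> j)) (b j v))" for z v
    using re[of "\<lambda>j. smult F (z (?\<rho> j)) (b j v)"] \<rho>\<pi> by simp
  show ?thesis
  proof (unfold_locales, goal_cases)
    case 1 show ?case by (rule base)
  next
    case 2 show ?case by (rule L)
  next
    case 3 show ?case using bij_betw_finite[OF \<pi>] fin by simp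
  next
    case (4 v)
    have "(\<exists>z. u = (\<Sum>k\<in>K. smult F (z k) (b (\<pi> k) v))) \<longleftrightarrow> (\<exists>z. u = (\<Sum>j\<in>J. smult F (z j) (b j v)))" for u
    proof
      assume "\<exists>z. u = (\<Sum>j\<in>J. smult F (z j) (b j v))"
      then obtain z where "u = (\<Sum>j\<in>J. smult F (z j) (b j v))" by blast
      then show "\<exists>z. u = (\<Sum>k\<in>K. smult F (z k) (b (\<pi> k) v))"
        using re[of "\<lambda>j. smult F (z j) (b j v)"] by (intro exI[of _ "\<lambda>k. z (\<pi> k)"]) simp
    qed (auto simp: re')
    then show ?case using fibre[OF 4] by auto
  next
    case (5 v z k)
    then show ?case using indep[OF 5(1,2), of "\<lambda>j. z (?\<rho> j)" "\<pi> k"] \<rho>\<pi>[of k] by (simp add: re')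
  next
    case (6 v a k)
    then show ?case using homogeneous[OF 6(1-3)] \<rho>\<pi> by simp
  next
    case (7 U s)
    show ?case unfolding sects[OF 7]
    proof (intro ball_cong refl iffI)
      fix x assume "\<exists>f. (\<forall>j\<in>J. rat L (d j) (f j) x) \<and> eventually (\<lambda>v. s (pt v) = (\<Sum>j\<in>J. smult F (f j v) (b j v))) (zn L x)"
      then obtain f where "\<forall>j\<in>J. rat L (d j) (f j) x" "eventually (\<lambda>v. s (pt v) = (\<Sum>j\<in>J. smult F (f j v) (b j v))) (zn L x)"
        by (elim exE conjE) (rule that)
      then show "\<exists>f. (\<forall>k\<in>K. rat L (d (\<pi> k)) (f k) x) \<and> eventually (\<lambda>v. s (pt v) = (\<Sum>k\<in>K. smult F (f k v) (b (\<pi> k) v))) (zn L x)"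
        using \<rho>\<pi> re[of "\<lambda>j. smult F (f j v) (b j v)" for v] by (intro exI[of _ "\<lambda>k. f (\<pi> k)"]) simp
    next
      fix x assume "\<exists>f. (\<forall>k\<in>K. rat L (d (\<pi> k)) (f k) x) \<and> eventually (\<lambda>v. s (pt v) = (\<Sum>k\<in>K. smult F (f k v) (b (\<pi> k) v))) (zn L x)"
      then obtain f where f: "\<forall>k\<in>K. rat L (d (\<pi> k)) (f k) x" "eventually (\<lambda>v. s (pt v) = (\<Sum>k\<in>K. smult F (f k v) (b (\<pi> k) v))) (zn L x)"
        by (elim exE conjE) (rule that)
      have "rat L (d j) (f (?\<rho> j)) x" if "j \<in> J" for j using f(1) \<pi>\<rho>[OF that] by metis
      then show "\<exists>f. (\<forall>j\<in>J. rat L (d j) (f j) x) \<and> eventually (\<lambda>v. s (pt v) = (\<Sum>j\<in>J. smult F (f j v) (b j v))) (zn L x)"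
        using f(2) by (intro exI[of _ "\<lambda>j. f (?\<rho> j)"]) (simp add: re')
    qed
  qed
qed

lemma framed_twist_sum:
  assumes "finite I" "X \<subseteq> proj_space"
  shows "\<exists>b. framed (bundle_sum X I (\<lambda>i. twist X (d i))) X I d b"
proof -
  have "framed (bundle_sum X I (\<lambda>i. twist X (d i))) X (Sigma I (\<lambda>_. {()})) (\<lambda>(i, j). d i)
    (\<lambda>(i, j) v i'. if i' = i then gen (d i) v 1 else 0)"
    using framed_sum[OF assms framed_twist[OF assms(2)] twist_smult_vector_space] .
  from framed_reindex[OF this, of "\<lambda>i. (i, ())" I] show ?thesis
    by (auto simp: bij_betw_def inj_on_def)
qed

lemma framed_twist_power: "X \<subseteq> proj_space \<Longrightarrow> \<exists>b. framed (twist_power X d m) X {..<m} (\<lambda>_. d) b"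
  unfolding twist_power_def by (rule framed_twist_sum) auto

lemma (in framed) rat_coeff:
  assumes U: "zopen L U" and s: "s \<in> sects F U" and x: "x \<in> U" and j: "j \<in> J"
  shows "rat L (d j) (\<lambda>v. coeff v (s (pt v)) j) x"
proof -
  have xL: "x \<in> L" using x zopen_subset[OF U] by auto
  from s[unfolded sects[OF U], THEN bspec, OF x] obtain f where f: "\<forall>j\<in>J. rat L (d j) (f j) x"
    "eventually (\<lambda>v. s (pt v) = (\<Sum>j\<in>J. smult F (f j v) (b j v))) (zn L x)" by (elim exE conjE) (rule that)
  show ?thesis
  proof (rule rat_cong)
    show "rat L (d j) (f j) x" using f(1) j by blast
    show "eventually (\<lambda>v. f j v = coeff v (s (pt v)) j) (zn L x)"
      using f(2) eventually_zn_open[OF zopen_self[OF L] xL L]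
    proof eventually_elim
      case (elim v)
      have "coeff v (s (pt v)) j = f j v" by (rule coeff_eq[OF _ _ _ j]) (use elim in auto)
      then show ?case by simp
    qed
  qed
qed

definition rep :: "('k::field ^ 'n::finite) set \<Rightarrow> 'k ^ 'n" where
  "rep y = (SOME v. v \<in> y - {0})"

lemma rep_pt: assumes "v \<noteq> 0" shows "\<exists>a. a \<noteq> 0 \<and> rep (pt v) = a *s v"
proof -
  have "v \<in> pt v - {0}" using assms by simp
  then have "rep (pt v) \<in> pt v - {0}" unfolding rep_def by (rule someI)
  then show ?thesis unfolding mem_pt_minus_zero[OF assms] .
qed

text \<open>If \<open>v\<close> and \<open>w\<close> are dependent, one is a multiple of the other
  and homogeneity alone suffices. The reduction is needed because arguments on the line through
  \<open>v\<close> and \<open>w\<close> presuppose independence.\<close>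

lemma homogeneous_additive:
  assumes hom: "\<And>a v. g (a *s v) = a * g v" and add: "\<And>v w. indep2 v w \<Longrightarrow> g (v + w) = g v + (g w :: 'k::field)"
  shows "g (v + w) = g v + g w"
proof (cases "indep2 v w")
  case False
  then obtain s t where st: "s *s v + t *s w = 0" "s \<noteq> 0 \<or> t \<noteq> 0" unfolding indep2_def by blast
  have multiple: "g (a + b) = g a + g b" if "p *s a + q *s b = 0" "p \<noteq> 0" for a b p q
  proof -
    have "a = (- q / p) *s b"
    proof -
      have "p *s a = (- q) *s b" using that(1) by (simp add: eq_neg_iff_add_eq_0)
      then have "(1 / p) *s (p *s a) = (1 / p) *s ((- q) *s b)" by simp
      then show ?thesis using that(2) by (simp del: vector_smult_lneg)
    qed
    then have a: "a = (- q / p) *s b" .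
    then have "a + b = (- q / p + 1) *s b" by (simp only: vector_sadd_rdistrib vector_smult_lid)
    then have "g (a + b) = (- q / p + 1) * g b" by (simp only: hom)
    also have "\<dots> = g a + g b" using a by (simp only: hom) (simp add: algebra_simps)
    finally show ?thesis .
  qed
  show ?thesis
  proof (cases "s = 0")
    case True
    then show ?thesis using multiple[of t w s v] st by (simp add: add.commute)
  next
    case False
    then show ?thesis using multiple[of s v t w] st by simp
  qed
qed (rule add)

text \<open>A Steiner bundle in coordinates: \<open>\<eta>\<close> embeds the fibre over \<open>pt v\<close> into \<open>k\<^sup>I\<close> as the kernel of
  the matrix \<open>a v\<close>, which depends linearly on \<open>v\<close>.\<close>

locale presented = vector_bundle E r
  for E :: "(('k::field ^ 'n::finite) set, 'k, 'v::ab_group_add) vbundle" and r :: nat +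
  fixes \<eta> :: "('k ^ 'n) set \<Rightarrow> 'v \<Rightarrow> nat \<Rightarrow> 'k" and a :: "nat \<Rightarrow> nat \<Rightarrow> 'k ^ 'n \<Rightarrow> 'k" and I :: "nat set" and c :: nat
  assumes base: "base E = proj_space" and fin: "finite I"
    and eta_add: "x \<in> proj_space \<Longrightarrow> u \<in> fibre E x \<Longrightarrow> w \<in> fibre E x \<Longrightarrow> i \<in> I \<Longrightarrow> \<eta> x (u + w) i = \<eta> x u i + \<eta> x w i"
    and eta_scale: "x \<in> proj_space \<Longrightarrow> u \<in> fibre E x \<Longrightarrow> i \<in> I \<Longrightarrow> \<eta> x (smult E t u) i = t * \<eta> x u i"
    and eta_inj: "x \<in> proj_space \<Longrightarrow> u \<in> fibre E x \<Longrightarrow> (\<forall>i\<in>I. \<eta> x u i = 0) \<Longrightarrow> u = 0"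
    and eta_kernel: "v \<noteq> 0 \<Longrightarrow> (\<exists>u\<in>fibre E (pt v). \<forall>i\<in>I. \<eta> (pt v) u i = y i) \<longleftrightarrow> (\<forall>j<c. (\<Sum>i\<in>I. a j i v * y i) = 0)"
    and eta_regular: "zopen proj_space U \<Longrightarrow> s \<in> sects E U \<Longrightarrow> x \<in> U \<Longrightarrow> i \<in> I \<Longrightarrow>
      rat proj_space 0 (\<lambda>v. \<eta> (pt v) (s (pt v)) i) x"
    and a_add: "j < c \<Longrightarrow> i \<in> I \<Longrightarrow> a j i (v + v') = a j i v + a j i v'"
    and a_scale: "j < c \<Longrightarrow> i \<in> I \<Longrightarrow> a j i (t *s v) = t * a j i v"
    and a_rows: "v \<noteq> 0 \<Longrightarrow> (\<forall>i\<in>I. (\<Sum>j<c. z j * a j i v) = 0) \<Longrightarrow> j < c \<Longrightarrow> z j = 0"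

text \<open>The matrix entries are the coefficients of the second map of the exact sequence on
  homogeneous frames of the two sums of twists. They are global sections of \<open>O(1)\<close>, and
  the argument on lines makes them linear; exactness gives the kernel condition and the independence
  of the rows.\<close>

lemma steiner_presented:
  fixes E :: "(('k::{alg_closed_field, field_char_0} ^ 'n::finite) set, 'k, 'v::ab_group_add) vbundle"
  assumes "steiner E r"
  shows "\<exists>\<eta> a m c. presented E r \<eta> a {..<m} c"
proof -
  let ?P = "proj_space :: ('k ^ 'n) set set"
  from assms obtain m c \<phi> \<psi> where E: "vector_bundle E r" and base: "base E = ?P"
    and ex: "short_exact E (twist_power ?P 0 m) (twist_power ?P 1 c) \<phi> \<psi>"
    unfolding steiner_def by blast
  let ?T0 = "twist_power ?P 0 m" and ?T1 = "twist_power ?P 1 c"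
  interpret E: vector_bundle E r by (rule E)
  from framed_twist_power[OF subset_refl] obtain bv where "framed ?T0 ?P {..<m} (\<lambda>_. 0) bv" by blast
  then interpret T0: framed ?T0 ?P "{..<m}" "\<lambda>_. 0" bv .
  from framed_twist_power[OF subset_refl] obtain cv where "framed ?T1 ?P {..<c} (\<lambda>_. 1) cv" by blast
  then interpret T1: framed ?T1 ?P "{..<c}" "\<lambda>_. 1" cv .
  have \<phi>: "bundle_hom E ?T0 \<phi>" and \<psi>: "bundle_hom ?T0 ?T1 \<psi>"
    and exact: "\<forall>x\<in>?P. inj_on (\<phi> x) (fibre E x) \<and>
       \<phi> x ` fibre E x = {u \<in> fibre ?T0 x. \<psi> x u = 0} \<and> \<psi> x ` fibre ?T0 x = fibre ?T1 x"
    using ex unfolding short_exact_def T0.base by blast+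
  define \<eta> where "\<eta> y u i = T0.coeff (rep y) (\<phi> y u) i" for y u i
  \<comment> \<open>The zero vector represents no point; the value \<open>0\<close> there makes the
    entries linear on the whole vector space.\<close>
  define a where "a j i v = (if v = 0 then 0 else T1.coeff v (\<psi> (pt v) (bv i v)) j)" for j i v
  have \<phi>_in: "\<phi> x u \<in> fibre ?T0 x" if "x \<in> ?P" "u \<in> fibre E x" for x u
    using bundle_homD(2)[OF \<phi>] that base by simp
  have \<psi>_in: "\<psi> x u \<in> fibre ?T1 x" if "x \<in> ?P" "u \<in> fibre ?T0 x" for x u
    using bundle_homD(2)[OF \<psi>] that T0.base by simp
  have \<phi>_lin: "\<phi> x (u + w) = \<phi> x u + \<phi> x w" "\<phi> x (smult E t u) = smult ?T0 t (\<phi> x u)"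
    if "x \<in> ?P" "u \<in> fibre E x" "w \<in> fibre E x" for x u w t
    using \<phi> that base unfolding bundle_hom_def by blast+
  have \<eta>: "\<eta> (pt v) u i = T0.coeff v (\<phi> (pt v) u) i" if v: "v \<noteq> 0" and u: "u \<in> fibre E (pt v)" and i: "i < m" for v u i
  proof -
    obtain t where t: "t \<noteq> 0" "rep (pt v) = t *s v" using rep_pt[OF v] by blast
    show ?thesis unfolding \<eta>_def t(2)
      using T0.coeff_scale[OF v _ t(1) \<phi>_in[OF _ u]] v i by simp
  qed
  have bv_scale: "bv i (t *s v) = bv i v" if "v \<noteq> 0" "t \<noteq> 0" "i < m" for v t i
    using T0.homogeneous[OF that(1) _ that(2)] that by simp
  have bv_in: "bv i v \<in> fibre ?T0 (pt v)" if "v \<noteq> 0" "i < m" for v i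
    using T0.b_in_fibre that by simp
  have \<psi>_sum: "\<psi> (pt v) (\<Sum>i<m. smult ?T0 (y i) (bv i v)) = (\<Sum>j<c. smult ?T1 (\<Sum>i<m. a j i v * y i) (cv j v))"
    if v: "v \<noteq> 0" for v y
  proof -
    have "\<psi> (pt v) (\<Sum>i<m. smult ?T0 (y i) (bv i v)) = (\<Sum>i<m. smult ?T1 (y i) (\<psi> (pt v) (bv i v)))"
      by (rule bundle_hom_sum[OF \<psi> _ T0.vector_space_axioms T1.vector_space_axioms T0.fibre_subspace])
        (use v bv_in T0.base in auto)
    also have "\<dots> = (\<Sum>i<m. smult ?T1 (y i) (\<Sum>j<c. smult ?T1 (a j i v) (cv j v)))"
      using T1.coeff_sum[OF v _ \<psi>_in[OF _ bv_in[OF v]]] v by (intro sum.cong) (auto simp: a_def)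
    also have "\<dots> = (\<Sum>i<m. \<Sum>j<c. smult ?T1 (a j i v * y i) (cv j v))"
      by (simp add: T1.scale_sum_right mult.commute)
    also have "\<dots> = (\<Sum>j<c. \<Sum>i<m. smult ?T1 (a j i v * y i) (cv j v))" by (rule sum.swap)
    finally show ?thesis by (simp add: T1.scale_sum_left)
  qed
  have a_hom: "a j i (t *s v) = t * a j i v" if "j < c" "i < m" for j i t v
  proof (cases "t = 0 \<or> v = 0")
    case True then show ?thesis by (auto simp: a_def)
  next
    case False
    then show ?thesis
      using T1.coeff_scale[of v t "\<psi> (pt v) (bv i v)" j] \<psi>_in[OF _ bv_in[of v i]] that
      by (simp add: a_def pt_scale bv_scale)
  qed
  \<comment> \<open>A frame vector of degree \<open>0\<close> is independent of the representative,
    so it is a global section; its image under \<open>\<psi>\<close> is a global section of a sum of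
    copies of \<open>O(1)\<close>.\<close>
  have a_rat: "rat ?P 1 (a j i) x" if "j < c" "i < m" "x \<in> ?P" for j i x
  proof -
    have op: "zopen ?P ?P" by (rule zopen_self) simp
    have bs: "bv i (rep (pt v)) = bv i v" if "v \<noteq> 0" for v
      using rep_pt[OF that] bv_scale[OF that] \<open>i < m\<close> by metis
    have "(\<lambda>y. bv i (rep y)) \<in> sects ?T0 ?P"
      unfolding T0.sects[OF op]
    proof
      fix y assume y: "y \<in> ?P"
      have "eventually (\<lambda>v. bv i (rep (pt v)) = (\<Sum>k<m. smult ?T0 (if k = i then 1 else 0) (bv k v))) (zn ?P y)"
        using eventually_zn_open[OF op y subset_refl]
      proof eventually_elim
        case (elim v)
        then show ?case using T0.b_as_sum[of i v] bs[of v] \<open>i < m\<close> by simp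
      qed
      then show "\<exists>f. (\<forall>k\<in>{..<m}. rat ?P 0 (f k) y) \<and>
          eventually (\<lambda>v. bv i (rep (pt v)) = (\<Sum>k<m. smult ?T0 (f k v) (bv k v))) (zn ?P y)"
        by (intro exI[of _ "\<lambda>k v. if k = i then 1 else 0"]) (simp add: rat_const)
    qed
    then have "(\<lambda>y. \<psi> y (bv i (rep y))) \<in> sects ?T1 ?P"
      using bundle_homD(3)[OF \<psi>] op T0.base by simp
    then have "rat ?P 1 (\<lambda>v. T1.coeff v (\<psi> (pt v) (bv i (rep (pt v)))) j) x"
      using T1.rat_coeff[OF op] that by simp
    then show ?thesis
    proof (rule rat_cong)
      show "eventually (\<lambda>v. T1.coeff v (\<psi> (pt v) (bv i (rep (pt v)))) j = a j i v) (zn ?P x)"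
        using eventually_zn_open[OF op that(3) subset_refl]
        by eventually_elim (simp add: a_def bs)
    qed
  qed
  have "presented E r \<eta> a {..<m} c"
  proof (unfold_locales, goal_cases)
    case 1 show ?case by (rule base)
  next
    case 2 show ?case by simp
  next
    case (3 x u w i)
    obtain v where v: "v \<noteq> 0" "x = pt v" using 3(1) proj_spaceE by blast
    have "u + w \<in> fibre E (pt v)" using E.subspace_add[OF E.fibre_subspace] 3 base v by simp
    then show ?case using 3 v \<eta> \<phi>_lin \<phi>_in T0.coeff_add[OF v(1)] by simp
  next
    case (4 x u i t)
    obtain v where v: "v \<noteq> 0" "x = pt v" using 4(1) proj_spaceE by blast
    have "smult E t u \<in> fibre E (pt v)" using E.subspace_scale[OF E.fibre_subspace] 4 base v by simp
    then show ?case using 4 v \<eta> \<phi>_lin \<phi>_in T0.coeff_smult[OF v(1)] by simp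
  next
    case (5 x u)
    obtain v where v: "v \<noteq> 0" "x = pt v" using 5(1) proj_spaceE by blast
    have "\<phi> x u = (\<Sum>i<m. smult ?T0 (T0.coeff v (\<phi> x u) i) (bv i v))"
      using T0.coeff_sum[OF v(1)] \<phi>_in[OF 5(1,2)] v 5(1) by simp
    also have "\<dots> = 0" using 5 \<eta>[OF v(1)] v by (intro sum.neutral) auto
    finally have "\<phi> x u = 0" .
    moreover have 0: "0 \<in> fibre E x" using E.subspace_0[OF E.fibre_subspace] 5 base by simp
    moreover have "\<phi> x 0 = 0" using \<phi>_lin(1)[OF 5(1) 0 0] by simp
    ultimately show ?case using exact 5 by (metis inj_onD)
  next
    case (6 v y)
    have v: "pt v \<in> ?P" using 6 by simp
    let ?h = "\<Sum>i<m. smult ?T0 (y i) (bv i v)"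
    have h: "?h \<in> fibre ?T0 (pt v)" using T0.sum_in_fibre[OF 6 v] by simp
    have "(\<exists>u\<in>fibre E (pt v). \<forall>i<m. \<eta> (pt v) u i = y i) \<longleftrightarrow> (\<exists>u\<in>fibre E (pt v). \<phi> (pt v) u = ?h)"
    proof (intro bex_cong refl iffI)
      fix u assume u: "u \<in> fibre E (pt v)"
      { assume "\<forall>i<m. \<eta> (pt v) u i = y i"
        then show "\<phi> (pt v) u = ?h"
          using T0.coeff_sum[OF 6 v \<phi>_in[OF v u]] \<eta>[OF 6 u] by simp }
      { assume "\<phi> (pt v) u = ?h"
        then show "\<forall>i<m. \<eta> (pt v) u i = y i" using \<eta>[OF 6 u] T0.coeff_eq[OF 6 v] by simp }
    qed
    also have "\<dots> \<longleftrightarrow> ?h \<in> \<phi> (pt v) ` fibre E (pt v)"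
      unfolding image_iff by (rule bex_cong[OF refl], rule eq_commute)
    also have "\<dots> \<longleftrightarrow> \<psi> (pt v) ?h = 0"
    proof -
      have "\<phi> (pt v) ` fibre E (pt v) = {u \<in> fibre ?T0 (pt v). \<psi> (pt v) u = 0}" using exact v by blast
      then show ?thesis using h by simp
    qed
    also have "\<dots> \<longleftrightarrow> (\<forall>j<c. (\<Sum>i<m. a j i v * y i) = 0)"
      unfolding \<psi>_sum[OF 6] using T1.indep[OF 6 v] by auto
    finally show ?case by (simp add: Ball_def)
  next
    case (7 U s x i)
    have "(\<lambda>x. \<phi> x (s x)) \<in> sects ?T0 U" using bundle_homD(3)[OF \<phi>] 7 base by simp
    then have "rat ?P 0 (\<lambda>v. T0.coeff v (\<phi> (pt v) (s (pt v))) i) x"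
      using T0.rat_coeff[OF 7(1)] 7 by simp
    then show ?case
    proof (rule rat_cong)
      show "eventually (\<lambda>v. T0.coeff v (\<phi> (pt v) (s (pt v))) i = \<eta> (pt v) (s (pt v)) i) (zn ?P x)"
        using eventually_zn_open[OF 7(1,3) subset_refl]
      proof eventually_elim
        case (elim v)
        then show ?case using \<eta>[of v "s (pt v)" i] E.sects_in_fibre[of U s "pt v"] 7 base by simp
      qed
    qed
  next
    case (8 j i v w)
    show ?case
    proof (rule homogeneous_additive)
      show "a j i (t *s v) = t * a j i v" for t v using a_hom 8 by simp
      fix v w :: "'k ^ 'n" assume vw: "indep2 v w"
      have nz: "s *s v + t *s w \<noteq> 0" if "s \<noteq> 0 \<or> t \<noteq> 0" for s t using indep2D[OF vw] that by auto
      \<comment> \<open>On the line through \<open>v\<close> and \<open>w\<close> the entry is a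
        global section of \<open>O(1)\<close>, hence affine along it.\<close>
      have "a j i (v + 1 *s w) = a j i v + 1 * a j i w"
        using 8 by (intro global_form_degree_1[OF vw subset_refl])
          (assumption | rule pt_in_proj_space nz a_rat a_hom | simp)+
      then show "a j i (v + w) = a j i v + a j i w" by simp
    qed
  next
    case (9 j i t v) then show ?case using a_hom by simp
  next
    case (10 v z j)
    have v: "pt v \<in> ?P" using 10 by simp
    have "cv j v \<in> fibre ?T1 (pt v)" using T1.b_in_fibre[OF 10(1) v] 10 by simp
    moreover have "fibre ?T1 (pt v) = \<psi> (pt v) ` fibre ?T0 (pt v)" using exact v by blast
    ultimately obtain u where u: "u \<in> fibre ?T0 (pt v)" "\<psi> (pt v) u = cv j v" by auto
    \<comment> \<open>\<open>y\<close> is a preimage of the unit vector \<open>j\<close> under the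
      matrix at \<open>v\<close>; pairing the relation among the rows with \<open>y\<close> isolates
      \<open>z j\<close>.\<close>
    obtain y where y: "u = (\<Sum>i<m. smult ?T0 (y i) (bv i v))" using T0.fibre[OF 10(1) v] u(1) by auto
    have sums: "(\<Sum>k<c. smult ?T1 (\<Sum>i<m. a k i v * y i) (cv k v)) = (\<Sum>k<c. smult ?T1 (if k = j then 1 else 0) (cv k v))"
      using \<psi>_sum[OF 10(1), of y] u(2) y T1.b_as_sum[of j v] 10 by simp
    have *: "(\<Sum>i<m. a k i v * y i) = (if k = j then 1 else 0)" if "k < c" for k
      by (rule T1.coeff_unique[OF 10(1) v sums]) (simp add: that)
    have "z j = (\<Sum>k<c. z k * (if k = j then 1 else 0))" using 10 by (simp add: if_distrib cong: if_cong)
    also have "\<dots> = (\<Sum>k<c. z k * (\<Sum>i<m. a k i v * y i))" using * by (intro sum.cong) auto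
    also have "\<dots> = (\<Sum>k<c. \<Sum>i<m. z k * a k i v * y i)" by (simp add: sum_distrib_left mult.assoc)
    also have "\<dots> = (\<Sum>i<m. (\<Sum>k<c. z k * a k i v) * y i)" by (subst sum.swap) (simp add: sum_distrib_right)
    also have "\<dots> = 0" using 10 by (intro sum.neutral) auto
    finally show ?case .
  qed
  then show ?thesis by blast
qed

section \<open>Restriction to lines\<close>

text \<open>Given by the parameters that the polynomial arguments use; \<open>line_eq\<close>
  recovers the description by a two-dimensional subspace.\<close>

definition line :: "'k::field ^ 'n::finite \<Rightarrow> 'k ^ 'n \<Rightarrow> ('k ^ 'n) set set" where
  "line v w = {pt (s *s v + t *s w) | s t. s \<noteq> 0 \<or> t \<noteq> 0}"

lemma line_nonzero: "indep2 v w \<Longrightarrow> s \<noteq> 0 \<or> t \<noteq> 0 \<Longrightarrow> s *s v + t *s w \<noteq> 0"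
  using indep2D by blast

lemma line_subset: "indep2 v w \<Longrightarrow> line v w \<subseteq> proj_space"
  unfolding line_def using pt_in_proj_space line_nonzero by blast

lemma pt_in_line: "s \<noteq> 0 \<or> t \<noteq> 0 \<Longrightarrow> pt (s *s v + t *s w) \<in> line v w"
  unfolding line_def by blast

lemma line_rep:
  assumes vw: "indep2 v w" and u: "u \<noteq> 0" "pt u \<in> line v w"
  shows "\<exists>s t. (s \<noteq> 0 \<or> t \<noteq> 0) \<and> u = s *s v + t *s w"
proof -
  obtain s t where st: "s \<noteq> 0 \<or> t \<noteq> 0" "pt u = pt (s *s v + t *s w)" using u(2) unfolding line_def by blast
  have "u \<in> pt (s *s v + t *s w) - {0}" using st(2) u(1) self_in_pt by blast
  then obtain c where c: "c \<noteq> 0" "u = c *s (s *s v + t *s w)"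
    unfolding mem_pt_minus_zero[OF line_nonzero[OF vw st(1)]] by blast
  then have "u = (c * s) *s v + (c * t) *s w" by (simp add: vector_add_ldistrib)
  moreover have "c * s \<noteq> 0 \<or> c * t \<noteq> 0" using c st by simp
  ultimately show ?thesis by blast
qed

lemma span_pair: "vec.span {v, w} = {s *s v + t *s w | s t. True}"
  by (auto simp: vec.span_insert vec.span_singleton) (metis add_diff_cancel_left' diff_add_cancel)+

lemma line_eq: 
  assumes vw: "indep2 v w" shows "line v w = {x \<in> proj_space. x \<subseteq> vec.span {v, w}}"
proof (intro set_eqI iffI)
  fix x assume "x \<in> line v w"
  then obtain s t where st: "s \<noteq> 0 \<or> t \<noteq> 0" "x = pt (s *s v + t *s w)" unfolding line_def by blast
  have "s *s v + t *s w \<in> vec.span {v, w}" unfolding span_pair by blast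
  then have "x \<subseteq> vec.span {v, w}" unfolding st(2) pt_def by (intro vec.span_minimal) auto
  then show "x \<in> {x \<in> proj_space. x \<subseteq> vec.span {v, w}}" using st line_nonzero[OF vw st(1)] by simp
next
  fix x assume x: "x \<in> {x \<in> proj_space. x \<subseteq> vec.span {v, w}}"
  then obtain u where u: "u \<noteq> 0" "x = pt u" using proj_spaceE by blast
  then have "u \<in> vec.span {v, w}" using x self_in_pt by blast
  then obtain s t where st: "u = s *s v + t *s w" unfolding span_pair by blast
  then have "s \<noteq> 0 \<or> t \<noteq> 0" using u(1) by auto
  then show "x \<in> line v w" using u st pt_in_line by blast
qed

lemma indep2_independent: "indep2 v w \<longleftrightarrow> v \<noteq> w \<and> vec.independent {v, w}"
proof
  assume vw: "indep2 v w"
  have "v \<noteq> w" using indep2D[OF vw, of 1 "-1"] by auto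
  moreover have "w \<notin> vec.span {}" using indep2_nonzero[OF vw] by simp
  moreover have "v \<notin> vec.span {w}"
  proof
    assume "v \<in> vec.span {w}"
    then obtain k where "v = k *s w" by (auto simp: vec.span_singleton)
    then show False using indep2D[OF vw, of 1 "-k"] by simp
  qed
  ultimately show "v \<noteq> w \<and> vec.independent {v, w}" by (simp add: vec.independent_insert)
next
  assume a: "v \<noteq> w \<and> vec.independent {v, w}"
  show "indep2 v w"
    unfolding indep2_def
  proof (intro allI impI)
    fix s t assume 0: "s *s v + t *s w = 0"
    let ?g = "\<lambda>x. if x = v then s else t"
    from a have ne: "v \<noteq> w" "w \<noteq> v" by auto
    have "(\<Sum>x\<in>{v, w}. ?g x *s x) = 0" using ne 0 by simp
    then have "?g v = 0" "?g w = 0"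
      using vec.independentD[of "{v, w}" "{v, w}" ?g] a by blast+
    then show "s = 0 \<and> t = 0" using a by auto
  qed
qed

lemma line_in_proj_lines: assumes "indep2 v w" shows "line v w \<in> proj_lines"
proof -
  have "vec.dim (vec.span {v, w}) = card {v, w}"
    using assms by (intro vec.dim_span_eq_card_independent) (simp add: indep2_independent)
  then have "vec.dim (vec.span {v, w}) = 2" using assms by (simp add: indep2_independent)
  then show ?thesis unfolding proj_lines_def line_eq[OF assms] using vec.subspace_span by blast
qed

lemma proj_lines_line: assumes "L \<in> proj_lines" shows "\<exists>v w. indep2 v w \<and> L = line v w"
proof -
  obtain S where S: "L = {x \<in> proj_space. x \<subseteq> S}" "vec.subspace S" "vec.dim S = 2"
    using assms unfolding proj_lines_def by blast
  obtain B where B: "B \<subseteq> S" "vec.independent B" "S \<subseteq> vec.span B" "card B = vec.dim S"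
    using vec.basis_exists by blast
  obtain v w where vw: "B = {v, w}" "v \<noteq> w" using B(4) S(3) by (auto simp: card_2_iff)
  have "indep2 v w" using B(2) vw by (simp add: indep2_independent)
  moreover have "S = vec.span {v, w}" using B S vw vec.span_minimal by blast
  ultimately show ?thesis using S(1) line_eq by blast
qed

text \<open>The key vanishing statement: a constant vector has no coefficients of negative degree, because
  \<open>O(-1)\<close> has no sections on a line.\<close>

lemma constant_coefficients:
  fixes m :: "'j \<Rightarrow> 'i \<Rightarrow> ('k::{alg_closed_field, field_char_0} ^ 'n::finite) \<Rightarrow> 'k"
  assumes vw: "indep2 v w" and J: "finite J"
    and rat: "\<And>j i x. j \<in> J \<Longrightarrow> i \<in> I \<Longrightarrow> x \<in> line v w \<Longrightarrow> rat (line v w) (d j) (m j i) x"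
    and indep: "\<And>u z. u \<noteq> 0 \<Longrightarrow> pt u \<in> line v w \<Longrightarrow> (\<forall>i\<in>I. (\<Sum>j\<in>J. z j * m j i u) = 0) \<Longrightarrow> (\<forall>j\<in>J. z j = 0)"
    and ex: "\<And>u. u \<noteq> 0 \<Longrightarrow> pt u \<in> line v w \<Longrightarrow> \<exists>z. \<forall>i\<in>I. (\<Sum>j\<in>J. z j * m j i u) = g i"
    and z: "\<forall>i\<in>I. (\<Sum>j\<in>J. z j * m j i v) = g i" and j: "j \<in> J" "d j = 1"
  shows "z j = 0"
proof -
  let ?L = "line v w"
  have L: "?L \<subseteq> proj_space" by (rule line_subset[OF vw])
  define f where "f u = (SOME z. \<forall>i\<in>I. (\<Sum>j\<in>J. z j * m j i u) = g i)" for u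
  have f: "\<forall>i\<in>I. (\<Sum>j\<in>J. f u j * m j i u) = g i" if "u \<noteq> 0" "pt u \<in> ?L" for u
    unfolding f_def by (rule someI_ex[OF ex[OF that]])
  have uni: "\<forall>j\<in>J. y j = f u j" if u: "u \<noteq> 0" "pt u \<in> ?L" and y: "\<forall>i\<in>I. (\<Sum>j\<in>J. y j * m j i u) = g i" for u y
  proof -
    have "\<forall>i\<in>I. (\<Sum>j\<in>J. (y j - f u j) * m j i u) = 0"
      using y f[OF u] by (simp add: left_diff_distrib sum_subtractf)
    from indep[OF u this] show ?thesis by simp
  qed
  \<comment> \<open>Independence forces the pointwise choice \<open>f\<close>, so
    \<open>coefficients_rat\<close> applies: constants have degree \<open>0\<close> and the entries
    degree \<open>d j\<close>, which leaves degree \<open>-1\<close> for the coefficient in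
    question.\<close>
  have rat_f: "rat ?L (0 - d j) (\<lambda>u. f u j) (pt u)" if u: "u \<noteq> 0" "pt u \<in> ?L" for u
  proof -
    have "\<forall>j\<in>J. rat ?L (0 - d j) (\<lambda>u. f u j) (pt u)"
    proof (rule coefficients_rat[OF J L u(2,1)])
      show "rat ?L (d j) (m j i) (pt u)" if "j \<in> J" "i \<in> I" for j i by (rule rat[OF that u(2)])
      show "rat ?L 0 (\<lambda>_. g i) (pt u)" for i by (rule rat_const)
      show "eventually (\<lambda>v. \<forall>i\<in>I. (\<Sum>j\<in>J. f v j * m j i v) = g i) (zn ?L (pt u))"
        using eventually_zn_open[OF zopen_self[OF L] u(2) L] by eventually_elim (use f in blast)
      show "\<forall>j\<in>J. z j = 0" if "\<forall>i\<in>I. (\<Sum>j\<in>J. z j * m j i u) = 0" for z by (rule indep[OF u that])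
    qed
    then show ?thesis using j by blast
  qed
  have "f v j = 0"
  proof (rule global_form_negative[OF vw L, where g = "\<lambda>u. f u j"])
    fix s t :: 'k assume st: "s \<noteq> 0 \<or> t \<noteq> 0"
    note u = line_nonzero[OF vw st] pt_in_line[OF st, of v w]
    show "pt (s *s v + t *s w) \<in> ?L" by (rule u)
    show "rat ?L (- 1) (\<lambda>u. f u j) (pt (s *s v + t *s w))" using rat_f[OF u] j by simp
    fix a :: 'k assume a: "a \<noteq> 0"
    show "f (a *s (s *s v + t *s w)) j = a powi - 1 * f (s *s v + t *s w) j"
      using rat_homogeneous[OF rat_f[OF u] L u(2,1) a] j by simp
  qed
  moreover have "v \<noteq> 0" "pt v \<in> ?L" using indep2_nonzero[OF vw] pt_in_line[of 1 0 v w] by auto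
  ultimately show ?thesis using uni[of v z] z j by simp
qed

text \<open>If \<open>B\<close> were larger, the matrix of coordinates of the \<open>f b\<close>
  would have a nontrivial kernel by \<open>underdetermined\<close>, which is a forbidden relation.
  It compares ranks of two frames at a single point.\<close>

lemma card_le_of_span:
  assumes "vector_space sc" "finite A" "finite B"
    and f: "\<And>b. b \<in> B \<Longrightarrow> \<exists>z. f b = (\<Sum>i\<in>A. sc (z i) (e i))"
    and indep: "\<And>z. (\<Sum>b\<in>B. sc (z b) (f b)) = 0 \<Longrightarrow> (\<forall>b\<in>B. z b = 0)"
  shows "card B \<le> card A"
proof (rule ccontr)
  interpret vector_space sc by (rule assms(1))
  assume "\<not> ?thesis"
  then have less: "card A < card B" by simp
  have "\<forall>b\<in>B. \<exists>z. f b = (\<Sum>i\<in>A. sc (z i) (e i))" using f by blast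
  from bchoice[OF this] obtain T where T: "\<forall>b\<in>B. f b = (\<Sum>i\<in>A. sc (T b i) (e i))" by (elim exE) (rule that)
  obtain y where y: "\<exists>b\<in>B. y b \<noteq> 0" "\<forall>i\<in>A. (\<Sum>b\<in>B. T b i * y b) = 0"
    using underdetermined[OF assms(2,3) less, of "\<lambda>i b. T b i"] by blast
  have "(\<Sum>b\<in>B. sc (y b) (f b)) = (\<Sum>b\<in>B. \<Sum>i\<in>A. sc (T b i * y b) (e i))"
    using T by (intro sum.cong) (auto simp: scale_sum_right mult.commute)
  also have "\<dots> = (\<Sum>i\<in>A. sc (\<Sum>b\<in>B. T b i * y b) (e i))"
    by (subst sum.swap) (simp add: scale_sum_left)
  also have "\<dots> = 0" using y by (intro sum.neutral) auto
  finally show False using indep y(1) by blast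
qed

text \<open>Regularity statements about \<open>E\<close> concern sections over open sets of its
  base. A frame vector of the restriction is therefore multiplied by a coordinate power, which makes
  it a section over part of \<open>L\<close>, and then extended off \<open>L\<close>.\<close>

lemma (in vector_bundle) restrict_local_section:
  assumes fr: "framed (restrict_bundle L E) L J d b" and L: "L \<subseteq> base E" and x: "x \<in> L" and j: "j \<in> J"
  shows "\<exists>W t i. zopen (base E) W \<and> x \<in> W \<and> t \<in> sects E W \<and>
    (\<forall>u. u \<noteq> 0 \<longrightarrow> pt u \<in> W \<inter> L \<longrightarrow> u $ i \<noteq> 0 \<and> t (pt u) = smult E ((u $ i) powi (d j)) (b j u))"
proof -
  interpret fr: framed "restrict_bundle L E" L J d b by (rule fr)
  obtain U s i where U: "zopen L U" "x \<in> U" "s \<in> sects (restrict_bundle L E) U"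
    and s: "\<And>v. v \<noteq> 0 \<Longrightarrow> pt v \<in> U \<Longrightarrow> v $ i \<noteq> 0 \<and> s (pt v) = smult (restrict_bundle L E) ((v $ i) powi (d j)) (b j v)"
    by (rule fr.local_section[OF x j]) blast
  have "\<forall>x\<in>U. \<exists>W. \<exists>t\<in>sects E W. zopen (base E) W \<and> x \<in> W \<and> (\<forall>y\<in>W \<inter> U. s y = t y)"
    using U(3) by (simp add: restrict_bundle_def)
  from this[THEN bspec, OF U(2)] obtain W t where W: "t \<in> sects E W" "zopen (base E) W" "x \<in> W" "\<forall>y\<in>W \<inter> U. s y = t y"
    by (elim exE bexE conjE) (rule that)
  obtain V where V: "zopen (base E) V" "U = V \<inter> L" using zopen_extend[OF L U(1)] by blast
  have WV: "zopen (base E) (W \<inter> V)" by (rule zopen_Int[OF W(2) V(1)])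
  have "t \<in> sects E (W \<inter> V)" by (rule sects_restrict[OF W(1,2) WV]) auto
  moreover have "u $ i \<noteq> 0 \<and> t (pt u) = smult E ((u $ i) powi (d j)) (b j u)"
    if "u \<noteq> 0" "pt u \<in> (W \<inter> V) \<inter> L" for u
    using s[of u] W(4) V(2) that by (auto simp: restrict_bundle_def)
  moreover have "x \<in> W \<inter> V" using W V U by auto
  ultimately show ?thesis using WV by blast
qed

lemma (in vector_bundle) framed_restrict_card:
  assumes fr: "framed (restrict_bundle L E) L J d b" and L: "L \<subseteq> base E" "L \<noteq> {}"
  shows "card J = r"
proof -
  interpret fr: framed "restrict_bundle L E" L J d b by (rule fr)
  obtain x where x: "x \<in> L" using L by blast
  obtain v where v: "v \<noteq> 0" "x = pt v" using x fr.L proj_spaceE by blast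
  have vL: "pt v \<in> L" using x v by simp
  have "x \<in> base E" using x L by auto
  then obtain U e where U: "x \<in> U" and e: "\<And>y. y \<in> U \<Longrightarrow> fibre E y = {\<Sum>i<r. smult E (z i) (e i y) | z. True}"
    "\<And>y z i. y \<in> U \<Longrightarrow> (\<Sum>i<r. smult E (z i) (e i y)) = 0 \<Longrightarrow> i < r \<Longrightarrow> z i = 0"
    by (rule local_frame) blast
  have sm: "smult (restrict_bundle L E) = smult E" "fibre (restrict_bundle L E) = fibre E"
    by (simp_all add: restrict_bundle_def)
  have f: "fibre E x = {\<Sum>j\<in>J. smult E (z j) (b j v) | z. True}" using fr.fibre[OF v(1) vL] v(2) sm by simp
  have "card J \<le> card {..<r}"
  proof (rule card_le_of_span[OF vector_space_axioms _ fr.fin])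
    show "\<exists>z. b j v = (\<Sum>i<r. smult E (z i) (e i x))" if "j \<in> J" for j
      using fr.b_in_fibre[OF v(1) vL that] e(1)[OF U] v(2) sm by auto
    show "\<forall>j\<in>J. z j = 0" if "(\<Sum>j\<in>J. smult E (z j) (b j v)) = 0" for z
      using fr.indep[OF v(1) vL, of z] that sm by simp
  qed simp
  moreover have "card {..<r} \<le> card J"
  proof (rule card_le_of_span[OF vector_space_axioms fr.fin])
    show "\<exists>z. e i x = (\<Sum>j\<in>J. smult E (z j) (b j v))" if "i \<in> {..<r}" for i
    proof -
      have "e i x = (\<Sum>k<r. smult E (if k = i then 1 else 0) (e k x))"
        using that by (simp add: if_distrib[of "\<lambda>x. smult E x _"] cong: if_cong)
      then have "e i x \<in> fibre E x"
        unfolding e(1)[OF U] by (intro CollectI exI[of _ "\<lambda>k. if k = i then 1 else 0"]) simp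
      then show ?thesis unfolding f by blast
    qed
    show "\<forall>i\<in>{..<r}. z i = 0" if "(\<Sum>i<r. smult E (z i) (e i x)) = 0" for z
      using e(2)[OF U that] by simp
  qed simp
  ultimately show ?thesis by simp
qed

context presented begin

lemma eta_zero: "x \<in> proj_space \<Longrightarrow> i \<in> I \<Longrightarrow> \<eta> x 0 i = 0"
  using eta_scale[of x 0 i 0] subspace_0[OF fibre_subspace] base by simp

lemma eta_sum:
  assumes "x \<in> proj_space" "\<And>j. j \<in> A \<Longrightarrow> u j \<in> fibre E x" "i \<in> I"
  shows "\<eta> x (\<Sum>j\<in>A. smult E (z j) (u j)) i = (\<Sum>j\<in>A. z j * \<eta> x (u j) i)"
  using assms(2)
proof (induction A rule: infinite_finite_induct)
  case (insert j A)
  have sub: "subspace (fibre E x)" using fibre_subspace assms(1) base by simp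
  have "(\<Sum>j\<in>A. smult E (z j) (u j)) \<in> fibre E x"
    using insert.prems by (intro subspace_sum[OF sub] subspace_scale[OF sub]) auto
  then show ?case using insert assms(1,3) by (simp add: eta_add eta_scale subspace_scale[OF sub])
qed (auto simp: eta_zero assms)

lemma eta_eq: 
  assumes "x \<in> proj_space" "u \<in> fibre E x" "w \<in> fibre E x" "\<forall>i\<in>I. \<eta> x u i = \<eta> x w i"
  shows "u = w"
proof -
  have sub: "subspace (fibre E x)" using fibre_subspace assms(1) base by simp
  have "u + smult E (-1) w \<in> fibre E x" using assms by (intro subspace_add[OF sub] subspace_scale[OF sub])
  moreover have "\<forall>i\<in>I. \<eta> x (u + smult E (-1) w) i = 0"
    using assms by (simp add: eta_add eta_scale subspace_scale[OF sub] del: scale_minus_left)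
  ultimately have "u + smult E (-1) w = 0" using eta_inj assms(1) by blast
  then show ?thesis by simp
qed

lemma a_sum_scale: "j < c \<Longrightarrow> i \<in> I \<Longrightarrow> a j i (\<Sum>k\<in>A. t k *s x k) = (\<Sum>k\<in>A. t k * a j i (x k))"
proof (induction A rule: infinite_finite_induct)
  case (insert k A) then show ?case by (simp add: a_add a_scale)
qed (use a_scale[of j i 0 0] in auto)

lemma a_rat: assumes "j < c" "i \<in> I" shows "rat X 1 (a j i) x"
proof -
  have "a j i = (\<lambda>v. \<Sum>k\<in>UNIV. a j i (axis k 1) * v $ k)"
  proof
    fix v
    have "a j i v = a j i (\<Sum>k\<in>UNIV. (v $ k) *s axis k 1)" by (simp add: basis_expansion)
    also have "\<dots> = (\<Sum>k\<in>UNIV. v $ k * a j i (axis k 1))" by (rule a_sum_scale[OF assms])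
    finally show "a j i v = (\<Sum>k\<in>UNIV. a j i (axis k 1) * v $ k)" by (simp add: mult.commute)
  qed
  then show ?thesis using rat_linear by metis
qed

lemma a_surj: assumes "v \<noteq> 0" shows "\<exists>y. \<forall>j<c. (\<Sum>i\<in>I. a j i v * y i) = b j"
proof -
  have "\<exists>y. \<forall>j\<in>{..<c}. (\<Sum>i\<in>I. a j i v * y i) = b j"
    by (rule fredholm_alternative) (use fin a_rows[OF assms] in \<open>auto intro!: sum.neutral\<close>)
  then show ?thesis by (simp only: Ball_def lessThan_iff)
qed

lemma eta_in_kernel: "v \<noteq> 0 \<Longrightarrow> u \<in> fibre E (pt v) \<Longrightarrow> j < c \<Longrightarrow> (\<Sum>i\<in>I. a j i v * \<eta> (pt v) u i) = 0"
  using eta_kernel[of v "\<eta> (pt v) u"] by blast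

text \<open>Rank-nullity in one fibre: the free columns \<open>K\<close> of the matrix at
  \<open>v\<close> index a basis of the fibre, and comparison with a local frame gives
  \<open>card K = r\<close>.\<close>

lemma card_I: "card I = r + c"
proof -
  obtain v :: "'k ^ 'n" where v: "v \<noteq> 0" by (metis axis_eq_0_iff zero_neq_one)
  have x: "pt v \<in> proj_space" using v by simp
  have indep: "\<forall>j\<in>{..<c}. z j = 0" if "\<forall>i\<in>I. (\<Sum>j<c. z j * a j i v) = 0" for z
    using a_rows[OF v that] by simp
  have "\<exists>K\<subseteq>I. card I = card K + card {..<c} \<and>
    (\<forall>b. \<exists>y. (\<forall>i\<in>K. y i = b i) \<and> (\<forall>j\<in>{..<c}. (\<Sum>i\<in>I. a j i v * y i) = 0)) \<and>
    (\<forall>y. (\<forall>i\<in>K. y i = 0) \<longrightarrow> (\<forall>j\<in>{..<c}. (\<Sum>i\<in>I. a j i v * y i) = 0) \<longrightarrow> (\<forall>i\<in>I. y i = 0))"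
    by (rule free_variables[OF finite_lessThan fin]) (erule indep)
  then obtain K where K: "K \<subseteq> I" "card I = card K + card {..<c}"
    "\<forall>b. \<exists>y. (\<forall>i\<in>K. y i = b i) \<and> (\<forall>j\<in>{..<c}. (\<Sum>i\<in>I. a j i v * y i) = 0)"
    "\<forall>y. (\<forall>i\<in>K. y i = 0) \<longrightarrow> (\<forall>j\<in>{..<c}. (\<Sum>i\<in>I. a j i v * y i) = 0) \<longrightarrow> (\<forall>i\<in>I. y i = 0)"
    by (elim exE conjE) (rule that)
  have finK: "finite K" using K(1) fin finite_subset by blast
  have ex: "\<exists>u\<in>fibre E (pt v). \<forall>i\<in>K. \<eta> (pt v) u i = b i" for b
  proof -
    from K(3)[THEN spec, of b] obtain y where y: "\<forall>i\<in>K. y i = b i" "\<forall>j\<in>{..<c}. (\<Sum>i\<in>I. a j i v * y i) = 0"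
      by (elim exE conjE) (rule that)
    then have "\<exists>u\<in>fibre E (pt v). \<forall>i\<in>I. \<eta> (pt v) u i = y i" using eta_kernel[OF v] by simp
    then show ?thesis using y(1) K(1) by fastforce
  qed
  have uni: "u = 0" if u: "u \<in> fibre E (pt v)" "\<forall>i\<in>K. \<eta> (pt v) u i = 0" for u
  proof (rule eta_inj[OF x u(1)])
    show "\<forall>i\<in>I. \<eta> (pt v) u i = 0"
      using K(4)[THEN spec, THEN mp, THEN mp, of "\<eta> (pt v) u"] u eta_in_kernel[OF v u(1)] by simp
  qed
  have "\<forall>k\<in>K. \<exists>u. u \<in> fibre E (pt v) \<and> (\<forall>i\<in>K. \<eta> (pt v) u i = (if i = k then 1 else 0))"
  proof
    fix k assume "k \<in> K"
    show "\<exists>u. u \<in> fibre E (pt v) \<and> (\<forall>i\<in>K. \<eta> (pt v) u i = (if i = k then 1 else 0))"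
      using ex[of "\<lambda>i. if i = k then 1 else 0"] by blast
  qed
  \<comment> \<open>Fibre vectors dual to the free coordinates, so the coefficients of a fibre
    vector in this basis are its own coordinates on \<open>K\<close>.\<close>
  from bchoice[OF this] obtain g where g: "\<forall>k\<in>K. g k \<in> fibre E (pt v) \<and> (\<forall>i\<in>K. \<eta> (pt v) (g k) i = (if i = k then 1 else 0))"
    by (elim exE) (rule that)
  have sub: "subspace (fibre E (pt v))" using fibre_subspace x base by simp
  have eta_g: "\<eta> (pt v) (\<Sum>k\<in>K. smult E (z k) (g k)) i = z i" if "i \<in> K" for z i
  proof -
    have "\<eta> (pt v) (\<Sum>k\<in>K. smult E (z k) (g k)) i = (\<Sum>k\<in>K. z k * \<eta> (pt v) (g k) i)"
      by (rule eta_sum[OF x]) (use g that K(1) in auto)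
    also have "\<dots> = (\<Sum>k\<in>K. if i = k then z k else 0)" using g that by (intro sum.cong) auto
    finally show ?thesis using that finK by simp
  qed
  have span_g: "u = (\<Sum>k\<in>K. smult E (\<eta> (pt v) u k) (g k))" if u: "u \<in> fibre E (pt v)" for u
  proof -
    let ?w = "\<Sum>k\<in>K. smult E (\<eta> (pt v) u k) (g k)"
    have w: "?w \<in> fibre E (pt v)" using g by (intro subspace_sum[OF sub] subspace_scale[OF sub]) auto
    have "u + smult E (-1) ?w = 0"
    proof (rule uni)
      show "u + smult E (-1) ?w \<in> fibre E (pt v)" using u w by (intro subspace_add[OF sub] subspace_scale[OF sub])
      show "\<forall>i\<in>K. \<eta> (pt v) (u + smult E (-1) ?w) i = 0"
        using u w x K(1) eta_g
        by (auto simp: eta_add eta_scale subspace_scale[OF sub] subset_iff simp del: scale_minus_left)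
    qed
    then show ?thesis by simp
  qed
  obtain U e where U: "pt v \<in> U" and e: "\<And>y. y \<in> U \<Longrightarrow> fibre E y = {\<Sum>i<r. smult E (z i) (e i y) | z. True}"
    "\<And>y z i. y \<in> U \<Longrightarrow> (\<Sum>i<r. smult E (z i) (e i y)) = 0 \<Longrightarrow> i < r \<Longrightarrow> z i = 0"
    using x[folded base] by (rule local_frame) blast
  have "card K \<le> card {..<r}"
  proof (rule card_le_of_span[OF vector_space_axioms _ finK])
    show "\<exists>z. g k = (\<Sum>i<r. smult E (z i) (e i (pt v)))" if "k \<in> K" for k
      using g that e(1)[OF U] by auto
    show "\<forall>k\<in>K. z k = 0" if s0: "(\<Sum>k\<in>K. smult E (z k) (g k)) = 0" for z
    proof
      fix k assume k: "k \<in> K"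
      have "z k = \<eta> (pt v) 0 k" using eta_g[OF k, of z] s0 by simp
      also have "\<dots> = 0" using eta_zero[OF x] k K(1) by auto
      finally show "z k = 0" .
    qed
  qed simp
  moreover have "card {..<r} \<le> card K"
  proof (rule card_le_of_span[OF vector_space_axioms finK])
    show "\<exists>z. e i (pt v) = (\<Sum>k\<in>K. smult E (z k) (g k))" if "i \<in> {..<r}" for i
    proof -
      have "e i (pt v) = (\<Sum>k<r. smult E (if k = i then 1 else 0) (e k (pt v)))"
        using that by (simp add: if_distrib[of "\<lambda>x. smult E x _"] cong: if_cong)
      then have "e i (pt v) \<in> fibre E (pt v)"
        unfolding e(1)[OF U] by (intro CollectI exI[of _ "\<lambda>k. if k = i then 1 else 0"]) simp
      from span_g[OF this] show ?thesis by (intro exI[of _ "\<eta> (pt v) (e i (pt v))"])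
    qed
    show "\<forall>i\<in>{..<r}. z i = 0" if "(\<Sum>i<r. smult E (z i) (e i (pt v))) = 0" for z
      using e(2)[OF U that] by simp
  qed simp
  ultimately show ?thesis using K(2) by simp
qed

end

lemma sum_swap_mult:
  fixes f :: "'i \<Rightarrow> 'k::field"
  shows "(\<Sum>i\<in>I. f i * (\<Sum>j\<in>J. x j * B j i)) = (\<Sum>j\<in>J. x j * (\<Sum>i\<in>I. f i * B j i))"
proof -
  have "(\<Sum>i\<in>I. f i * (\<Sum>j\<in>J. x j * B j i)) = (\<Sum>i\<in>I. \<Sum>j\<in>J. x j * (f i * B j i))"
    by (simp add: sum_distrib_left ac_simps)
  also have "\<dots> = (\<Sum>j\<in>J. \<Sum>i\<in>I. x j * (f i * B j i))" by (rule sum.swap)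
  finally show ?thesis by (simp add: sum_distrib_left)
qed

lemma sum_swap_mult_add:
  fixes f :: "'i \<Rightarrow> 'k::field"
  shows "(\<Sum>i\<in>I. f i * ((\<Sum>j\<in>J. x j * B j i) + (\<Sum>l\<in>K. y l * C l i)))
    = (\<Sum>j\<in>J. x j * (\<Sum>i\<in>I. f i * B j i)) + (\<Sum>l\<in>K. y l * (\<Sum>i\<in>I. f i * C l i))"
  by (simp only: distrib_left sum.distrib sum_swap_mult[where x = x and B = B] sum_swap_mult[where x = y and B = C])

text \<open>In coordinates the frame vectors are constant or linear on the plane of the line, so the
  fibres over \<open>v\<close> and \<open>w\<close> control all others. If they did not span the
  coordinate space, a constant functional would vanish on the restricted bundle and be a combination
  of rows with coefficients in \<open>O(-1)\<close>. Both claims follow from this spanning. The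
  second says that the restriction has degree \<open>-c\<close>.\<close>

lemma framed_nonneg_split:
  fixes E :: "(('k::{alg_closed_field, field_char_0} ^ 'n::finite) set, 'k, 'v::ab_group_add) vbundle"
  assumes P: "presented E r \<eta> a I c" and vw: "indep2 v w"
    and fr: "framed (restrict_bundle (line v w) E) (line v w) J d b"
    and d: "\<And>j. j \<in> J \<Longrightarrow> d j = 0 \<or> d j = -1"
  shows "(\<forall>i\<in>I. (\<Sum>j<c. y j * a j i v) + (\<Sum>j<c. z j * a j i w) = 0) \<Longrightarrow> j < c \<Longrightarrow> y j = 0 \<and> z j = 0"
    and "card {j \<in> J. d j = -1} = c"
proof -
  interpret presented E r \<eta> a I c by (rule P)
  let ?L = "line v w"
  interpret fr: framed "restrict_bundle ?L E" ?L J d b by (rule fr)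
  have L: "?L \<subseteq> proj_space" by (rule line_subset[OF vw])
  have Lb: "?L \<subseteq> base E" using L base by simp
  have sm: "smult (restrict_bundle ?L E) = smult E" "fibre (restrict_bundle ?L E) = fibre E"
    by (simp_all add: restrict_bundle_def)
  have v: "v \<noteq> 0" "pt v \<in> ?L" and w: "w \<noteq> 0" "pt w \<in> ?L"
    using indep2_nonzero[OF vw] pt_in_line[of 1 0 v w] pt_in_line[of 0 1 v w] by auto
  define B where "B j i u = \<eta> (pt u) (b j u) i" for j i u
  have P: "pt u \<in> proj_space" if "pt u \<in> ?L" for u using that L by auto
  have b_in: "b j u \<in> fibre E (pt u)" if "u \<noteq> 0" "pt u \<in> ?L" "j \<in> J" for j u
    using fr.b_in_fibre[OF that] sm by simp
  \<comment> \<open>A frame vector becomes a section of \<open>E\<close> near \<open>x\<close> only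
    after multiplication by a coordinate power of degree \<open>d j\<close>. There
    \<open>eta_regular\<close> applies, and dividing by the power shifts the degree to
    \<open>- d j\<close>.\<close>
  have B_rat: "rat ?L (- d j) (B j i) x" if j: "j \<in> J" and i: "i \<in> I" and x: "x \<in> ?L" for j i x
  proof -
    obtain u0 where u0: "u0 \<noteq> 0" "x = pt u0" using x L proj_spaceE by blast
    from restrict_local_section[OF fr Lb x j] obtain W t i0 where W: "zopen (base E) W" "x \<in> W" "t \<in> sects E W"
      and t: "\<forall>u. u \<noteq> 0 \<longrightarrow> pt u \<in> W \<inter> ?L \<longrightarrow> u $ i0 \<noteq> 0 \<and> t (pt u) = smult E ((u $ i0) powi (d j)) (b j u)"
      by (elim exE conjE) (rule that)
    have W': "zopen proj_space W" using W(1) base by simp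
    have "rat proj_space 0 (\<lambda>v. \<eta> (pt v) (t (pt v)) i) x" by (rule eta_regular[OF W' W(3,2) i])
    then have "rat ?L 0 (\<lambda>v. \<eta> (pt v) (t (pt v)) i) x" using rat_mono L x by blast
    moreover have "rat ?L (- d j) (\<lambda>v. (v $ i0) powi (- d j)) x"
      unfolding u0(2) by (rule rat_coord_powi[OF L]) (use t u0 W x in auto)
    ultimately have "rat ?L (0 + - d j) (\<lambda>v. \<eta> (pt v) (t (pt v)) i * (v $ i0) powi (- d j)) x"
      by (rule rat_mult)
    then have "rat ?L (- d j) (\<lambda>v. \<eta> (pt v) (t (pt v)) i * (v $ i0) powi (- d j)) x" by simp
    then show ?thesis
    proof (rule rat_cong)
      have op: "zopen ?L (W \<inter> ?L)" "x \<in> W \<inter> ?L" using zopen_mono[OF Lb W(1)] W x by auto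
      show "eventually (\<lambda>v. \<eta> (pt v) (t (pt v)) i * (v $ i0) powi (- d j) = B j i v) (zn ?L x)"
        using eventually_zn_open[OF op L]
      proof eventually_elim
        case (elim u)
        then have "u $ i0 \<noteq> 0" "t (pt u) = smult E ((u $ i0) powi (d j)) (b j u)" using t by auto
        then show ?case using eta_scale[OF P b_in[OF _ _ j] i] elim by (simp add: B_def power_int_minus)
      qed
    qed
  qed
  have B_sum: "\<eta> (pt u) (\<Sum>j\<in>J. smult E (z j) (b j u)) i = (\<Sum>j\<in>J. z j * B j i u)"
    if "u \<noteq> 0" "pt u \<in> ?L" "i \<in> I" for u z i
    unfolding B_def using b_in[OF that(1,2)] that by (intro eta_sum P)
  have sub: "subspace (fibre E (pt u))" if "pt u \<in> ?L" for u using fibre_subspace P[OF that] base by simp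
  have B_ind: "\<forall>j\<in>J. z j = 0" if u: "u \<noteq> 0" "pt u \<in> ?L" and z: "\<forall>i\<in>I. (\<Sum>j\<in>J. z j * B j i u) = 0" for u z
  proof -
    have "(\<Sum>j\<in>J. smult E (z j) (b j u)) = 0"
    proof (rule eta_inj[OF P[OF u(2)]])
      show "(\<Sum>j\<in>J. smult E (z j) (b j u)) \<in> fibre E (pt u)"
        using b_in[OF u] sub[OF u(2)] by (intro subspace_sum subspace_scale)
      show "\<forall>i\<in>I. \<eta> (pt u) (\<Sum>j\<in>J. smult E (z j) (b j u)) i = 0" using B_sum[OF u] z by simp
    qed
    then show ?thesis using fr.indep[OF u, of z] sm by simp
  qed
  have B_ker: "(\<Sum>i\<in>I. a k i u * B j i u) = 0" if "u \<noteq> 0" "pt u \<in> ?L" "j \<in> J" "k < c" for u j k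
    unfolding B_def by (rule eta_in_kernel[OF that(1) b_in[OF that(1-3)] that(4)])
  have B_ex: "\<exists>z. \<forall>i\<in>I. (\<Sum>j\<in>J. z j * B j i u) = y i"
    if u: "u \<noteq> 0" "pt u \<in> ?L" and y: "\<forall>k<c. (\<Sum>i\<in>I. a k i u * y i) = 0" for u y
  proof -
    obtain f where f: "f \<in> fibre E (pt u)" "\<forall>i\<in>I. \<eta> (pt u) f i = y i" using eta_kernel[OF u(1), of y] y by blast
    obtain z where z: "f = (\<Sum>j\<in>J. smult E (z j) (b j u))" using fr.fibre[OF u] f(1) sm by auto
    show ?thesis using B_sum[OF u] f(2) unfolding z by (intro exI[of _ z]) auto
  qed
  have cone: "s *s v + t *s w \<noteq> 0" "pt (s *s v + t *s w) \<in> ?L" if "s \<noteq> 0 \<or> t \<noteq> 0" for s t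
    using line_nonzero[OF vw that] pt_in_line[OF that] by auto
  have B_hom: "B j i (s *s u) = s powi (- d j) * B j i u"
    if "u \<noteq> 0" "pt u \<in> ?L" "s \<noteq> 0" "j \<in> J" "i \<in> I" for u s j i
    by (rule rat_homogeneous[OF B_rat[OF that(4,5,2)] L that(2,1,3)])
  \<comment> \<open>This is where the splitting type enters: the coordinates of the frame vectors
    have degree \<open>0\<close> or \<open>1\<close>, so they are constant here and linear in
    \<open>B1\<close>.\<close>
  have B0: "B j i (s *s v + t *s w) = B j i v" if j: "j \<in> J" "d j = 0" and i: "i \<in> I" and st: "s \<noteq> 0 \<or> t \<noteq> 0" for j i s t
  proof -
    have rat0: "rat ?L 0 (B j i) x" if "x \<in> ?L" for x using B_rat[OF j(1) i that] j(2) by simp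
    have hom0: "B j i (p *s (s *s v + t *s w)) = B j i (s *s v + t *s w)" if "p \<noteq> 0" "s \<noteq> 0 \<or> t \<noteq> 0" for p s t
      using B_hom[OF cone[OF that(2)] that(1) j(1) i] j(2) by simp
    have g: "B j i (v + t *s w) = B j i v" "B j i w = B j i v" for t
      using global_form_degree_0[OF vw L, of "B j i"] cone(2) rat0 hom0 by blast+
    show ?thesis
    proof (cases "s = 0")
      case True
      then show ?thesis using st g(2) hom0[of t 0 1] by simp
    next
      case False
      then have "s *s v + t *s w = s *s (1 *s v + (t / s) *s w)" by (simp add: vector_add_ldistrib)
      then show ?thesis using hom0[of s 1 "t / s"] False g(1)[of "t / s"] by simp
    qed
  qed
  have B1: "B j i (s *s v + t *s w) = s * B j i v + t * B j i w"
    if j: "j \<in> J" "d j = -1" and i: "i \<in> I" and st: "s \<noteq> 0 \<or> t \<noteq> 0" for j i s t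
  proof -
    have rat1: "rat ?L 1 (B j i) x" if "x \<in> ?L" for x using B_rat[OF j(1) i that] j(2) by simp
    have hom1: "B j i (p *s (s *s v + t *s w)) = p * B j i (s *s v + t *s w)" if "p \<noteq> 0" "s \<noteq> 0 \<or> t \<noteq> 0" for p s t
      using B_hom[OF cone[OF that(2)] that(1) j(1) i] j(2) by simp
    have g: "B j i (v + t *s w) = B j i v + t * B j i w" for t
      using global_form_degree_1[OF vw L, of "B j i"] cone(2) rat1 hom1 by blast
    show ?thesis
    proof (cases "s = 0")
      case True
      then show ?thesis using st hom1[of t 0 1] by simp
    next
      case False
      then have "s *s v + t *s w = s *s (1 *s v + (t / s) *s w)" by (simp add: vector_add_ldistrib)
      then have "B j i (s *s v + t *s w) = s * (B j i v + t / s * B j i w)"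
        using hom1[of s 1 "t / s"] False g[of "t / s"] by simp
      then show ?thesis using False by (simp add: distrib_left)
    qed
  qed
  have B_orth: "(\<Sum>i\<in>I. f i * B j i u) = 0"
    if u: "u \<noteq> 0" "pt u \<in> ?L" and j: "j \<in> J" and f: "(\<Sum>i\<in>I. f i * B j i v) = 0" "(\<Sum>i\<in>I. f i * B j i w) = 0" for u j f
  proof -
    obtain s t where st: "s \<noteq> 0 \<or> t \<noteq> 0" "u = s *s v + t *s w" using line_rep[OF vw u] by blast
    show ?thesis
    proof (cases "d j = 0")
      case True
      then show ?thesis using B0[OF j True _ st(1)] f(1) st(2) by simp
    next
      case False
      then have "(\<Sum>i\<in>I. f i * B j i u) = (\<Sum>i\<in>I. s * (f i * B j i v) + t * (f i * B j i w))"
        using B1[OF j _ _ st(1)] d[OF j] st(2) by (intro sum.cong) (auto simp: algebra_simps)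
      then show ?thesis using f by (simp add: sum.distrib sum_distrib_left[symmetric])
    qed
  qed
  \<comment> \<open>By duality it suffices that a functional \<open>f\<close> vanishing on the
    fibres over \<open>v\<close> and \<open>w\<close> is zero. By \<open>B_orth\<close> it vanishes
    on every fibre along the line, hence lies in the row space of \<open>a u\<close> for every
    \<open>u\<close>.\<close>
  have spans: "\<exists>x x'. \<forall>i\<in>I. y i = (\<Sum>j\<in>J. x j * B j i v) + (\<Sum>j\<in>J. x' j * B j i w)" for y
  proof -
    let ?M = "\<lambda>i p. case p of Inl j \<Rightarrow> B j i v | Inr j \<Rightarrow> B j i w"
    have plus: "(\<Sum>p\<in>J <+> J. g p) = (\<Sum>j\<in>J. g (Inl j)) + (\<Sum>j\<in>J. g (Inr j))" for g :: "_ \<Rightarrow> 'k"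
      using fr.fin by (simp add: sum.Plus)
    have "\<exists>x. \<forall>i\<in>I. (\<Sum>p\<in>J <+> J. ?M i p * x p) = y i"
    proof (rule fredholm_alternative[OF fin])
      show "finite (J <+> J)" using fr.fin by simp
      fix f assume f: "\<forall>p\<in>J <+> J. (\<Sum>i\<in>I. f i * ?M i p) = 0"
      have fv: "(\<Sum>i\<in>I. f i * B j i v) = 0" and fw: "(\<Sum>i\<in>I. f i * B j i w) = 0" if "j \<in> J" for j
        using f[THEN bspec, of "Inl j"] f[THEN bspec, of "Inr j"] that by auto
      have ex: "\<exists>z. \<forall>i\<in>I. (\<Sum>k<c. z k * a k i u) = f i" if u: "u \<noteq> 0" "pt u \<in> ?L" for u
      proof -
        have "\<exists>z. \<forall>i\<in>I. (\<Sum>k<c. a k i u * z k) = f i"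
        proof (rule fredholm_alternative[OF fin finite_lessThan])
          fix g assume g: "\<forall>k\<in>{..<c}. (\<Sum>i\<in>I. g i * a k i u) = 0"
          then obtain z where z: "\<forall>i\<in>I. (\<Sum>j\<in>J. z j * B j i u) = g i"
            using B_ex[OF u, of g] by (auto simp: mult.commute)
          have "(\<Sum>i\<in>I. g i * f i) = (\<Sum>i\<in>I. f i * (\<Sum>j\<in>J. z j * B j i u))"
            using z by (intro sum.cong) auto
          also have "\<dots> = (\<Sum>j\<in>J. z j * (\<Sum>i\<in>I. f i * B j i u))" by (rule sum_swap_mult)
          also have "\<dots> = 0" using B_orth[OF u] fv fw by (intro sum.neutral) simp
          finally show "(\<Sum>i\<in>I. g i * f i) = 0" .
        qed
        then show ?thesis by (simp add: mult.commute)
      qed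
      from ex[OF v] obtain z where z: "\<forall>i\<in>I. (\<Sum>k<c. z k * a k i v) = f i" by blast
      \<comment> \<open>The vector \<open>f\<close> is constant and the rows have degree
        \<open>1\<close>, so the coefficients are global sections of \<open>O(-1)\<close>.\<close>
      have "z k = 0" if "k < c" for k
      proof (rule constant_coefficients[where J = "{..<c}" and I = I and m = a and g = f and z = z and d = "\<lambda>_. 1", OF vw])
        show "rat ?L 1 (a k i) x" if "k \<in> {..<c}" "i \<in> I" for k i x using a_rat that by simp
        show "\<forall>k\<in>{..<c}. z k = 0" if "u \<noteq> 0" "\<forall>i\<in>I. (\<Sum>k<c. z k * a k i u) = 0" for u z
          using a_rows[OF that] by simp
        show "\<exists>z. \<forall>i\<in>I. (\<Sum>k<c. z k * a k i u) = f i" if "u \<noteq> 0" "pt u \<in> ?L" for u by (rule ex[OF that])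
      qed (use that z in auto)
      then have "\<forall>i\<in>I. f i = 0" using z by simp
      then show "(\<Sum>i\<in>I. f i * y i) = 0" by simp
    qed
    then obtain x where x: "\<forall>i\<in>I. (\<Sum>p\<in>J <+> J. ?M i p * x p) = y i" by blast
    show ?thesis
      using x by (intro exI[of _ "\<lambda>j. x (Inl j)"] exI[of _ "\<lambda>j. x (Inr j)"]) (simp add: plus mult.commute)
  qed
  \<comment> \<open>The matrix \<open>a v\<close> is surjective and kills the fibre over
    \<open>v\<close>; since both fibres together span, already the fibre over \<open>w\<close> maps
    onto all of \<open>k^c\<close>.\<close>
  have q_ex: "\<exists>x. \<forall>k<c. (\<Sum>j\<in>J. x j * (\<Sum>i\<in>I. a k i v * B j i w)) = e k" for e
  proof -
    obtain y where y: "\<forall>k<c. (\<Sum>i\<in>I. a k i v * y i) = e k" using a_surj[OF v(1)] by blast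
    obtain x x' where x: "\<forall>i\<in>I. y i = (\<Sum>j\<in>J. x j * B j i v) + (\<Sum>j\<in>J. x' j * B j i w)" using spans by blast
    have "(\<Sum>j\<in>J. x' j * (\<Sum>i\<in>I. a k i v * B j i w)) = e k" if k: "k < c" for k
    proof -
      have "e k = (\<Sum>i\<in>I. a k i v * ((\<Sum>j\<in>J. x j * B j i v) + (\<Sum>j\<in>J. x' j * B j i w)))"
        using y k x by simp
      also have "\<dots> = (\<Sum>j\<in>J. x j * (\<Sum>i\<in>I. a k i v * B j i v)) + (\<Sum>j\<in>J. x' j * (\<Sum>i\<in>I. a k i v * B j i w))"
        by (rule sum_swap_mult_add)
      also have "(\<Sum>j\<in>J. x j * (\<Sum>i\<in>I. a k i v * B j i v)) = 0" using B_ker[OF v] k by simp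
      finally show ?thesis by simp
    qed
    then show ?thesis by blast
  qed
  have p_ex: "\<exists>x. \<forall>k<c. (\<Sum>j\<in>J. x j * (\<Sum>i\<in>I. a k i w * B j i v)) = e k" for e
  proof -
    obtain y where y: "\<forall>k<c. (\<Sum>i\<in>I. a k i w * y i) = e k" using a_surj[OF w(1)] by blast
    obtain x x' where x: "\<forall>i\<in>I. y i = (\<Sum>j\<in>J. x j * B j i v) + (\<Sum>j\<in>J. x' j * B j i w)" using spans by blast
    have "(\<Sum>j\<in>J. x j * (\<Sum>i\<in>I. a k i w * B j i v)) = e k" if k: "k < c" for k
    proof -
      have "e k = (\<Sum>i\<in>I. a k i w * ((\<Sum>j\<in>J. x j * B j i v) + (\<Sum>j\<in>J. x' j * B j i w)))"
        using y k x by simp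
      also have "\<dots> = (\<Sum>j\<in>J. x j * (\<Sum>i\<in>I. a k i w * B j i v)) + (\<Sum>j\<in>J. x' j * (\<Sum>i\<in>I. a k i w * B j i w))"
        by (rule sum_swap_mult_add)
      also have "(\<Sum>j\<in>J. x' j * (\<Sum>i\<in>I. a k i w * B j i w)) = 0" using B_ker[OF w] k by simp
      finally show ?thesis by simp
    qed
    then show ?thesis by blast
  qed
  \<comment> \<open>Pairing the relation with a fibre vector over \<open>w\<close> removes the part
    with \<open>a w\<close>, and by \<open>q_ex\<close> the remaining part detects every coordinate
    of \<open>y\<close>. The roles of \<open>v\<close> and \<open>w\<close> are exchanged for
    \<open>z\<close>.\<close>
  show "y k = 0 \<and> z k = 0" if rel: "\<forall>i\<in>I. (\<Sum>j<c. y j * a j i v) + (\<Sum>j<c. z j * a j i w) = 0" and k: "k < c" for y z k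
  proof
    have rel_B: "(\<Sum>l<c. y l * (\<Sum>i\<in>I. a l i v * B j i u)) + (\<Sum>l<c. z l * (\<Sum>i\<in>I. a l i w * B j i u)) = 0" for j u
    proof -
      have "0 = (\<Sum>i\<in>I. B j i u * ((\<Sum>l<c. y l * a l i v) + (\<Sum>l<c. z l * a l i w)))" using rel by simp
      also have "\<dots> = (\<Sum>l<c. y l * (\<Sum>i\<in>I. B j i u * a l i v)) + (\<Sum>l<c. z l * (\<Sum>i\<in>I. B j i u * a l i w))"
        by (rule sum_swap_mult_add)
      finally show ?thesis by (simp add: mult.commute)
    qed
    have delta: "(\<Sum>l<c. f l * (if l = k then 1 else 0)) = (f k :: 'k)" for f
      using k by (simp add: if_distrib cong: if_cong)
    obtain x where x: "\<forall>l<c. (\<Sum>j\<in>J. x j * (\<Sum>i\<in>I. a l i v * B j i w)) = (if l = k then 1 else 0)"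
      using q_ex[of "\<lambda>l. if l = k then 1 else 0"] by blast
    have "y k = (\<Sum>l<c. y l * (\<Sum>j\<in>J. x j * (\<Sum>i\<in>I. a l i v * B j i w)))" using x delta[of y] by simp
    also have "\<dots> = (\<Sum>j\<in>J. x j * (\<Sum>l<c. y l * (\<Sum>i\<in>I. a l i v * B j i w)))" by (rule sum_swap_mult)
    also have "\<dots> = 0"
    proof (intro sum.neutral ballI)
      fix j assume j: "j \<in> J"
      have "(\<Sum>l<c. z l * (\<Sum>i\<in>I. a l i w * B j i w)) = 0" using B_ker[OF w j] by simp
      then show "x j * (\<Sum>l<c. y l * (\<Sum>i\<in>I. a l i v * B j i w)) = 0" using rel_B[of j w] by simp
    qed
    finally show "y k = 0" .
    obtain x where x: "\<forall>l<c. (\<Sum>j\<in>J. x j * (\<Sum>i\<in>I. a l i w * B j i v)) = (if l = k then 1 else 0)"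
      using p_ex[of "\<lambda>l. if l = k then 1 else 0"] by blast
    have "z k = (\<Sum>l<c. z l * (\<Sum>j\<in>J. x j * (\<Sum>i\<in>I. a l i w * B j i v)))" using x delta[of z] by simp
    also have "\<dots> = (\<Sum>j\<in>J. x j * (\<Sum>l<c. z l * (\<Sum>i\<in>I. a l i w * B j i v)))" by (rule sum_swap_mult)
    also have "\<dots> = 0"
    proof (intro sum.neutral ballI)
      fix j assume j: "j \<in> J"
      have "(\<Sum>l<c. y l * (\<Sum>i\<in>I. a l i v * B j i v)) = 0" using B_ker[OF v j] by simp
      then show "x j * (\<Sum>l<c. z l * (\<Sum>i\<in>I. a l i w * B j i v)) = 0" using rel_B[of j v] by simp
    qed
    finally show "z k = 0" .
  qed
  let ?J1 = "{j \<in> J. d j = -1}"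
  have fin1: "finite ?J1" using fr.fin by simp
  \<comment> \<open>Frame vectors of degree \<open>0\<close> are the same at \<open>v\<close> and
    \<open>w\<close>, so \<open>a v\<close> kills them. The surjection in \<open>q_ex\<close> is
    thus carried by the frame vectors with \<open>d j = -1\<close> alone.\<close>
  have "c \<le> card ?J1"
  proof (rule ccontr)
    assume "\<not> ?thesis"
    then have "card ?J1 < card {..<c}" by simp
    from underdetermined[OF fin1 finite_lessThan this, of "\<lambda>j k. \<Sum>i\<in>I. a k i v * B j i w"]
    obtain z where z: "\<exists>k\<in>{..<c}. z k \<noteq> 0" "\<forall>j\<in>?J1. (\<Sum>k<c. (\<Sum>i\<in>I. a k i v * B j i w) * z k) = 0" by blast
    obtain k where k: "k < c" "z k \<noteq> 0" using z(1) by auto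
    obtain x where x: "\<forall>l<c. (\<Sum>j\<in>J. x j * (\<Sum>i\<in>I. a l i v * B j i w)) = (if l = k then 1 else 0)"
      using q_ex[of "\<lambda>l. if l = k then 1 else 0"] by blast
    have "z k = (\<Sum>l<c. z l * (if l = k then 1 else 0))" using k by (simp add: if_distrib cong: if_cong)
    also have "\<dots> = (\<Sum>l<c. z l * (\<Sum>j\<in>J. x j * (\<Sum>i\<in>I. a l i v * B j i w)))" using x by simp
    also have "\<dots> = (\<Sum>j\<in>J. x j * (\<Sum>l<c. z l * (\<Sum>i\<in>I. a l i v * B j i w)))" by (rule sum_swap_mult)
    also have "\<dots> = 0"
    proof (intro sum.neutral ballI)
      fix j assume j: "j \<in> J"
      have "(\<Sum>l<c. z l * (\<Sum>i\<in>I. a l i v * B j i w)) = 0"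
      proof (cases "d j = 0")
        case True
        have "B j i w = B j i v" if "i \<in> I" for i using B0[OF j True that, of 0 1] by simp
        then have "(\<Sum>i\<in>I. a l i v * B j i w) = 0" if "l < c" for l using B_ker[OF v j that] by simp
        then show ?thesis by simp
      next
        case False
        then show ?thesis using z(2) d[OF j] j by (simp add: mult.commute)
      qed
      then show "x j * (\<Sum>l<c. z l * (\<Sum>i\<in>I. a l i v * B j i w)) = 0" by simp
    qed
    finally show False using k by simp
  qed
  \<comment> \<open>With more than \<open>c\<close> such frame vectors, a nontrivial combination at
    \<open>v\<close> is killed by \<open>a w\<close> too, hence by the matrix at every point of the
    line. It is a constant section, whose coefficients in the copies of \<open>O(-1)\<close> must
    vanish.\<close>
  moreover have "card ?J1 \<le> c"
  proof (rule ccontr)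
    assume "\<not> ?thesis"
    then have "card {..<c} < card ?J1" by simp
    from underdetermined[OF finite_lessThan fin1 this, of "\<lambda>k j. \<Sum>i\<in>I. a k i w * B j i v"]
    obtain z where z: "\<exists>j\<in>?J1. z j \<noteq> 0" "\<forall>k\<in>{..<c}. (\<Sum>j\<in>?J1. (\<Sum>i\<in>I. a k i w * B j i v) * z j) = 0" by blast
    define z' where "z' j = (if d j = -1 then z j else 0)" for j
    have z'_sum: "(\<Sum>j\<in>J. z' j * g j) = (\<Sum>j\<in>?J1. z j * g j)" for g
      using fr.fin by (simp add: z'_def if_distrib[of "\<lambda>x. x * _"] sum.inter_filter[symmetric] cong: if_cong)
    define p where "p i = (\<Sum>j\<in>J. z' j * B j i v)" for i
    have pv: "(\<Sum>i\<in>I. a k i v * p i) = 0" if "k < c" for k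
      unfolding p_def by (subst sum_swap_mult) (simp add: B_ker[OF v _ that])
    have pw: "(\<Sum>i\<in>I. a k i w * p i) = 0" if "k < c" for k
      unfolding p_def by (subst sum_swap_mult) (use z(2) that in \<open>simp add: z'_sum mult.commute\<close>)
    have ex: "\<exists>y. \<forall>i\<in>I. (\<Sum>j\<in>J. y j * B j i u) = p i" if u: "u \<noteq> 0" "pt u \<in> ?L" for u
    proof (rule B_ex[OF u], intro allI impI)
      fix k assume k: "k < c"
      obtain s t where "u = s *s v + t *s w" using line_rep[OF vw u] by blast
      then have "(\<Sum>i\<in>I. a k i u * p i) = (\<Sum>i\<in>I. s * (a k i v * p i) + t * (a k i w * p i))"
        using k by (intro sum.cong) (auto simp: a_add a_scale algebra_simps)
      also have "\<dots> = 0" using pv[OF k] pw[OF k] by (simp add: sum.distrib sum_distrib_left[symmetric])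
      finally show "(\<Sum>i\<in>I. a k i u * p i) = 0" .
    qed
    have "z' j = 0" if j: "j \<in> J" "d j = -1" for j
    proof (rule constant_coefficients[where J = J and I = I and m = B and g = p and z = z' and d = "\<lambda>j. - d j", OF vw fr.fin])
      show "rat ?L (- d j) (B j i) x" if "j \<in> J" "i \<in> I" "x \<in> ?L" for j i x by (rule B_rat[OF that])
      show "\<forall>j\<in>J. z j = 0" if "u \<noteq> 0" "pt u \<in> ?L" "\<forall>i\<in>I. (\<Sum>j\<in>J. z j * B j i u) = 0" for u z by (rule B_ind[OF that])
      show "\<exists>y. \<forall>i\<in>I. (\<Sum>j\<in>J. y j * B j i u) = p i" if "u \<noteq> 0" "pt u \<in> ?L" for u by (rule ex[OF that])
    qed (use j in \<open>auto simp: p_def\<close>)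
    then show False using z(1) by (auto simp: z'_def)
  qed
  ultimately show "card ?J1 = c" by simp
qed

section \<open>The first Chern class\<close>

text \<open>Multilinear expansion reduces \<open>D u\<close> to values of \<open>D\<close> on
  families of the vectors \<open>f\<close>. A repeated vector gives zero by alternation, and
  otherwise the family is a permutation of \<open>f\<close> and its value is, up to sign, the given
  zero. Contrapositively, a nonzero determinant form does not vanish on a frame.\<close>

lemma alternating_zero:
  fixes D :: "(nat \<Rightarrow> 'v::ab_group_add) \<Rightarrow> 'w::ab_group_add" and sc :: "'k::field \<Rightarrow> 'v \<Rightarrow> 'v" and sw :: "'k \<Rightarrow> 'w \<Rightarrow> 'w"
  assumes vs: "vector_space sc" and vw: "vector_space sw" and sub: "module.subspace sc V"
    and add: "\<And>u i p q. u \<in> {..<r} \<rightarrow>\<^sub>E V \<Longrightarrow> i < r \<Longrightarrow> p \<in> V \<Longrightarrow> q \<in> V \<Longrightarrow> D (u(i := p + q)) = D (u(i := p)) + D (u(i := q))"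
    and scale: "\<And>u i a p. u \<in> {..<r} \<rightarrow>\<^sub>E V \<Longrightarrow> i < r \<Longrightarrow> p \<in> V \<Longrightarrow> D (u(i := sc a p)) = sw a (D (u(i := p)))"
    and alt: "\<And>u i j. u \<in> {..<r} \<rightarrow>\<^sub>E V \<Longrightarrow> i < r \<Longrightarrow> j < r \<Longrightarrow> i \<noteq> j \<Longrightarrow> u i = u j \<Longrightarrow> D u = 0"
    and f: "\<And>i. i < r \<Longrightarrow> f i \<in> V" and span: "\<And>p. p \<in> V \<Longrightarrow> \<exists>z. p = (\<Sum>i<r. sc (z i) (f i))"
    and zero: "D (\<lambda>i\<in>{..<r}. f i) = 0" and u: "u \<in> {..<r} \<rightarrow>\<^sub>E V"
  shows "D u = 0"
proof -
  interpret V: vector_space sc by (rule vs)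
  interpret W: vector_space sw by (rule vw)
  have upd: "u(i := p) \<in> {..<r} \<rightarrow>\<^sub>E V" if "u \<in> {..<r} \<rightarrow>\<^sub>E V" "i < r" "p \<in> V" for u i p
    using that by (auto simp: PiE_def extensional_def)
  \<comment> \<open>Antisymmetry by polarisation: \<open>T\<close> is biadditive and zero on the
    diagonal, so it is evaluated at the sum of the two entries.\<close>
  have swap_eq: "D (u(i := u j, j := u i)) = - D u" if u: "u \<in> {..<r} \<rightarrow>\<^sub>E V" and ij: "i < r" "j < r" "i \<noteq> j" for u i j
  proof -
    define T where "T x y = D (u(i := x, j := y))" for x y
    have V: "u i \<in> V" "u j \<in> V" using u ij by auto
    have diag: "T x x = 0" if "x \<in> V" for x
      unfolding T_def using that ij by (intro alt[of _ i j] upd u) auto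
    have right: "T x (y + z) = T x y + T x z" if "x \<in> V" "y \<in> V" "z \<in> V" for x y z
      unfolding T_def using that ij by (intro add upd u)
    have left: "T (x + y) z = T x z + T y z" if "x \<in> V" "y \<in> V" "z \<in> V" for x y z
      unfolding T_def fun_upd_twist[OF ij(3)] using that ij by (intro add upd u)
    have pq: "u i + u j \<in> V" using V.subspace_add[OF sub] V by blast
    have "0 = T (u i + u j) (u i + u j)" using diag[OF pq] by simp
    also have "\<dots> = T (u i) (u j) + T (u j) (u i)"
      using V pq diag[OF V(1)] diag[OF V(2)] by (simp add: right left)
    finally have "T (u j) (u i) = - T (u i) (u j)" by (simp add: eq_neg_iff_add_eq_0 add.commute)
    moreover have "T (u i) (u j) = D u" unfolding T_def by simp
    ultimately show ?thesis unfolding T_def by simp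
  qed
  have perm: "D (\<lambda>i\<in>{..<r}. f (p i)) = 0" if "p permutes {..<r}" for p
    using that finite_lessThan
  proof (induction p rule: permutes_induct)
    case id then show ?case using zero by (simp add: restrict_def)
  next
    case (swap a b p)
    let ?T = "\<lambda>i\<in>{..<r}. f (p i)"
    define i j where "i = inv p a" and "j = inv p b"
    have pij: "p i = a" "p j = b" unfolding i_def j_def using permutes_inverses[OF swap(4)] by auto
    have ij: "i < r" "j < r" "i \<noteq> j" using pij permutes_in_image[OF swap(4)] swap(1-3) by (auto simp: lessThan_iff[symmetric] simp del: lessThan_iff)
    have T: "?T \<in> {..<r} \<rightarrow>\<^sub>E V" using f permutes_in_image[OF swap(4)] by auto
    have "p k = a \<longleftrightarrow> k = i" "p k = b \<longleftrightarrow> k = j" for k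
      using pij permutes_inj[OF swap(4)] by (auto dest: injD)
    then have other: "p k \<noteq> a" "p k \<noteq> b" if "k \<noteq> i" "k \<noteq> j" for k using that by auto
    have "(\<lambda>k\<in>{..<r}. f ((Transposition.transpose a b \<circ> p) k)) = ?T(i := ?T j, j := ?T i)"
    proof
      fix k show "(\<lambda>k\<in>{..<r}. f ((Transposition.transpose a b \<circ> p) k)) k = (?T(i := ?T j, j := ?T i)) k"
        using other[of k] pij ij by (cases "k = i"; cases "k = j") (auto simp: transpose_def)
    qed
    then show ?case by (simp only: swap_eq[OF T ij] swap(5) minus_zero)
  qed
  \<comment> \<open>Entries from position \<open>k\<close> on are among the vectors
    \<open>f\<close>, those before \<open>k\<close> are arbitrary. Each step of the induction
    expands one more entry.\<close>
  have claim: "\<forall>u\<in>{..<r} \<rightarrow>\<^sub>E V. (\<forall>i. k \<le> i \<and> i < r \<longrightarrow> (\<exists>m<r. u i = f m)) \<longrightarrow> D u = 0" if "k \<le> r" for k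
    using that
  proof (induction k)
    case 0
    show ?case
    proof (intro ballI impI)
      fix u assume u: "u \<in> {..<r} \<rightarrow>\<^sub>E V" and m: "\<forall>i. 0 \<le> i \<and> i < r \<longrightarrow> (\<exists>m<r. u i = f m)"
      then have "\<forall>i\<in>{..<r}. \<exists>m. m < r \<and> u i = f m" by auto
      from bchoice[OF this] obtain \<sigma> where \<sigma>: "\<forall>i\<in>{..<r}. \<sigma> i < r \<and> u i = f (\<sigma> i)" by (elim exE) (rule that)
      show "D u = 0"
      proof (cases "inj_on \<sigma> {..<r}")
        case True
        define p where "p i = (if i < r then \<sigma> i else i)" for i
        have "inj_on p {..<r}" using True by (auto simp: p_def inj_on_def)
        then have "p permutes {..<r}" by (rule inj_imp_permutes) (use \<sigma> in \<open>auto simp: p_def\<close>)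
        moreover have "u = (\<lambda>i\<in>{..<r}. f (p i))"
          using u \<sigma> by (auto simp: fun_eq_iff restrict_def p_def PiE_def extensional_def)
        ultimately show ?thesis using perm by simp
      next
        case False
        then obtain i j where "i < r" "j < r" "i \<noteq> j" "\<sigma> i = \<sigma> j" by (auto simp: inj_on_def)
        then show ?thesis using alt[OF u, of i j] \<sigma> by simp
      qed
    qed
  next
    case (Suc k)
    show ?case
    proof (intro ballI impI)
      fix u assume u: "u \<in> {..<r} \<rightarrow>\<^sub>E V" and m: "\<forall>i. Suc k \<le> i \<and> i < r \<longrightarrow> (\<exists>m<r. u i = f m)"
      have k: "k < r" using Suc.prems by simp
      have uk: "u k \<in> V" using u k by auto
      from span[OF uk] obtain z where z: "u k = (\<Sum>m<r. sc (z m) (f m))" by blast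
      have IH: "D (u(k := f m)) = 0" if "m < r" for m
      proof -
        have "u(k := f m) \<in> {..<r} \<rightarrow>\<^sub>E V" using upd[OF u k f[OF that]] .
        moreover have "\<exists>l<r. (u(k := f m)) i = f l" if i: "k \<le> i \<and> i < r" for i
        proof (cases "i = k")
          case True then show ?thesis using \<open>m < r\<close> by auto
        next
          case False then show ?thesis using m i by simp
        qed
        ultimately show ?thesis using Suc.IH k by simp
      qed
      have "D (u(k := \<Sum>m\<in>A. sc (z m) (f m))) = 0" if "A \<subseteq> {..<r}" for A
      proof -
        have "finite A" using that finite_subset by blast
        then show ?thesis using that
        proof (induction A rule: finite_induct)
          case empty
          \<comment> \<open>The empty sum is written as the multiple of \<open>u k\<close> by
            \<open>0\<close>, so that homogeneity applies.\<close>
          have "D (u(k := sc 0 (u k))) = sw 0 (D (u(k := u k)))" by (rule scale[OF u k uk])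
          then show ?case by (simp only: V.scale_zero_left W.scale_zero_left sum.empty)
        next
          case (insert a A)
          have "(\<Sum>m\<in>A. sc (z m) (f m)) \<in> V"
            using insert.prems f by (intro V.subspace_sum[OF sub] V.subspace_scale[OF sub]) auto
          moreover have "sc (z a) (f a) \<in> V" using insert.prems f by (intro V.subspace_scale[OF sub]) auto
          ultimately have "D (u(k := \<Sum>m\<in>insert a A. sc (z m) (f m)))
            = D (u(k := sc (z a) (f a))) + D (u(k := \<Sum>m\<in>A. sc (z m) (f m)))"
            using insert.hyps add[OF u k] by simp
          also have "D (u(k := sc (z a) (f a))) = 0" using scale[OF u k f] IH insert.prems by simp
          finally show ?case using insert by simp
        qed
      qed
      from this[OF subset_refl] show "D u = 0" using z by (metis fun_upd_triv)
    qed
  qed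
  show ?thesis by (rule claim[OF order_refl, THEN bspec, OF u, THEN mp]) auto
qed

lemma zopen_finite_Int:
  assumes "X \<subseteq> proj_space" "finite A" "\<And>i. i \<in> A \<Longrightarrow> zopen X (W i)"
  shows "zopen X (X \<inter> (\<Inter>i\<in>A. W i))"
  using assms(2,3)
proof (induction A rule: finite_induct)
  case empty then show ?case using zopen_self[OF assms(1)] by simp
next
  case (insert a A)
  have "X \<inter> (\<Inter>i\<in>insert a A. W i) = W a \<inter> (X \<inter> (\<Inter>i\<in>A. W i))" by auto
  moreover have "zopen X (W a)" "zopen X (X \<inter> (\<Inter>i\<in>A. W i))" using insert by auto
  then have "zopen X (W a \<inter> (X \<inter> (\<Inter>i\<in>A. W i)))" by (rule zopen_Int)
  ultimately show ?case by (simp only:)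
qed

lemma rat_prod: "(\<And>i. i \<in> A \<Longrightarrow> rat X (e i) (g i) x) \<Longrightarrow> rat X (\<Sum>i\<in>A. e i) (\<lambda>v. \<Prod>i\<in>A. g i v) x"
  by (induction A rule: infinite_finite_induct) (auto simp: rat_const intro: rat_mult)

text \<open>Converse to \<open>steiner_presented\<close>: subbundles are constructed as
  presentations, and this returns them to the definition by an exact sequence.\<close>

lemma presented_steiner:
  assumes "presented E r \<eta> a I c" shows "steiner E r"
proof -
  interpret presented E r \<eta> a I c by (rule assms)
  let ?P = "proj_space :: ('a ^ 'b) set set"
  let ?T0 = "twist_power ?P 0 (card I)" and ?T1 = "twist_power ?P 1 c"
  obtain h where h: "bij_betw h I {..<card I}" using ex_bij_betw_finite_nat[OF fin] by (auto simp: atLeast0LessThan)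
  from framed_twist_power[OF subset_refl, of 0 "card I"] obtain bv0 where "framed ?T0 ?P {..<card I} (\<lambda>_. 0) bv0" by blast
  from framed_reindex[OF this h] obtain bv where "framed ?T0 ?P I (\<lambda>_. 0) bv" by blast
  then interpret T0: framed ?T0 ?P I "\<lambda>_. 0" bv .
  from framed_twist_power[OF subset_refl, of 1 c] obtain cv where "framed ?T1 ?P {..<c} (\<lambda>_. 1) cv" by blast
  then interpret T1: framed ?T1 ?P "{..<c}" "\<lambda>_. 1" cv .
  have op: "zopen ?P ?P" by (rule zopen_self) simp
  define \<phi> where "\<phi> y u = (\<Sum>i\<in>I. smult ?T0 (\<eta> y u i) (bv i (rep y)))" for y u
  define \<psi> where "\<psi> y g = (\<Sum>j<c. smult ?T1 (\<Sum>i\<in>I. a j i (rep y) * T0.coeff (rep y) g i) (cv j (rep y)))" for y g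
  have \<phi>: "\<phi> (pt v) u = (\<Sum>i\<in>I. smult ?T0 (\<eta> (pt v) u i) (bv i v))" if v: "v \<noteq> 0" for v u
  proof -
    obtain t where t: "t \<noteq> 0" "rep (pt v) = t *s v" using rep_pt[OF v] by blast
    then show ?thesis unfolding \<phi>_def t(2) using T0.homogeneous[OF v _ t(1)] v by (intro sum.cong) auto
  qed
  have \<psi>: "\<psi> (pt v) g = (\<Sum>j<c. smult ?T1 (\<Sum>i\<in>I. a j i v * T0.coeff v g i) (cv j v))"
    if v: "v \<noteq> 0" and g: "g \<in> fibre ?T0 (pt v)" for v g
  proof -
    obtain t where t: "t \<noteq> 0" "rep (pt v) = t *s v" using rep_pt[OF v] by blast
    have "(\<Sum>i\<in>I. a j i (t *s v) * T0.coeff (t *s v) g i) = t * (\<Sum>i\<in>I. a j i v * T0.coeff v g i)" if "j < c" for j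
      using T0.coeff_scale[OF v _ t(1) g] a_scale[OF that] v by (simp add: sum_distrib_left mult.assoc)
    \<comment> \<open>The factor \<open>1 / t\<close> cancels the factor \<open>t\<close> of the
      linear entries, so \<open>\<psi>\<close> does not depend on the representative.\<close>
    moreover have "cv j (t *s v) = smult ?T1 (1 / t) (cv j v)" if "j < c" for j
      using T1.homogeneous[OF v _ t(1)] v that by (simp add: power_int_minus inverse_eq_divide)
    ultimately show ?thesis unfolding \<psi>_def t(2) using t(1) by (intro sum.cong) auto
  qed
  have \<phi>_in: "\<phi> (pt v) u \<in> fibre ?T0 (pt v)" if "v \<noteq> 0" for v u
    unfolding \<phi>[OF that] using T0.sum_in_fibre[OF that] that by simp
  have hom1: "bundle_hom E ?T0 \<phi>"
    unfolding bundle_hom_def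
  proof (intro conjI ballI allI impI)
    show "base E = base ?T0" using base T0.base by simp
  next
    fix x assume "x \<in> base E"
    then have x: "x \<in> ?P" using base by simp
    then obtain v where v: "v \<noteq> 0" "x = pt v" using proj_spaceE by blast
    show "\<phi> x ` fibre E x \<subseteq> fibre ?T0 x" using \<phi>_in[OF v(1)] v(2) by auto
    fix u assume u: "u \<in> fibre E x"
    show "\<phi> x (smult E t u) = smult ?T0 t (\<phi> x u)" for t
      unfolding v(2) \<phi>[OF v(1)] using eta_scale[OF x u] v(2) by (simp add: T0.scale_sum_right)
    fix w assume w: "w \<in> fibre E x"
    show "\<phi> x (u + w) = \<phi> x u + \<phi> x w"
      unfolding v(2) \<phi>[OF v(1)] using eta_add[OF x u w] v(2) by (simp add: T0.scale_left_distrib sum.distrib)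
  next
    fix U s assume "zopen (base E) U" and s: "s \<in> sects E U"
    then have U: "zopen ?P U" using base by simp
    show "(\<lambda>x. \<phi> x (s x)) \<in> sects ?T0 U"
      unfolding T0.sects[OF U]
    proof
      fix x assume x: "x \<in> U"
      have "eventually (\<lambda>v. \<phi> (pt v) (s (pt v)) = (\<Sum>i\<in>I. smult ?T0 (\<eta> (pt v) (s (pt v)) i) (bv i v))) (zn ?P x)"
        using eventually_zn_open[OF U x subset_refl] by eventually_elim (simp add: \<phi>)
      then show "\<exists>f. (\<forall>i\<in>I. rat ?P 0 (f i) x) \<and>
          eventually (\<lambda>v. \<phi> (pt v) (s (pt v)) = (\<Sum>i\<in>I. smult ?T0 (f i v) (bv i v))) (zn ?P x)"
        using eta_regular[OF U s x] by (intro exI[of _ "\<lambda>i v. \<eta> (pt v) (s (pt v)) i"]) simp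
    qed
  qed
  have hom2: "bundle_hom ?T0 ?T1 \<psi>"
    unfolding bundle_hom_def
  proof (intro conjI ballI allI impI)
    show "base ?T0 = base ?T1" using T1.base T0.base by simp
  next
    fix x assume "x \<in> base ?T0"
    then have x: "x \<in> ?P" using T0.base by simp
    then obtain v where v: "v \<noteq> 0" "x = pt v" using proj_spaceE by blast
    have vP: "pt v \<in> ?P" using v by simp
    show "\<psi> x ` fibre ?T0 x \<subseteq> fibre ?T1 x" using \<psi>[OF v(1)] T1.sum_in_fibre[OF v(1) vP] v(2) by auto
    have sub: "T0.subspace (fibre ?T0 x)" by (rule T0.fibre_subspace[OF x])
    fix u assume u: "u \<in> fibre ?T0 x"
    show "\<psi> x (smult ?T0 t u) = smult ?T1 t (\<psi> x u)" for t
      using T0.subspace_scale[OF sub u] u \<psi>[OF v(1)] T0.coeff_smult[OF v(1) vP]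
      by (simp add: v(2) T1.scale_sum_right sum_distrib_left mult.left_commute)
    fix w assume w: "w \<in> fibre ?T0 x"
    show "\<psi> x (u + w) = \<psi> x u + \<psi> x w"
      using T0.subspace_add[OF sub u w] u w \<psi>[OF v(1)] T0.coeff_add[OF v(1) vP]
      by (simp add: v(2) distrib_left sum.distrib T1.scale_left_distrib)
  next
    fix U s assume "zopen (base ?T0) U" and s: "s \<in> sects ?T0 U"
    then have U: "zopen ?P U" using T0.base by simp
    show "(\<lambda>x. \<psi> x (s x)) \<in> sects ?T1 U"
      unfolding T1.sects[OF U]
    proof
      fix x assume x: "x \<in> U"
      then have xP: "x \<in> ?P" using zopen_subset[OF U] by auto
      have "eventually (\<lambda>v. \<psi> (pt v) (s (pt v)) = (\<Sum>j<c. smult ?T1 (\<Sum>i\<in>I. a j i v * T0.coeff v (s (pt v)) i) (cv j v))) (zn ?P x)"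
        using eventually_zn_open[OF U x subset_refl]
        by eventually_elim (use \<psi> T0.sects_in_fibre[OF U s] in auto)
      moreover have "rat ?P 1 (\<lambda>v. \<Sum>i\<in>I. a j i v * T0.coeff v (s (pt v)) i) x" if "j < c" for j
      proof (rule rat_sum[OF _ subset_refl xP])
        fix i assume i: "i \<in> I"
        show "rat ?P 1 (\<lambda>v. a j i v * T0.coeff v (s (pt v)) i) x"
          using rat_mult[OF a_rat[OF that i] T0.rat_coeff[OF U s x i]] by simp
      qed
      ultimately show "\<exists>f. (\<forall>j\<in>{..<c}. rat ?P 1 (f j) x) \<and>
          eventually (\<lambda>v. \<psi> (pt v) (s (pt v)) = (\<Sum>j<c. smult ?T1 (f j v) (cv j v))) (zn ?P x)"
        by (intro exI[of _ "\<lambda>j v. \<Sum>i\<in>I. a j i v * T0.coeff v (s (pt v)) i"]) simp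
    qed
  qed
  have "short_exact E ?T0 ?T1 \<phi> \<psi>"
    unfolding short_exact_def
  proof (intro conjI ballI hom1 hom2)
    fix x assume "x \<in> base ?T0"
    then have x: "x \<in> ?P" using T0.base by simp
    then obtain v where v: "v \<noteq> 0" "x = pt v" using proj_spaceE by blast
    have vP: "pt v \<in> ?P" using v by simp
    show "inj_on (\<phi> x) (fibre E x)"
    proof (rule inj_onI)
      fix u w assume u: "u \<in> fibre E x" and w: "w \<in> fibre E x" and eq: "\<phi> x u = \<phi> x w"
      have sums: "(\<Sum>i\<in>I. smult ?T0 (\<eta> (pt v) u i) (bv i v)) = (\<Sum>i\<in>I. smult ?T0 (\<eta> (pt v) w i) (bv i v))"
        using eq unfolding v(2) \<phi>[OF v(1)] .
      have "\<eta> (pt v) u i = \<eta> (pt v) w i" if "i \<in> I" for i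
        by (rule T0.coeff_unique[OF v(1) vP sums that])
      then show "u = w" using eta_eq[OF x u w] v(2) by simp
    qed
    have \<psi>_sum: "\<psi> (pt v) (\<Sum>i\<in>I. smult ?T0 (y i) (bv i v)) = (\<Sum>j<c. smult ?T1 (\<Sum>i\<in>I. a j i v * y i) (cv j v))" for y
      using \<psi>[OF v(1) T0.sum_in_fibre[OF v(1) vP]] T0.coeff_eq[OF v(1) vP refl, of _ y] by simp
    show "\<phi> x ` fibre E x = {u \<in> fibre ?T0 x. \<psi> x u = 0}"
    proof (intro set_eqI iffI)
      fix g assume "g \<in> \<phi> x ` fibre E x"
      then obtain u where u: "u \<in> fibre E x" "g = \<phi> x u" by blast
      have "\<psi> x g = (\<Sum>j<c. smult ?T1 (\<Sum>i\<in>I. a j i v * \<eta> (pt v) u i) (cv j v))"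
        unfolding u(2) v(2) \<phi>[OF v(1)] \<psi>_sum ..
      also have "\<dots> = 0" using eta_in_kernel[OF v(1)] u(1) v(2) by (intro sum.neutral) auto
      finally show "g \<in> {u \<in> fibre ?T0 x. \<psi> x u = 0}" using \<phi>_in[OF v(1)] u v(2) by simp
    next
      fix g assume "g \<in> {u \<in> fibre ?T0 x. \<psi> x u = 0}"
      then have g: "g \<in> fibre ?T0 (pt v)" "\<psi> (pt v) g = 0" using v(2) by auto
      obtain y where y: "g = (\<Sum>i\<in>I. smult ?T0 (y i) (bv i v))" using T0.fibre[OF v(1) vP] g(1) by auto
      have z: "(\<Sum>j<c. smult ?T1 (\<Sum>i\<in>I. a j i v * y i) (cv j v)) = 0" using g(2) unfolding y \<psi>_sum .
      have "\<forall>j<c. (\<Sum>i\<in>I. a j i v * y i) = 0" using T1.indep[OF v(1) vP z] by simp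
      then obtain u where u: "u \<in> fibre E (pt v)" "\<forall>i\<in>I. \<eta> (pt v) u i = y i" using eta_kernel[OF v(1), of y] by blast
      then have "\<phi> x u = g" unfolding v(2) \<phi>[OF v(1)] y by simp
      then show "g \<in> \<phi> x ` fibre E x" using u(1) v(2) by blast
    qed
    show "\<psi> x ` fibre ?T0 x = fibre ?T1 x"
    proof (intro set_eqI iffI)
      fix g assume "g \<in> \<psi> x ` fibre ?T0 x"
      then show "g \<in> fibre ?T1 x" using bundle_homD(2)[OF hom2] x T0.base by auto
    next
      fix g assume g: "g \<in> fibre ?T1 x"
      then obtain z where z: "g = (\<Sum>j<c. smult ?T1 (z j) (cv j v))" using T1.fibre[OF v(1) vP] v(2) by auto
      obtain y where y: "\<forall>j<c. (\<Sum>i\<in>I. a j i v * y i) = z j" using a_surj[OF v(1)] by blast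
      have "\<psi> x (\<Sum>i\<in>I. smult ?T0 (y i) (bv i v)) = g" unfolding v(2) \<psi>_sum z using y by simp
      moreover have "(\<Sum>i\<in>I. smult ?T0 (y i) (bv i v)) \<in> fibre ?T0 x"
        unfolding v(2) by (rule T0.sum_in_fibre[OF v(1) vP])
      ultimately show "g \<in> \<psi> x ` fibre ?T0 x" by (intro image_eqI[of g "\<psi> x"]) (rule sym)
    qed
  qed
  then show ?thesis unfolding steiner_def by (intro conjI vector_bundle_axioms base exI)
qed

text \<open>The determinant form evaluated on a homogeneous frame is a function on the cone whose
  degree is the difference of the two sides. It has no zeros, so \<open>global_unit_degree_0\<close>
  makes this degree zero.\<close>

lemma first_chern_line:
  fixes E :: "(('k::{alg_closed_field, field_char_0} ^ 'n::finite) set, 'k, 'v::ab_group_add) vbundle"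
  assumes "vector_bundle E r" and base: "base E = proj_space" and ch: "first_chern E r e"
    and vw: "indep2 v w" and fr: "framed (restrict_bundle (line v w) E) (line v w) J d b"
  shows "e = (\<Sum>j\<in>J. d j)"
proof -
  interpret vector_bundle E r by (rule assms(1))
  let ?L = "line v w"
  interpret fr: framed "restrict_bundle ?L E" ?L J d b by (rule fr)
  have L: "?L \<subseteq> proj_space" by (rule line_subset[OF vw])
  have Lb: "?L \<subseteq> base E" using L base by simp
  have "?L \<noteq> {}" using pt_in_line[of 1 0 v w] by auto
  then have cardJ: "card J = r" using framed_restrict_card[OF fr Lb] by simp
  obtain h where h: "bij_betw h {..<r} J"
    using ex_bij_betw_nat_finite[OF fr.fin] cardJ by (auto simp: atLeast0LessThan)
  have hJ: "h i \<in> J" if "i < r" for i using h that by (auto simp: bij_betw_def)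
  have sum_h: "(\<Sum>i<r. g (h i)) = (\<Sum>j\<in>J. g j)" for g :: "_ \<Rightarrow> int" by (rule sum.reindex_bij_betw[OF h])
  have sum_h': "(\<Sum>i<r. g (h i)) = (\<Sum>j\<in>J. g j)" for g :: "_ \<Rightarrow> 'v" by (rule sum.reindex_bij_betw[OF h])
  have sm: "smult (restrict_bundle ?L E) = smult E" "fibre (restrict_bundle ?L E) = fibre E"
    by (simp_all add: restrict_bundle_def)
  let ?T = "twist (proj_space :: ('k ^ 'n) set set) e"
  have tw: "smult ?T a g = (\<lambda>v. a * g v)" for a g by (simp add: twist_def)
  from ch obtain \<delta> :: "('k ^ 'n) set \<Rightarrow> (nat \<Rightarrow> 'v) \<Rightarrow> 'k ^ 'n \<Rightarrow> 'k" where
    \<delta>: "\<forall>x\<in>base E.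
       (\<forall>u\<in>{..<r} \<rightarrow>\<^sub>E fibre E x.
         \<delta> x u \<in> fibre (twist (base E) e) x \<and>
         (\<forall>i<r. \<forall>v\<in>fibre E x. \<forall>w\<in>fibre E x. \<delta> x (u(i := v + w)) = \<delta> x (u(i := v)) + \<delta> x (u(i := w))) \<and>
         (\<forall>i<r. \<forall>a. \<forall>v\<in>fibre E x.
            \<delta> x (u(i := smult E a v)) = smult (twist (base E) e) a (\<delta> x (u(i := v)))) \<and>
         (\<forall>i<r. \<forall>j<r. i \<noteq> j \<longrightarrow> u i = u j \<longrightarrow> \<delta> x u = 0)) \<and>
       (\<exists>u\<in>{..<r} \<rightarrow>\<^sub>E fibre E x. \<delta> x u \<noteq> 0)"
    and \<delta>_reg: "\<forall>U s. zopen (base E) U \<longrightarrow> (\<forall>i<r. s i \<in> sects E U) \<longrightarrow>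
      (\<lambda>x. \<delta> x (\<lambda>i\<in>{..<r}. s i x)) \<in> sects (twist (base E) e) U"
    unfolding first_chern_def by (elim exE conjE) (rule that)
  note \<delta> = \<delta>[unfolded base]
  have \<delta>_in: "\<delta> x u \<in> fibre ?T x" if "x \<in> proj_space" "u \<in> {..<r} \<rightarrow>\<^sub>E fibre E x" for x u
    using \<delta> that by blast
  have \<delta>_add: "\<delta> x (u(i := p + q)) = \<delta> x (u(i := p)) + \<delta> x (u(i := q))"
    if "x \<in> proj_space" "u \<in> {..<r} \<rightarrow>\<^sub>E fibre E x" "i < r" "p \<in> fibre E x" "q \<in> fibre E x" for x u i p q
    using \<delta>[THEN bspec, OF that(1), THEN conjunct1, THEN bspec, OF that(2)] that(3-) by simp
  have \<delta>_scale: "\<delta> x (u(i := smult E a p)) = smult ?T a (\<delta> x (u(i := p)))"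
    if "x \<in> proj_space" "u \<in> {..<r} \<rightarrow>\<^sub>E fibre E x" "i < r" "p \<in> fibre E x" for x u i p a
    using \<delta>[THEN bspec, OF that(1), THEN conjunct1, THEN bspec, OF that(2)] that(3-) by simp
  have \<delta>_alt: "\<delta> x u = 0"
    if "x \<in> proj_space" "u \<in> {..<r} \<rightarrow>\<^sub>E fibre E x" "i < r" "j < r" "i \<noteq> j" "u i = u j" for x u i j
    using \<delta>[THEN bspec, OF that(1), THEN conjunct1, THEN bspec, OF that(2)] that(3-) by simp
  have \<delta>_ex: "\<exists>u\<in>{..<r} \<rightarrow>\<^sub>E fibre E x. \<delta> x u \<noteq> 0" if "x \<in> proj_space" for x
    using \<delta>[THEN bspec, OF that, THEN conjunct2] .
  have P: "pt u \<in> proj_space" if "pt u \<in> ?L" for u using that L by auto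
  have sub: "subspace (fibre E (pt u))" if "pt u \<in> ?L" for u using fibre_subspace P[OF that] base by simp
  have b_in: "b (h i) u \<in> fibre E (pt u)" if "u \<noteq> 0" "pt u \<in> ?L" "i < r" for i u
    using fr.b_in_fibre[OF that(1,2) hJ[OF that(3)]] sm by simp
  have bt_in: "(\<lambda>i\<in>{..<r}. b (h i) u) \<in> {..<r} \<rightarrow>\<^sub>E fibre E (pt u)" if "u \<noteq> 0" "pt u \<in> ?L" for u
    using b_in[OF that] by auto
  \<comment> \<open>The form takes values in the fibre of \<open>O(e)\<close>, which consists of
    functions on the cone; evaluating at \<open>u\<close> itself gives a scalar function of
    \<open>u\<close>.\<close>
  define D where "D u = \<delta> (pt u) (\<lambda>i\<in>{..<r}. b (h i) u) u" for u
  have D_nz: "D u \<noteq> 0" if u: "u \<noteq> 0" "pt u \<in> ?L" for u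
  proof
    assume "D u = 0"
    then have z: "\<delta> (pt u) (\<lambda>i\<in>{..<r}. b (h i) u) = 0"
      using \<delta>_in[OF P[OF u(2)] bt_in[OF u]] unfolding twist_fibre_iff[OF u(1)] D_def
      by (simp add: gen_def[abs_def] fun_eq_iff)
    obtain f where f: "f \<in> {..<r} \<rightarrow>\<^sub>E fibre E (pt u)" "\<delta> (pt u) f \<noteq> 0" using \<delta>_ex[OF P[OF u(2)]] by blast
    have "\<delta> (pt u) f = 0"
    proof (rule alternating_zero[where D = "\<delta> (pt u)" and f = "\<lambda>i. b (h i) u" and sc = "smult E" and sw = "smult ?T"
          and V = "fibre E (pt u)" and r = r])
      show "\<exists>z. p = (\<Sum>i<r. smult E (z i) (b (h i) u))" if p: "p \<in> fibre E (pt u)" for p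
      proof -
        obtain z where "p = (\<Sum>j\<in>J. smult E (z j) (b j u))" using fr.fibre[OF u] p sm by auto
        then show ?thesis using sum_h'[of "\<lambda>j. smult E (z j) (b j u)"] by (intro exI[of _ "\<lambda>i. z (h i)"]) simp
      qed
    next
      show "vector_space (smult E)" "vector_space (smult ?T)"
        by (rule vector_space_axioms, rule twist_smult_vector_space)
      show "subspace (fibre E (pt u))" by (rule sub[OF u(2)])
      show "\<delta> (pt u) (\<lambda>i\<in>{..<r}. b (h i) u) = 0" by (rule z)
      show "f \<in> {..<r} \<rightarrow>\<^sub>E fibre E (pt u)" by (rule f(1))
    qed (fact \<delta>_add[OF P[OF u(2)]] \<delta>_scale[OF P[OF u(2)]] \<delta>_alt[OF P[OF u(2)]] b_in[OF u])+
    then show False using f(2) by simp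
  qed
  \<comment> \<open>The arguments are rescaled one at a time; \<open>k\<close> counts those already
    done.\<close>
  have D_scale: "\<delta> (pt u) (\<lambda>i\<in>{..<r}. smult E (t i) (b (h i) u)) u = (\<Prod>i<r. t i) * D u"
    if u: "u \<noteq> 0" "pt u \<in> ?L" for u t
  proof -
    have "\<delta> (pt u) (\<lambda>i\<in>{..<r}. if i < k then smult E (t i) (b (h i) u) else b (h i) u) u = (\<Prod>i<k. t i) * D u"
      if "k \<le> r" for k
      using that
    proof (induction k)
      case 0 show ?case by (simp only: D_def not_less_zero if_False lessThan_0 prod.empty mult_1)
    next
      case (Suc k)
      let ?f = "\<lambda>i\<in>{..<r}. if i < k then smult E (t i) (b (h i) u) else b (h i) u"
      have k: "k < r" using Suc.prems by simp
      have f: "?f \<in> {..<r} \<rightarrow>\<^sub>E fibre E (pt u)"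
        using b_in[OF u] subspace_scale[OF sub[OF u(2)]] by auto
      have "(\<lambda>i\<in>{..<r}. if i < Suc k then smult E (t i) (b (h i) u) else b (h i) u)
        = ?f(k := smult E (t k) (b (h k) u))" using k by (auto simp: fun_eq_iff restrict_def less_Suc_eq)
      then have step: "\<delta> (pt u) (\<lambda>i\<in>{..<r}. if i < Suc k then smult E (t i) (b (h i) u) else b (h i) u) u
        = t k * \<delta> (pt u) (?f(k := b (h k) u)) u"
        by (simp only: \<delta>_scale[OF P[OF u(2)] f k b_in[OF u k], of "t k"] tw)
      have same: "?f(k := b (h k) u) = ?f" using k by (auto simp: fun_eq_iff restrict_def)
      have IH: "\<delta> (pt u) ?f u = (\<Prod>i<k. t i) * D u" by (rule Suc.IH) (use k in simp)
      show ?case by (simp only: step same IH prod.lessThan_Suc ac_simps)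
    qed
    from this[OF order_refl]
    have "\<delta> (pt u) (\<lambda>i\<in>{..<r}. if i < r then smult E (t i) (b (h i) u) else b (h i) u) u = (\<Prod>i<r. t i) * D u" .
    moreover have "(\<lambda>i\<in>{..<r}. if i < r then smult E (t i) (b (h i) u) else b (h i) u) = (\<lambda>i\<in>{..<r}. smult E (t i) (b (h i) u))"
      by (rule restrict_ext) simp
    ultimately show ?thesis by (simp only:)
  qed
  have D_rat: "rat ?L (e - (\<Sum>j\<in>J. d j)) D x" if x: "x \<in> ?L" for x
  proof -
    obtain u0 where u0: "u0 \<noteq> 0" "x = pt u0" using x L proj_spaceE by blast
    \<comment> \<open>Regularity of the form is known for sections of \<open>E\<close> over open
      sets only, so each frame vector is rescaled and extended off the line. The triples of open
      set, section and coordinate are packed into \<open>p\<close> for one simultaneous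
      choice.\<close>
    have "\<forall>i\<in>{..<r}. \<exists>p. zopen (base E) (fst p) \<and> x \<in> fst p \<and> fst (snd p) \<in> sects E (fst p) \<and>
      (\<forall>u. u \<noteq> 0 \<longrightarrow> pt u \<in> fst p \<inter> ?L \<longrightarrow> u $ snd (snd p) \<noteq> 0 \<and>
        fst (snd p) (pt u) = smult E ((u $ snd (snd p)) powi (d (h i))) (b (h i) u))"
    proof
      fix i assume i: "i \<in> {..<r}"
      then have hi: "h i \<in> J" using hJ by simp
      from restrict_local_section[OF fr Lb x hi] obtain W t k where "zopen (base E) W \<and> x \<in> W \<and> t \<in> sects E W \<and>
        (\<forall>u. u \<noteq> 0 \<longrightarrow> pt u \<in> W \<inter> ?L \<longrightarrow> u $ k \<noteq> 0 \<and> t (pt u) = smult E ((u $ k) powi (d (h i))) (b (h i) u))"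
        by (elim exE) (rule that)
      then show "\<exists>p. zopen (base E) (fst p) \<and> x \<in> fst p \<and> fst (snd p) \<in> sects E (fst p) \<and>
        (\<forall>u. u \<noteq> 0 \<longrightarrow> pt u \<in> fst p \<inter> ?L \<longrightarrow> u $ snd (snd p) \<noteq> 0 \<and>
          fst (snd p) (pt u) = smult E ((u $ snd (snd p)) powi (d (h i))) (b (h i) u))"
        by (intro exI[of _ "(W, t, k)"]) simp
    qed
    from bchoice[OF this] obtain p where p: "\<forall>i\<in>{..<r}. zopen (base E) (fst (p i)) \<and> x \<in> fst (p i) \<and>
      fst (snd (p i)) \<in> sects E (fst (p i)) \<and>
      (\<forall>u. u \<noteq> 0 \<longrightarrow> pt u \<in> fst (p i) \<inter> ?L \<longrightarrow> u $ snd (snd (p i)) \<noteq> 0 \<and>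
        fst (snd (p i)) (pt u) = smult E ((u $ snd (snd (p i))) powi (d (h i))) (b (h i) u))"
      by (elim exE) (rule that)
    define W t k where "W i = fst (p i)" and "t i = fst (snd (p i))" and "k i = snd (snd (p i))" for i
    have W: "\<And>i. i < r \<Longrightarrow> zopen (base E) (W i)" "\<And>i. i < r \<Longrightarrow> x \<in> W i" "\<And>i. i < r \<Longrightarrow> t i \<in> sects E (W i)"
      and t: "\<And>i u. i < r \<Longrightarrow> u \<noteq> 0 \<Longrightarrow> pt u \<in> W i \<inter> ?L \<Longrightarrow> u $ k i \<noteq> 0 \<and> t i (pt u) = smult E ((u $ k i) powi (d (h i))) (b (h i) u)"
      using p unfolding W_def t_def k_def by auto
    let ?W = "base E \<inter> (\<Inter>i\<in>{..<r}. W i)"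
    have oW: "zopen (base E) ?W" using zopen_finite_Int[OF base_subset finite_lessThan, of r W] W(1) by simp
    have xW: "x \<in> ?W" using W(2) x Lb by auto
    have "t i \<in> sects E ?W" if "i < r" for i
      by (rule sects_restrict[OF W(3)[OF that] W(1)[OF that] oW]) (use that in auto)
    then have ts: "\<forall>i<r. t i \<in> sects E ?W" by simp
    have "(\<lambda>x. \<delta> x (\<lambda>i\<in>{..<r}. t i x)) \<in> sects (twist (base E) e) ?W"
      by (rule \<delta>_reg[THEN spec, THEN spec, THEN mp, THEN mp, OF oW ts])
    from twist_sects_iff[OF base_subset oW, THEN iffD1, OF this, THEN bspec, OF xW, THEN conjunct2]
    have 1: "rat ?L e (\<lambda>u. \<delta> (pt u) (\<lambda>i\<in>{..<r}. t i (pt u)) u) x"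
      by (rule rat_mono[OF _ Lb base_subset x])
    have 2: "rat ?L (\<Sum>i<r. - d (h i)) (\<lambda>u. \<Prod>i<r. (u $ k i) powi (- d (h i))) x"
    proof (rule rat_prod)
      show "rat ?L (- d (h i)) (\<lambda>u. (u $ k i) powi (- d (h i))) x" if "i \<in> {..<r}" for i
        unfolding u0(2) by (rule rat_coord_powi[OF L]) (use t[of i u0] W(2) u0 x that in auto)
    qed
    have "e + (\<Sum>i<r. - d (h i)) = e - (\<Sum>j\<in>J. d j)" using sum_h[of d] by (simp add: sum_negf)
    with rat_mult[OF 1 2] have "rat ?L (e - (\<Sum>j\<in>J. d j)) (\<lambda>u. \<delta> (pt u) (\<lambda>i\<in>{..<r}. t i (pt u)) u * (\<Prod>i<r. (u $ k i) powi (- d (h i)))) x"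
      by simp
    then show ?thesis
    proof (rule rat_cong)
      have op: "zopen ?L (?W \<inter> ?L)" "x \<in> ?W \<inter> ?L" using zopen_mono[OF Lb oW] xW x by auto
      show "eventually (\<lambda>u. \<delta> (pt u) (\<lambda>i\<in>{..<r}. t i (pt u)) u * (\<Prod>i<r. (u $ k i) powi (- d (h i))) = D u) (zn ?L x)"
        using eventually_zn_open[OF op L]
      proof eventually_elim
        case (elim u)
        have ti: "u $ k i \<noteq> 0" "t i (pt u) = smult E ((u $ k i) powi (d (h i))) (b (h i) u)" if "i < r" for i
          using t[OF that, of u] elim that by auto
        have "(\<lambda>i\<in>{..<r}. t i (pt u)) = (\<lambda>i\<in>{..<r}. smult E ((u $ k i) powi (d (h i))) (b (h i) u))"
          by (rule restrict_ext) (use ti in simp)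
        then have "\<delta> (pt u) (\<lambda>i\<in>{..<r}. t i (pt u)) u = (\<Prod>i<r. (u $ k i) powi (d (h i))) * D u"
          using D_scale[of u] elim by simp
        moreover have "(\<Prod>i<r. (u $ k i) powi (d (h i))) * (\<Prod>i<r. (u $ k i) powi (- d (h i))) = 1"
          unfolding prod.distrib[symmetric] by (intro prod.neutral) (use ti in \<open>simp add: power_int_minus\<close>)
        ultimately show ?case by (simp add: mult.commute mult.left_commute)
      qed
    qed
  qed
  have cone: "s *s v + t *s w \<noteq> 0" "pt (s *s v + t *s w) \<in> ?L" if "s \<noteq> 0 \<or> t \<noteq> 0" for s t
    using line_nonzero[OF vw that] pt_in_line[OF that] by auto
  have "e - (\<Sum>j\<in>J. d j) = 0"
  proof (rule global_unit_degree_0[OF vw L, where g = D])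
    fix s t :: 'k assume st: "s \<noteq> 0 \<or> t \<noteq> 0"
    show "pt (s *s v + t *s w) \<in> ?L" by (rule cone[OF st])
    then show "rat ?L (e - (\<Sum>j\<in>J. d j)) D (pt (s *s v + t *s w))" by (rule D_rat)
    show "D (s *s v + t *s w) \<noteq> 0" by (rule D_nz[OF cone[OF st]])
    fix a :: 'k assume "a \<noteq> 0"
    then show "D (a *s (s *s v + t *s w)) = a powi (e - (\<Sum>j\<in>J. d j)) * D (s *s v + t *s w)"
      using rat_homogeneous[OF D_rat[OF cone(2)[OF st]] L cone(2)[OF st] cone(1)[OF st]] by blast
  qed
  then show ?thesis by simp
qed

section \<open>Kernels of functionals and generic hyperplanes\<close>

text \<open>The way back from families of coefficients to the sets of basis vectors in
  \<open>locally_trivial\<close>, opposite to \<open>local_frame\<close>.\<close>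

lemma (in vector_space) frame_basis:
  fixes e :: "nat \<Rightarrow> 'b"
  assumes indep: "\<And>z i. (\<Sum>i<r. scale (z i) (e i)) = 0 \<Longrightarrow> i < r \<Longrightarrow> z i = 0"
  shows "inj_on e {..<r}" "independent (e ` {..<r})" "span (e ` {..<r}) = {\<Sum>i<r. scale (z i) (e i) | z. True}"
proof -
  show inj: "inj_on e {..<r}"
  proof (rule inj_onI, rule ccontr)
    fix i j assume ij: "i \<in> {..<r}" "j \<in> {..<r}" "e i = e j" "i \<noteq> j"
    let ?z = "\<lambda>k. (if k = i then 1 else 0) - (if k = j then 1 else 0) :: 'a"
    have "(\<Sum>k<r. scale (?z k) (e k)) = e i - e j"
      using ij by (simp add: scale_left_diff_distrib sum_subtractf if_distrib[of "\<lambda>x. scale x _"] cong: if_cong)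
    then have "?z i = 0" using indep[of ?z i] ij by simp
    then show False using ij by simp
  qed
  show "independent (e ` {..<r})"
  proof
    assume "dependent (e ` {..<r})"
    then obtain u where u: "\<exists>v\<in>e ` {..<r}. u v \<noteq> 0" "(\<Sum>v\<in>e ` {..<r}. scale (u v) v) = 0"
      by (auto simp: dependent_finite)
    then have "(\<Sum>i<r. scale (u (e i)) (e i)) = 0" by (simp add: sum.reindex[OF inj])
    then show False using u(1) indep[of "\<lambda>i. u (e i)"] by auto
  qed
  have "(\<Sum>w\<in>e ` {..<r}. scale (g w) w) = (\<Sum>i<r. scale (g (e i)) (e i))" for g
    by (simp add: sum.reindex[OF inj])
  moreover have "\<exists>g. (\<Sum>i<r. scale (z i) (e i)) = (\<Sum>i<r. scale (g (e i)) (e i))" for z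
    by (rule exI[of _ "\<lambda>w. z (inv_into {..<r} e w)"]) (use inv_into_f_f[OF inj] in \<open>auto intro!: sum.cong\<close>)
  ultimately have "range (\<lambda>g. \<Sum>w\<in>e ` {..<r}. scale (g w) w) = {\<Sum>i<r. scale (z i) (e i) | z. True}"
    by (auto simp: image_def)
  then show "span (e ` {..<r}) = {\<Sum>i<r. scale (z i) (e i) | z. True}" by (simp add: span_finite)
qed

definition kernel_bundle ::
  "('p, 'k, 'v) vbundle \<Rightarrow> ('p \<Rightarrow> 'v \<Rightarrow> 'k::zero) \<Rightarrow> ('p, 'k, 'v) vbundle" where
  "kernel_bundle E \<theta> = \<lparr>base = base E, fibre = (\<lambda>x. {u \<in> fibre E x. \<theta> x u = 0}), smult = smult E,
     sects = (\<lambda>U. {s \<in> sects E U. \<forall>x\<in>U. \<theta> x (s x) = 0})\<rparr>"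

text \<open>Near a point some frame vector \<open>e i0\<close> has nonzero value under
  \<open>\<theta>\<close>; subtracting suitable multiples of it from the other frame vectors puts
  them in the kernel, where they form a frame.\<close>

lemma (in vector_bundle) vector_bundle_kernel:
  assumes add: "\<And>x u w. x \<in> base E \<Longrightarrow> u \<in> fibre E x \<Longrightarrow> w \<in> fibre E x \<Longrightarrow> \<theta> x (u + w) = \<theta> x u + \<theta> x w"
    and scale: "\<And>x u t. x \<in> base E \<Longrightarrow> u \<in> fibre E x \<Longrightarrow> \<theta> x (smult E t u) = t * \<theta> x u"
    and reg: "\<And>U s x. zopen (base E) U \<Longrightarrow> s \<in> sects E U \<Longrightarrow> x \<in> U \<Longrightarrow> rat (base E) 0 (\<lambda>v. \<theta> (pt v) (s (pt v))) x"
    and nz: "\<And>x. x \<in> base E \<Longrightarrow> \<exists>u\<in>fibre E x. \<theta> x u \<noteq> 0"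
  shows "vector_bundle (kernel_bundle E \<theta>) (r - 1)"
proof -
  let ?F = "kernel_bundle E \<theta>"
  have F: "base ?F = base E" "fibre ?F x = {u \<in> fibre E x. \<theta> x u = 0}" "smult ?F = smult E"
    "sects ?F U = {s \<in> sects E U. \<forall>x\<in>U. \<theta> x (s x) = 0}" for x U by (simp_all add: kernel_bundle_def)
  have zero: "\<theta> x 0 = 0" if "x \<in> base E" for x
    using scale[OF that subspace_0[OF fibre_subspace[OF that]], of 0] by simp
  have triv: "\<exists>U e. zopen (base E) U \<and> x \<in> U \<and>
        (\<forall>y\<in>U. inj_on (\<lambda>i. e i y) {..<r - 1} \<and> independent ((\<lambda>i. e i y) ` {..<r - 1}) \<and>
          span ((\<lambda>i. e i y) ` {..<r - 1}) = fibre ?F y) \<and>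
        (\<forall>V. zopen (base E) V \<longrightarrow> V \<subseteq> U \<longrightarrow>
          sects ?F V = {s. \<exists>f. (\<forall>i<r - 1. f i \<in> regular_functions (base E) V) \<and>
            (\<forall>y\<in>V. s y = (\<Sum>i<r - 1. smult E (f i y) (e i y)))})" if x: "x \<in> base E" for x
  proof -
    obtain U e where U: "zopen (base E) U" "x \<in> U"
      and fr: "\<And>y. y \<in> U \<Longrightarrow> fibre E y = {\<Sum>i<r. smult E (z i) (e i y) | z. True}"
        "\<And>y z i. y \<in> U \<Longrightarrow> (\<Sum>i<r. smult E (z i) (e i y)) = 0 \<Longrightarrow> i < r \<Longrightarrow> z i = 0"
      and se: "\<And>V s. zopen (base E) V \<Longrightarrow> V \<subseteq> U \<Longrightarrow> s \<in> sects E V \<longleftrightarrow>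
        (\<exists>f. (\<forall>i<r. \<forall>y\<in>V. rat (base E) 0 (\<lambda>v. f i (pt v)) y) \<and> (\<forall>y\<in>V. s y = (\<Sum>i<r. smult E (f i y) (e i y))))"
      using x by (rule local_frame) blast
    have Ub: "y \<in> base E" if "y \<in> U" for y using zopen_subset[OF U(1)] that by auto
    have e_sum: "e i y = (\<Sum>k<r. smult E (if k = i then 1 else 0) (e k y))" if "i < r" for i y
      using that by (simp add: if_distrib[of "\<lambda>x. smult E x _"] cong: if_cong)
    have e_in: "e i y \<in> fibre E y" if "y \<in> U" "i < r" for i y
      unfolding fr(1)[OF that(1)] by (intro CollectI exI[of _ "\<lambda>k. if k = i then 1 else 0"]) (simp only: e_sum[OF that(2), symmetric] simp_thms)
    have e_sect: "e i \<in> sects E U" if "i < r" for i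
      unfolding se[OF U(1) subset_refl] using e_sum[OF that]
      by (intro exI[of _ "\<lambda>k y. if k = i then 1 else 0"]) (auto simp: rat_const)
    define l where "l i y = \<theta> y (e i y)" for i y
    have l_rat: "rat (base E) 0 (\<lambda>v. l i (pt v)) y" if "i < r" "y \<in> U" for i y
      unfolding l_def by (rule reg[OF U(1) e_sect[OF that(1)] that(2)])
    have \<theta>_sum: "\<theta> y (\<Sum>i\<in>A. smult E (z i) (e i y)) = (\<Sum>i\<in>A. z i * l i y)" if y: "y \<in> U" and A: "A \<subseteq> {..<r}" for y z A
    proof -
      have "finite A" using A finite_subset by blast
      then show ?thesis using A
      proof (induction A rule: finite_induct)
        case empty then show ?case using zero[OF Ub[OF y]] by simp
      next
        case (insert a A)
        have sub: "subspace (fibre E y)" by (rule fibre_subspace[OF Ub[OF y]])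
        have "(\<Sum>i\<in>A. smult E (z i) (e i y)) \<in> fibre E y"
          using insert.prems e_in[OF y] by (intro subspace_sum[OF sub] subspace_scale[OF sub]) auto
        then show ?case using insert e_in[OF y, of a]
          by (simp add: add[OF Ub[OF y]] scale[OF Ub[OF y]] subspace_scale[OF sub] l_def)
      qed
    qed
    have "\<exists>i0<r. l i0 x \<noteq> 0"
    proof (rule ccontr)
      assume "\<not> ?thesis"
      then have "\<theta> x u = 0" if "u \<in> fibre E x" for u
        using that \<theta>_sum[OF U(2) subset_refl] unfolding fr(1)[OF U(2)] by auto
      then show False using nz[OF x] by blast
    qed
    then obtain i0 where i0: "i0 < r" "l i0 x \<noteq> 0" by blast
    obtain v0 where v0: "v0 \<noteq> 0" "x = pt v0" using x base_subset proj_spaceE by blast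
    have "eventually (\<lambda>v. l i0 (pt v) \<noteq> 0) (zn (base E) (pt v0))"
      using rat_eventually_nonzero[where g = "\<lambda>v. l i0 (pt v)", OF _ _ base_subset] l_rat[OF i0(1) U(2)] i0 v0 x by simp
    then have "eventually (\<lambda>v. l i0 (pt v) \<noteq> 0) (zn (base E) x)" using v0 by simp
    from this[unfolded eventually_zn[OF base_subset x]]
    obtain W where W: "zopen (base E) W" "x \<in> W" "\<forall>y\<in>W. \<forall>v\<in>y - {0}. l i0 (pt v) \<noteq> 0"
      by (elim exE conjE) (rule that)
    define U' where "U' = U \<inter> W"
    have U': "zopen (base E) U'" "x \<in> U'" "U' \<subseteq> U" unfolding U'_def using U W by (auto intro: zopen_Int)
    have l0: "l i0 y \<noteq> 0" if y: "y \<in> U'" for y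
    proof -
      have "y \<in> proj_space" using y U'(3) Ub base_subset by auto
      then obtain v where "v \<noteq> 0" "y = pt v" using proj_spaceE by blast
      then show ?thesis using W(3) y self_in_pt[of v] unfolding U'_def by blast
    qed
    let ?K = "{..<r} - {i0}"
    have "card ?K = r - 1" using i0 by simp
    then obtain \<sigma> where \<sigma>: "bij_betw \<sigma> {..<r - 1} ?K"
      using ex_bij_betw_nat_finite[of ?K] by (auto simp: atLeast0LessThan)
    define \<rho> where "\<rho> = inv_into {..<r - 1} \<sigma>"
    have \<sigma>K: "\<sigma> i < r" "\<sigma> i \<noteq> i0" "\<rho> (\<sigma> i) = i" if "i < r - 1" for i
      using \<sigma> that unfolding \<rho>_def by (auto simp: bij_betw_def)
    have \<rho>: "\<sigma> (\<rho> k) = k" "\<rho> k < r - 1" if "k \<in> ?K" for k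
      using \<sigma> that inv_into_into[of k \<sigma> "{..<r - 1}"] f_inv_into_f[of k \<sigma> "{..<r - 1}"] unfolding \<rho>_def by (auto simp: bij_betw_def)
    \<comment> \<open>The multiple of \<open>e i0\<close> is the one that makes
      \<open>\<theta>\<close> vanish.\<close>
    define e' where "e' i y = e (\<sigma> i) y + smult E (- l (\<sigma> i) y / l i0 y) (e i0 y)" for i y
    \<comment> \<open>Coefficients in the old frame of the kernel vector that has the prescribed
      coefficients away from \<open>i0\<close>; the one at \<open>i0\<close> is forced by
      \<open>\<theta>\<close>.\<close>
    define ext where "ext w y k = (if k = i0 then - (\<Sum>k\<in>?K. w k * l k y) / l i0 y else w k)" for w :: "nat \<Rightarrow> 'k" and y k
    have reK: "(\<Sum>i<r - 1. g (\<sigma> i)) = (\<Sum>k\<in>?K. g k)" for g :: "nat \<Rightarrow> 'v" by (rule sum.reindex_bij_betw[OF \<sigma>])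
    have split: "(\<Sum>k<r. g k) = g i0 + (\<Sum>k\<in>?K. g k)" for g :: "nat \<Rightarrow> 'v" using i0 by (simp add: sum.remove)
    have split': "(\<Sum>k<r. g k) = g i0 + (\<Sum>k\<in>?K. g k)" for g :: "nat \<Rightarrow> 'k" using i0 by (simp add: sum.remove)
    have I1: "(\<Sum>i<r - 1. smult E (z i) (e' i y)) = (\<Sum>k<r. smult E (ext (\<lambda>k. z (\<rho> k)) y k) (e k y))" for z y
    proof -
      let ?w = "\<lambda>k. z (\<rho> k)"
      have "(\<Sum>i<r - 1. smult E (z i) (e' i y)) = (\<Sum>i<r - 1. smult E (?w (\<sigma> i)) (e (\<sigma> i) y + smult E (- l (\<sigma> i) y / l i0 y) (e i0 y)))"
        using \<sigma>K by (intro sum.cong) (auto simp: e'_def)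
      also have "\<dots> = (\<Sum>k\<in>?K. smult E (?w k) (e k y + smult E (- l k y / l i0 y) (e i0 y)))" by (rule reK)
      also have "\<dots> = (\<Sum>k\<in>?K. smult E (?w k) (e k y)) + smult E (\<Sum>k\<in>?K. ?w k * (- l k y / l i0 y)) (e i0 y)"
        by (simp add: scale_right_distrib sum.distrib scale_sum_left del: scale_minus_left)
      also have "(\<Sum>k\<in>?K. ?w k * (- l k y / l i0 y)) = - (\<Sum>k\<in>?K. ?w k * l k y) / l i0 y"
        by (simp add: sum_divide_distrib sum_negf)
      also have "(\<Sum>k\<in>?K. smult E (?w k) (e k y)) = (\<Sum>k\<in>?K. smult E (ext ?w y k) (e k y))"
        by (intro sum.cong) (auto simp: ext_def)
      finally show ?thesis unfolding split by (simp add: ext_def add.commute)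
    qed
    have ext_self: "ext z y k = z k" if y: "y \<in> U'" and z: "(\<Sum>k<r. z k * l k y) = 0" for z y k
    proof -
      have "z i0 * l i0 y = - (\<Sum>k\<in>?K. z k * l k y)" using z unfolding split' by (simp add: eq_neg_iff_add_eq_0)
      then show ?thesis using l0[OF y] by (auto simp: ext_def field_simps)
    qed
    have ext_cong: "ext (\<lambda>k. z (\<sigma> (\<rho> k))) y k = ext z y k" if "k < r" for z y k
      using that \<rho> by (auto simp: ext_def)
    have ext_\<theta>: "(\<Sum>k<r. ext w y k * l k y) = 0" if y: "y \<in> U'" for w y
    proof -
      have "(\<Sum>k\<in>?K. ext w y k * l k y) = (\<Sum>k\<in>?K. w k * l k y)" by (intro sum.cong) (auto simp: ext_def)
      then show ?thesis unfolding split' using l0[OF y] by (simp add: ext_def)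
    qed
    have I2: "(\<Sum>k<r. smult E (z k) (e k y)) = (\<Sum>i<r - 1. smult E (z (\<sigma> i)) (e' i y))"
      if y: "y \<in> U'" and z: "(\<Sum>k<r. z k * l k y) = 0" for z y
      unfolding I1 using ext_cong ext_self[OF y z] by (intro sum.cong) auto
    have ind': "z i = 0" if y: "y \<in> U'" and z: "(\<Sum>i<r - 1. smult E (z i) (e' i y)) = 0" and i: "i < r - 1" for y z i
    proof -
      have "ext (\<lambda>k. z (\<rho> k)) y (\<sigma> i) = 0"
        by (rule fr(2)[of y]) (use y U'(3) z[unfolded I1] \<sigma>K[OF i] in auto)
      then show ?thesis using \<sigma>K[OF i] by (simp add: ext_def)
    qed
    have fib': "fibre ?F y = {\<Sum>i<r - 1. smult E (z i) (e' i y) | z. True}" if y: "y \<in> U'" for y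
    proof -
      have yU: "y \<in> U" using y U' by auto
      have "\<exists>z. u = (\<Sum>i<r - 1. smult E (z i) (e' i y))" if u: "u \<in> fibre E y" "\<theta> y u = 0" for u
      proof -
        obtain z where z: "u = (\<Sum>k<r. smult E (z k) (e k y))" using u(1) unfolding fr(1)[OF yU] by blast
        have "(\<Sum>k<r. z k * l k y) = 0" using u(2) \<theta>_sum[OF yU subset_refl] unfolding z by simp
        from I2[OF y this] show ?thesis unfolding z by (intro exI[of _ "\<lambda>i. z (\<sigma> i)"])
      qed
      moreover have "(\<Sum>i<r - 1. smult E (z i) (e' i y)) \<in> fibre E y \<and> \<theta> y (\<Sum>i<r - 1. smult E (z i) (e' i y)) = 0" for z
        unfolding I1 \<theta>_sum[OF yU subset_refl] ext_\<theta>[OF y] using fr(1)[OF yU] by blast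
      ultimately show ?thesis unfolding F(2) by blast
    qed
    have sec': "s \<in> sects ?F V \<longleftrightarrow> (\<exists>f. (\<forall>i<r - 1. f i \<in> regular_functions (base E) V) \<and>
            (\<forall>y\<in>V. s y = (\<Sum>i<r - 1. smult E (f i y) (e' i y))))" if V: "zopen (base E) V" "V \<subseteq> U'" for V s
    proof
      have VU: "V \<subseteq> U" using V U' by auto
      have regf: "f \<in> regular_functions (base E) V \<longleftrightarrow> (\<forall>y\<in>V. rat (base E) 0 (\<lambda>v. f (pt v)) y)" for f
        by (rule regular_functions_iff[OF base_subset V(1)])
      {
        assume "s \<in> sects ?F V"
        then have s: "s \<in> sects E V" "\<forall>y\<in>V. \<theta> y (s y) = 0" by (auto simp: F)
        from s(1)[unfolded se[OF V(1) VU]] obtain f where f: "\<forall>i<r. \<forall>y\<in>V. rat (base E) 0 (\<lambda>v. f i (pt v)) y"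
          "\<forall>y\<in>V. s y = (\<Sum>i<r. smult E (f i y) (e i y))" by (elim exE conjE) (rule that)
        have "s y = (\<Sum>i<r - 1. smult E (f (\<sigma> i) y) (e' i y))" if y: "y \<in> V" for y
        proof -
          have "(\<Sum>k<r. f k y * l k y) = 0" using s(2) y f(2) \<theta>_sum[of y "{..<r}" "\<lambda>k. f k y"] VU by auto
          then show ?thesis using I2[of y "\<lambda>k. f k y"] f(2) y V(2) by auto
        qed
        then show "\<exists>f. (\<forall>i<r - 1. f i \<in> regular_functions (base E) V) \<and>
            (\<forall>y\<in>V. s y = (\<Sum>i<r - 1. smult E (f i y) (e' i y)))"
          using f(1) \<sigma>K unfolding regf by (intro exI[of _ "\<lambda>i. f (\<sigma> i)"]) auto
      }
      {
        assume "\<exists>f. (\<forall>i<r - 1. f i \<in> regular_functions (base E) V) \<and>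
            (\<forall>y\<in>V. s y = (\<Sum>i<r - 1. smult E (f i y) (e' i y)))"
        then obtain f where f: "\<forall>i<r - 1. \<forall>y\<in>V. rat (base E) 0 (\<lambda>v. f i (pt v)) y"
          "\<forall>y\<in>V. s y = (\<Sum>i<r - 1. smult E (f i y) (e' i y))" unfolding regf by (elim exE conjE) (rule that)
        let ?g = "\<lambda>k y. ext (\<lambda>k. f (\<rho> k) y) y k"
        \<comment> \<open>The forced coefficient is a quotient by \<open>l i0\<close>, regular on
          \<open>V\<close> because \<open>l i0\<close> has no zero on \<open>U'\<close>.\<close>
        have "rat (base E) 0 (\<lambda>v. ?g k (pt v)) y" if k: "k < r" and y: "y \<in> V" for k y
        proof (cases "k = i0")
          case True
          have yb: "y \<in> base E" using y VU Ub by auto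
          then obtain v where v: "v \<noteq> 0" "y = pt v" using base_subset proj_spaceE by blast
          have "rat (base E) (0 + 0) (\<lambda>v. f (\<rho> k) (pt v) * l k (pt v)) y" if "k \<in> ?K" for k
            using f(1) \<rho>[OF that] l_rat[of k y] that y VU by (intro rat_mult) auto
          then have "rat (base E) 0 (\<lambda>v. \<Sum>k\<in>?K. f (\<rho> k) (pt v) * l k (pt v)) y"
            by (intro rat_sum[OF _ base_subset yb]) simp
          then have "rat (base E) 0 (\<lambda>v. -1 * (\<Sum>k\<in>?K. f (\<rho> k) (pt v) * l k (pt v))) y" by (rule rat_scale)
          then have "rat (base E) (0 - 0) (\<lambda>v. (-1 * (\<Sum>k\<in>?K. f (\<rho> k) (pt v) * l k (pt v))) / l i0 (pt v)) y"
            unfolding v(2) by (rule rat_divide) (use l_rat[OF i0(1)] y VU v yb l0[of y] V(2) base_subset in auto)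
          then show ?thesis using True by (simp add: ext_def)
        next
          case False
          then show ?thesis using f(1) \<rho>(2)[of k] k y by (simp add: ext_def)
        qed
        moreover have sy: "s y = (\<Sum>k<r. smult E (?g k y) (e k y))" if "y \<in> V" for y using f(2) that unfolding I1 by blast
        ultimately have "s \<in> sects E V" unfolding se[OF V(1) VU] by (intro exI[of _ ?g]) auto
        moreover have "\<theta> y (s y) = 0" if y: "y \<in> V" for y
        proof -
          have yU: "y \<in> U" "y \<in> U'" using y VU V(2) by auto
          show ?thesis unfolding sy[OF y]
            using \<theta>_sum[OF yU(1) subset_refl, of "ext (\<lambda>k. f (\<rho> k) y) y"] ext_\<theta>[OF yU(2), of "\<lambda>k. f (\<rho> k) y"] by simp
        qed
        ultimately show "s \<in> sects ?F V" by (simp add: F)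
      }
    qed
    have A: "\<forall>y\<in>U'. inj_on (\<lambda>i. e' i y) {..<r - 1} \<and> independent ((\<lambda>i. e' i y) ` {..<r - 1}) \<and>
          span ((\<lambda>i. e' i y) ` {..<r - 1}) = fibre ?F y"
    proof (intro ballI conjI)
      fix y assume y: "y \<in> U'"
      show "inj_on (\<lambda>i. e' i y) {..<r - 1}" by (rule frame_basis(1)) (erule (1) ind'[OF y])
      show "independent ((\<lambda>i. e' i y) ` {..<r - 1})" by (rule frame_basis(2)) (erule (1) ind'[OF y])
      have "span ((\<lambda>i. e' i y) ` {..<r - 1}) = {\<Sum>i<r - 1. smult E (z i) (e' i y) | z. True}"
        by (rule frame_basis(3)) (erule (1) ind'[OF y])
      then show "span ((\<lambda>i. e' i y) ` {..<r - 1}) = fibre ?F y" using fib'[OF y] by simp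
    qed
    have B: "\<forall>V. zopen (base E) V \<longrightarrow> V \<subseteq> U' \<longrightarrow>
          sects ?F V = {s. \<exists>f. (\<forall>i<r - 1. f i \<in> regular_functions (base E) V) \<and>
            (\<forall>y\<in>V. s y = (\<Sum>i<r - 1. smult E (f i y) (e' i y)))}"
    proof (intro allI impI set_eqI)
      fix V s assume V: "zopen (base E) V" "V \<subseteq> U'"
      show "s \<in> sects ?F V \<longleftrightarrow> s \<in> {s. \<exists>f. (\<forall>i<r - 1. f i \<in> regular_functions (base E) V) \<and>
            (\<forall>y\<in>V. s y = (\<Sum>i<r - 1. smult E (f i y) (e' i y)))}"
        unfolding mem_Collect_eq by (rule sec'[OF V])
    qed
    show ?thesis by (intro exI[of _ U'] exI[of _ e'] conjI U'(1,2) A B)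
  qed
  show ?thesis
  proof (rule vector_bundle.intro, unfold F)
    show "vector_space (smult E)" by (rule vector_space_axioms)
    show "vector_bundle_axioms ?F (r - 1)"
    proof (rule vector_bundle_axioms.intro, unfold F, goal_cases)
      case 1 show ?case by (rule base_subset)
    next
      case (2 x)
      have sub: "subspace (fibre E x)" by (rule fibre_subspace[OF 2])
      show ?case
        by (rule subspaceI) (auto simp: subspace_0[OF sub] zero[OF 2] add[OF 2] scale[OF 2]
            subspace_add[OF sub] subspace_scale[OF sub])
    next
      case (3 s U V)
      then show ?case using sects_restrict[of s U V] by auto
    next
      case (4 U s)
      have "s \<in> sects E U" by (rule sects_glue[OF 4(1)]) (use 4(2) in blast)
      moreover have "\<theta> x (s x) = 0" if "x \<in> U" for x using 4(2)[OF that] by blast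
      ultimately show ?case by blast
    next
      case (5 x)
      then show ?case using triv[OF 5] by (simp add: F)
    qed
  qed
qed

text \<open>Dependence on one parameter with degree at most one, as \<open>images_miss_point\<close>
  requires. Closure under sums and constant multiples is enough, because a single parameter never
  moves both factors of a product.\<close>

definition affine_fun :: "('k::field \<Rightarrow> 'k) \<Rightarrow> bool" where
  "affine_fun g \<longleftrightarrow> (\<exists>A B. \<forall>t. g t = A + t * B)"

lemma affine_fun_const: "affine_fun (\<lambda>_. a)"
  unfolding affine_fun_def by (intro exI[of _ a] exI[of _ 0]) simp

lemma affine_fun_id: "affine_fun (\<lambda>t. t)"
  unfolding affine_fun_def by (intro exI[of _ 0] exI[of _ 1]) simp

lemma affine_fun_add: assumes "affine_fun g" "affine_fun h" shows "affine_fun (\<lambda>t. g t + h t)"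
proof -
  from assms obtain A B C D where "\<forall>t. g t = A + t * B" "\<forall>t. h t = C + t * D"
    unfolding affine_fun_def by blast
  then show ?thesis unfolding affine_fun_def
    by (intro exI[of _ "A + C"] exI[of _ "B + D"]) (simp add: algebra_simps)
qed

lemma affine_fun_cmult: assumes "affine_fun g" shows "affine_fun (\<lambda>t. g t * a)" "affine_fun (\<lambda>t. a * g t)"
proof -
  from assms obtain A B where "\<forall>t. g t = A + t * B" unfolding affine_fun_def by blast
  then show "affine_fun (\<lambda>t. g t * a)" "affine_fun (\<lambda>t. a * g t)" unfolding affine_fun_def
    by (intro exI[of _ "A * a"] exI[of _ "B * a"], simp add: algebra_simps)+
qed

lemma affine_fun_sum: "(\<And>i. i \<in> A \<Longrightarrow> affine_fun (g i)) \<Longrightarrow> affine_fun (\<lambda>t. \<Sum>i\<in>A. g i t)"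
  by (induction A rule: infinite_finite_induct) (auto intro: affine_fun_const affine_fun_add)

lemma affine_fun_poly: "affine_fun g \<Longrightarrow> \<exists>R. degree R \<le> 1 \<and> (\<forall>t. g t = poly R t)"
proof -
  assume "affine_fun g"
  then obtain A B where "\<forall>t. g t = A + t * B" unfolding affine_fun_def by blast
  then show ?thesis by (intro exI[of _ "[:A, B:]"]) simp
qed

text \<open>The condition on the matrix that encodes splitting into copies of \<open>O\<close> and
  \<open>O(-1)\<close> on every line: \<open>framed_nonneg_split\<close> derives it from such
  splittings, and \<open>split_on_line\<close> produces them from it.\<close>

definition rows2 :: "(nat \<Rightarrow> nat \<Rightarrow> 'k::field ^ 'n::finite \<Rightarrow> 'k) \<Rightarrow> nat set \<Rightarrow> nat \<Rightarrow> bool" where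
  "rows2 a I c \<longleftrightarrow> (\<forall>v w y z. indep2 v w \<longrightarrow> (\<forall>i\<in>I. (\<Sum>j<c. y j * a j i v) + (\<Sum>j<c. z j * a j i w) = 0) \<longrightarrow>
     (\<forall>j<c. y j = 0 \<and> z j = 0))"

lemma rows2D: "rows2 a I c \<Longrightarrow> indep2 v w \<Longrightarrow> (\<forall>i\<in>I. (\<Sum>j<c. y j * a j i v) + (\<Sum>j<c. z j * a j i w) = 0) \<Longrightarrow>
  j < c \<Longrightarrow> y j = 0 \<and> z j = 0"
  unfolding rows2_def by blast

text \<open>A nonzero minor selects the standard chart of the Grassmannian of lines that contains
  the given one.\<close>

lemma indep2_minor:
  assumes "indep2 v w" shows "\<exists>i j. i \<noteq> j \<and> v $ i * w $ j - v $ j * w $ i \<noteq> 0"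
proof (rule ccontr)
  assume "\<not> ?thesis"
  then have eq: "v $ i * w $ j = v $ j * w $ i" for i j by (cases "i = j") auto
  obtain j where j: "w $ j \<noteq> 0" using nonzero_coord indep2_nonzero[OF assms] by blast
  have "(w $ j) *s v + (- (v $ j)) *s w = 0" by (simp add: vec_eq_iff eq mult.commute)
  from indep2D[OF assms this] j show False by simp
qed

text \<open>Lines are parametrised by the reduced echelon forms of their bases, with \<open>2(n - 1)\<close>
  parameters for each of the finitely many pairs of pivots.\<close>

lemma generic_functional:
  fixes E :: "(('k::field_char_0 ^ 'n::finite) set, 'k, 'v::ab_group_add) vbundle"
  assumes pr: "presented E r \<eta> a I c" and n: "CARD('n) = n + 1" and big: "2 * c + 2 * (n - 1) < card I"
  shows "\<exists>l. \<forall>v w y z. indep2 v w \<longrightarrow> (\<exists>i\<in>I. (\<Sum>j<c. y j * a j i v) + (\<Sum>j<c. z j * a j i w) \<noteq> l i)"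
proof -
  interpret presented E r \<eta> a I c by (rule pr)
  \<comment> \<open>The possible pairs of pivot positions, one for each chart of the lines.\<close>
  define S where "S = {s :: 'n \<times> 'n. fst s \<noteq> snd s}"
  have "\<forall>s\<in>S. \<exists>\<beta>. bij_betw \<beta> (UNIV - {fst s, snd s}) {..<n - 1}"
  proof
    fix s assume "s \<in> S"
    then have "card (UNIV - {fst s, snd s}) = n - 1" using n by (auto simp: S_def card_Diff_subset)
    then show "\<exists>\<beta>. bij_betw \<beta> (UNIV - {fst s, snd s}) {..<n - 1}"
      using ex_bij_betw_finite_nat[of "UNIV - {fst s, snd s}"] by (auto simp: atLeast0LessThan)
  qed
  from bchoice[OF this] obtain \<beta> where \<beta>: "\<forall>s\<in>S. bij_betw (\<beta> s) (UNIV - {fst s, snd s}) {..<n - 1}"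
    by (elim exE) (rule that)
  \<comment> \<open>The left half holds the free entries of the two echelon vectors,
    \<open>n - 1\<close> each since the pivot columns are fixed; the right half holds the
    \<open>2c\<close> coefficients of a vector in the span.\<close>
  define P where "P = ({..<n - 1} <+> {..<n - 1}) <+> ({..<c} <+> {..<c})"
  have P: "finite P" "card P < card I" unfolding P_def using big by (auto simp: card_Plus)
  define V where "V s \<theta> = (\<chi> k. if k = fst s then 1 else if k = snd s then 0 else \<theta> (Inl (Inl (\<beta> s k))))"
    for s and \<theta> :: "(nat + nat) + (nat + nat) \<Rightarrow> 'k"
  define W where "W s \<theta> = (\<chi> k. if k = fst s then 0 else if k = snd s then 1 else \<theta> (Inl (Inr (\<beta> s k))))"
    for s and \<theta> :: "(nat + nat) + (nat + nat) \<Rightarrow> 'k"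
  define f where "f s \<theta> i = (\<Sum>j<c. \<theta> (Inr (Inl j)) * a j i (V s \<theta>)) + (\<Sum>j<c. \<theta> (Inr (Inr j)) * a j i (W s \<theta>))" for s \<theta> i
  \<comment> \<open>A parameter is either an entry of a vector or a coefficient. In the first case
    the linear matrix entries change affinely and the coefficients are fixed, in the second case the
    reverse.\<close>
  have aff: "affine_fun (\<lambda>t. f s (\<theta>(p := t)) i)" if i: "i \<in> I" for s \<theta> p i
  proof -
    have upd: "affine_fun (\<lambda>t. (\<theta>(p := t)) q)" for q
      by (cases "q = p") (auto intro: affine_fun_const affine_fun_id)
    show ?thesis
    proof (cases p)
      case (Inl p')
      have av: "affine_fun (\<lambda>t. a j i (x t))" if j: "j < c" and x: "\<And>k. affine_fun (\<lambda>t. x t $ k)" for j x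
      proof -
        have eq: "a j i u = (\<Sum>k\<in>UNIV. u $ k * a j i (axis k 1))" for u
          using a_sum_scale[OF j i, of "\<lambda>k. u $ k" "\<lambda>k. axis k 1" UNIV] by (simp add: basis_expansion)
        show ?thesis by (subst eq) (intro affine_fun_sum affine_fun_cmult x)
      qed
      have "affine_fun (\<lambda>t. V s (\<theta>(p := t)) $ k)" "affine_fun (\<lambda>t. W s (\<theta>(p := t)) $ k)" for k
        using upd by (cases "k = fst s"; cases "k = snd s";
          simp add: V_def W_def affine_fun_const del: fun_upd_apply)+
      then have "affine_fun (\<lambda>t. (\<Sum>j<c. \<theta> (Inr (Inl j)) * a j i (V s (\<theta>(p := t)))) + (\<Sum>j<c. \<theta> (Inr (Inr j)) * a j i (W s (\<theta>(p := t)))))"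
        by (intro affine_fun_add affine_fun_sum affine_fun_cmult av) auto
      then show ?thesis unfolding f_def Inl by simp
    next
      case (Inr p')
      have VW: "V s (\<theta>(p := t)) = V s \<theta>" "W s (\<theta>(p := t)) = W s \<theta>" for t unfolding V_def W_def Inr by auto
      show ?thesis unfolding f_def VW
        by (intro affine_fun_add affine_fun_sum affine_fun_cmult upd)
    qed
  qed
  have "\<exists>l. \<forall>s\<in>S. \<forall>\<theta>\<in>extensional P. \<exists>i\<in>I. f s \<theta> i \<noteq> l i"
  proof (rule images_miss_point[OF _ P(1) fin P(2)])
    show "finite S" by simp
    show "\<exists>R. degree R \<le> 1 \<and> (\<forall>t. f s (\<theta>(p := t)) i = poly R t)" if "i \<in> I" for s \<theta> p i
      by (rule affine_fun_poly[OF aff[OF that]])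
  qed
  then obtain l where l: "\<forall>s\<in>S. \<forall>\<theta>\<in>extensional P. \<exists>i\<in>I. f s \<theta> i \<noteq> l i" by blast
  have "\<exists>i\<in>I. (\<Sum>j<c. y j * a j i v) + (\<Sum>j<c. z j * a j i w) \<noteq> l i" if vw: "indep2 v w" for v w y z
  proof -
    obtain i j where ij: "i \<noteq> j" "v $ i * w $ j - v $ j * w $ i \<noteq> 0" using indep2_minor[OF vw] by blast
    let ?m = "v $ i * w $ j - v $ j * w $ i"
    \<comment> \<open>The echelon basis, obtained by applying the inverse of the chosen two-by-two
      block.\<close>
    define v' where "v' = (w $ j / ?m) *s v + (- (v $ j) / ?m) *s w"
    define w' where "w' = (- (w $ i) / ?m) *s v + (v $ i / ?m) *s w"
    have v'c: "v' $ i = 1" "v' $ j = 0" and w'c: "w' $ i = 0" "w' $ j = 1"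
      using ij(2) by (simp_all add: v'_def w'_def diff_divide_distrib[symmetric] add_divide_distrib[symmetric] mult.commute)
    have "v = (v $ i) *s v' + (v $ j) *s w'" "w = (w $ i) *s v' + (w $ j) *s w'"
    proof -
      have "(v $ i) *s v' + (v $ j) *s w' = ((v $ i * w $ j - v $ j * w $ i) / ?m) *s v"
        by (simp add: vec_eq_iff v'_def w'_def field_simps add_divide_distrib diff_divide_distrib)
      then show "v = (v $ i) *s v' + (v $ j) *s w'" using ij(2) by simp
      have "(w $ i) *s v' + (w $ j) *s w' = ((v $ i * w $ j - v $ j * w $ i) / ?m) *s w"
        by (simp add: vec_eq_iff v'_def w'_def field_simps add_divide_distrib diff_divide_distrib)
      then show "w = (w $ i) *s v' + (w $ j) *s w'" using ij(2) by simp
    qed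
    then have av: "a k q v = v $ i * a k q v' + v $ j * a k q w'" "a k q w = w $ i * a k q v' + w $ j * a k q w'"
      if "k < c" "q \<in> I" for k q
      using a_add[OF that] a_scale[OF that] by metis+
    have s: "(i, j) \<in> S" using ij by (simp add: S_def)
    let ?\<gamma> = "inv_into (UNIV - {i, j}) (\<beta> (i, j))"
    have \<beta>ij: "bij_betw (\<beta> (i, j)) (UNIV - {i, j}) {..<n - 1}" using \<beta> s by auto
    have \<gamma>: "?\<gamma> (\<beta> (i, j) k) = k" "\<beta> (i, j) k < n - 1" if "k \<noteq> i" "k \<noteq> j" for k
      using bij_betw_inv_into_left[OF \<beta>ij, of k] bij_betwE[OF \<beta>ij] that by auto
    \<comment> \<open>The parameters of the given combination: the free entries are those of
      \<open>v'\<close> and \<open>w'\<close>, and the coefficients follow from expanding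
      \<open>v\<close> and \<open>w\<close> in this basis.\<close>
    define \<theta> where "\<theta> = restrict (\<lambda>p. case p of Inl (Inl m) \<Rightarrow> v' $ ?\<gamma> m | Inl (Inr m) \<Rightarrow> w' $ ?\<gamma> m
      | Inr (Inl k) \<Rightarrow> y k * v $ i + z k * w $ i | Inr (Inr k) \<Rightarrow> y k * v $ j + z k * w $ j) P"
    have \<theta>P: "\<theta> \<in> extensional P" by (simp add: \<theta>_def)
    have mem: "Inl (Inl m) \<in> P \<longleftrightarrow> m < n - 1" "Inl (Inr m) \<in> P \<longleftrightarrow> m < n - 1" for m by (auto simp: P_def)
    have \<theta>v: "\<theta> (Inl (Inl (\<beta> (i, j) k))) = v' $ k" "\<theta> (Inl (Inr (\<beta> (i, j) k))) = w' $ k" if "k \<noteq> i" "k \<noteq> j" for k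
      using \<gamma>[OF that] by (simp_all add: \<theta>_def mem)
    have V: "V (i, j) \<theta> = v'"
      unfolding V_def vec_eq_iff using v'c \<theta>v by simp
    have W: "W (i, j) \<theta> = w'"
      unfolding W_def vec_eq_iff using w'c \<theta>v by simp
    have "f (i, j) \<theta> q = (\<Sum>j<c. y j * a j q v) + (\<Sum>j<c. z j * a j q w)" if q: "q \<in> I" for q
    proof -
      have "f (i, j) \<theta> q = (\<Sum>k<c. (y k * v $ i + z k * w $ i) * a k q v') + (\<Sum>k<c. (y k * v $ j + z k * w $ j) * a k q w')"
        unfolding f_def V W by (intro arg_cong2[of _ _ _ _ "(+)"] sum.cong) (auto simp: \<theta>_def P_def)
      also have "\<dots> = (\<Sum>k<c. y k * (v $ i * a k q v' + v $ j * a k q w')) + (\<Sum>k<c. z k * (w $ i * a k q v' + w $ j * a k q w'))"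
        by (simp add: sum.distrib[symmetric] algebra_simps)
      also have "\<dots> = (\<Sum>j<c. y j * a j q v) + (\<Sum>j<c. z j * a j q w)"
        using av[OF _ q] by (intro arg_cong2[of _ _ _ _ "(+)"] sum.cong) auto
      finally show ?thesis .
    qed
    then show ?thesis using l s \<theta>P by force
  qed
  then show ?thesis by blast
qed

section \<open>Cutting down by one functional\<close>

definition functional_on :: "(('k::field ^ 'n::finite) set, 'k, 'v::ab_group_add) vbundle \<Rightarrow> (('k ^ 'n) set \<Rightarrow> 'v \<Rightarrow> 'k) \<Rightarrow> bool" where
  "functional_on E \<theta> \<longleftrightarrow>
     (\<forall>x\<in>base E. \<forall>u\<in>fibre E x. (\<forall>w\<in>fibre E x. \<theta> x (u + w) = \<theta> x u + \<theta> x w) \<and> (\<forall>t. \<theta> x (smult E t u) = t * \<theta> x u)) \<and>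
     (\<forall>U. zopen (base E) U \<longrightarrow> (\<forall>s\<in>sects E U. \<forall>x\<in>U. rat (base E) 0 (\<lambda>v. \<theta> (pt v) (s (pt v))) x))"

lemma (in presented) functional_eta:
  assumes "K \<subseteq> I" shows "functional_on E (\<lambda>x u. \<Sum>i\<in>K. l i * \<eta> x u i)"
proof -
  have K: "i \<in> I" if "i \<in> K" for i using assms that by auto
  show ?thesis
    unfolding functional_on_def base
  proof (intro conjI ballI allI impI)
    fix x u w assume x: "x \<in> proj_space" and u: "u \<in> fibre E x" and w: "w \<in> fibre E x"
    show "(\<Sum>i\<in>K. l i * \<eta> x (u + w) i) = (\<Sum>i\<in>K. l i * \<eta> x u i) + (\<Sum>i\<in>K. l i * \<eta> x w i)"
      using eta_add[OF x u w K] by (simp add: distrib_left sum.distrib)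
  next
    fix x u t assume x: "x \<in> proj_space" and u: "u \<in> fibre E x"
    show "(\<Sum>i\<in>K. l i * \<eta> x (smult E t u) i) = t * (\<Sum>i\<in>K. l i * \<eta> x u i)"
      using eta_scale[OF x u K] by (simp add: sum_distrib_left mult.left_commute)
  next
    fix U s x assume U: "zopen proj_space U" and s: "s \<in> sects E U" and x: "x \<in> U"
    have "x \<in> proj_space" using zopen_subset[OF U] x by auto
    then show "rat proj_space 0 (\<lambda>v. \<Sum>i\<in>K. l i * \<eta> (pt v) (s (pt v)) i) x"
      using eta_regular[OF U s x K] by (intro rat_sum rat_scale) auto
  qed
qed

text \<open>A functional outside all the spans has nonzero restriction to every fibre, so its kernel
  is a bundle. Solving the equation of the hyperplane for one coordinate \<open>i0\<close> presents
  the kernel with one column fewer. A relation among its rows on a line would place a multiple of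
  \<open>l\<close> in a span, so it is trivial.\<close>

lemma hyperplane_step:
  fixes E :: "(('k::field_char_0 ^ 'n::finite) set, 'k, 'v::ab_group_add) vbundle"
  assumes pr: "presented E r \<eta> a I c" and rows: "rows2 a I c"
    and n: "CARD('n) = n + 1" "n \<ge> 2" and r: "r > c + 2 * (n - 1)"
  shows "\<exists>l a' I'. I' \<subseteq> I \<and> rows2 a' I' c \<and>
    presented (kernel_bundle E (\<lambda>x u. \<Sum>i\<in>I. l i * \<eta> x u i)) (r - 1) \<eta> a' I' c \<and>
    (\<forall>x\<in>proj_space. \<exists>u\<in>fibre E x. (\<Sum>i\<in>I. l i * \<eta> x u i) \<noteq> 0)"
proof -
  interpret presented E r \<eta> a I c by (rule pr)
  have big: "2 * c + 2 * (n - 1) < card I" using card_I r by simp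
  from generic_functional[OF pr n(1) big] obtain l where
    l': "\<forall>v w y z. indep2 v w \<longrightarrow> (\<exists>i\<in>I. (\<Sum>j<c. y j * a j i v) + (\<Sum>j<c. z j * a j i w) \<noteq> l i)" by blast
  have l: "False" if "indep2 v w" "\<forall>i\<in>I. (\<Sum>j<c. y j * a j i v) + (\<Sum>j<c. z j * a j i w) = l i" for v w y z
    using l'[THEN spec, THEN spec, THEN spec, THEN spec, THEN mp, OF that(1), of y z] that(2) by blast
  \<comment> \<open>The choice of \<open>l\<close> speaks of pairs of vectors; a single point is
    covered by completing \<open>v\<close> to a pair and taking zero coefficients for the second
    vector.\<close>
  have partner: "\<exists>w. indep2 v w" if v: "v \<noteq> 0" for v :: "'k ^ 'n"
  proof -
    obtain i where i: "v $ i \<noteq> 0" using nonzero_coord[OF v] by blast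
    obtain j where j: "j \<noteq> i"
    proof (rule ccontr)
      assume "\<not> thesis"
      then have "UNIV = {i}" using that by auto
      then have "CARD('n) = 1" using card_1_singleton_iff[of "UNIV :: 'n set"] by (metis One_nat_def)
      then show False using n by simp
    qed
    have "indep2 v (axis j 1)"
      unfolding indep2_def
    proof (intro allI impI)
      fix s t assume 0: "s *s v + t *s axis j 1 = 0"
      have "(s *s v + t *s axis j 1) $ i = s * v $ i" using j by (simp add: axis_def)
      then have "s = 0" using i unfolding 0 by simp
      moreover have "(s *s v + t *s axis j 1) $ j = s * v $ j + t" by (simp add: axis_def)
      ultimately show "s = 0 \<and> t = 0" unfolding 0 by simp
    qed
    then show ?thesis by blast
  qed
  obtain v0 :: "'k ^ 'n" where v0: "v0 \<noteq> 0" by (metis axis_eq_0_iff zero_neq_one)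
  \<comment> \<open>The zero functional lies in every span, with all coefficients zero.\<close>
  have "\<exists>i0\<in>I. l i0 \<noteq> 0"
  proof (rule ccontr)
    assume "\<not> ?thesis"
    then show False using partner[OF v0] l[of v0 _ "\<lambda>_. 0" "\<lambda>_. 0"] by auto
  qed
  then obtain i0 where i0: "i0 \<in> I" "l i0 \<noteq> 0" by blast
  define \<theta> where "\<theta> x u = (\<Sum>i\<in>I. l i * \<eta> x u i)" for x u
  define I' where "I' = I - {i0}"
  \<comment> \<open>The matrix after substituting the solution of \<open>l = 0\<close> for
    coordinate \<open>i0\<close>.\<close>
  define a' where "a' j i v = a j i v - a j i0 v * l i / l i0" for j i v
  have fun_\<theta>: "functional_on E \<theta>" unfolding \<theta>_def using functional_eta[OF subset_refl] .
  have nz: "\<exists>u\<in>fibre E x. \<theta> x u \<noteq> 0" if x: "x \<in> proj_space" for x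
  proof -
    obtain v where v: "v \<noteq> 0" "x = pt v" using x proj_spaceE by blast
    obtain w where w: "indep2 v w" using partner[OF v(1)] by blast
    show ?thesis
    proof (rule ccontr)
      assume no: "\<not> ?thesis"
      \<comment> \<open>A functional that vanishes on the kernel of \<open>a v\<close> is a
        combination of its rows, which the choice of \<open>l\<close> excludes.\<close>
      have "\<exists>y. \<forall>i\<in>I. (\<Sum>j\<in>{..<c}. a j i v * y j) = l i"
      proof (rule fredholm_alternative[OF fin finite_lessThan])
        fix z assume z: "\<forall>j\<in>{..<c}. (\<Sum>i\<in>I. z i * a j i v) = 0"
        then have "\<forall>j<c. (\<Sum>i\<in>I. a j i v * z i) = 0" by (simp add: mult.commute)
        then obtain u where u: "u \<in> fibre E (pt v)" "\<forall>i\<in>I. \<eta> (pt v) u i = z i" using eta_kernel[OF v(1), of z] by blast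
        have "\<theta> x u = 0" using no u(1) v(2) by blast
        then show "(\<Sum>i\<in>I. z i * l i) = 0" using u(2) v(2) by (simp add: \<theta>_def mult.commute)
      qed
      then obtain y where "\<forall>i\<in>I. (\<Sum>j<c. a j i v * y j) = l i" by blast
      then have "\<forall>i\<in>I. (\<Sum>j<c. y j * a j i v) + (\<Sum>j<c. 0 * a j i w) = l i" by (simp add: mult.commute)
      then show False by (rule l[OF w])
    qed
  qed
  have vb: "vector_bundle (kernel_bundle E \<theta>) (r - 1)"
    by (rule vector_bundle_kernel) (use fun_\<theta> nz base in \<open>auto simp: functional_on_def\<close>)
  have F: "base (kernel_bundle E \<theta>) = proj_space" "fibre (kernel_bundle E \<theta>) x = {u \<in> fibre E x. \<theta> x u = 0}"
    "smult (kernel_bundle E \<theta>) = smult E" "sects (kernel_bundle E \<theta>) U = {s \<in> sects E U. \<forall>x\<in>U. \<theta> x (s x) = 0}" for x U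
    by (simp_all add: kernel_bundle_def base)
  have combine: "(\<Sum>j<c. y j * a' j i v) = (\<Sum>j<c. y j * a j i v) - (\<Sum>j<c. y j * a j i0 v) * (l i / l i0)" for y i v
    unfolding sum_distrib_right sum_subtractf[symmetric] by (intro sum.cong) (auto simp: a'_def algebra_simps)
  have rows': "rows2 a' I' c"
    unfolding rows2_def
  proof (intro allI impI)
    fix v w y z j assume vw: "indep2 v w" and rel: "\<forall>i\<in>I'. (\<Sum>j<c. y j * a' j i v) + (\<Sum>j<c. z j * a' j i w) = 0" and j: "j < c"
    \<comment> \<open>A relation among the reduced rows says that the corresponding combination of
      the original rows is a multiple of \<open>l\<close>; the factor is read off in column
      \<open>i0\<close>.\<close>
    define \<mu> where "\<mu> = ((\<Sum>j<c. y j * a j i0 v) + (\<Sum>j<c. z j * a j i0 w)) / l i0"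
    have rel': "(\<Sum>j<c. y j * a j i v) + (\<Sum>j<c. z j * a j i w) = \<mu> * l i" if "i \<in> I" for i
    proof (cases "i = i0")
      case True then show ?thesis using i0 by (simp add: \<mu>_def)
    next
      case False
      then have "(\<Sum>j<c. y j * a' j i v) + (\<Sum>j<c. z j * a' j i w) = 0" using rel that by (simp add: I'_def)
      then show ?thesis unfolding combine \<mu>_def by (simp add: algebra_simps add_divide_distrib)
    qed
    have "\<mu> = 0"
    proof (rule ccontr)
      assume \<mu>: "\<mu> \<noteq> 0"
      have "(\<Sum>j<c. y j / \<mu> * a j i v) + (\<Sum>j<c. z j / \<mu> * a j i w) = ((\<Sum>j<c. y j * a j i v) + (\<Sum>j<c. z j * a j i w)) / \<mu>" for i
        by (simp add: add_divide_distrib sum_divide_distrib)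
      then have "\<forall>i\<in>I. (\<Sum>j<c. y j / \<mu> * a j i v) + (\<Sum>j<c. z j / \<mu> * a j i w) = l i" using rel' \<mu> by simp
      then show False by (rule l[OF vw])
    qed
    then show "y j = 0 \<and> z j = 0" using rows2D[OF rows vw _ j, of y z] rel' by simp
  qed
  have a'_sum: "(\<Sum>i\<in>I'. a' j i v * y i) = (\<Sum>i\<in>I. a j i v * y' i)"
    if "\<forall>i\<in>I'. y' i = y i" "y' i0 = - (\<Sum>i\<in>I'. l i * y i) / l i0" for j v y y'
  proof -
    have "(\<Sum>i\<in>I. a j i v * y' i) = a j i0 v * y' i0 + (\<Sum>i\<in>I'. a j i v * y i)"
      using fin i0 that(1) by (simp add: sum.remove[of I i0] I'_def)
    also have "\<dots> = (\<Sum>i\<in>I'. a j i v * y i) - (\<Sum>i\<in>I'. a j i0 v * l i / l i0 * y i)"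
      unfolding that(2) by (simp add: sum_distrib_left sum_divide_distrib mult.assoc sum_negf)
    also have "\<dots> = (\<Sum>i\<in>I'. a' j i v * y i)"
      unfolding sum_subtractf[symmetric] by (intro sum.cong) (auto simp: a'_def algebra_simps)
    finally show ?thesis ..
  qed
  have \<theta>_zero: "\<theta> x u = 0 \<longleftrightarrow> \<eta> x u i0 = - (\<Sum>i\<in>I'. l i * \<eta> x u i) / l i0" for x u
  proof -
    have "\<theta> x u = l i0 * \<eta> x u i0 + (\<Sum>i\<in>I'. l i * \<eta> x u i)"
      unfolding \<theta>_def using fin i0 by (simp add: sum.remove[of I i0] I'_def)
    then show ?thesis using i0(2) by (auto simp: field_simps eq_neg_iff_add_eq_0)
  qed
  have "presented (kernel_bundle E \<theta>) (r - 1) \<eta> a' I' c"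
  proof (rule presented.intro[OF vb], rule presented_axioms.intro, unfold F, goal_cases)
    case 1 show ?case by simp
  next
    case 2 show ?case using fin by (simp add: I'_def)
  next
    case (3 x u w i) then show ?case using eta_add by (simp add: I'_def)
  next
    case (4 x u i t) then show ?case using eta_scale by (simp add: I'_def)
  next
    case (5 x u)
    then have u: "u \<in> fibre E x" "\<theta> x u = 0" by auto
    have "\<eta> x u i0 = 0" using \<theta>_zero[of x u] u(2) 5(3) by simp
    then have "\<forall>i\<in>I. \<eta> x u i = 0" using 5(3) by (auto simp: I'_def)
    then show ?case using eta_inj[OF 5(1) u(1)] by blast
  next
    case (6 v y)
    define y' where "y' = y(i0 := - (\<Sum>i\<in>I'. l i * y i) / l i0)"
    have y': "\<forall>i\<in>I'. y' i = y i" "y' i0 = - (\<Sum>i\<in>I'. l i * y i) / l i0" by (auto simp: y'_def I'_def)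
    have "(\<exists>u\<in>{u \<in> fibre E (pt v). \<theta> (pt v) u = 0}. \<forall>i\<in>I'. \<eta> (pt v) u i = y i) \<longleftrightarrow>
        (\<exists>u\<in>fibre E (pt v). \<forall>i\<in>I. \<eta> (pt v) u i = y' i)"
    proof
      assume "\<exists>u\<in>{u \<in> fibre E (pt v). \<theta> (pt v) u = 0}. \<forall>i\<in>I'. \<eta> (pt v) u i = y i"
      then obtain u where u: "u \<in> fibre E (pt v)" "\<theta> (pt v) u = 0" "\<forall>i\<in>I'. \<eta> (pt v) u i = y i" by blast
      have "\<eta> (pt v) u i0 = y' i0" using u(2) unfolding \<theta>_zero y'(2) using u(3) by simp
      then have "\<eta> (pt v) u i = y' i" if "i \<in> I" for i
        using u(3) y'(1) that by (cases "i = i0") (auto simp: I'_def)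
      then show "\<exists>u\<in>fibre E (pt v). \<forall>i\<in>I. \<eta> (pt v) u i = y' i" using u(1) by blast
    next
      assume "\<exists>u\<in>fibre E (pt v). \<forall>i\<in>I. \<eta> (pt v) u i = y' i"
      then obtain u where u: "u \<in> fibre E (pt v)" "\<forall>i\<in>I. \<eta> (pt v) u i = y' i" by blast
      then have eq: "\<forall>i\<in>I'. \<eta> (pt v) u i = y i" using y'(1) by (auto simp: I'_def)
      moreover have "\<theta> (pt v) u = 0" unfolding \<theta>_zero using u(2) i0(1) y'(2) eq by simp
      ultimately show "\<exists>u\<in>{u \<in> fibre E (pt v). \<theta> (pt v) u = 0}. \<forall>i\<in>I'. \<eta> (pt v) u i = y i" using u(1) by blast
    qed
    also have "\<dots> \<longleftrightarrow> (\<forall>j<c. (\<Sum>i\<in>I. a j i v * y' i) = 0)" by (rule eta_kernel[OF 6])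
    also have "\<dots> \<longleftrightarrow> (\<forall>j<c. (\<Sum>i\<in>I'. a' j i v * y i) = 0)" using a'_sum[OF y'] by simp
    finally show ?case .
  next
    case (7 U s x i) then show ?case using eta_regular[of U s x i] by (simp add: I'_def)
  next
    case (8 j i v w)
    then show ?case using a_add[OF 8(1), of i v w] a_add[OF 8(1) i0(1), of v w]
      by (simp add: a'_def I'_def add_divide_distrib distrib_right)
  next
    case (9 j i t v)
    then show ?case using a_scale[OF 9(1), of i t v] a_scale[OF 9(1) i0(1), of t v]
      by (simp add: a'_def I'_def right_diff_distrib mult.assoc)
  next
    case (10 v z j)
    obtain w where w: "indep2 v w" using partner[OF 10(1)] by blast
    show ?case using rows2D[OF rows' w _ 10(3), of z "\<lambda>_. 0"] 10(2) by simp
  qed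
  then show ?thesis using rows' nz unfolding \<theta>_def[abs_def] by (intro exI[of _ l] exI[of _ a'] exI[of _ I']) (auto simp: I'_def)
qed

section \<open>Splitting on lines and the reduction of the rank\<close>

text \<open>The coordinates of the plane are taken from linear forms on the whole space, so that
  they are regular on the cone over the line.\<close>

lemma linear_coordinates:
  fixes v w :: "'k::field ^ 'n::finite"
  assumes "indep2 v w"
  shows "\<exists>p q. (\<Sum>k\<in>UNIV. p k * v $ k) = 1 \<and> (\<Sum>k\<in>UNIV. p k * w $ k) = 0 \<and>
    (\<Sum>k\<in>UNIV. q k * v $ k) = 0 \<and> (\<Sum>k\<in>UNIV. q k * w $ k) = 1"
proof -
  let ?M = "\<lambda>b k. if b then v $ k else w $ k"
  have "\<exists>y. \<forall>b\<in>{True, False}. (\<Sum>k\<in>UNIV. ?M b k * y k) = g b" for g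
  proof (rule fredholm_alternative)
    fix z assume z: "\<forall>k\<in>UNIV. (\<Sum>b\<in>{True, False}. z b * ?M b k) = 0"
    have "z True *s v + z False *s w = 0" using z by (simp add: vec_eq_iff)
    from indep2D[OF assms this] show "(\<Sum>b\<in>{True, False}. z b * g b) = 0" by simp
  qed auto
  from this[of "\<lambda>b. if b then 1 else 0"] this[of "\<lambda>b. if b then 0 else 1"]
  obtain p q where p: "\<forall>b\<in>{True, False}. (\<Sum>k\<in>UNIV. ?M b k * p k) = (if b then 1 else 0)"
    and q: "\<forall>b\<in>{True, False}. (\<Sum>k\<in>UNIV. ?M b k * q k) = (if b then 0 else 1)" by (elim exE) (rule that)
  show ?thesis
    using p[THEN bspec, of True] p[THEN bspec, of False] q[THEN bspec, of True] q[THEN bspec, of False]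
    by (intro exI[of _ p] exI[of _ q]) (simp add: mult.commute)
qed

lemma mem_Plus [simp]: "Inl x \<in> A <+> B \<longleftrightarrow> x \<in> A" "Inr y \<in> A <+> B \<longleftrightarrow> y \<in> B"
  by auto

text \<open>Vectors killed by both \<open>a v\<close> and \<open>a w\<close> are constant sections
  and give the copies of \<open>O\<close>. The copies of \<open>O(-1)\<close> come from vectors
  linear in the coordinates of the line, built so that the two contributions to the matrix cancel.
  The ranks fit: the \<open>2c\<close> independent rows leave \<open>card K = card I - 2 * c\<close>
  free columns, and \<open>card I = r + c\<close>.\<close>

lemma split_on_line:
  assumes pr: "presented E r \<eta> a I c" and rows: "rows2 a I c" and vw: "indep2 v w"
  shows "\<exists>(K :: nat set) b. finite K \<and> card K + c = r \<and>
    framed (restrict_bundle (line v w) E) (line v w) ({..<c} <+> K) (case_sum (\<lambda>_. -1) (\<lambda>_. 0)) b"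
proof -
  interpret presented E r \<eta> a I c by (rule pr)
  let ?L = "line v w" and ?JJ = "{..<c} <+> {..<c}"
  have L: "?L \<subseteq> proj_space" by (rule line_subset[OF vw])
  have Lb: "?L \<subseteq> base E" using L base by simp
  define M where "M p i = (case p of Inl j \<Rightarrow> a j i v | Inr j \<Rightarrow> a j i w)" for p :: "nat + nat" and i
  have plus0: "(\<Sum>p\<in>?JJ. g p) = (\<Sum>j<c. g (Inl j)) + (\<Sum>j<c. g (Inr j))" for g :: "nat + nat \<Rightarrow> 'a"
    by (simp add: sum.Plus)
  have M_ind: "\<forall>p\<in>?JJ. z p = 0" if z: "\<forall>i\<in>I. (\<Sum>p\<in>?JJ. z p * M p i) = 0" for z
  proof -
    have "\<forall>i\<in>I. (\<Sum>j<c. z (Inl j) * a j i v) + (\<Sum>j<c. z (Inr j) * a j i w) = 0"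
      using z by (simp add: plus0 M_def)
    from rows2D[OF rows vw this] show ?thesis by auto
  qed
  have solve: "\<exists>y. \<forall>p\<in>?JJ. (\<Sum>i\<in>I. M p i * y i) = g p" for g
  proof (rule fredholm_alternative)
    fix z assume "\<forall>i\<in>I. (\<Sum>p\<in>?JJ. z p * M p i) = 0"
    then have "\<forall>p\<in>?JJ. z p = 0" by (rule M_ind)
    then show "(\<Sum>p\<in>?JJ. z p * g p) = 0" by simp
  qed (use fin in auto)
  have "\<exists>K\<subseteq>I. card I = card K + card ?JJ \<and>
    (\<forall>b. \<exists>y. (\<forall>i\<in>K. y i = b i) \<and> (\<forall>p\<in>?JJ. (\<Sum>i\<in>I. M p i * y i) = 0)) \<and>
    (\<forall>y. (\<forall>i\<in>K. y i = 0) \<longrightarrow> (\<forall>p\<in>?JJ. (\<Sum>i\<in>I. M p i * y i) = 0) \<longrightarrow> (\<forall>i\<in>I. y i = 0))"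
  proof (rule free_variables)
    show "\<forall>p\<in>?JJ. z p = 0" if "\<forall>i\<in>I. (\<Sum>p\<in>?JJ. z p * M p i) = 0" for z by (rule M_ind[OF that])
  qed (use fin in auto)
  then obtain K where K: "K \<subseteq> I" "card I = card K + card ?JJ"
    "\<forall>b. \<exists>y. (\<forall>i\<in>K. y i = b i) \<and> (\<forall>p\<in>?JJ. (\<Sum>i\<in>I. M p i * y i) = 0)"
    "\<forall>y. (\<forall>i\<in>K. y i = 0) \<longrightarrow> (\<forall>p\<in>?JJ. (\<Sum>i\<in>I. M p i * y i) = 0) \<longrightarrow> (\<forall>i\<in>I. y i = 0)"
    by (elim exE conjE) (rule that)
  have finK: "finite K" using K(1) fin finite_subset by blast
  have cardK: "card K + c = r" using K(2) card_I by (simp add: card_Plus)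
  have "\<forall>k. \<exists>y. (\<forall>i\<in>K. y i = (if i = k then 1 else 0)) \<and> (\<forall>p\<in>?JJ. (\<Sum>i\<in>I. M p i * y i) = 0)"
    by (rule allI, rule K(3)[THEN spec])
  from choice[OF this] obtain u where u: "\<forall>k. (\<forall>i\<in>K. u k i = (if i = k then 1 else 0)) \<and> (\<forall>p\<in>?JJ. (\<Sum>i\<in>I. M p i * u k i) = 0)"
    by (elim exE) (rule that)
  \<comment> \<open>Independence of all \<open>2c\<close> rows permits prescribing their values.
    \<open>q j\<close> is sent to unit vector \<open>j\<close> by \<open>a v\<close> and to zero by
    \<open>a w\<close>; \<open>p j\<close> is sent to zero by \<open>a v\<close> and to the negative
    unit vector by \<open>a w\<close>.\<close>
  have "\<forall>j. \<exists>y. \<forall>p\<in>?JJ. (\<Sum>i\<in>I. M p i * y i) = (if p = Inl j then 1 else 0)" by (rule allI, rule solve)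
  from choice[OF this] obtain q where q: "\<forall>j. \<forall>p\<in>?JJ. (\<Sum>i\<in>I. M p i * q j i) = (if p = Inl j then 1 else 0)"
    by (elim exE) (rule that)
  have "\<forall>j. \<exists>y. \<forall>p\<in>?JJ. (\<Sum>i\<in>I. M p i * y i) = (if p = Inr j then -1 else 0)" by (rule allI, rule solve)
  from choice[OF this] obtain p where p: "\<forall>j. \<forall>p'\<in>?JJ. (\<Sum>i\<in>I. M p' i * p j i) = (if p' = Inr j then -1 else 0)"
    by (elim exE) (rule that)
  have Av: "(\<Sum>i\<in>I. a k i v * q j i) = (if k = j then 1 else 0)" "(\<Sum>i\<in>I. a k i v * p j i) = 0" "(\<Sum>i\<in>I. a k i v * u l i) = 0"
    and Aw: "(\<Sum>i\<in>I. a k i w * q j i) = 0" "(\<Sum>i\<in>I. a k i w * p j i) = (if k = j then -1 else 0)" "(\<Sum>i\<in>I. a k i w * u l i) = 0"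
    if "k < c" for k j l
    using q[THEN spec, of j, THEN bspec, of "Inl k"] p[THEN spec, of j, THEN bspec, of "Inl k"]
      u[THEN spec, of l, THEN conjunct2, THEN bspec, of "Inl k"]
      q[THEN spec, of j, THEN bspec, of "Inr k"] p[THEN spec, of j, THEN bspec, of "Inr k"]
      u[THEN spec, of l, THEN conjunct2, THEN bspec, of "Inr k"] that by (auto simp: M_def)
  obtain cs ct where cst: "(\<Sum>k\<in>UNIV. cs k * v $ k) = 1" "(\<Sum>k\<in>UNIV. cs k * w $ k) = 0"
    "(\<Sum>k\<in>UNIV. ct k * v $ k) = 0" "(\<Sum>k\<in>UNIV. ct k * w $ k) = 1"
    using linear_coordinates[OF vw] by (elim exE conjE) (rule that)
  define \<sigma> where "\<sigma> x = (\<Sum>k\<in>UNIV. cs k * x $ k)" for x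
  define \<tau> where "\<tau> x = (\<Sum>k\<in>UNIV. ct k * x $ k)" for x
  have lin: "\<sigma> (s *s v + t *s w) = s" "\<tau> (s *s v + t *s w) = t" for s t
  proof -
    have "\<sigma> (s *s v + t *s w) = s * (\<Sum>k\<in>UNIV. cs k * v $ k) + t * (\<Sum>k\<in>UNIV. cs k * w $ k)"
      by (simp add: \<sigma>_def distrib_left sum.distrib sum_distrib_left mult.left_commute)
    then show "\<sigma> (s *s v + t *s w) = s" by (simp add: cst)
    have "\<tau> (s *s v + t *s w) = s * (\<Sum>k\<in>UNIV. ct k * v $ k) + t * (\<Sum>k\<in>UNIV. ct k * w $ k)"
      by (simp add: \<tau>_def distrib_left sum.distrib sum_distrib_left mult.left_commute)
    then show "\<tau> (s *s v + t *s w) = t" by (simp add: cst)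
  qed
  have rep: "x = \<sigma> x *s v + \<tau> x *s w" "\<sigma> x \<noteq> 0 \<or> \<tau> x \<noteq> 0" if x: "x \<noteq> 0" "pt x \<in> ?L" for x
  proof -
    obtain s t where "s \<noteq> 0 \<or> t \<noteq> 0" "x = s *s v + t *s w" using line_rep[OF vw x] by blast
    then show "x = \<sigma> x *s v + \<tau> x *s w" "\<sigma> x \<noteq> 0 \<or> \<tau> x \<noteq> 0" using lin by auto
  qed
  have hom: "\<sigma> (t *s x) = t * \<sigma> x" "\<tau> (t *s x) = t * \<tau> x" for t x
    by (simp_all add: \<sigma>_def \<tau>_def sum_distrib_left mult.left_commute)
  \<comment> \<open>At \<open>x = s v + t w\<close> the matrix is \<open>s\<close> times
    \<open>a v\<close> plus \<open>t\<close> times \<open>a w\<close>. On \<open>s\<close> times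
    \<open>p j\<close> plus \<open>t\<close> times \<open>q j\<close> it yields \<open>s t\<close>
    and \<open>- t s\<close> in row \<open>j\<close>, hence zero.\<close>
  define G where "G m x i = (case m of Inl j \<Rightarrow> \<sigma> x * p j i + \<tau> x * q j i | Inr k \<Rightarrow> u k i)" for m :: "nat + nat" and x i
  let ?J = "{..<c} <+> K" and ?d = "case_sum (\<lambda>_. -1) (\<lambda>_. 0) :: nat + nat \<Rightarrow> int"
  have finJ: "finite ?J" using finK by simp
  have plus: "(\<Sum>m\<in>?J. g m) = (\<Sum>j<c. g (Inl j)) + (\<Sum>k\<in>K. g (Inr k))" for g :: "nat + nat \<Rightarrow> 'a"
    using finK by (simp add: sum.Plus)
  have AvG: "(\<Sum>i\<in>I. a k i v * G m x i) = (if m = Inl k then \<tau> x else 0)"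
    and AwG: "(\<Sum>i\<in>I. a k i w * G m x i) = (if m = Inl k then - \<sigma> x else 0)" if k: "k < c" for k m x
  proof -
    have "(\<Sum>i\<in>I. f i * (\<sigma> x * p j i + \<tau> x * q j i)) = \<sigma> x * (\<Sum>i\<in>I. f i * p j i) + \<tau> x * (\<Sum>i\<in>I. f i * q j i)" for f j
      by (simp add: distrib_left sum.distrib sum_distrib_left mult.left_commute)
    then show "(\<Sum>i\<in>I. a k i v * G m x i) = (if m = Inl k then \<tau> x else 0)"
      "(\<Sum>i\<in>I. a k i w * G m x i) = (if m = Inl k then - \<sigma> x else 0)"
      using Av[OF k] Aw[OF k] by (cases m; simp add: G_def)+
  qed
  have a_split: "a k i x = \<sigma> x * a k i v + \<tau> x * a k i w" if "x \<noteq> 0" "pt x \<in> ?L" "k < c" "i \<in> I" for k i x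
    using a_add[OF that(3,4)] a_scale[OF that(3,4)] rep(1)[OF that(1,2)] by metis
  have A_sum: "(\<Sum>i\<in>I. a k i x * y i) = \<sigma> x * (\<Sum>i\<in>I. a k i v * y i) + \<tau> x * (\<Sum>i\<in>I. a k i w * y i)"
    if x: "x \<noteq> 0" "pt x \<in> ?L" and k: "k < c" for k x y
  proof -
    have "(\<Sum>i\<in>I. a k i x * y i) = (\<Sum>i\<in>I. \<sigma> x * (a k i v * y i) + \<tau> x * (a k i w * y i))"
      using a_split[OF x k] by (intro sum.cong) (auto simp: distrib_right mult.assoc)
    then show ?thesis by (simp add: sum.distrib sum_distrib_left)
  qed
  have P: "pt x \<in> proj_space" if "pt x \<in> ?L" for x using that L by auto
  have sub: "subspace (fibre E (pt x))" if "pt x \<in> ?L" for x using fibre_subspace P[OF that] base by simp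
  define b where "b m x = (SOME f. f \<in> fibre E (pt x) \<and> (\<forall>i\<in>I. \<eta> (pt x) f i = G m x i))" for m x
  have b: "b m x \<in> fibre E (pt x)" "\<And>i. i \<in> I \<Longrightarrow> \<eta> (pt x) (b m x) i = G m x i" if x: "x \<noteq> 0" "pt x \<in> ?L" for m x
  proof -
    have "\<forall>k<c. (\<Sum>i\<in>I. a k i x * G m x i) = 0" using A_sum[OF x] AvG AwG by simp
    then have "\<exists>f. f \<in> fibre E (pt x) \<and> (\<forall>i\<in>I. \<eta> (pt x) f i = G m x i)" using eta_kernel[OF x(1), of "G m x"] by blast
    then have "b m x \<in> fibre E (pt x) \<and> (\<forall>i\<in>I. \<eta> (pt x) (b m x) i = G m x i)" unfolding b_def by (rule someI_ex)
    then show "b m x \<in> fibre E (pt x)" "\<And>i. i \<in> I \<Longrightarrow> \<eta> (pt x) (b m x) i = G m x i" by auto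
  qed
  have b_sum_in: "(\<Sum>m\<in>?J. smult E (z m) (b m x)) \<in> fibre E (pt x)" if "x \<noteq> 0" "pt x \<in> ?L" for x z
    using b(1)[OF that] by (intro subspace_sum[OF sub[OF that(2)]] subspace_scale[OF sub[OF that(2)]])
  have b_sum: "\<eta> (pt x) (\<Sum>m\<in>?J. smult E (z m) (b m x)) i = (\<Sum>m\<in>?J. z m * G m x i)"
    if x: "x \<noteq> 0" "pt x \<in> ?L" and i: "i \<in> I" for x z i
    using eta_sum[OF P[OF x(2)] b(1)[OF x] i, where z = z and A = ?J] b(2)[OF x i] by simp
  have G_ind: "\<forall>m\<in>?J. z m = 0" if x: "x \<noteq> 0" "pt x \<in> ?L" and z: "\<forall>i\<in>I. (\<Sum>m\<in>?J. z m * G m x i) = 0" for x z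
  proof -
    have swap: "(\<Sum>m\<in>?J. z m * (\<Sum>i\<in>I. f i * G m x i)) = 0" for f
      using z by (simp add: sum_swap_mult[where f = f and x = z, symmetric])
    have delta: "(\<Sum>m\<in>?J. z m * (if m = Inl k then t else 0)) = z (Inl k) * t" if "k < c" for k t
      using finJ that by (simp add: if_distrib[of "\<lambda>x. _ * x"] cong: if_cong)
    have z1: "z (Inl k) = 0" if "k < c" for k
    proof -
      have "z (Inl k) * \<tau> x = 0" using swap[of "\<lambda>i. a k i v"] AvG[OF that] delta[OF that] by simp
      moreover have "z (Inl k) * (- \<sigma> x) = 0" using swap[of "\<lambda>i. a k i w"] AwG[OF that] delta[OF that] by simp
      ultimately show ?thesis using rep(2)[OF x] by auto
    qed
    have "z (Inr k) = 0" if k: "k \<in> K" for k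
    proof -
      have "0 = (\<Sum>j\<in>K. z (Inr j) * u j k)" using z[THEN bspec, of k] K(1) k z1 by (auto simp: plus G_def)
      also have "\<dots> = (\<Sum>j\<in>K. if j = k then z (Inr j) else 0)" using u k by (intro sum.cong) auto
      finally show ?thesis using finK k by simp
    qed
    with z1 show ?thesis by auto
  qed
  have G_span: "\<exists>z. \<forall>i\<in>I. (\<Sum>m\<in>?J. z m * G m x i) = y i"
    if x: "x \<noteq> 0" "pt x \<in> ?L" and y: "\<forall>k<c. (\<Sum>i\<in>I. a k i x * y i) = 0" for x y
  proof -
    define \<alpha> where "\<alpha> k = (\<Sum>i\<in>I. a k i v * y i)" for k
    define \<beta> where "\<beta> k = (\<Sum>i\<in>I. a k i w * y i)" for k
    \<comment> \<open>By \<open>rel\<close> the pair of \<open>\<alpha> k\<close> and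
      \<open>\<beta> k\<close> is orthogonal to that of \<open>\<sigma> x\<close> and
      \<open>\<tau> x\<close>, hence a multiple of \<open>\<tau> x\<close> and
      \<open>- \<sigma> x\<close>. The factor is read off from a nonzero coordinate.\<close>
    define l where "l k = (if \<tau> x \<noteq> 0 then \<alpha> k / \<tau> x else - \<beta> k / \<sigma> x)" for k
    have rel: "\<sigma> x * \<alpha> k + \<tau> x * \<beta> k = 0" if "k < c" for k using y A_sum[OF x that, of y] that by (simp add: \<alpha>_def \<beta>_def)
    have l: "l k * \<tau> x = \<alpha> k \<and> - (l k * \<sigma> x) = \<beta> k" if k: "k < c" for k
    proof (cases "\<tau> x = 0")
      case True
      then show ?thesis using rel[OF k] rep(2)[OF x] by (simp add: l_def)
    next
      case False
      then have "\<beta> k = - (\<sigma> x * \<alpha> k) / \<tau> x" using rel[OF k] by (simp add: field_simps eq_neg_iff_add_eq_0 add.commute)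
      then show ?thesis using False by (simp add: l_def mult.commute)
    qed
    define z where "z m = (case m of Inl k \<Rightarrow> l k | Inr k \<Rightarrow> y k - (\<Sum>j<c. l j * G (Inl j) x k))" for m
    \<comment> \<open>The first part of \<open>z\<close> removes the values under \<open>a v\<close>
      and \<open>a w\<close>, the second part the entries on \<open>K\<close>. The remainder
      vanishes by the uniqueness half of \<open>free_variables\<close>.\<close>
    define e where "e i = y i - (\<Sum>m\<in>?J. z m * G m x i)" for i
    have eK: "e k = 0" if k: "k \<in> K" for k
    proof -
      have "(\<Sum>j\<in>K. z (Inr j) * u j k) = (\<Sum>j\<in>K. if j = k then z (Inr j) else 0)" using u k by (intro sum.cong) auto
      also have "\<dots> = z (Inr k)" using finK k by simp
      finally have "(\<Sum>m\<in>?J. z m * G m x k) = (\<Sum>j<c. l j * G (Inl j) x k) + z (Inr k)"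
        by (simp add: plus z_def G_def)
      then show ?thesis by (simp add: e_def z_def)
    qed
    have swap: "(\<Sum>i\<in>I. f i * e i) = (\<Sum>i\<in>I. f i * y i) - (\<Sum>m\<in>?J. z m * (\<Sum>i\<in>I. f i * G m x i))" for f
      by (simp add: e_def right_diff_distrib sum_subtractf sum_swap_mult[where f = f and x = z])
    have delta: "(\<Sum>m\<in>?J. z m * (if m = Inl k then t else 0)) = l k * t" if "k < c" for k t
      using finJ that by (simp add: if_distrib[of "\<lambda>x. _ * x"] z_def cong: if_cong)
    have "\<forall>p'\<in>?JJ. (\<Sum>i\<in>I. M p' i * e i) = 0"
    proof
      fix p' assume "p' \<in> ?JJ"
      then consider k where "k < c" "p' = Inl k" | k where "k < c" "p' = Inr k" by auto
      then show "(\<Sum>i\<in>I. M p' i * e i) = 0"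
      proof cases
        case 1
        then show ?thesis using swap[of "\<lambda>i. a k i v"] AvG[OF 1(1)] delta[OF 1(1)] l[OF 1(1)]
          by (simp add: M_def \<alpha>_def[symmetric])
      next
        case 2
        then show ?thesis using swap[of "\<lambda>i. a k i w"] AwG[OF 2(1)] delta[OF 2(1), of "- \<sigma> x"] l[OF 2(1)]
          by (simp add: M_def \<beta>_def[symmetric])
      qed
    qed
    moreover have "\<forall>i\<in>K. e i = 0" using eK by blast
    ultimately have "\<forall>i\<in>I. e i = 0" using K(4)[THEN spec, THEN mp, THEN mp] by blast
    then show ?thesis by (intro exI[of _ z]) (simp add: e_def)
  qed
  have d_neg: "rat ?L (- ?d m) (\<lambda>x. G m x i) y" for m i y
  proof (cases m)
    case (Inl j)
    have "rat ?L 1 (\<lambda>x. \<sigma> x * p j i + \<tau> x * q j i) y"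
      unfolding \<sigma>_def \<tau>_def using rat_scale[OF rat_linear] by (intro rat_add) (simp_all add: mult.commute)
    then show ?thesis using Inl by (simp add: G_def)
  next
    case (Inr k) then show ?thesis by (simp add: G_def rat_const)
  qed
  let ?R = "restrict_bundle ?L E"
  have R: "base ?R = ?L" "fibre ?R = fibre E" "smult ?R = smult E"
    "sects ?R U = {s. \<forall>x\<in>U. \<exists>W. \<exists>t\<in>sects E W. zopen (base E) W \<and> x \<in> W \<and> (\<forall>y\<in>W \<inter> U. s y = t y)}" for U
    by (simp_all add: restrict_bundle_def)
  have "framed ?R ?L ?J ?d b"
  proof (rule framed.intro, rule restrict_vector_space, rule framed_axioms.intro, unfold R, goal_cases)
    case 1 show ?case by simp
  next
    case 2 show ?case by (rule L)
  next
    case 3 show ?case by (rule finJ)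
  next
    case (4 x)
    have "\<exists>z. f = (\<Sum>m\<in>?J. smult E (z m) (b m x))" if f: "f \<in> fibre E (pt x)" for f
    proof -
      have "\<forall>k<c. (\<Sum>i\<in>I. a k i x * \<eta> (pt x) f i) = 0" using eta_in_kernel[OF 4(1) f] by blast
      from G_span[OF 4 this] obtain z where z: "\<forall>i\<in>I. (\<Sum>m\<in>?J. z m * G m x i) = \<eta> (pt x) f i" by blast
      have "f = (\<Sum>m\<in>?J. smult E (z m) (b m x))"
        by (rule eta_eq[OF P[OF 4(2)] f b_sum_in[OF 4]]) (use b_sum[OF 4] z in simp)
      then show ?thesis by blast
    qed
    then show ?case using b_sum_in[OF 4] by blast
  next
    case (5 x z m)
    have "(\<Sum>m\<in>?J. z m * G m x i) = 0" if "i \<in> I" for i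
      using b_sum[OF 5(1,2) that, of z] unfolding 5(3) using eta_zero[OF P[OF 5(2)] that] by simp
    then show ?case using G_ind[OF 5(1,2), of z] 5(4) by blast
  next
    case (6 x t m)
    have tx: "t *s x \<noteq> 0" "pt (t *s x) \<in> ?L" using 6 by (auto simp: pt_scale)
    show ?case
    proof (rule eta_eq[OF P[OF tx(2)] b(1)[OF tx]])
      show "smult E (t powi - ?d m) (b m x) \<in> fibre E (pt (t *s x))"
        using subspace_scale[OF sub[OF 6(2)] b(1)[OF 6(1,2)]] 6 by (simp add: pt_scale)
      show "\<forall>i\<in>I. \<eta> (pt (t *s x)) (b m (t *s x)) i = \<eta> (pt (t *s x)) (smult E (t powi - ?d m) (b m x)) i"
      proof
        fix i assume i: "i \<in> I"
        have "G m (t *s x) i = t powi - ?d m * G m x i" by (cases m) (simp_all add: G_def hom algebra_simps)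
        then show "\<eta> (pt (t *s x)) (b m (t *s x)) i = \<eta> (pt (t *s x)) (smult E (t powi - ?d m) (b m x)) i"
          using b(2)[OF tx i] eta_scale[OF P[OF 6(2)] b(1)[OF 6(1,2)] i] b(2)[OF 6(1,2) i] 6 by (simp add: pt_scale)
      qed
    qed
  next
    case (7 U s)
    have "(\<exists>W. \<exists>t\<in>sects E W. zopen (base E) W \<and> x \<in> W \<and> (\<forall>y\<in>W \<inter> U. s y = t y)) \<longleftrightarrow>
        (\<exists>f. (\<forall>m\<in>?J. rat ?L (?d m) (f m) x) \<and> eventually (\<lambda>v. s (pt v) = (\<Sum>m\<in>?J. smult E (f m v) (b m v))) (zn ?L x))"
      if x: "x \<in> U" for x
    proof
      have xL: "x \<in> ?L" using x zopen_subset[OF 7] by auto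
      obtain x0 where x0: "x0 \<noteq> 0" "x = pt x0" using xL L proj_spaceE by blast
      have x0L: "pt x0 \<in> ?L" using xL x0 by simp
      have xb: "x \<in> base E" using xL Lb by auto
      {
        assume "\<exists>W. \<exists>t\<in>sects E W. zopen (base E) W \<and> x \<in> W \<and> (\<forall>y\<in>W \<inter> U. s y = t y)"
        then obtain W t where W: "t \<in> sects E W" "zopen (base E) W" "x \<in> W" "\<forall>y\<in>W \<inter> U. s y = t y"
          by (elim exE bexE conjE) (rule that)
        have ex: "\<exists>z. \<forall>i\<in>I. (\<Sum>m\<in>?J. z m * G m v i) = \<eta> (pt v) (t (pt v)) i" if v: "v \<noteq> 0" "pt v \<in> ?L" "pt v \<in> W" for v
          by (rule G_span[OF v(1,2)]) (use eta_in_kernel[OF v(1) sects_in_fibre[OF W(2,1) v(3)]] in blast)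
        \<comment> \<open>The coefficients are chosen pointwise; since the vectors
          \<open>G m v\<close> are independent, \<open>coefficients_rat\<close> makes them
          regular.\<close>
        define f where "f m v = (SOME z. \<forall>i\<in>I. (\<Sum>m\<in>?J. z m * G m v i) = \<eta> (pt v) (t (pt v)) i) m" for m v
        have f: "\<forall>i\<in>I. (\<Sum>m\<in>?J. f m v * G m v i) = \<eta> (pt v) (t (pt v)) i" if v: "v \<noteq> 0" "pt v \<in> ?L" "pt v \<in> W" for v
          unfolding f_def by (rule someI_ex[OF ex[OF v]])
        have opL: "zopen ?L (W \<inter> U)" "x \<in> W \<inter> U"
        proof -
          have "zopen ?L ((W \<inter> ?L) \<inter> U)" using zopen_Int[OF zopen_mono[OF Lb W(2)] 7] .
          moreover have "(W \<inter> ?L) \<inter> U = W \<inter> U" using zopen_subset[OF 7] by auto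
          ultimately show "zopen ?L (W \<inter> U)" by simp
          show "x \<in> W \<inter> U" using W x by simp
        qed
        have WL: "y \<in> ?L" if "y \<in> W \<inter> U" for y using zopen_subset[OF 7] that by auto
        have W': "zopen proj_space W" using W(2) base by simp
        have "\<forall>m\<in>?J. rat ?L (0 - - ?d m) (f m) (pt x0)"
        proof (rule coefficients_rat[where m = "\<lambda>m i v. G m v i" and I = I and g = "\<lambda>i v. \<eta> (pt v) (t (pt v)) i",
              OF finJ L x0L x0(1)])
          show "rat ?L (- ?d m) (\<lambda>v. G m v i) (pt x0)" for m i by (rule d_neg)
          show "rat ?L 0 (\<lambda>v. \<eta> (pt v) (t (pt v)) i) (pt x0)" if "i \<in> I" for i
            using rat_mono[OF eta_regular[OF W' W(1,3) that] L _ xL] x0 by simp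
          have "eventually (\<lambda>v. \<forall>i\<in>I. (\<Sum>m\<in>?J. f m v * G m v i) = \<eta> (pt v) (t (pt v)) i) (zn ?L x)"
            using eventually_zn_open[OF opL L] by eventually_elim (use f WL in blast)
          then show "eventually (\<lambda>v. \<forall>i\<in>I. (\<Sum>m\<in>?J. f m v * G m v i) = \<eta> (pt v) (t (pt v)) i) (zn ?L (pt x0))"
            using x0 by simp
          show "\<forall>m\<in>?J. z m = 0" if "\<forall>i\<in>I. (\<Sum>m\<in>?J. z m * G m x0 i) = 0" for z by (rule G_ind[OF x0(1) x0L that])
        qed
        then have "\<forall>m\<in>?J. rat ?L (?d m) (f m) x" using x0 by simp
        moreover have "eventually (\<lambda>v. s (pt v) = (\<Sum>m\<in>?J. smult E (f m v) (b m v))) (zn ?L x)"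
          using eventually_zn_open[OF opL L]
        proof eventually_elim
          case (elim v)
          then have v: "v \<noteq> 0" "pt v \<in> ?L" "pt v \<in> W" using WL by auto
          have "t (pt v) = (\<Sum>m\<in>?J. smult E (f m v) (b m v))"
            by (rule eta_eq[OF P[OF v(2)] sects_in_fibre[OF W(2,1) v(3)] b_sum_in[OF v(1,2)]])
               (use b_sum[OF v(1,2)] f[OF v] in simp)
          then show ?case using W(4) elim by simp
        qed
        ultimately show "\<exists>f. (\<forall>m\<in>?J. rat ?L (?d m) (f m) x) \<and>
            eventually (\<lambda>v. s (pt v) = (\<Sum>m\<in>?J. smult E (f m v) (b m v))) (zn ?L x)" by blast
      }
      {
        assume "\<exists>f. (\<forall>m\<in>?J. rat ?L (?d m) (f m) x) \<and> eventually (\<lambda>v. s (pt v) = (\<Sum>m\<in>?J. smult E (f m v) (b m v))) (zn ?L x)"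
        then obtain f where f: "\<forall>m\<in>?J. rat ?L (?d m) (f m) x"
          "eventually (\<lambda>v. s (pt v) = (\<Sum>m\<in>?J. smult E (f m v) (b m v))) (zn ?L x)" by (elim exE conjE) (rule that)
        obtain V e where V: "zopen (base E) V" "x \<in> V"
          and fr: "\<And>y. y \<in> V \<Longrightarrow> fibre E y = {\<Sum>i<r. smult E (z i) (e i y) | z. True}"
            "\<And>y z i. y \<in> V \<Longrightarrow> (\<Sum>i<r. smult E (z i) (e i y)) = 0 \<Longrightarrow> i < r \<Longrightarrow> z i = 0"
          and se: "\<And>W s. zopen (base E) W \<Longrightarrow> W \<subseteq> V \<Longrightarrow> s \<in> sects E W \<longleftrightarrow>
            (\<exists>f. (\<forall>i<r. \<forall>y\<in>W. rat (base E) 0 (\<lambda>v. f i (pt v)) y) \<and> (\<forall>y\<in>W. s y = (\<Sum>i<r. smult E (f i y) (e i y))))"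
          using xb by (rule local_frame) blast
        have e_sum: "e i y = (\<Sum>k<r. smult E (if k = i then 1 else 0) (e k y))" if "i < r" for i y
          using that by (simp add: if_distrib[of "\<lambda>x. smult E x _"] cong: if_cong)
        have e_sect: "e i \<in> sects E V" if "i < r" for i
          unfolding se[OF V(1) subset_refl] using e_sum[OF that]
          by (intro exI[of _ "\<lambda>k y. if k = i then 1 else 0"]) (auto simp: rat_const)
        have V': "zopen proj_space V" using V(1) base by simp
        have e_in: "e i y \<in> fibre E y" if "i < r" "y \<in> V" for i y by (rule sects_in_fibre[OF V(1) e_sect[OF that(1)] that(2)])
        have e_eta: "\<eta> y (\<Sum>k<r. smult E (z k) (e k y)) i = (\<Sum>k<r. z k * \<eta> y (e k y) i)" if "y \<in> V" "i \<in> I" for y z i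
          using zopen_subset[OF V'] that e_in by (intro eta_sum) auto
        have opL: "zopen ?L (V \<inter> ?L)" "x \<in> V \<inter> ?L" using zopen_mono[OF Lb V(1)] V xL by auto
        have ex: "\<exists>z. s' = (\<Sum>i<r. smult E (z i) (e i (pt v)))" if "pt v \<in> V" "s' \<in> fibre E (pt v)" for v s'
          using fr(1)[OF that(1)] that(2) by auto
        \<comment> \<open>For the converse a combination of the frame on the line must extend to a
          section of \<open>E\<close>. It is rewritten in a local frame \<open>e\<close> of
          \<open>E\<close>, where its coefficients have degree \<open>0\<close>.\<close>
        define h where "h i v = (SOME z. (\<Sum>m\<in>?J. smult E (f m v) (b m v)) = (\<Sum>i<r. smult E (z i) (e i (pt v)))) i" for i v
        have h: "(\<Sum>m\<in>?J. smult E (f m v) (b m v)) = (\<Sum>i<r. smult E (h i v) (e i (pt v)))" if v: "v \<noteq> 0" "pt v \<in> V \<inter> ?L" for v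
          unfolding h_def by (rule someI_ex[OF ex]) (use v b_sum_in[of v] in auto)
        have "\<forall>k\<in>{..<r}. rat ?L (0 - 0) (h k) (pt x0)"
        proof (rule coefficients_rat[where m = "\<lambda>k i v. \<eta> (pt v) (e k (pt v)) i" and I = I and g = "\<lambda>i v. \<Sum>m\<in>?J. f m v * G m v i" and d = "\<lambda>_. 0",
              OF finite_lessThan L x0L x0(1)])
          show "rat ?L 0 (\<lambda>v. \<eta> (pt v) (e k (pt v)) i) (pt x0)" if "k \<in> {..<r}" "i \<in> I" for k i
            using rat_mono[OF eta_regular[OF V' e_sect V(2) that(2)] L _ xL] that x0 by simp
          show "rat ?L 0 (\<lambda>v. \<Sum>m\<in>?J. f m v * G m v i) (pt x0)" for i
          proof (rule rat_sum[OF _ L x0L])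
            fix m assume "m \<in> ?J"
            then have "rat ?L (?d m + - ?d m) (\<lambda>v. f m v * G m v i) (pt x0)" using f(1) x0 d_neg by (intro rat_mult) auto
            then show "rat ?L 0 (\<lambda>v. f m v * G m v i) (pt x0)" by simp
          qed
          have "eventually (\<lambda>v. \<forall>i\<in>I. (\<Sum>k<r. h k v * \<eta> (pt v) (e k (pt v)) i) = (\<Sum>m\<in>?J. f m v * G m v i)) (zn ?L x)"
            using eventually_zn_open[OF opL L]
          proof eventually_elim
            case (elim v)
            show ?case
            proof
              fix i assume i: "i \<in> I"
              show "(\<Sum>k<r. h k v * \<eta> (pt v) (e k (pt v)) i) = (\<Sum>m\<in>?J. f m v * G m v i)"
                using e_eta[of "pt v" i "\<lambda>k. h k v"] b_sum[of v i "\<lambda>m. f m v"] h[of v] elim i by simp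
            qed
          qed
          then show "eventually (\<lambda>v. \<forall>i\<in>I. (\<Sum>k\<in>{..<r}. h k v * \<eta> (pt v) (e k (pt v)) i) = (\<Sum>m\<in>?J. f m v * G m v i)) (zn ?L (pt x0))"
            using x0 by simp
          show "\<forall>k\<in>{..<r}. z k = 0" if z: "\<forall>i\<in>I. (\<Sum>k\<in>{..<r}. z k * \<eta> (pt x0) (e k (pt x0)) i) = 0" for z
          proof -
            have xV: "pt x0 \<in> V" using V x0 by simp
            have "(\<Sum>k<r. smult E (z k) (e k (pt x0))) \<in> fibre E (pt x0)" unfolding fr(1)[OF xV] by blast
            then have "(\<Sum>k<r. smult E (z k) (e k (pt x0))) = 0"
              by (rule eta_inj[OF P[OF x0L]]) (use e_eta[OF xV] z in simp)
            then show ?thesis using fr(2)[OF xV] by blast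
          qed
        qed
        then have h_rat: "rat ?L 0 (h k) x" if "k < r" for k using that x0 by simp
        \<comment> \<open>Coefficients of degree \<open>0\<close> extend off the line, and with the
          frame \<open>e\<close> they define a section of \<open>E\<close> near
          \<open>x\<close>.\<close>
        have "\<forall>k\<in>{..<r}. \<exists>p. zopen (base E) (fst p) \<and> x \<in> fst p \<and> (\<forall>y\<in>fst p. rat (base E) 0 (\<lambda>v. snd p (pt v)) y) \<and>
          (\<forall>v. v \<noteq> 0 \<longrightarrow> pt v \<in> fst p \<inter> ?L \<longrightarrow> snd p (pt v) = h k v)"
        proof
          fix k assume "k \<in> {..<r}"
          then have "rat ?L 0 (h k) x" using h_rat by simp
          from rat_degree_0_extends[OF this Lb base_subset xL] obtain W g where "zopen (base E) W \<and> x \<in> W \<and>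
            (\<forall>y\<in>W. rat (base E) 0 (\<lambda>v. g (pt v)) y) \<and> (\<forall>v. v \<noteq> 0 \<longrightarrow> pt v \<in> W \<inter> ?L \<longrightarrow> g (pt v) = h k v)"
            by (elim exE) (rule that)
          then show "\<exists>p. zopen (base E) (fst p) \<and> x \<in> fst p \<and> (\<forall>y\<in>fst p. rat (base E) 0 (\<lambda>v. snd p (pt v)) y) \<and>
            (\<forall>v. v \<noteq> 0 \<longrightarrow> pt v \<in> fst p \<inter> ?L \<longrightarrow> snd p (pt v) = h k v)" by (intro exI[of _ "(W, g)"]) simp
        qed
        from bchoice[OF this] obtain pg where pg: "\<forall>k\<in>{..<r}. zopen (base E) (fst (pg k)) \<and> x \<in> fst (pg k) \<and>
          (\<forall>y\<in>fst (pg k). rat (base E) 0 (\<lambda>v. snd (pg k) (pt v)) y) \<and>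
          (\<forall>v. v \<noteq> 0 \<longrightarrow> pt v \<in> fst (pg k) \<inter> ?L \<longrightarrow> snd (pg k) (pt v) = h k v)" by (elim exE) (rule that)
        from f(2)[unfolded eventually_zn[OF L xL]] obtain W1 where W1: "zopen ?L W1" "x \<in> W1"
          "\<forall>y\<in>W1. \<forall>v\<in>y - {0}. s (pt v) = (\<Sum>m\<in>?J. smult E (f m v) (b m v))" by (elim exE conjE) (rule that)
        obtain W2 where W2: "zopen (base E) W2" "W1 = W2 \<inter> ?L" using zopen_extend[OF Lb W1(1)] by blast
        define W where "W = (base E \<inter> (\<Inter>k\<in>{..<r}. fst (pg k))) \<inter> (V \<inter> W2)"
        have W: "zopen (base E) W" "x \<in> W" "W \<subseteq> V"
          unfolding W_def using zopen_finite_Int[OF base_subset finite_lessThan, of r "\<lambda>k. fst (pg k)"] pg V W2 W1(2) xb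
          by (auto intro: zopen_Int)
        define t where "t y = (\<Sum>k<r. smult E (snd (pg k) y) (e k y))" for y
        have "t \<in> sects E W"
          unfolding se[OF W(1,3)] t_def
          by (intro exI[of _ "\<lambda>k. snd (pg k)"]) (use pg in \<open>auto simp: W_def\<close>)
        moreover have "s y = t y" if y: "y \<in> W \<inter> U" for y
        proof -
          have yL: "y \<in> ?L" using zopen_subset[OF 7] y by auto
          obtain y0 where y0: "y0 \<noteq> 0" "y = pt y0" using yL L proj_spaceE by blast
          have "y \<in> W1" "y0 \<in> y - {0}" using y yL y0 W2(2) by (auto simp: W_def)
          then have "s y = (\<Sum>m\<in>?J. smult E (f m y0) (b m y0))" using W1(3) y0(2) by blast
          also have "\<dots> = (\<Sum>k<r. smult E (h k y0) (e k (pt y0)))" using h[OF y0(1)] y yL y0(2) W(3) by auto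
          also have "\<dots> = t y"
          proof -
            have "h k y0 = snd (pg k) y" if "k < r" for k
              using pg[THEN bspec, of k] that y yL y0 by (auto simp: W_def)
            then show ?thesis unfolding t_def by (simp add: y0(2))
          qed
          finally show ?thesis .
        qed
        ultimately show "\<exists>W. \<exists>t\<in>sects E W. zopen (base E) W \<and> x \<in> W \<and> (\<forall>y\<in>W \<inter> U. s y = t y)"
          using W by (intro exI[of _ W] bexI[of _ t]) auto
      }
    qed
    then show ?case by auto
  qed
  then show ?thesis by (intro exI[of _ K] exI[of _ b] conjI finK cardK)
qed

lemma functional_onD:
  assumes "functional_on E \<theta>" "x \<in> base E" "u \<in> fibre E x"
  shows "w \<in> fibre E x \<Longrightarrow> \<theta> x (u + w) = \<theta> x u + \<theta> x w" "\<theta> x (smult E t u) = t * \<theta> x u"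
  using assms unfolding functional_on_def by blast+

text \<open>All functionals are kept on \<open>E\<close> itself and proved jointly surjective on
  fibres, so that a single map to a sum of \<open>\<alpha>\<close> copies of \<open>O\<close>
  results and no iterated extension has to be resolved.\<close>

lemma reduce_rank:
  fixes E :: "(('k::field_char_0 ^ 'n::finite) set, 'k, 'v::ab_group_add) vbundle"
  assumes pr: "presented E r \<eta> a I c" and rows: "rows2 a I c" and n: "CARD('n) = n + 1" "n \<ge> 2"
  shows "\<alpha> + (c + 2 * (n - 1)) \<le> r \<Longrightarrow> \<exists>\<theta> F a' I'. presented F (r - \<alpha>) \<eta> a' I' c \<and> rows2 a' I' c \<and> I' \<subseteq> I \<and>
    (\<forall>x. fibre F x = {u \<in> fibre E x. \<forall>k<\<alpha>. \<theta> k x u = 0}) \<and> smult F = smult E \<and> (\<forall>U. sects F U \<subseteq> sects E U) \<and>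
    (\<forall>k<\<alpha>. functional_on E (\<theta> k)) \<and> (\<forall>x\<in>proj_space. \<forall>b. \<exists>u\<in>fibre E x. \<forall>k<\<alpha>. \<theta> k x u = b k)"
proof (induction \<alpha>)
  case 0
  interpret presented E r \<eta> a I c by (rule pr)
  have "\<exists>u. u \<in> fibre E x" if "x \<in> proj_space" for x
    using subspace_0[OF fibre_subspace] that base by blast
  then show ?case using pr rows by (intro exI[of _ "\<lambda>_ _ _. 0"] exI[of _ E] exI[of _ a] exI[of _ I]) auto
next
  case (Suc \<alpha>)
  interpret E: presented E r \<eta> a I c by (rule pr)
  from Suc have "\<alpha> + (c + 2 * (n - 1)) \<le> r" by simp
  from Suc.IH[OF this] obtain \<theta> F a' I' where F: "presented F (r - \<alpha>) \<eta> a' I' c" "rows2 a' I' c" "I' \<subseteq> I"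
    "\<forall>x. fibre F x = {u \<in> fibre E x. \<forall>k<\<alpha>. \<theta> k x u = 0}" "smult F = smult E" "\<forall>U. sects F U \<subseteq> sects E U"
    "\<forall>k<\<alpha>. functional_on E (\<theta> k)" "\<forall>x\<in>proj_space. \<forall>b. \<exists>u\<in>fibre E x. \<forall>k<\<alpha>. \<theta> k x u = b k"
    by (elim exE conjE) (rule that)
  interpret F: presented F "r - \<alpha>" \<eta> a' I' c by (rule F(1))
  have "r - \<alpha> > c + 2 * (n - 1)" using Suc.prems by simp
  from hyperplane_step[OF F(1,2) n this] obtain l a'' I'' where step: "I'' \<subseteq> I'" "rows2 a'' I'' c"
    "presented (kernel_bundle F (\<lambda>x u. \<Sum>i\<in>I'. l i * \<eta> x u i)) (r - \<alpha> - 1) \<eta> a'' I'' c"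
    "\<forall>x\<in>proj_space. \<exists>u\<in>fibre F x. (\<Sum>i\<in>I'. l i * \<eta> x u i) \<noteq> 0" by (elim exE conjE) (rule that)
  \<comment> \<open>The functional found on \<open>F\<close> is a combination of coordinates
    \<open>\<eta>\<close>, and \<open>F\<close> shares these with \<open>E\<close>; because
    \<open>I'\<close> is contained in \<open>I\<close>, the same formula defines a functional on
    \<open>E\<close>.\<close>
  define t where "t x u = (\<Sum>i\<in>I'. l i * \<eta> x u i)" for x u
  define \<theta>' where "\<theta>' k = (if k < \<alpha> then \<theta> k else t)" for k
  have t: "functional_on E t" unfolding t_def by (rule E.functional_eta[OF F(3)])
  have fun_\<theta>': "functional_on E (\<theta>' k)" for k using F(7) t by (cases "k < \<alpha>") (auto simp: \<theta>'_def)
  let ?F' = "kernel_bundle F t"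
  have pr': "presented ?F' (r - Suc \<alpha>) \<eta> a'' I'' c" using step(3) by (simp add: t_def[abs_def])
  have fib: "fibre ?F' x = {u \<in> fibre E x. \<forall>k<Suc \<alpha>. \<theta>' k x u = 0}" for x
    using F(4) by (auto simp: kernel_bundle_def \<theta>'_def less_Suc_eq)
  have sec: "sects ?F' U \<subseteq> sects E U" for U using F(6) by (auto simp: kernel_bundle_def)
  have surj: "\<exists>u\<in>fibre E x. \<forall>k<Suc \<alpha>. \<theta>' k x u = g k" if x: "x \<in> proj_space" for x g
  proof -
    obtain u1 where u1: "u1 \<in> fibre E x" "\<forall>k<\<alpha>. \<theta> k x u1 = g k" using F(8) x by blast
    obtain u2 where u2': "u2 \<in> fibre F x" "t x u2 \<noteq> 0" using step(4) x unfolding t_def by blast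
    then have u2: "u2 \<in> fibre E x" "\<forall>k<\<alpha>. \<theta> k x u2 = 0" using F(4) by auto
    have sub: "E.subspace (fibre E x)" using E.fibre_subspace x E.base by simp
    \<comment> \<open>\<open>u2\<close> is killed by the old functionals but not by
      \<open>t\<close>, so adding a multiple of it corrects the last value alone.\<close>
    let ?e = "(g \<alpha> - t x u1) / t x u2"
    let ?u = "u1 + smult E ?e u2"
    have e2: "smult E ?e u2 \<in> fibre E x" by (rule E.subspace_scale[OF sub u2(1)])
    have xb: "x \<in> base E" using x E.base by simp
    have val: "\<theta>' k x ?u = \<theta>' k x u1 + ?e * \<theta>' k x u2" for k
      using functional_onD[OF fun_\<theta>' xb u1(1)] functional_onD[OF fun_\<theta>' xb u2(1)] e2 by simp
    have "\<theta>' k x ?u = g k" if "k < Suc \<alpha>" for k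
      using that u1(2) u2(2) u2'(2) val[of k] by (cases "k < \<alpha>") (auto simp: \<theta>'_def less_Suc_eq)
    moreover have "?u \<in> fibre E x" by (rule E.subspace_add[OF sub u1(1) e2])
    ultimately show ?thesis by blast
  qed
  have sm: "smult ?F' = smult E" using F(5) by (simp add: kernel_bundle_def)
  have sub': "I'' \<subseteq> I" using step(1) F(3) by blast
  show ?case
    by (intro exI[of _ \<theta>'] exI[of _ ?F'] exI[of _ a''] exI[of _ I''] conjI pr' step(2) sub' sm allI impI ballI fib sec fun_\<theta>' surj)
qed

text \<open>The functionals are the coefficients in a homogeneous frame of degree \<open>0\<close>;
  joint surjectivity and independence of the frame give image and kernel.\<close>

lemma functionals_to_trivial_bundle:
  fixes E :: "(('k::field ^ 'n::finite) set, 'k, 'v::ab_group_add) vbundle"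
  assumes base: "base E = proj_space" and fnl: "\<And>k. k < \<alpha> \<Longrightarrow> functional_on E (\<theta> k)"
    and surj: "\<And>x g. x \<in> proj_space \<Longrightarrow> \<exists>u\<in>fibre E x. \<forall>k<\<alpha>. \<theta> k x u = g k"
  shows "\<exists>\<psi>. bundle_hom E (twist_power proj_space 0 \<alpha>) \<psi> \<and>
    (\<forall>x\<in>proj_space. \<psi> x ` fibre E x = fibre (twist_power proj_space 0 \<alpha>) x \<and>
      (\<forall>u\<in>fibre E x. \<psi> x u = 0 \<longleftrightarrow> (\<forall>k<\<alpha>. \<theta> k x u = 0)))"
proof -
  let ?P = "proj_space :: ('k ^ 'n) set set" and ?T = "twist_power (proj_space :: ('k ^ 'n) set set) 0 \<alpha>"
  from framed_twist_power[OF subset_refl, of 0 \<alpha>] obtain bv where "framed ?T ?P {..<\<alpha>} (\<lambda>_. 0) bv" by blast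
  then interpret T: framed ?T ?P "{..<\<alpha>}" "\<lambda>_. 0" bv .
  define \<psi> where "\<psi> y u = (\<Sum>k<\<alpha>. smult ?T (\<theta> k y u) (bv k (rep y)))" for y u
  have \<psi>: "\<psi> (pt v) u = (\<Sum>k<\<alpha>. smult ?T (\<theta> k (pt v) u) (bv k v))" if v: "v \<noteq> 0" for v u
  proof -
    obtain t where t: "t \<noteq> 0" "rep (pt v) = t *s v" using rep_pt[OF v] by blast
    then show ?thesis unfolding \<psi>_def t(2) using T.homogeneous[OF v _ t(1)] v by (intro sum.cong) auto
  qed
  have in_T: "\<psi> (pt v) u \<in> fibre ?T (pt v)" if "v \<noteq> 0" for v u
    unfolding \<psi>[OF that] using T.sum_in_fibre[OF that] that by simp
  have "bundle_hom E ?T \<psi>"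
    unfolding bundle_hom_def
  proof (intro conjI ballI allI impI)
    show "base E = base ?T" using base T.base by simp
  next
    fix x assume xb: "x \<in> base E"
    then obtain v where v: "v \<noteq> 0" "x = pt v" using base proj_spaceE by blast
    show "\<psi> x ` fibre E x \<subseteq> fibre ?T x" using in_T[OF v(1)] v(2) by auto
    fix u assume u: "u \<in> fibre E x"
    show "\<psi> x (smult E t u) = smult ?T t (\<psi> x u)" for t
      unfolding v(2) \<psi>[OF v(1)] using functional_onD(2)[OF fnl xb u] v(2) by (simp add: T.scale_sum_right)
    fix w assume w: "w \<in> fibre E x"
    show "\<psi> x (u + w) = \<psi> x u + \<psi> x w"
      unfolding v(2) \<psi>[OF v(1)] using functional_onD(1)[OF fnl xb u w] v(2)
      by (simp add: T.scale_left_distrib sum.distrib)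
  next
    fix U s assume U: "zopen (base E) U" and s: "s \<in> sects E U"
    then have U': "zopen ?P U" using base by simp
    show "(\<lambda>x. \<psi> x (s x)) \<in> sects ?T U"
      unfolding T.sects[OF U']
    proof
      fix x assume x: "x \<in> U"
      have "eventually (\<lambda>v. \<psi> (pt v) (s (pt v)) = (\<Sum>k<\<alpha>. smult ?T (\<theta> k (pt v) (s (pt v))) (bv k v))) (zn ?P x)"
        using eventually_zn_open[OF U' x subset_refl] by eventually_elim (simp add: \<psi>)
      moreover have "rat ?P 0 (\<lambda>v. \<theta> k (pt v) (s (pt v))) x" if "k < \<alpha>" for k
        using fnl[OF that] U s x unfolding functional_on_def base by blast
      ultimately show "\<exists>f. (\<forall>k\<in>{..<\<alpha>}. rat ?P 0 (f k) x) \<and>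
          eventually (\<lambda>v. \<psi> (pt v) (s (pt v)) = (\<Sum>k<\<alpha>. smult ?T (f k v) (bv k v))) (zn ?P x)"
        by (intro exI[of _ "\<lambda>k v. \<theta> k (pt v) (s (pt v))"]) simp
    qed
  qed
  moreover have "\<psi> x ` fibre E x = fibre ?T x \<and> (\<forall>u\<in>fibre E x. \<psi> x u = 0 \<longleftrightarrow> (\<forall>k<\<alpha>. \<theta> k x u = 0))"
    if x: "x \<in> ?P" for x
  proof -
    obtain v where v: "v \<noteq> 0" "x = pt v" using x proj_spaceE by blast
    have vP: "pt v \<in> ?P" using v by simp
    have "fibre ?T x \<subseteq> \<psi> x ` fibre E x"
    proof
      fix g assume "g \<in> fibre ?T x"
      then obtain z where z: "g = (\<Sum>k<\<alpha>. smult ?T (z k) (bv k v))" using T.fibre[OF v(1) vP] v(2) by auto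
      obtain u where u: "u \<in> fibre E x" "\<forall>k<\<alpha>. \<theta> k x u = z k" using surj[OF x, of z] by blast
      have "g = \<psi> x u" using u(2) unfolding z v(2) \<psi>[OF v(1)] by simp
      then show "g \<in> \<psi> x ` fibre E x" using u(1) by (rule image_eqI)
    qed
    moreover have "\<psi> x ` fibre E x \<subseteq> fibre ?T x" using in_T[OF v(1)] v(2) by auto
    moreover have "\<psi> x u = 0 \<longleftrightarrow> (\<forall>k<\<alpha>. \<theta> k x u = 0)" for u
      unfolding v(2) \<psi>[OF v(1)] using T.indep[OF v(1) vP] by auto
    ultimately show ?thesis by blast
  qed
  ultimately show ?thesis by blast
qed

section \<open>Return to uniform Steiner bundles and conclusion\<close>

lemma framed_twist_power_sum:
  fixes d :: "nat \<Rightarrow> int" and m :: "nat \<Rightarrow> nat"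
  assumes "X \<subseteq> proj_space"
  shows "\<exists>b. framed (bundle_sum X {..k} (\<lambda>i. twist_power X (d i) (m i))) X
    (Sigma {..k} (\<lambda>i. {..<m i})) (\<lambda>(i, j). d i) b"
proof -
  have "\<forall>i. \<exists>b. framed (twist_power X (d i) (m i)) X {..<m i} (\<lambda>_. d i) b"
    using framed_twist_power[OF assms] by blast
  from choice[OF this] obtain b where b: "\<forall>i. framed (twist_power X (d i) (m i)) X {..<m i} (\<lambda>_. d i) (b i)"
    by (elim exE) (rule that)
  have vs: "vector_space (smult (twist_power X (d i) (m i)))" for i
    using b[THEN spec, of i] by (rule framed.axioms(1))
  have "framed (bundle_sum X {..k} (\<lambda>i. twist_power X (d i) (m i))) X
    (Sigma {..k} (\<lambda>i. {..<m i})) (\<lambda>(i, j). d i) (\<lambda>(i, j) v i'. if i' = i then b i j v else 0)"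
    by (rule framed_sum[where d = "\<lambda>i _. d i", OF finite_atMost assms b[THEN spec] vs])
  then show ?thesis by (intro exI[of _ "\<lambda>(i, j) v i'. if i' = i then b i j v else 0"])
qed

text \<open>The explicit frame on each line is matched with both required shapes, the sum of
  \<open>r\<close> twists of increasing degree and the sum of powers grouped by degree. The
  multiplicities depend only on \<open>r\<close> and \<open>c\<close>.\<close>

lemma presented_type_uniform:
  fixes E :: "(('k::field ^ 'n::finite) set, 'k, 'v::ab_group_add) vbundle"
  assumes pr: "presented E r \<eta> a I c" and rows: "rows2 a I c" and c: "c > 0"
  shows "type_uniform_steiner 1 E r"
proof -
  interpret presented E r \<eta> a I c by (rule pr)
  define m where "m i = (if i = 0 then r - c else c)" for i :: nat
  \<comment> \<open>The copies of \<open>O(-1)\<close> come before those of \<open>O\<close>, as the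
    monotonicity in \<open>uniform\<close> requires.\<close>
  define d where "d i = (if i < c then -1 else 0 :: int)" for i :: nat
  have iso: "bundle_iso (restrict_bundle L E) (bundle_sum L {..<r} (\<lambda>i. twist L (d i))) \<and>
      bundle_iso (restrict_bundle L E) (bundle_sum L {..1} (\<lambda>i. twist_power L (- int i) (m i)))"
    if L: "L \<in> proj_lines" for L
  proof -
    obtain v w where vw: "indep2 v w" "L = line v w" using proj_lines_line[OF L] by blast
    have LP: "L \<subseteq> proj_space" using line_subset[OF vw(1)] vw(2) by simp
    from split_on_line[OF pr rows vw(1), folded vw(2)] obtain K :: "nat set" and b where K: "finite K" "card K + c = r"
      "framed (restrict_bundle L E) L ({..<c} <+> K) (case_sum (\<lambda>_. -1) (\<lambda>_. 0)) b"
      by (elim exE conjE) (rule that)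
    obtain h where h: "bij_betw h K {..<card K}" using ex_bij_betw_finite_nat[OF K(1)] by (auto simp: atLeast0LessThan)
    have hK: "h k < card K" if "k \<in> K" for k using bij_betwE[OF h] that by auto
    have h_surj: "\<exists>k\<in>K. h k = i" if "i < card K" for i using h that by (auto simp: bij_betw_def image_iff set_eq_iff) metis
    have h_inj: "h k = h k' \<longleftrightarrow> k = k'" if "k \<in> K" "k' \<in> K" for k k' using h that by (auto simp: bij_betw_def inj_on_def)
    have rK: "r - c = card K" "r = c + card K" using K(2) by auto
    from framed_twist_sum[OF finite_lessThan LP, of r d] obtain b1 where
      b1: "framed (bundle_sum L {..<r} (\<lambda>i. twist L (d i))) L {..<r} d b1" by blast
    let ?\<pi>1 = "case_sum (\<lambda>j. j) (\<lambda>k. c + h k)"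
    have "bij_betw ?\<pi>1 ({..<c} <+> K) {..<r}"
    proof (rule bij_betw_imageI)
      show "inj_on ?\<pi>1 ({..<c} <+> K)" by (rule inj_onI) (auto simp: h_inj)
      show "?\<pi>1 ` ({..<c} <+> K) = {..<r}"
      proof (intro set_eqI iffI)
        fix i assume "i \<in> ?\<pi>1 ` ({..<c} <+> K)"
        then show "i \<in> {..<r}" using hK rK by auto
      next
        fix i assume i: "i \<in> {..<r}"
        show "i \<in> ?\<pi>1 ` ({..<c} <+> K)"
        proof (cases "i < c")
          case True then show ?thesis by (intro image_eqI[of _ _ "Inl i"]) auto
        next
          case False
          then have "i - c < card K" using i rK by simp
          then obtain k where "k \<in> K" "h k = i - c" using h_surj by blast
          then show ?thesis using False by (intro image_eqI[of _ _ "Inr k"]) auto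
        qed
      qed
    qed
    then have 1: "bundle_iso (restrict_bundle L E) (bundle_sum L {..<r} (\<lambda>i. twist L (d i)))"
      by (rule framed_iso[OF K(3) b1]) (auto simp: d_def)
    from framed_twist_power_sum[OF LP, of 1 "\<lambda>i. - int i" m] obtain b2 where
      b2: "framed (bundle_sum L {..1} (\<lambda>i. twist_power L (- int i) (m i))) L
        (Sigma {..1} (\<lambda>i. {..<m i})) (\<lambda>(i, j). - int i) b2" by blast
    let ?\<pi>2 = "case_sum (\<lambda>j. (1 :: nat, j)) (\<lambda>k. (0 :: nat, h k))"
    have "bij_betw ?\<pi>2 ({..<c} <+> K) (Sigma {..1} (\<lambda>i. {..<m i}))"
    proof (rule bij_betw_imageI)
      show "inj_on ?\<pi>2 ({..<c} <+> K)" by (rule inj_onI) (auto simp: h_inj)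
      show "?\<pi>2 ` ({..<c} <+> K) = Sigma {..1} (\<lambda>i. {..<m i})"
      proof (intro set_eqI iffI)
        fix p assume "p \<in> ?\<pi>2 ` ({..<c} <+> K)"
        then show "p \<in> Sigma {..1} (\<lambda>i. {..<m i})" using hK rK by (auto simp: m_def)
      next
        fix p assume p: "p \<in> Sigma {..1} (\<lambda>i. {..<m i})"
        then obtain i j where p: "p = (i, j)" "i \<le> 1" "j < m i" by (cases p) auto
        then have ij: "p = (i, j)" "i = 0 \<or> i = 1" "j < m i" by auto
        show "p \<in> ?\<pi>2 ` ({..<c} <+> K)"
        proof (cases "i = 0")
          case True
          then have "j < card K" using ij rK by (simp add: m_def)
          then obtain k where "k \<in> K" "h k = j" using h_surj by blast
          then show ?thesis using True ij by (intro image_eqI[of _ _ "Inr k"]) auto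
        next
          case False
          then show ?thesis using ij by (intro image_eqI[of _ _ "Inl j"]) (auto simp: m_def)
        qed
      qed
    qed
    then have 2: "bundle_iso (restrict_bundle L E) (bundle_sum L {..1} (\<lambda>i. twist_power L (- int i) (m i)))"
      by (rule framed_iso[OF K(3) b2]) auto
    from 1 2 show ?thesis by blast
  qed
  have "uniform E r"
    unfolding uniform_def
  proof (intro conjI vector_bundle_axioms base exI[of _ d] ballI)
    show "mono_on {..<r} d" by (auto simp: mono_on_def d_def)
    show "bundle_iso (restrict_bundle L E) (bundle_sum L {..<r} (\<lambda>i. twist L (d i)))" if "L \<in> proj_lines" for L
      using iso[OF that] by blast
  qed
  moreover have "m 1 > 0" using c by (simp add: m_def)
  ultimately show ?thesis
    unfolding type_uniform_steiner_def using iso presented_steiner[OF pr]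
    by (intro conjI exI[of _ m]) auto
qed

lemma exists_indep2: assumes "CARD('n::finite) \<ge> 2" shows "\<exists>v w :: 'k::field ^ 'n. indep2 v w"
proof -
  obtain i j :: 'n where ij: "i \<noteq> j"
  proof (rule ccontr)
    assume "\<not> thesis"
    then have "\<forall>i j :: 'n. i = j" using that by blast
    then have "UNIV = {undefined :: 'n}" by auto
    then have "CARD('n) = 1" by (metis card_1_singleton_iff One_nat_def)
    then show False using assms by simp
  qed
  have "indep2 (axis i 1) (axis j 1 :: 'k ^ 'n)"
    unfolding indep2_def
  proof (intro allI impI)
    fix s t :: 'k assume 0: "s *s axis i 1 + t *s axis j 1 = (0 :: 'k ^ 'n)"
    have "(s *s axis i 1 + t *s axis j 1 :: 'k ^ 'n) $ i = s" "(s *s axis i 1 + t *s axis j 1 :: 'k ^ 'n) $ j = t"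
      using ij by (simp_all add: axis_def)
    then show "s = 0 \<and> t = 0" unfolding 0 by simp
  qed
  then show ?thesis by blast
qed

theorem theorem14:
  fixes E :: "(('k::{alg_closed_field, field_char_0} ^ 'n::finite) set, 'k, 'v::ab_group_add) vbundle"
    and n c r :: nat
  assumes "CARD('n) = n + 1" and "n \<ge> 2"
    and "type_uniform_steiner 1 E r"
    and "first_chern E r (- int c)"
    and "r \<ge> c + 2 * (n - 1)"
  shows "\<exists>(\<alpha>::nat) (F :: (('k ^ 'n) set, 'k, 'v) vbundle) \<phi> \<psi>.
           type_uniform_steiner 1 F (c + 2 * (n - 1)) \<and>
           short_exact F E (twist_power proj_space 0 \<alpha>) \<phi> \<psi>"
proof -
  from assms(3) have st: "steiner E r" unfolding type_uniform_steiner_def by blast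
  from assms(3)[unfolded type_uniform_steiner_def] obtain m :: "nat \<Rightarrow> nat" where m: "m 1 > 0"
    and iso: "\<forall>L\<in>proj_lines. bundle_iso (restrict_bundle L E) (bundle_sum L {..1} (\<lambda>i. twist_power L (- int i) (m i)))"
    by (elim exE conjE) (rule that)
  from steiner_presented[OF st] obtain \<eta> a N c0 where pr: "presented E r \<eta> a {..<N} c0" by (elim exE) (rule that)
  interpret presented E r \<eta> a "{..<N}" c0 by (rule pr)
  let ?J = "Sigma {..1} (\<lambda>i. {..<m i})" and ?d = "\<lambda>(i, j). - int i"
  have fr: "\<exists>b. framed (restrict_bundle (line v w) E) (line v w) ?J ?d b" if vw: "indep2 v w" for v w
  proof -
    have Lb: "line v w \<subseteq> base E" using line_subset[OF vw] base by simp
    from framed_twist_power_sum[OF line_subset[OF vw], of 1 "\<lambda>i. - int i" m] obtain b where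
      b: "framed (bundle_sum (line v w) {..1} (\<lambda>i. twist_power (line v w) (- int i) (m i))) (line v w) ?J ?d b" by blast
    show ?thesis
      by (rule framed_restrict[OF Lb iso[THEN bspec, OF line_in_proj_lines[OF vw]] b])
  qed
  have d: "?d j = 0 \<or> ?d j = -1" if "j \<in> ?J" for j using that by (auto simp: le_Suc_eq)
  have rows: "rows2 a {..<N} c0"
    unfolding rows2_def
  proof (intro allI impI)
    fix v w y z j assume vw: "indep2 v w" and rel: "\<forall>i\<in>{..<N}. (\<Sum>j<c0. y j * a j i v) + (\<Sum>j<c0. z j * a j i w) = 0"
      and j: "j < c0"
    obtain b where b: "framed (restrict_bundle (line v w) E) (line v w) ?J ?d b" using fr[OF vw] by blast
    show "y j = 0 \<and> z j = 0" by (rule framed_nonneg_split(1)[OF pr vw b d rel j])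
  qed
  obtain v w :: "'k ^ 'n" where vw: "indep2 v w" using exists_indep2[where 'n = 'n and 'k = 'k] assms(1,2) by auto
  obtain b where b: "framed (restrict_bundle (line v w) E) (line v w) ?J ?d b" using fr[OF vw] by blast
  \<comment> \<open>The part of the index set with degree \<open>-1\<close> is the block
    \<open>i = 1\<close>; its size \<open>m 1\<close> is compared with the number of rows here and
    with the Chern class below.\<close>
  have J1: "{j \<in> ?J. ?d j = -1} = {1} \<times> {..<m 1}" by auto
  have "card {j \<in> ?J. ?d j = -1} = c0" by (rule framed_nonneg_split(2)[OF pr vw b d])
  then have c0: "c0 = m 1" unfolding J1 by simp
  have "- int c = (\<Sum>j\<in>?J. ?d j)"
    by (rule first_chern_line[OF vector_bundle_axioms base assms(4) vw b])
  also have "\<dots> = (\<Sum>i\<in>{..1}. \<Sum>j\<in>{..<m i}. - int i)" by (subst sum.Sigma) auto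
  also have "\<dots> = - int (m 1)" by simp
  finally have c: "c = c0" using c0 by simp
  \<comment> \<open>The number of hyperplane steps; the hypothesis on \<open>r\<close> keeps this
    natural subtraction from truncating, and the value zero is possible.\<close>
  define \<alpha> where "\<alpha> = r - (c + 2 * (n - 1))"
  have "\<alpha> + (c0 + 2 * (n - 1)) \<le> r" using assms(5) c by (simp add: \<alpha>_def)
  from reduce_rank[OF pr rows assms(1,2) this] obtain \<theta> F a' I' where
    F: "presented F (r - \<alpha>) \<eta> a' I' c0" "rows2 a' I' c0" "I' \<subseteq> {..<N}"
    "\<forall>x. fibre F x = {u \<in> fibre E x. \<forall>k<\<alpha>. \<theta> k x u = 0}" "smult F = smult E" "\<forall>U. sects F U \<subseteq> sects E U"
    "\<forall>k<\<alpha>. functional_on E (\<theta> k)" "\<forall>x\<in>proj_space. \<forall>b. \<exists>u\<in>fibre E x. \<forall>k<\<alpha>. \<theta> k x u = b k"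
    by (elim exE conjE) (rule that)
  have rank: "r - \<alpha> = c + 2 * (n - 1)" using assms(5) by (simp add: \<alpha>_def)
  \<comment> \<open>Positivity of the multiplicity of \<open>O(-1)\<close> is inherited from
    \<open>E\<close>: both bundles have \<open>c0 = m 1\<close> copies on each line.\<close>
  have type: "type_uniform_steiner 1 F (c + 2 * (n - 1))"
    using presented_type_uniform[OF F(1,2)] m c0 rank by simp
  have baseF: "base F = proj_space" using presented.base[OF F(1)] .
  have "\<exists>\<psi>. bundle_hom E (twist_power proj_space 0 \<alpha>) \<psi> \<and>
    (\<forall>x\<in>proj_space. \<psi> x ` fibre E x = fibre (twist_power proj_space 0 \<alpha>) x \<and>
      (\<forall>u\<in>fibre E x. \<psi> x u = 0 \<longleftrightarrow> (\<forall>k<\<alpha>. \<theta> k x u = 0)))"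
    by (rule functionals_to_trivial_bundle[OF base]) (use F(7,8) in blast)+
  then obtain \<psi> where \<psi>: "bundle_hom E (twist_power proj_space 0 \<alpha>) \<psi>"
    "\<forall>x\<in>proj_space. \<psi> x ` fibre E x = fibre (twist_power proj_space 0 \<alpha>) x \<and>
      (\<forall>u\<in>fibre E x. \<psi> x u = 0 \<longleftrightarrow> (\<forall>k<\<alpha>. \<theta> k x u = 0))" by (elim exE conjE) (rule that)
  \<comment> \<open>\<open>F\<close> has the same ambient space and scalar multiplication as
    \<open>E\<close> and smaller fibres, so its inclusion is the identity of the ambient
    space.\<close>
  have "bundle_hom F E (\<lambda>_ u. u)"
    unfolding bundle_hom_def using F(4-6) base baseF by auto
  then have "short_exact F E (twist_power proj_space 0 \<alpha>) (\<lambda>_ u. u) \<psi>"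
    unfolding short_exact_def using \<psi> F(4) base by auto
  with type show ?thesis by blast
qed

end
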